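(* Let $k$ be an algebraic number field, $G$ a connected $k$-algebraic group and $B$ a Borel subgroup of $G$. Then every subgroup of $B_{\mathcal O_k}$ is separable in $G_{\mathcal O_k}$.
   Context: A linear algebraic group is a Zariski closed subgroup of $\mathrm{GL}(n;\mathbb C)$; it is $k$-algebraic if its vanishing ideal is generated by polynomials with coefficients in $k$. For a subring $R\subset\mathbb C$, the $R$-points are $G_R=G\cap\mathrm{GL}(n;R)$. $\mathcal O_k$ is the ring of integers of $k$. A Borel subgroup is a maximal connected solvable algebraic subgroup (it need not be defined over $k$). A subgroup $H<\Gamma$ is separable in $\Gamma$ if for every $g\in\Gamma\setminus H$ there is a finite index subgroup $K<\Gamma$ with $H<K$, $g\notin K$. *)

theory Defs
  imports "HOL-Analysis.Analysis" "HOL-Algebra.Solvable_Groups" "HOL-Algebra.Coset"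
    "HOL-Computational_Algebra.Polynomial"
begin

section \<open>Number fields and rings of integers\<close>

definition subfield_C :: "complex set \<Rightarrow> bool" where
  "subfield_C k \<longleftrightarrow> 0 \<in> k \<and> 1 \<in> k \<and> (\<forall>x\<in>k. \<forall>y\<in>k. x + y \<in> k \<and> x - y \<in> k \<and> x * y \<in> k)
     \<and> (\<forall>x\<in>k. x \<noteq> 0 \<longrightarrow> inverse x \<in> k)"

text \<open>An algebraic number field: a subfield of C that is finite-dimensional over Q.\<close>
definition number_field :: "complex set \<Rightarrow> bool" where
  "number_field k \<longleftrightarrow> subfield_C k \<and>
     (\<exists>b. finite b \<and> b \<subseteq> k \<and> (\<forall>x\<in>k. \<exists>q. x = (\<Sum>y\<in>b. of_rat (q y) * y)))"

definition ring_of_integers :: "complex set \<Rightarrow> complex set" where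
  "ring_of_integers k = {x \<in> k. algebraic_int x}"

section \<open>GL(n, C) as a group\<close>

definition GL_grp :: "(complex^'n^'n) monoid" where
  "GL_grp = \<lparr>carrier = {A. invertible A}, mult = (**), one = mat 1\<rparr>"

text \<open>R-points: G_R = G \<inter> GL(n;R).\<close>
definition GL_R :: "complex set \<Rightarrow> (complex^'n^'n) set" where
  "GL_R R = {A. (\<forall>i j. A$i$j \<in> R) \<and>
      (\<exists>A'. A ** A' = mat 1 \<and> A' ** A = mat 1 \<and> (\<forall>i j. A'$i$j \<in> R))}"

definition points :: "complex set \<Rightarrow> (complex^'n^'n) set \<Rightarrow> (complex^'n^'n) set" where
  "points R G = G \<inter> GL_R R"

section \<open>Polynomial functions in the matrix entries\<close>

text \<open>Polynomials in the n^2 entries with coefficients in S, as functions on matrices.\<close>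
inductive_set poly_fun :: "complex set \<Rightarrow> (complex^'n^'n \<Rightarrow> complex) set"
  for S :: "complex set" where
  const: "c \<in> S \<Longrightarrow> (\<lambda>A. c) \<in> poly_fun S"
| var: "(\<lambda>A. A$i$j) \<in> poly_fun S"
| add: "p \<in> poly_fun S \<Longrightarrow> q \<in> poly_fun S \<Longrightarrow> (\<lambda>A. p A + q A) \<in> poly_fun S"
| mult: "p \<in> poly_fun S \<Longrightarrow> q \<in> poly_fun S \<Longrightarrow> (\<lambda>A. p A * q A) \<in> poly_fun S"

definition zero_set :: "(complex^'n^'n \<Rightarrow> complex) set \<Rightarrow> (complex^'n^'n) set" where
  "zero_set P = {A. \<forall>p\<in>P. p A = 0}"

definition vanishing_ideal :: "(complex^'n^'n) set \<Rightarrow> (complex^'n^'n \<Rightarrow> complex) set" where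
  "vanishing_ideal G = {p \<in> poly_fun UNIV. \<forall>A\<in>G. p A = 0}"

text \<open>Ideal of C[x_ij] generated by a set F of polynomials.\<close>
definition gen_ideal :: "(complex^'n^'n \<Rightarrow> complex) set \<Rightarrow> (complex^'n^'n \<Rightarrow> complex) set" where
  "gen_ideal F = {p. \<exists>(m::nat) c f. (\<forall>i<m. c i \<in> poly_fun UNIV \<and> f i \<in> F) \<and>
                          p = (\<lambda>A. \<Sum>i<m. c i A * f i A)}"

section \<open>Linear algebraic groups\<close>

text \<open>Zariski closed subsets of GL(n,C).\<close>
definition zariski_closed :: "(complex^'n^'n) set \<Rightarrow> bool" where
  "zariski_closed G \<longleftrightarrow> (\<exists>P \<subseteq> poly_fun UNIV. G = {A. invertible A} \<inter> zero_set P)"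

definition lin_alg_group :: "(complex^'n^'n) set \<Rightarrow> bool" where
  "lin_alg_group G \<longleftrightarrow> subgroup G GL_grp \<and> zariski_closed G"

definition k_algebraic :: "complex set \<Rightarrow> (complex^'n^'n) set \<Rightarrow> bool" where
  "k_algebraic k G \<longleftrightarrow> lin_alg_group G \<and>
     (\<exists>Fs \<subseteq> poly_fun k. Fs \<subseteq> vanishing_ideal G \<and> vanishing_ideal G \<subseteq> gen_ideal Fs)"

text \<open>Connectedness in the Zariski topology (closed subsets of G are G \<inter> zero_set P).\<close>
definition zariski_connected :: "(complex^'n^'n) set \<Rightarrow> bool" where
  "zariski_connected G \<longleftrightarrow> \<not> (\<exists>P Q. P \<subseteq> poly_fun UNIV \<and> Q \<subseteq> poly_fun UNIV \<and>
      G \<inter> zero_set P \<noteq> {} \<and> G \<inter> zero_set Q \<noteq> {} \<and>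
      G \<subseteq> zero_set P \<union> zero_set Q \<and> G \<inter> zero_set P \<inter> zero_set Q = {})"

definition conn_solv_alg :: "(complex^'n^'n) set \<Rightarrow> bool" where
  "conn_solv_alg B \<longleftrightarrow> lin_alg_group B \<and> zariski_connected B \<and>
     solvable (GL_grp\<lparr>carrier := B\<rparr>)"

text \<open>Borel subgroup: maximal connected solvable algebraic subgroup of G.\<close>
definition borel_subgroup :: "(complex^'n^'n) set \<Rightarrow> (complex^'n^'n) set \<Rightarrow> bool" where
  "borel_subgroup B G \<longleftrightarrow> B \<subseteq> G \<and> conn_solv_alg B \<and>
     (\<forall>C. B \<subseteq> C \<and> C \<subseteq> G \<and> conn_solv_alg C \<longrightarrow> C = B)"

section \<open>Separability\<close>

definition separable_in :: "('a, 'b) monoid_scheme \<Rightarrow> 'a set \<Rightarrow> bool" where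
  "separable_in \<Gamma> H \<longleftrightarrow> (\<forall>g \<in> carrier \<Gamma> - H. \<exists>K. subgroup K \<Gamma> \<and> finite (rcosets\<^bsub>\<Gamma>\<^esub> K)
      \<and> H \<subseteq> K \<and> g \<notin> K)"

end

theory Submission
  imports "Jordan_Normal_Form.Char_Poly" "HOL-Library.Function_Algebras" Defs
begin

no_notation Matrix.vec_index (infixl "$" 100)

text \<open>
  Call \<open>X\<close> congruence closed if every integral matrix which is congruent to an element of \<open>X\<close> modulo each
  \<open>m > 0\<close> lies in \<open>X\<close>. If \<open>H\<close> is congruence closed, then \<open>g\<close> outside \<open>H\<close> is avoided by the product of \<open>H\<close> with
  some principal congruence subgroup, which has finite index; so it suffices to show that all subgroups of
  \<open>B\<close> over the integers are congruence closed.

  By the theorem of Lie and Kolchin there is a basis of \<open>C^n\<close> in which \<open>B\<close> is triangular. The matrix entries in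
  this basis need not be algebraic, but for integral matrices they lie in a finitely generated subgroup of \<open>C\<close>,
  and congruent matrices have congruent entries there. Making the entries trivial one after another, first
  the diagonal and then each superdiagonal, gives a chain of groups in which each step is the kernel of a
  homomorphism to a multiplicative or additive group of numbers, and congruence closedness passes up the
  chain as soon as the subgroups of these target groups are closed in the congruence topology. For the
  additive steps this is elementary. The diagonal entries are units of a number field, and the statement
  is Chevalley's theorem: every finite index subgroup of the unit group is a congruence subgroup.

  Chevalley's theorem reduces to the following: if a unit \<open>y\<close> is an \<open>l\<close>-th power modulo all \<open>M\<close> prime to \<open>l\<close>, then it
  is an \<open>l\<close>-th power. Instead of the density theorem of Chebotarev, a count is used. Otherwise \<open>O[y^(1/l)]\<close> is an order of
  degree \<open>l n\<close>, and pairs of principal ideals \<open>(a1, a2)\<close> of \<open>O\<close> with norms of product of size \<open>T\<close> yield, via two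
  different roots of \<open>X^l - y\<close> modulo the ideals, more ideals of index about \<open>T\<close> in that order than there are.
\<close>

section \<open>Finitely generated abelian groups\<close>

text \<open>The contradiction in the count comes from a logarithm. An order has O(T) ideals of index
  about T, whereas pairs of principal ideals with product of indices about T number some T log T:
  there are about log T scales on which to split T, and each contributes a fixed multiple of T. This
  is the double pole of the squared zeta function of the smaller field against the simple pole for
  the larger one. Implied constants cannot spoil the argument, as the number of scales is arbitrary.
  The ideals need not be prime: generators congruent to 1 modulo \<open>l\<close> make
  \<open>l\<close> and \<open>1 - w\<close> invertible, which keeps the two roots apart.

  The reduction to \<open>l\<close>-th powers is an induction on \<open>s\<close>. If a unit
  \<open>y ^ (l ^ s)\<close> is 1 modulo M, then \<open>y\<close> is a root of unity modulo M, and
  such a residue is an \<open>l\<close>-th power once the roots of unity of order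
  \<open>l ^ (s + 1)\<close> are present. Adjoining them may turn non-powers into powers; the
  cyclotomic towers show that only roots of unity are responsible for this, and these vanish in
  \<open>y ^ (l ^ s)\<close>.\<close>

definition add_subgroup :: "'a::ab_group_add set \<Rightarrow> bool" where
  "add_subgroup X \<longleftrightarrow> 0 \<in> X \<and> (\<forall>x\<in>X. \<forall>y\<in>X. x - y \<in> X)"

lemma add_subgroupD:
  assumes "add_subgroup X"
  shows "0 \<in> X" "x \<in> X \<Longrightarrow> y \<in> X \<Longrightarrow> x - y \<in> X" "x \<in> X \<Longrightarrow> - x \<in> X"
    "x \<in> X \<Longrightarrow> y \<in> X \<Longrightarrow> x + y \<in> X"
proof -
  show 0: "0 \<in> X" and d: "x \<in> X \<Longrightarrow> y \<in> X \<Longrightarrow> x - y \<in> X" for x y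
    using assms by (auto simp: add_subgroup_def)
  show m: "x \<in> X \<Longrightarrow> - x \<in> X" for x using d[OF 0, of x] by simp
  show "x \<in> X \<Longrightarrow> y \<in> X \<Longrightarrow> x + y \<in> X" using d[OF _ m, of x y] by simp
qed

lemma add_subgroup_sum:
  assumes "add_subgroup X" "\<And>i. i \<in> I \<Longrightarrow> f i \<in> X"
  shows "sum f I \<in> X"
  using assms(2) by (induction I rule: infinite_finite_induct)
    (auto intro: add_subgroupD[OF assms(1)])

lemma add_subgroup_of_int_mult:
  fixes x :: "'a::comm_ring_1"
  assumes X: "add_subgroup X" and x: "x \<in> X"
  shows "of_int c * x \<in> X"
proof -
  have n: "of_nat k * x \<in> X" for k
    by (induction k) (auto simp: algebra_simps x intro: add_subgroupD[OF X])
  show ?thesis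
  proof (cases "c \<ge> 0")
    case True
    then show ?thesis using n[of "nat c"] by simp
  next
    case False
    then have "of_int c * x = - (of_nat (nat (- c)) * x)" by simp
    then show ?thesis using add_subgroupD(3)[OF X n] by metis
  qed
qed

lemma add_subgroup_fun_scale:
  fixes x :: "nat \<Rightarrow> int"
  assumes X: "add_subgroup X" and x: "x \<in> X"
  shows "(\<lambda>i. c * x i) \<in> X"
proof -
  have n: "(\<lambda>i. int k * x i) \<in> X" for k
  proof (induction k)
    case 0
    then show ?case using add_subgroupD(1)[OF X] by (simp add: zero_fun_def)
  next
    case (Suc k)
    have "(\<lambda>i. int (Suc k) * x i) = x + (\<lambda>i. int k * x i)" by (auto simp: algebra_simps)
    then show ?case using add_subgroupD(4)[OF X x Suc] by simp
  qed
  show ?thesis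
  proof (cases "c \<ge> 0")
    case True
    then show ?thesis using n[of "nat c"] by simp
  next
    case False
    then have "(\<lambda>i. c * x i) = - (\<lambda>i. int (nat (- c)) * x i)" by auto
    then show ?thesis using add_subgroupD(3)[OF X n] by metis
  qed
qed

lemma int_add_subgroup_cyclic:
  fixes S :: "int set"
  assumes S: "add_subgroup S"
  shows "\<exists>d\<in>S. \<forall>x\<in>S. d dvd x"
proof (cases "S = {0}")
  case False
  then obtain x where x: "x \<in> S" "x \<noteq> 0" using add_subgroupD(1)[OF S] by auto
  have "\<bar>x\<bar> \<in> S" using x add_subgroupD(3)[OF S] by (auto simp: abs_if)
  then have ex: "\<exists>n. n > 0 \<and> int n \<in> S" using x by (intro exI[of _ "nat \<bar>x\<bar>"]) auto
  define n where "n = (LEAST n. n > 0 \<and> int n \<in> S)"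
  have n: "n > 0" "int n \<in> S" using LeastI_ex[OF ex] unfolding n_def by auto
  have "int n dvd y" if y: "y \<in> S" for y
  proof (rule ccontr)
    assume nd: "\<not> int n dvd y"
    have "y mod int n \<in> S"
      using add_subgroupD(2)[OF S y add_subgroup_of_int_mult[OF S n(2), of "y div int n"]]
      by (simp only: of_int_eq_id id_apply minus_div_mult_eq_mod)
    moreover have "y mod int n \<noteq> 0" using nd by auto
    moreover have "y mod int n \<ge> 0" using n by simp
    ultimately have "nat (y mod int n) > 0 \<and> int (nat (y mod int n)) \<in> S" by simp
    then have "n \<le> nat (y mod int n)" unfolding n_def by (rule Least_le)
    moreover have "nat (y mod int n) < n" using n by (simp add: nat_less_iff)
    ultimately show False by simp
  qed
  then show ?thesis using n by blast
qed auto

text \<open>Rank \<open>r\<close> is encoded by vanishing from index \<open>r\<close> on, so that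
  all ranks share one type and lie inside each other during inductions.\<close>

definition zvec :: "nat \<Rightarrow> (nat \<Rightarrow> int) set" where
  "zvec r = {a. \<forall>i\<ge>r. a i = 0}"

text \<open>The last coordinates of \<open>X\<close> form a cyclic group, and \<open>w\<close> lies
  over a generator. The pivot \<open>w r\<close> may be 0, hence the case distinctions
  below.\<close>

lemma zvec_Suc_pivot:
  assumes X: "add_subgroup X"
  obtains w where "w \<in> X" "\<And>x. x \<in> X \<Longrightarrow> w r dvd (x r :: int)"
proof -
  have "add_subgroup ((\<lambda>x. x r) ` X)"
    unfolding add_subgroup_def
    by (auto simp: image_iff add_subgroupD[OF X] intro: bexI[of _ 0] bexI[of _ "_ - _"])
  from int_add_subgroup_cyclic[OF this] that show ?thesis by auto
qed

lemma zvec_Suc_sub: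
  assumes X: "add_subgroup X" "X \<subseteq> zvec (Suc r)"
  defines "X0 \<equiv> {x \<in> X. x r = 0}"
  shows "add_subgroup X0" "X0 \<subseteq> zvec r"
proof -
  show "add_subgroup X0" unfolding X0_def add_subgroup_def
    by (auto simp: add_subgroupD[OF X(1)])
  show "X0 \<subseteq> zvec r"
  proof
    fix x assume "x \<in> X0"
    then have "x \<in> zvec (Suc r)" "x r = 0" using X by (auto simp: X0_def)
    then show "x \<in> zvec r" by (auto simp: zvec_def) (metis Suc_leI le_neq_implies_less)
  qed
qed

text \<open>Subgroups of a free abelian group of finite rank are closed in the profinite topology.
  If the pivot does not divide \<open>a r\<close>, the last coordinate alone separates; otherwise a
  multiple of \<open>w\<close> moves \<open>a\<close> into \<open>zvec r\<close> and the induction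
  hypothesis applies to \<open>X0\<close>.\<close>

lemma zvec_subgroup_separable:
  assumes "add_subgroup X" "X \<subseteq> zvec r" "a \<in> zvec r" "a \<notin> X"
  shows "\<exists>m>0. \<forall>x\<in>X. \<forall>z\<in>zvec r. a \<noteq> (\<lambda>i. x i + m * z i)"
  using assms
proof (induction r arbitrary: X a)
  case 0
  then have "a = 0" by (auto simp: zvec_def)
  then show ?case using 0 add_subgroupD(1) by blast
next
  case (Suc r)
  note X = Suc.prems(1) and sub = add_subgroupD[OF Suc.prems(1)]
  obtain w where w: "w \<in> X" "\<And>x. x \<in> X \<Longrightarrow> w r dvd x r"
    using zvec_Suc_pivot[OF X] by metis
  define X0 where "X0 = {x \<in> X. x r = 0}"
  have X0: "add_subgroup X0" "X0 \<subseteq> zvec r"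
    using zvec_Suc_sub[OF Suc.prems(1,2)] by (auto simp: X0_def)
  show ?case
  proof (cases "w r dvd a r")
    case False
    \<comment> \<open>With pivot 0 all last coordinates of \<open>X\<close> vanish, and a modulus
      larger than the nonzero \<open>a r\<close> cannot divide it.\<close>
    define m where "m = (if w r = 0 then \<bar>a r\<bar> + 1 else \<bar>w r\<bar>)"
    have m0: "m > 0" by (auto simp: m_def)
    have "a \<noteq> (\<lambda>i. x i + m * z i)" if "x \<in> X" for x z
    proof
      assume "a = (\<lambda>i. x i + m * z i)"
      then have e: "a r = x r + m * z r" by metis
      show False
      proof (cases "w r = 0")
        case True
        then have "a r = m * z r" using w(2)[OF that] e by simp
        then have "m dvd a r" by simp
        then show False using True False zdvd_imp_le[of m "\<bar>a r\<bar>"] by (auto simp: m_def)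
      next
        case F: False
        then have "w r dvd m * z r" by (simp add: m_def)
        then show False using e w(2)[OF that] False by simp
      qed
    qed
    then show ?thesis using m0 by blast
  next
    case True
    then obtain q where q: "a r = w r * q" by (auto elim: dvdE)
    define b where "b = a - (\<lambda>i. q * w i)"
    have br: "b r = 0" using q by (simp add: b_def)
    have bX: "b \<notin> X0"
    proof
      assume "b \<in> X0"
      then have "b + (\<lambda>i. q * w i) \<in> X"
        using sub(4) add_subgroup_fun_scale[OF X w(1)] by (auto simp: X0_def)
      then show False using Suc.prems(4) by (simp add: b_def)
    qed
    have bz: "b \<in> zvec r"
    proof -
      have "w \<in> zvec (Suc r)" using w Suc.prems by auto
      then have "b i = 0" if "i \<ge> r" for i
        using br Suc.prems(3) that by (cases "i = r") (auto simp: b_def zvec_def)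
      then show ?thesis by (simp add: zvec_def)
    qed
    from Suc.IH[OF X0 bz bX] obtain m0 where m0: "m0 > 0"
      "\<And>x z. x \<in> X0 \<Longrightarrow> z \<in> zvec r \<Longrightarrow> b \<noteq> (\<lambda>i. x i + m0 * z i)" by blast
    \<comment> \<open>The extra factor allows the last coordinate of \<open>m * z\<close> to be
      cancelled by an integer multiple of \<open>w\<close>; what remains is a multiple of
      \<open>m0\<close> in \<open>zvec r\<close>.\<close>
    define m where "m = (if w r = 0 then m0 else m0 * \<bar>w r\<bar>)"
    have mp: "m > 0" using m0 by (auto simp: m_def)
    define s where "s = sgn (w r)"
    have "a \<noteq> (\<lambda>i. x i + m * z i)" if x: "x \<in> X" and z: "z \<in> zvec (Suc r)" for x z
    proof
      assume a: "a = (\<lambda>i. x i + m * z i)"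
      then have e: "a r = x r + m * z r" by metis
      show False
      proof (cases "w r = 0")
        case True
        have zr: "z r = 0" "x r = 0" using True e w(2)[OF x] q mp by auto
        have "z \<in> zvec r" using z zr by (auto simp: zvec_def) (metis Suc_leI le_neq_implies_less)
        moreover have "b = (\<lambda>i. (x - (\<lambda>i. q * w i)) i + m0 * z i)"
          using a True by (auto simp: b_def m_def)
        moreover have "x - (\<lambda>i. q * w i) \<in> X0"
          using sub(2)[OF x add_subgroup_fun_scale[OF X w(1)], of q] zr True by (simp add: X0_def)
        ultimately show False using m0 by blast
      next
        case False
        have sw: "\<bar>w r\<bar> = s * w r" by (simp add: s_def abs_sgn mult.commute)
        define x' where "x' = (\<lambda>i. x i + (m0 * s * z r - q) * w i)"
        define z' where "z' = (\<lambda>i. \<bar>w r\<bar> * z i - s * z r * w i)"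
        have bx: "b = (\<lambda>i. x' i + m0 * z' i)"
          using a False by (auto simp: b_def x'_def z'_def m_def algebra_simps)
        have z'r: "z' r = 0" by (simp add: z'_def sw)
        then have x'r: "x' r = 0" using bx br by (metis add.right_neutral mult_zero_right)
        have "x' = x + (\<lambda>i. (m0 * s * z r - q) * w i)" by (auto simp: x'_def)
        then have "x' \<in> X0" using sub(4)[OF x add_subgroup_fun_scale[OF X w(1)]] x'r
          by (simp add: X0_def)
        moreover have "z' \<in> zvec r"
        proof -
          have "w \<in> zvec (Suc r)" using w Suc.prems by auto
          then have "z' i = 0" if "i \<ge> r" for i
            using z'r z that by (cases "i = r") (auto simp: z'_def zvec_def)
          then show ?thesis by (simp add: zvec_def)
        qed
        ultimately show False using m0 bx by blast
      qed
    qed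
    then show ?thesis using mp by blast
  qed
qed

text \<open>\<open>N\<close> is a common exponent for the torsion of \<open>zvec r\<close> modulo
  \<open>X\<close>. Multiplication by the pivot allows the last coordinate to be cleared, so the
  exponent for \<open>X0\<close> only has to be multiplied by it.\<close>

lemma zvec_isolator:
  assumes "add_subgroup X" "X \<subseteq> zvec r"
  shows "\<exists>N>0. \<forall>z\<in>zvec r. \<forall>j>0. (\<lambda>i. j * z i) \<in> X \<longrightarrow> (\<lambda>i. N * z i) \<in> X"
  using assms
proof (induction r arbitrary: X)
  case 0
  then show ?case using add_subgroupD(1)[OF 0(1)] by (auto simp: zvec_def zero_fun_def intro!: exI[of _ 1])
next
  case (Suc r)
  note X = Suc.prems(1) and sub = add_subgroupD[OF Suc.prems(1)]
  obtain w where w: "w \<in> X" "\<And>x. x \<in> X \<Longrightarrow> w r dvd x r"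
    using zvec_Suc_pivot[OF X] by metis
  define X0 where "X0 = {x \<in> X. x r = 0}"
  have X0: "add_subgroup X0" "X0 \<subseteq> zvec r"
    using zvec_Suc_sub[OF Suc.prems(1,2)] by (auto simp: X0_def)
  from Suc.IH[OF X0] obtain N where N: "N > 0"
    "\<And>z j. z \<in> zvec r \<Longrightarrow> j > 0 \<Longrightarrow> (\<lambda>i. j * z i) \<in> X0 \<Longrightarrow> (\<lambda>i. N * z i) \<in> X0" by blast
  define d where "d = (if w r = 0 then 1 else \<bar>w r\<bar>)"
  have "(\<lambda>i. (N * d) * z i) \<in> X" if z: "z \<in> zvec (Suc r)" and j: "j > 0" and jz: "(\<lambda>i. j * z i) \<in> X" for z j
  proof -
    define s where "s = sgn (w r)"
    define z' where "z' = (\<lambda>i. d * z i - s * z r * w i)"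
    have wz: "w \<in> zvec (Suc r)" using w Suc.prems by auto
    have z'r: "z' r = 0"
    proof (cases "w r = 0")
      case True
      then have "z r = 0" using w(2)[OF jz] j by simp
      then show ?thesis using True by (simp add: z'_def)
    next
      case False
      then show ?thesis by (simp add: z'_def d_def s_def abs_sgn mult.commute)
    qed
    have "z' i = 0" if "i \<ge> r" for i
      using z'r z wz that by (cases "i = r") (auto simp: z'_def zvec_def)
    then have "z' \<in> zvec r" by (simp add: zvec_def)
    moreover have "(\<lambda>i. j * z' i) = (\<lambda>i. d * (j * z i)) - (\<lambda>i. (j * s * z r) * w i)"
      by (auto simp: z'_def algebra_simps)
    then have "(\<lambda>i. j * z' i) \<in> X"
      using sub(2)[OF add_subgroup_fun_scale[OF X jz, of d] add_subgroup_fun_scale[OF X w(1)]] by metis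
    then have "(\<lambda>i. j * z' i) \<in> X0" using z'r by (simp add: X0_def)
    ultimately have "(\<lambda>i. N * z' i) \<in> X" using N(2)[of z' j] j by (auto simp: X0_def)
    moreover have "(\<lambda>i. (N * d) * z i) = (\<lambda>i. N * z' i) + (\<lambda>i. (N * s * z r) * w i)"
      by (auto simp: z'_def algebra_simps)
    ultimately show ?thesis using sub(4) add_subgroup_fun_scale[OF X w(1)] by metis
  qed
  then show ?case using N(1) by (intro exI[of _ "N * d"]) (auto simp: d_def)
qed

lemma zvec_subgroup_fg:
  assumes "add_subgroup X" "X \<subseteq> zvec r"
  shows "\<exists>w. (\<forall>k<r. w k \<in> X) \<and> (\<forall>x\<in>X. \<exists>c. x = (\<lambda>i. \<Sum>k<r. c k * w k i :: int))"
  using assms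
proof (induction r arbitrary: X)
  case 0
  then show ?case by (auto simp: zvec_def)
next
  case (Suc r)
  note X = Suc.prems(1) and sub = add_subgroupD[OF Suc.prems(1)]
  obtain v where v: "v \<in> X" "\<And>x. x \<in> X \<Longrightarrow> v r dvd x r"
    using zvec_Suc_pivot[OF X] by metis
  define X0 where "X0 = {x \<in> X. x r = 0}"
  have X0: "add_subgroup X0" "X0 \<subseteq> zvec r"
    using zvec_Suc_sub[OF Suc.prems(1,2)] by (auto simp: X0_def)
  from Suc.IH[OF X0] obtain w where w: "\<And>k. k < r \<Longrightarrow> w k \<in> X0"
    "\<And>x. x \<in> X0 \<Longrightarrow> \<exists>c. x = (\<lambda>i. \<Sum>k<r. c k * w k i)" by blast
  have "\<exists>c. x = (\<lambda>i. \<Sum>k<Suc r. c k * (w(r := v)) k i)" if x: "x \<in> X" for x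
  proof -
    obtain q where q: "x r = v r * q" using v(2)[OF x] by (auto elim: dvdE)
    have "x - (\<lambda>i. q * v i) \<in> X0"
      using sub(2)[OF x add_subgroup_fun_scale[OF X v(1), of q]] q by (simp add: X0_def)
    from w(2)[OF this] obtain c where c: "x - (\<lambda>i. q * v i) = (\<lambda>i. \<Sum>k<r. c k * w k i)" by blast
    have "x i = (\<Sum>k<Suc r. (c(r := q)) k * (w(r := v)) k i)" for i
      using fun_cong[OF c, of i] by simp
    then show ?thesis by blast
  qed
  moreover have "(w(r := v)) k \<in> X" if "k < Suc r" for k
    using w(1)[of k] v(1) that by (auto simp: X0_def)
  ultimately show ?case by blast
qed

section \<open>Finitely generated additive groups of complex numbers\<close>

definition zspan :: "(nat \<Rightarrow> complex) \<Rightarrow> nat \<Rightarrow> complex set" where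
  "zspan e r = {(\<Sum>i<r. of_int (a i) * e i) | a. True}"

lemma zspan_eq_image: "zspan e r = (\<lambda>a. \<Sum>i<r. of_int (a i) * e i) ` zvec r"
proof -
  have "\<exists>b\<in>zvec r. (\<Sum>i<r. of_int (a i) * e i) = (\<Sum>i<r. of_int (b i) * e i)" for a
    by (rule bexI[of _ "\<lambda>i. if i < r then a i else 0"]) (auto simp: zvec_def intro!: sum.cong)
  then show ?thesis unfolding zspan_def image_def by blast
qed

lemma add_subgroup_zspan: "add_subgroup (zspan e r)"
  unfolding add_subgroup_def zspan_def
proof (intro conjI ballI)
  show "0 \<in> {(\<Sum>i<r. of_int (a i) * e i) | a. True}" by (auto intro: exI[of _ "\<lambda>_. 0"])
next
  fix x y assume "x \<in> {(\<Sum>i<r. of_int (a i) * e i) | a. True}" "y \<in> {(\<Sum>i<r. of_int (a i) * e i) | a. True}"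
  then obtain a b where "x = (\<Sum>i<r. of_int (a i) * e i)" "y = (\<Sum>i<r. of_int (b i) * e i)" by auto
  then have "x - y = (\<Sum>i<r. of_int (a i - b i) * e i)"
    by (simp add: sum_subtractf algebra_simps)
  then show "x - y \<in> {(\<Sum>i<r. of_int (a i) * e i) | a. True}" by (auto intro!: exI[of _ "\<lambda>i. a i - b i"])
qed

lemma zspan_base: "i < r \<Longrightarrow> e i \<in> zspan e r"
  unfolding zspan_def
  by (rule CollectI, rule exI[of _ "\<lambda>j. if j = i then 1 else 0"])
    (simp add: if_distrib[of of_int] if_distrib[of "\<lambda>x. x * _"] cong: if_cong)

lemma zspan_least:
  assumes "add_subgroup X" "\<And>i. i < r \<Longrightarrow> e i \<in> X"
  shows "zspan e r \<subseteq> X"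
  unfolding zspan_def
  by (auto intro!: add_subgroup_sum[OF assms(1)] add_subgroup_of_int_mult[OF assms(1)] assms(2))

lemma zvec_preimage_subgroup:
  assumes "add_subgroup X"
  shows "add_subgroup {a \<in> zvec r. (\<Sum>i<r. of_int (a i) * e i) \<in> X}"
  unfolding add_subgroup_def
  using add_subgroupD(1,2)[OF assms]
  by (simp add: zvec_def sum_subtractf left_diff_distrib)

text \<open>Pull \<open>X\<close> back along the coefficient map. The preimage contains all
  relations between the generators, so separation upstairs suffices even for dependent
  generators.\<close>

lemma zspan_subgroup_separable:
  assumes X: "add_subgroup X" "X \<subseteq> zspan e r" and g: "g \<in> zspan e r" "g \<notin> X"
  shows "\<exists>m>0. \<forall>x\<in>X. \<forall>z\<in>zspan e r. g \<noteq> x + of_nat m * z"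
proof -
  let ?f = "\<lambda>a. \<Sum>i<r. of_int (a i) * e i"
  define Y where "Y = {a \<in> zvec r. ?f a \<in> X}"
  obtain a where a: "a \<in> zvec r" "g = ?f a" using g by (auto simp: zspan_eq_image)
  have "add_subgroup Y" unfolding Y_def by (rule zvec_preimage_subgroup[OF X(1)])
  moreover have "a \<notin> Y" using a g by (auto simp: Y_def)
  ultimately obtain m where m: "m > 0" "\<And>x z. x \<in> Y \<Longrightarrow> z \<in> zvec r \<Longrightarrow> a \<noteq> (\<lambda>i. x i + m * z i)"
    using zvec_subgroup_separable[of Y r a] a by (auto simp: Y_def)
  have "g \<noteq> x + of_nat (nat m) * z" if x: "x \<in> X" and z: "z \<in> zspan e r" for x z
  proof
    assume *: "g = x + of_nat (nat m) * z"
    obtain c where c: "c \<in> zvec r" "z = ?f c" using z by (auto simp: zspan_eq_image)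
    define b where "b = (\<lambda>i. a i - m * c i)"
    have "?f b = ?f a - of_int m * ?f c"
      by (simp add: b_def sum_subtractf sum_distrib_left algebra_simps)
    then have "?f b = x" using * a c m by simp
    then have "b \<in> Y" using x a c by (auto simp: Y_def b_def zvec_def)
    moreover have "a = (\<lambda>i. b i + m * c i)" by (simp add: b_def)
    ultimately show False using m(2) c by blast
  qed
  then show ?thesis using m(1) by (intro exI[of _ "nat m"]) auto
qed

lemma zspan_subgroup_fg:
  assumes X: "add_subgroup X" "X \<subseteq> zspan e r"
  shows "\<exists>e'. X = zspan e' r"
proof -
  let ?f = "\<lambda>a. \<Sum>i<r. of_int (a i) * e i"
  define Y where "Y = {a \<in> zvec r. ?f a \<in> X}"
  have "add_subgroup Y" unfolding Y_def by (rule zvec_preimage_subgroup[OF X(1)])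
  then obtain w where w: "\<And>k. k < r \<Longrightarrow> w k \<in> Y"
     "\<And>x. x \<in> Y \<Longrightarrow> \<exists>c. x = (\<lambda>i. \<Sum>k<r. c k * w k i :: int)"
    using zvec_subgroup_fg[of Y r] by (auto simp: Y_def)
  have "x \<in> zspan (\<lambda>k. ?f (w k)) r" if x: "x \<in> X" for x
  proof -
    obtain a where a: "a \<in> zvec r" "x = ?f a" using x X by (auto simp: zspan_eq_image)
    then obtain c where c: "a = (\<lambda>i. \<Sum>k<r. c k * w k i)" using w(2)[of a] x by (auto simp: Y_def)
    have "x = (\<Sum>i<r. \<Sum>k<r. of_int (c k) * of_int (w k i) * e i)"
      by (simp add: a c sum_distrib_right)
    also have "\<dots> = (\<Sum>k<r. \<Sum>i<r. of_int (c k) * of_int (w k i) * e i)" by (rule sum.swap)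
    also have "\<dots> = (\<Sum>k<r. of_int (c k) * ?f (w k))" by (simp add: sum_distrib_left mult.assoc)
    finally show ?thesis by (auto simp: zspan_def)
  qed
  moreover have "zspan (\<lambda>k. ?f (w k)) r \<subseteq> X"
    by (rule zspan_least[OF X(1)]) (use w in \<open>auto simp: Y_def\<close>)
  ultimately show ?thesis by blast
qed

section \<open>Finitely generated multiplicative groups of complex numbers\<close>

definition mult_subgroup :: "complex set \<Rightarrow> bool" where
  "mult_subgroup Y \<longleftrightarrow> 1 \<in> Y \<and> 0 \<notin> Y \<and> (\<forall>x\<in>Y. \<forall>y\<in>Y. x / y \<in> Y)"

lemma mult_subgroupD:
  assumes "mult_subgroup Y"
  shows "1 \<in> Y" "x \<in> Y \<Longrightarrow> y \<in> Y \<Longrightarrow> x / y \<in> Y" "x \<in> Y \<Longrightarrow> inverse x \<in> Y"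
    "x \<in> Y \<Longrightarrow> y \<in> Y \<Longrightarrow> x * y \<in> Y" "x \<in> Y \<Longrightarrow> x \<noteq> 0" "x \<in> Y \<Longrightarrow> x ^ n \<in> Y"
proof -
  show 1: "1 \<in> Y" and d: "x \<in> Y \<Longrightarrow> y \<in> Y \<Longrightarrow> x / y \<in> Y" and "x \<in> Y \<Longrightarrow> x \<noteq> 0" for x y
    using assms by (auto simp: mult_subgroup_def)
  show m: "x \<in> Y \<Longrightarrow> inverse x \<in> Y" for x using d[OF 1, of x] by (simp add: field_simps)
  show p: "x \<in> Y \<Longrightarrow> y \<in> Y \<Longrightarrow> x * y \<in> Y" for x y using d[OF _ m, of x y] by (simp add: field_simps)
  show "x \<in> Y \<Longrightarrow> x ^ n \<in> Y" by (induction n) (auto intro: 1 p)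
qed

lemma mult_subgroup_prod:
  assumes "mult_subgroup Y" "\<And>i. i \<in> I \<Longrightarrow> f i \<in> Y"
  shows "prod f I \<in> Y"
  using assms(2) by (induction I rule: infinite_finite_induct)
    (auto intro: mult_subgroupD[OF assms(1)])

lemma mult_subgroup_powi:
  assumes "mult_subgroup Y" "x \<in> Y"
  shows "x powi n \<in> Y"
  using mult_subgroupD(3,6)[OF assms(1)] assms(2) by (auto simp: power_int_def)

definition mspan :: "(nat \<Rightarrow> complex) \<Rightarrow> nat \<Rightarrow> complex set" where
  "mspan e r = {(\<Prod>i<r. e i powi a i) | a. True}"

lemma mspan_eq_image: "mspan e r = (\<lambda>a. \<Prod>i<r. e i powi a i) ` zvec r"
proof -
  have "\<exists>b\<in>zvec r. (\<Prod>i<r. e i powi a i) = (\<Prod>i<r. e i powi b i)" for a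
    by (rule bexI[of _ "\<lambda>i. if i < r then a i else 0"]) (auto simp: zvec_def intro!: prod.cong)
  then show ?thesis unfolding mspan_def image_def by blast
qed

context
  fixes e :: "nat \<Rightarrow> complex" and r :: nat
  assumes e0: "\<And>i. i < r \<Longrightarrow> e i \<noteq> 0"
begin

private definition pw :: "(nat \<Rightarrow> int) \<Rightarrow> complex" where "pw a = (\<Prod>i<r. e i powi a i)"

private lemma pw_diff: "pw (a - b) = pw a / pw b"
  unfolding pw_def using e0 by (simp add: power_int_diff prod_dividef)

private lemma pw_nz: "pw a \<noteq> 0"
  unfolding pw_def using e0 by (auto simp: prod_zero_iff)

private lemma pw_scale: "pw (\<lambda>i. int m * a i) = pw a ^ m"
  unfolding pw_def using e0
  by (simp add: prod_power_distrib power_int_mult mult.commute[of "int m"])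

private lemma pre_subgroup:
  assumes "mult_subgroup Y"
  shows "add_subgroup {a \<in> zvec r. pw a \<in> Y}"
proof -
  have "pw 0 = 1" by (simp add: pw_def)
  moreover have "pw (a - b) \<in> Y" if "pw a \<in> Y" "pw b \<in> Y" for a b
    using that mult_subgroupD(2)[OF assms] by (simp add: pw_diff)
  ultimately show ?thesis unfolding add_subgroup_def
    using mult_subgroupD(1)[OF assms] by (auto simp: zvec_def)
qed

private lemma mspan_pw: "mspan e r = pw ` zvec r"
  by (simp add: mspan_eq_image pw_def[abs_def])

lemma mspan_subgroup_separable:
  assumes Y: "mult_subgroup Y" "Y \<subseteq> mspan e r" and g: "g \<in> mspan e r" "g \<notin> Y"
  shows "\<exists>m>0. \<forall>x\<in>Y. \<forall>z\<in>mspan e r. g \<noteq> x * z ^ m"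
proof -
  define X where "X = {a \<in> zvec r. pw a \<in> Y}"
  obtain a where a: "a \<in> zvec r" "g = pw a" using g by (auto simp: mspan_pw)
  have "add_subgroup X" unfolding X_def by (rule pre_subgroup[OF Y(1)])
  moreover have "a \<notin> X" using a g by (auto simp: X_def)
  ultimately obtain m where m: "m > 0" "\<And>x z. x \<in> X \<Longrightarrow> z \<in> zvec r \<Longrightarrow> a \<noteq> (\<lambda>i. x i + m * z i)"
    using zvec_subgroup_separable[of X r a] a by (auto simp: X_def)
  have "g \<noteq> x * z ^ nat m" if x: "x \<in> Y" and z: "z \<in> mspan e r" for x z
  proof
    assume *: "g = x * z ^ nat m"
    obtain c where c: "c \<in> zvec r" "z = pw c" using z by (auto simp: mspan_pw)
    define b where "b = a - (\<lambda>i. int (nat m) * c i)"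
    have "pw b = x" using * a c pw_nz unfolding b_def by (simp only: pw_diff pw_scale) simp
    then have "b \<in> X" using x a c by (auto simp: X_def b_def zvec_def)
    moreover have "a = (\<lambda>i. b i + m * c i)" using m by (auto simp: b_def)
    ultimately show False using m(2) c by blast
  qed
  then show ?thesis using m(1) by (intro exI[of _ "nat m"]) auto
qed

text \<open>One exponent serves for all elements with some power in \<open>Y\<close>. It is used to
  return from the units of an extension field to those of the base field.\<close>

lemma mspan_isolator:
  assumes Y: "mult_subgroup Y"
  shows "\<exists>N>0. \<forall>z\<in>mspan e r. \<forall>j>0. z ^ j \<in> Y \<longrightarrow> z ^ N \<in> Y"
proof -
  define X where "X = {a \<in> zvec r. pw a \<in> Y}"
  have "add_subgroup X" unfolding X_def by (rule pre_subgroup[OF Y(1)])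
  then obtain N where N: "N > 0" "\<And>z j. z \<in> zvec r \<Longrightarrow> j > 0 \<Longrightarrow> (\<lambda>i. j * z i) \<in> X \<Longrightarrow> (\<lambda>i. N * z i) \<in> X"
    using zvec_isolator[of X r] by (auto simp: X_def)
  have "z ^ nat N \<in> Y" if z: "z \<in> mspan e r" and j: "j > 0" "z ^ j \<in> Y" for z j
  proof -
    obtain c where c: "c \<in> zvec r" "z = pw c" using z by (auto simp: mspan_pw)
    have "(\<lambda>i. int j * c i) \<in> X" using c j pw_scale[of j c] by (auto simp: X_def zvec_def)
    then have "(\<lambda>i. int (nat N) * c i) \<in> X" using N(2)[of c "int j"] N(1) c j by simp
    then show ?thesis using c pw_scale[of "nat N" c] by (auto simp: X_def)
  qed
  then show ?thesis using N(1) by (intro exI[of _ "nat N"]) auto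
qed

lemma mspan_finite_mod_powers:
  assumes m: "m > 0"
  shows "\<exists>F. finite F \<and> F \<subseteq> mspan e r \<and> (\<forall>z\<in>mspan e r. \<exists>f\<in>F. \<exists>w\<in>mspan e r. z = f * w ^ m)"
proof -
  define A where "A = {a. \<forall>i. (i \<in> {..<r} \<longrightarrow> a i \<in> {0..<int m}) \<and> (i \<notin> {..<r} \<longrightarrow> a i = 0)}"
  have "finite A" unfolding A_def
    by (rule finite_set_of_finite_funs) auto
  moreover have "\<exists>f\<in>pw ` A. \<exists>w\<in>mspan e r. z = f * w ^ m" if z: "z \<in> mspan e r" for z
  proof -
    obtain c where c: "c \<in> zvec r" "z = pw c" using z by (auto simp: mspan_pw)
    define a where "a = (\<lambda>i. c i mod int m)"
    define b where "b = (\<lambda>i. c i div int m)"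
    have "a \<in> A" using c m by (auto simp: A_def a_def zvec_def)
    moreover have "b \<in> zvec r" using c by (auto simp: b_def zvec_def)
    moreover have "a = c - (\<lambda>i. int m * b i)"
      by (auto simp: a_def b_def minus_mult_div_eq_mod)
    then have "pw a = pw c / pw b ^ m" by (simp only: pw_diff pw_scale)
    then have "z = pw a * pw b ^ m" using pw_nz c by simp
    ultimately show ?thesis by (auto simp: mspan_pw)
  qed
  moreover have "pw ` A \<subseteq> mspan e r" by (auto simp: A_def mspan_pw zvec_def)
  ultimately show ?thesis by (intro exI[of _ "pw ` A"]) auto
qed

end

lemma mspan_least:
  assumes "mult_subgroup Y" "\<And>i. i < r \<Longrightarrow> e i \<in> Y"
  shows "mspan e r \<subseteq> Y"
  unfolding mspan_def
  by (auto intro!: mult_subgroup_prod[OF assms(1)] mult_subgroup_powi[OF assms(1)] assms(2))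

section \<open>Common eigenvectors of commuting operators\<close>

locale complex_vector_space = vector_space scale
  for scale :: "complex \<Rightarrow> 'b::ab_group_add \<Rightarrow> 'b"
begin

definition op_poly :: "complex poly \<Rightarrow> ('b \<Rightarrow> 'b) \<Rightarrow> 'b \<Rightarrow> 'b" where
  "op_poly p f v = (\<Sum>i\<le>degree p. scale (coeff p i) ((f ^^ i) v))"

lemma op_poly_bound:
  assumes "degree p \<le> N"
  shows "op_poly p f v = (\<Sum>i\<le>N. scale (coeff p i) ((f ^^ i) v))"
  unfolding op_poly_def using assms
  by (intro sum.mono_neutral_left) (auto simp: coeff_eq_0)

lemma op_poly_diff: "op_poly (p - q) f v = op_poly p f v - op_poly q f v"
proof -
  let ?N = "max (degree p) (degree q)"
  have "degree (p - q) \<le> ?N" by (rule degree_diff_le_max)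
  then show ?thesis
    by (simp add: op_poly_bound[of _ ?N] scale_left_diff_distrib sum_subtractf)
qed

lemma op_poly_smult: "op_poly (Polynomial.smult c p) f v = scale c (op_poly p f v)"
  using degree_smult_le[of c p]
  by (simp add: op_poly_bound[of _ "degree p"] scale_sum_right)

end

text \<open>Linearity is asked for on \<open>W\<close> only, so that a restriction to a smaller
  stable subspace is given by the same function.\<close>

locale complex_operator = complex_vector_space scale
  for scale :: "complex \<Rightarrow> 'b::ab_group_add \<Rightarrow> 'b" +
  fixes f :: "'b \<Rightarrow> 'b" and W :: "'b set"
  assumes W: "subspace W"
    and f_W: "v \<in> W \<Longrightarrow> f v \<in> W"
    and f_add: "v \<in> W \<Longrightarrow> w \<in> W \<Longrightarrow> f (v + w) = f v + f w"
    and f_scale: "v \<in> W \<Longrightarrow> f (scale c v) = scale c (f v)"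
begin

lemma f_0: "f 0 = 0"
  using f_scale[OF subspace_0[OF W], of 0] by simp

lemma f_sum: "(\<And>i. i \<in> I \<Longrightarrow> g i \<in> W) \<Longrightarrow> f (sum g I) = (\<Sum>i\<in>I. f (g i))"
  by (induction I rule: infinite_finite_induct) (auto simp: f_0 f_add subspace_sum[OF W])

lemma funpow_W: "v \<in> W \<Longrightarrow> (f ^^ i) v \<in> W"
  by (induction i) (auto intro: f_W)

lemma op_poly_W: "v \<in> W \<Longrightarrow> op_poly p f v \<in> W"
  unfolding op_poly_def by (intro subspace_sum[OF W] subspace_scale[OF W] funpow_W)

lemma op_poly_pCons:
  assumes v: "v \<in> W"
  shows "op_poly (pCons c p) f v = scale c v + f (op_poly p f v)"
proof -
  have "degree (pCons c p) \<le> Suc (degree p)" by (rule degree_pCons_le)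
  then have "op_poly (pCons c p) f v = (\<Sum>i\<le>Suc (degree p). scale (coeff (pCons c p) i) ((f ^^ i) v))"
    by (rule op_poly_bound)
  also have "\<dots> = scale c v + (\<Sum>i\<le>degree p. scale (coeff p i) ((f ^^ Suc i) v))"
    unfolding sum.atMost_Suc_shift by simp
  also have "(\<Sum>i\<le>degree p. scale (coeff p i) ((f ^^ Suc i) v)) = f (op_poly p f v)"
    unfolding op_poly_def
    by (subst f_sum) (auto simp: f_scale funpow_W v subspace_scale[OF W])
  finally show ?thesis .
qed

lemma op_poly_eigenvector:
  assumes "v \<in> W" "f v = scale c v"
  shows "op_poly p f v = scale (poly p c) v"
proof (induction p)
  case 0
  then show ?case by (simp add: op_poly_def)
next
  case (pCons a p)
  show ?case using assms pCons
    by (simp add: op_poly_pCons f_scale scale_left_distrib mult.commute)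
qed

lemma op_poly_sum:
  assumes "\<And>i. i \<in> I \<Longrightarrow> g i \<in> W"
  shows "op_poly p f (sum g I) = (\<Sum>i\<in>I. op_poly p f (g i))"
proof (induction p)
  case 0
  then show ?case by (simp add: op_poly_def)
next
  case (pCons a p)
  have "op_poly (pCons a p) f (sum g I) = scale a (sum g I) + f (\<Sum>i\<in>I. op_poly p f (g i))"
    using assms pCons by (simp add: op_poly_pCons subspace_sum[OF W])
  also have "\<dots> = (\<Sum>i\<in>I. scale a (g i) + f (op_poly p f (g i)))"
    using assms by (subst f_sum) (auto simp: op_poly_W scale_sum_right sum.distrib)
  also have "\<dots> = (\<Sum>i\<in>I. op_poly (pCons a p) f (g i))"
    using assms by (intro sum.cong) (auto simp: op_poly_pCons)
  finally show ?case .
qed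

lemma op_poly_scale:
  assumes "v \<in> W"
  shows "op_poly p f (scale c v) = scale c (op_poly p f v)"
proof -
  have "(f ^^ i) (scale c v) = scale c ((f ^^ i) v)" for i
    using assms by (induction i) (auto simp: f_scale funpow_W)
  then show ?thesis by (simp add: op_poly_def scale_sum_right mult.commute)
qed

text \<open>Eigenvectors for distinct eigenvalues are independent: a polynomial vanishing at all
  these eigenvalues but one isolates a single term of a linear relation. So there are at most
  \<open>card S\<close> of them.\<close>

lemma finite_eigenvalues:
  assumes fin: "finite S" "W \<subseteq> span S"
  shows "finite {c. \<exists>v\<in>W. v \<noteq> 0 \<and> f v = scale c v}"
proof (rule ccontr)
  assume "infinite {c. \<exists>v\<in>W. v \<noteq> 0 \<and> f v = scale c v}"
  from infinite_arbitrarily_large[OF this, of "Suc (card S)"]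
  obtain T where T: "finite T" "card T = Suc (card S)"
      "T \<subseteq> {c. \<exists>v\<in>W. v \<noteq> 0 \<and> f v = scale c v}"
    by (elim exE conjE)
  have "\<forall>c\<in>T. \<exists>v. v \<in> W \<and> v \<noteq> 0 \<and> f v = scale c v" using T(3) by auto
  from bchoice[OF this] obtain v where
    v: "\<And>c. c \<in> T \<Longrightarrow> v c \<in> W \<and> v c \<noteq> 0 \<and> f (v c) = scale c (v c)" by blast
  have inj: "inj_on v T"
  proof
    fix c d assume cd: "c \<in> T" "d \<in> T" "v c = v d"
    then have "scale c (v c) = scale d (v c)" using v by metis
    then show "c = d" using v[OF cd(1)] by simp
  qed
  have "independent (v ` T)"
  proof
    assume "dependent (v ` T)"
    then obtain u where u: "\<exists>x\<in>v ` T. u x \<noteq> 0" "(\<Sum>x\<in>v ` T. scale (u x) x) = 0"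
      using dependent_finite[of "v ` T"] T(1) by auto
    then obtain c where c: "c \<in> T" "u (v c) \<noteq> 0" by auto
    define p where "p = (\<Prod>d\<in>T - {c}. [:- d, 1:])"
    have pz: "poly p d = 0" if "d \<in> T" "d \<noteq> c" for d
      using that T(1) by (auto simp: p_def poly_prod prod_zero_iff)
    have pc: "poly p c \<noteq> 0" using T(1) by (auto simp: p_def poly_prod prod_zero_iff)
    have "(\<Sum>d\<in>T. scale (u (v d)) (v d)) = 0" using u(2) by (simp add: sum.reindex[OF inj])
    then have "0 = op_poly p f (\<Sum>d\<in>T. scale (u (v d)) (v d))"
      using op_poly_scale[OF subspace_0[OF W], of p 0] by simp
    also have "\<dots> = (\<Sum>d\<in>T. op_poly p f (scale (u (v d)) (v d)))"
      using v by (intro op_poly_sum) (auto intro: subspace_scale[OF W])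
    also have "\<dots> = (\<Sum>d\<in>T. scale (u (v d) * poly p d) (v d))"
      using v by (intro sum.cong) (auto simp: op_poly_scale op_poly_eigenvector)
    also have "\<dots> = scale (u (v c) * poly p c) (v c)"
      using pz T(1) c by (subst sum.remove[of _ c]) auto
    finally show False using c pc v[OF c(1)] by simp
  qed
  moreover have "v ` T \<subseteq> span S" using v fin by auto
  ultimately have "card (v ` T) \<le> card S" using independent_span_bound[OF fin(1)] by blast
  then show False using T card_image[OF inj] by simp
qed

text \<open>A nonzero polynomial of least degree that kills \<open>v\<close> has a linear factor,
  and the cofactor maps \<open>v\<close> to an eigenvector.\<close>

lemma ex_eigenvector:
  assumes fin: "finite S" "W \<subseteq> span S" and v: "v \<in> W" "v \<noteq> 0"
  shows "\<exists>c. \<exists>u\<in>W. u \<noteq> 0 \<and> f u = scale c u"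
proof -
  \<comment> \<open>If two iterates of \<open>v\<close> coincide, a difference of monomials kills
    \<open>v\<close>; otherwise more iterates than the dimension are linearly dependent.\<close>
  have ex: "\<exists>p. p \<noteq> 0 \<and> op_poly p f v = 0"
  proof (cases "inj (\<lambda>i. (f ^^ i) v)")
    case False
    then obtain i j where ij: "i < j" "(f ^^ i) v = (f ^^ j) v"
      by (auto simp: inj_def) (metis nat_neq_iff)
    define p where "p = monom (1::complex) j - monom 1 i"
    have "coeff p j = 1" using ij by (simp add: p_def)
    then have "p \<noteq> 0" by auto
    moreover have "op_poly (monom 1 k) f v = (f ^^ k) v" for k
      by (simp add: op_poly_def degree_monom_eq if_distrib[of "\<lambda>c. scale c _"] cong: if_cong)
    then have "op_poly p f v = 0" using ij by (simp add: p_def op_poly_diff)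
    ultimately show ?thesis by blast
  next
    case True
    let ?g = "\<lambda>i. (f ^^ i) v"
    let ?I = "{..card S}"
    have inj: "inj_on ?g ?I" using True by (rule inj_on_subset) auto
    have "?g ` ?I \<subseteq> span S" using funpow_W[OF v(1)] fin by auto
    then have "dependent (?g ` ?I)"
      using independent_span_bound[OF fin(1), of "?g ` ?I"] card_image[OF inj] by fastforce
    then obtain u where u: "\<exists>x\<in>?g ` ?I. u x \<noteq> 0" "(\<Sum>x\<in>?g ` ?I. scale (u x) x) = 0"
      using dependent_finite[of "?g ` ?I"] by auto
    define p where "p = (\<Sum>i\<in>?I. monom (u (?g i)) i)"
    have cp: "coeff p i = (if i \<in> ?I then u (?g i) else 0)" for i
      by (simp add: p_def coeff_sum)
    have "p \<noteq> 0" using u(1) cp by (metis (no_types, lifting) coeff_0 image_iff)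
    moreover have "degree p \<le> card S" by (rule degree_le) (simp add: cp)
    then have "op_poly p f v = (\<Sum>i\<in>?I. scale (u (?g i)) (?g i))"
      by (simp add: op_poly_bound[of _ "card S"] cp)
    then have "op_poly p f v = 0" using u(2) by (simp add: sum.reindex[OF inj])
    ultimately show ?thesis by blast
  qed
  define d where "d = (LEAST d. \<exists>p. p \<noteq> 0 \<and> op_poly p f v = 0 \<and> degree p = d)"
  have "\<exists>p. p \<noteq> 0 \<and> op_poly p f v = 0 \<and> degree p = d"
    unfolding d_def by (rule LeastI_ex) (use ex in auto)
  then obtain p where p: "p \<noteq> 0" "op_poly p f v = 0" "degree p = d" by blast
  have min: "d \<le> degree q" if "q \<noteq> 0" "op_poly q f v = 0" for q
    unfolding d_def by (rule Least_le) (use that in auto)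
  have "degree p \<noteq> 0"
  proof
    assume "degree p = 0"
    then obtain a where a: "p = [:a:]" by (auto elim: degree_eq_zeroE)
    then show False using p v by (simp add: op_poly_def)
  qed
  then obtain a where "poly p a = 0"
    using fundamental_theorem_of_algebra[of p] constant_degree[of p] by auto
  then obtain q where q: "p = [:- a, 1:] * q" by (metis dvdE poly_eq_0_iff_dvd)
  have q0: "q \<noteq> 0" using p q by auto
  have "degree p = Suc (degree q)" using q q0 by (simp add: degree_mult_eq del: mult_pCons_left)
  then have "op_poly q f v \<noteq> 0" using min[OF q0] p by auto
  moreover have "f (op_poly q f v) = scale a (op_poly q f v)"
  proof -
    have "p = pCons 0 q - Polynomial.smult a q" by (simp add: q)
    then have "op_poly p f v = f (op_poly q f v) - scale a (op_poly q f v)"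
      by (simp only: op_poly_diff op_poly_smult op_poly_pCons[OF v(1)]) simp
    then show ?thesis using p by simp
  qed
  ultimately show ?thesis using op_poly_W[OF v(1)] by blast
qed

end

context complex_vector_space
begin

text \<open>An operator that is not scalar on \<open>W\<close> has a proper nonzero eigenspace,
  which all operators commuting with it preserve. The result provides the embeddings of a number
  field as well as the weight vectors of solvable groups.\<close>

lemma common_eigenvector:
  assumes W: "subspace W" "finite S" "W \<subseteq> span S" "W \<noteq> {0}"
    and op: "\<And>f. f \<in> F \<Longrightarrow> complex_operator scale f W"
    and comm: "\<And>f g v. f \<in> F \<Longrightarrow> g \<in> F \<Longrightarrow> v \<in> W \<Longrightarrow> f (g v) = g (f v)"
  shows "\<exists>v\<in>W. v \<noteq> 0 \<and> (\<forall>f\<in>F. \<exists>c. f v = scale c v)"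
  using W op comm
proof (induction "dim W" arbitrary: W rule: less_induct)
  case less
  note op = less.prems(5) and comm = less.prems(6)
  obtain v where v: "v \<in> W" "v \<noteq> 0" using less.prems(1,4) subspace_0 by blast
  show ?case
  proof (cases "\<forall>f\<in>F. \<exists>c. \<forall>w\<in>W. f w = scale c w")
    case True
    then show ?thesis using v by blast
  next
    case False
    then obtain f where f: "f \<in> F" "\<And>c. \<exists>w\<in>W. f w \<noteq> scale c w" by blast
    interpret f: complex_operator scale f W using op f by auto
    obtain c u where u: "u \<in> W" "u \<noteq> 0" "f u = scale c u"
      using f.ex_eigenvector[OF less.prems(2,3) v] by blast
    define W' where "W' = {w \<in> W. f w = scale c w}"
    have sW': "subspace W'"
      unfolding W'_def
      by (rule subspaceI) (auto simp: f.f_0 f.f_add f.f_scale scale_right_distrib mult.commute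
          intro: subspace_0[OF less.prems(1)] subspace_add[OF less.prems(1)] subspace_scale[OF less.prems(1)])
    have "W' \<subset> W" using f(2)[of c] by (auto simp: W'_def)
    then have "span W' \<subset> span W"
      using sW' less.prems(1) by (metis span_eq_iff)
    moreover obtain B where B: "finite B" "independent B" "span B = W"
    proof -
      obtain B where B: "B \<subseteq> W" "independent B" "W \<subseteq> span B" using maximal_independent_subset by blast
      moreover have "span B = W" using B less.prems(1) by (metis span_mono span_eq_iff subset_antisym)
      moreover have "finite B" using independent_span_bound[OF less.prems(2) B(2)] B(1) less.prems(3) by blast
      ultimately show ?thesis using that by blast
    qed
    moreover have "dim W' < dim W"
    proof -
      obtain B' where B': "B' \<subseteq> W'" "independent B'" "W' \<subseteq> span B'" "card B' = dim W'"
        using basis_exists[of W'] by blast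
      have sB': "span B' = W'" using B' sW' by (metis span_mono span_eq_iff subset_antisym)
      obtain x where x: "x \<in> W" "x \<notin> W'" using \<open>W' \<subset> W\<close> by blast
      have ind: "independent (insert x B')" using independent_insertI[of x B'] B'(2) x sB' by simp
      have "insert x B' \<subseteq> span B" using B' x \<open>W' \<subset> W\<close> B(3) by auto
      then have bd: "finite (insert x B')" "card (insert x B') \<le> card B"
        using independent_span_bound[OF B(1) ind] by auto
      have "x \<notin> B'" using x B' by auto
      then have "card B' < card B" using bd by auto
      moreover have "dim W = card B" using B dim_eq_card_independent[of B] dim_span[of B] by simp
      ultimately show ?thesis using B' by simp
    qed
    moreover have "complex_operator scale g W'" if "g \<in> F" for g
    proof -
      interpret g: complex_operator scale g W using op that by auto
      show ?thesis
        by (unfold_locales, rule sW')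
          (auto simp: W'_def g.f_W g.f_add g.f_scale comm[OF f(1) that])
    qed
    moreover have "W' \<noteq> {0}" using u by (auto simp: W'_def)
    ultimately obtain w where "w \<in> W'" "w \<noteq> 0" "\<forall>f\<in>F. \<exists>c. f w = scale c w"
      using less.hyps[of W', OF _ sW' less.prems(2)] less.prems(3) \<open>W' \<subset> W\<close> comm by blast
    then show ?thesis by (auto simp: W'_def)
  qed
qed

end

section \<open>Algebraic integers\<close>

lemma char_poly_of_int_algebraic_int:
  assumes A: "A \<in> carrier_mat r r" and k: "poly (char_poly (map_mat of_int A)) k = (0::complex)"
  shows "algebraic_int k"
proof -
  have h: "comm_ring_hom (of_int :: int \<Rightarrow> complex)" by unfold_locales auto
  have "char_poly (map_mat of_int A) = map_poly (of_int :: int \<Rightarrow> complex) (char_poly A)"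
    by (rule comm_ring_hom.char_poly_hom[OF h A])
  moreover have "lead_coeff (char_poly A) = 1" using degree_monic_char_poly[OF A] by simp
  ultimately show ?thesis unfolding algebraic_int_altdef_ipoly using k by metis
qed

lemma eigen_imp_char_poly_root:
  fixes a :: "nat \<Rightarrow> nat \<Rightarrow> complex"
  assumes "\<And>i. i < n \<Longrightarrow> (\<Sum>j<n. a i j * e j) = k * e i" and "i0 < n" "e i0 \<noteq> 0"
  shows "poly (char_poly (Matrix.mat n n (\<lambda>(i, j). a i j))) k = 0"
proof -
  let ?A = "Matrix.mat n n (\<lambda>(i, j). a i j)"
  let ?v = "Matrix.vec n e"
  have A: "?A \<in> carrier_mat n n" by simp
  have "?A *\<^sub>v ?v = k \<cdot>\<^sub>v ?v"
    by (rule eq_vecI) (auto simp: scalar_prod_def assms(1) row_def atLeast0LessThan)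
  moreover have "?v \<noteq> 0\<^sub>v n"
    using assms(2,3) by (metis index_vec index_zero_vec(1))
  ultimately have "eigenvector ?A ?v k" by (auto simp: eigenvector_def)
  then show ?thesis using eigenvalue_root_char_poly[OF A] by (auto simp: eigenvalue_def)
qed

text \<open>The determinant trick: \<open>x\<close> acts on the generators by an integer matrix, and
  the vector of generators is an eigenvector of it for the eigenvalue \<open>x\<close>.\<close>

lemma zspan_stable_algebraic_int:
  assumes st: "\<And>i. i < r \<Longrightarrow> x * e i \<in> zspan e r" and "i0 < r" "e i0 \<noteq> 0"
  shows "algebraic_int x"
proof -
  have "\<forall>i. \<exists>a. i < r \<longrightarrow> x * e i = (\<Sum>j<r. of_int (a j) * e j)"
    using st by (fastforce simp: zspan_def)
  then obtain a where a: "\<And>i. i < r \<Longrightarrow> x * e i = (\<Sum>j<r. of_int (a i j) * e j)" by metis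
  have "poly (char_poly (Matrix.mat r r (\<lambda>(i, j). of_int (a i j)))) x = 0"
    by (rule eigen_imp_char_poly_root[of r _ e, OF _ assms(2,3)]) (simp add: a)
  moreover have "Matrix.mat r r (\<lambda>(i, j). of_int (a i j)) = map_mat (of_int :: int \<Rightarrow> complex) (Matrix.mat r r (\<lambda>(i, j). a i j))"
    by (rule eq_matI) auto
  ultimately show ?thesis by (metis char_poly_of_int_algebraic_int mat_carrier)
qed

lemma algebraic_int_power_span:
  assumes "algebraic_int (x::complex)"
  shows "\<exists>d>0. x ^ d \<in> zspan (\<lambda>i. x ^ i) d"
proof -
  obtain p where p: "poly (map_poly of_int p) x = 0" "lead_coeff p = 1"
    using assms by (auto simp: algebraic_int_altdef_ipoly)
  have "degree p > 0"
  proof (rule ccontr)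
    assume "\<not> degree p > 0"
    then obtain c where "p = [:c:]" by (auto elim: degree_eq_zeroE)
    then show False using p by simp
  qed
  have dg: "degree (map_poly of_int p :: complex poly) = degree p" by (rule degree_map_poly) auto
  have "0 = (\<Sum>i\<le>degree p. of_int (coeff p i) * x ^ i)"
    using p(1) unfolding poly_altdef dg by (simp add: coeff_map_poly)
  also have "\<dots> = (\<Sum>i<degree p. of_int (coeff p i) * x ^ i) + x ^ degree p"
    using p(2) by (simp add: lessThan_Suc_atMost[symmetric])
  finally have *: "0 = (\<Sum>i<degree p. of_int (coeff p i) * x ^ i) + x ^ degree p" .
  have "x ^ degree p = (\<Sum>i<degree p. of_int (- coeff p i) * x ^ i)"
    using add.inverse_unique[OF *[symmetric], symmetric] by (simp add: sum_negf)
  then have "x ^ degree p \<in> zspan (\<lambda>i. x ^ i) (degree p)"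
    unfolding zspan_def by (intro CollectI exI conjI TrueI)
  then show ?thesis using \<open>degree p > 0\<close> by (intro exI conjI)
qed

lemma add_subgroup_mult_preimage:
  fixes x :: "'a::comm_ring_1"
  assumes "add_subgroup X"
  shows "add_subgroup {y. x * y \<in> X}"
  using add_subgroupD(1,2)[OF assms] by (simp add: add_subgroup_def right_diff_distrib)

text \<open>The monomials \<open>x ^ i * y ^ j\<close> span a finitely generated group stable under \<open>x\<close> and \<open>y\<close>.\<close>

lemma algebraic_int_pair_module:
  assumes "algebraic_int (x::complex)" "algebraic_int (y::complex)"
  shows "\<exists>e r. r > 0 \<and> e 0 = 1 \<and> (\<forall>z\<in>zspan e r. x * z \<in> zspan e r \<and> y * z \<in> zspan e r)"
proof -
  obtain c where c: "c > 0" "x ^ c \<in> zspan (\<lambda>i. x ^ i) c" using algebraic_int_power_span[OF assms(1)] by blast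
  obtain d where d: "d > 0" "y ^ d \<in> zspan (\<lambda>i. y ^ i) d" using algebraic_int_power_span[OF assms(2)] by blast
  \<comment> \<open>Quotient and remainder of \<open>k\<close> by \<open>d\<close> encode the pair
    of exponents.\<close>
  define e where "e k = x ^ (k div d) * y ^ (k mod d)" for k
  define M where "M = zspan e (c * d)"
  have M: "add_subgroup M" unfolding M_def by (rule add_subgroup_zspan)
  have eM: "x ^ i * y ^ j \<in> M" if "i < c" "j < d" for i j
  proof -
    have "e (i * d + j) = x ^ i * y ^ j" using that by (simp add: e_def)
    moreover have "i * d + j < Suc i * d" using that by simp
    then have "i * d + j < c * d" using that mult_le_mono1[of "Suc i" c d] by linarith
    ultimately show ?thesis using zspan_base[of "i * d + j" "c * d" e] by (simp add: M_def)
  qed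
  have xM: "x ^ c * y ^ j \<in> M" if j: "j < d" for j
  proof -
    have "zspan (\<lambda>i. x ^ i) c \<subseteq> {u. y ^ j * u \<in> M}"
      by (rule zspan_least[OF add_subgroup_mult_preimage[OF M]]) (use eM j in \<open>auto simp: mult.commute\<close>)
    then show ?thesis using c by (auto simp: mult.commute)
  qed
  have yM: "x ^ i * y ^ d \<in> M" if i: "i < c" for i
  proof -
    have "zspan (\<lambda>i. y ^ i) d \<subseteq> {u. x ^ i * u \<in> M}"
      by (rule zspan_least[OF add_subgroup_mult_preimage[OF M]]) (use eM i in auto)
    then show ?thesis using d by auto
  qed
  have kb: "k div d < c" "k mod d < d" if "k < c * d" for k
    using that d by (auto simp: less_mult_imp_div_less)
  have "M \<subseteq> {u. x * u \<in> M}" unfolding M_def[symmetric]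
  proof (subst M_def, rule zspan_least[OF add_subgroup_mult_preimage[OF M]])
    fix k assume k: "k < c * d"
    show "e k \<in> {u. x * u \<in> M}"
    proof (cases "Suc (k div d) = c")
      case True
      have "x * e k = x ^ Suc (k div d) * y ^ (k mod d)" by (simp add: e_def)
      then show ?thesis using xM[OF kb(2)[OF k]] unfolding True by simp
    next
      case False
      then have "Suc (k div d) < c" using kb[OF k] by simp
      then show ?thesis using eM[OF _ kb(2)[OF k], of "Suc (k div d)"] by (simp add: e_def mult.assoc)
    qed
  qed
  moreover have "M \<subseteq> {u. y * u \<in> M}" unfolding M_def[symmetric]
  proof (subst M_def, rule zspan_least[OF add_subgroup_mult_preimage[OF M]])
    fix k assume k: "k < c * d"
    show "e k \<in> {u. y * u \<in> M}"
    proof (cases "Suc (k mod d) = d")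
      case True
      have "y * e k = x ^ (k div d) * y ^ Suc (k mod d)" by (simp add: e_def algebra_simps)
      then show ?thesis using yM[OF kb(1)[OF k]] unfolding True by simp
    next
      case False
      then have "Suc (k mod d) < d" using kb[OF k] by (simp add: le_neq_implies_less Suc_leI)
      then show ?thesis using eM[OF kb(1)[OF k], of "Suc (k mod d)"] by (simp add: e_def algebra_simps)
    qed
  qed
  ultimately show ?thesis using c d
    by (intro exI[of _ e] exI[of _ "c * d"]) (auto simp: M_def e_def)
qed

lemma algebraic_int_ring:
  assumes "algebraic_int (x::complex)" "algebraic_int (y::complex)"
  shows "algebraic_int (x + y)" "algebraic_int (x - y)" "algebraic_int (x * y)"
proof -
  obtain e r where e: "r > 0" "e 0 = 1" "\<And>z. z \<in> zspan e r \<Longrightarrow> x * z \<in> zspan e r"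
     "\<And>z. z \<in> zspan e r \<Longrightarrow> y * z \<in> zspan e r"
    using algebraic_int_pair_module[OF assms] by blast
  note M = add_subgroup_zspan[of e r]
  have b: "e i \<in> zspan e r" if "i < r" for i using zspan_base that .
  have alg: "algebraic_int u" if "\<And>z. z \<in> zspan e r \<Longrightarrow> u * z \<in> zspan e r" for u
    using zspan_stable_algebraic_int[of r u e 0] that b e(1,2) by simp
  show "algebraic_int (x + y)"
    by (rule alg) (simp add: distrib_right add_subgroupD(4)[OF M] e(3,4))
  show "algebraic_int (x - y)"
    by (rule alg) (simp add: left_diff_distrib add_subgroupD(2)[OF M] e(3,4))
  show "algebraic_int (x * y)"
    by (rule alg) (simp add: mult.assoc e(3,4))
qed

lemma algebraic_int_power: "algebraic_int (x :: complex) \<Longrightarrow> algebraic_int (x ^ n)"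
  by (induction n) (auto intro: algebraic_int_ring)

text \<open>With \<open>c\<close> the leading coefficient and \<open>d\<close> the degree of the
  equation, multiplying it by \<open>c ^ (d - 1)\<close> writes \<open>(c x) ^ d\<close> as an
  integer combination of lower powers of \<open>c x\<close>, whose span is therefore stable under
  \<open>c x\<close>.\<close>

lemma algebraic_multiple_algebraic_int:
  assumes "algebraic (x::complex)"
  shows "\<exists>D>0. algebraic_int (of_nat D * x)"
proof -
  obtain p where p: "\<And>i. coeff p i \<in> \<int>" "p \<noteq> 0" "poly p x = 0" using assms by (auto simp: algebraic_def)
  obtain c where c: "lead_coeff p = of_int c" using p(1) by (auto elim: Ints_cases)
  have c0: "c \<noteq> 0" using c p(2) by auto
  let ?d = "degree p"
  have dpos: "?d > 0"
  proof (rule ccontr)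
    assume "\<not> ?d > 0"
    then obtain a where "p = [:a:]" by (auto elim: degree_eq_zeroE)
    then show False using p by simp
  qed
  define e where "e = (\<lambda>i. (of_int c * x) ^ i)"
  have M: "add_subgroup (zspan e ?d)" by (rule add_subgroup_zspan)
  have b: "e i \<in> zspan e ?d" if "i < ?d" for i using zspan_base that .
  have e0: "0 = (\<Sum>i\<le>?d. coeff p i * x ^ i)" using p(3) by (simp add: poly_altdef)
  also have "\<dots> = (\<Sum>i<?d. coeff p i * x ^ i) + of_int c * x ^ ?d"
    using c by (simp add: lessThan_Suc_atMost[symmetric])
  finally have *: "0 = (\<Sum>i<?d. coeff p i * x ^ i) + of_int c * x ^ ?d" .
  note add.inverse_unique[OF *[symmetric], symmetric]
  then have "of_int c ^ (?d - 1) * (of_int c * x ^ ?d) = - (\<Sum>i<?d. of_int c ^ (?d - 1) * (coeff p i * x ^ i))"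
    by (simp add: sum_distrib_left)
  also have "of_int c ^ (?d - 1) * (of_int c * x ^ ?d) = e ?d"
    using dpos by (simp add: e_def power_mult_distrib) (metis One_nat_def Suc_pred power_Suc2 mult.assoc)
  also have "(\<Sum>i<?d. of_int c ^ (?d - 1) * (coeff p i * x ^ i)) = (\<Sum>i<?d. of_int (c ^ (?d - 1 - i)) * (coeff p i * e i))"
  proof (rule sum.cong)
    fix i assume "i \<in> {..<?d}"
    then have "?d - 1 = (?d - 1 - i) + i" by auto
    then have "(of_int c :: complex) ^ (?d - 1) = of_int c ^ (?d - 1 - i) * of_int c ^ i" by (metis power_add)
    then show "of_int c ^ (?d - 1) * (coeff p i * x ^ i) = of_int (c ^ (?d - 1 - i)) * (coeff p i * e i)"
      by (simp add: e_def power_mult_distrib)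
  qed simp
  finally have "e ?d \<in> zspan e ?d"
  proof -
    assume *: "e ?d = - (\<Sum>i<?d. of_int (c ^ (?d - 1 - i)) * (coeff p i * e i))"
    have "coeff p i * e i \<in> zspan e ?d" if "i < ?d" for i
      using p(1)[of i] add_subgroup_of_int_mult[OF M b[OF that]] by (auto elim: Ints_cases)
    then show ?thesis unfolding *
      by (intro add_subgroupD(3)[OF M] add_subgroup_sum[OF M] add_subgroup_of_int_mult[OF M]) auto
  qed
  moreover have "of_int c * x * e i = e (Suc i)" for i by (simp add: e_def)
  ultimately have "of_int c * x * e i \<in> zspan e ?d" if "i < ?d" for i
    using that b[of "Suc i"] by (cases "Suc i = ?d") auto
  then have ai: "algebraic_int (of_int c * x)"
    using zspan_stable_algebraic_int[of ?d "of_int c * x" e 0] dpos by (simp add: e_def)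
  have "algebraic_int (of_int \<bar>c\<bar> * x)"
    using ai algebraic_int_minus[OF ai] by (cases "c \<ge> 0") auto
  then show ?thesis using c0 by (intro exI[of _ "nat \<bar>c\<bar>"]) auto
qed

section \<open>Number fields: integral bases, embeddings and units\<close>

lemma subfield_CD:
  assumes "subfield_C K"
  shows "0 \<in> K" "1 \<in> K" "x \<in> K \<Longrightarrow> y \<in> K \<Longrightarrow> x + y \<in> K" "x \<in> K \<Longrightarrow> y \<in> K \<Longrightarrow> x - y \<in> K"
    "x \<in> K \<Longrightarrow> y \<in> K \<Longrightarrow> x * y \<in> K" "x \<in> K \<Longrightarrow> inverse x \<in> K" "x \<in> K \<Longrightarrow> y \<in> K \<Longrightarrow> x / y \<in> K"
    "x \<in> K \<Longrightarrow> - x \<in> K" "x \<in> K \<Longrightarrow> x ^ m \<in> K" "of_nat m \<in> K" "of_int k \<in> K" "of_rat q \<in> K"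
proof -
  note d = assms[unfolded subfield_C_def]
  show 0: "0 \<in> K" and 1: "1 \<in> K" using d by auto
  show add: "x \<in> K \<Longrightarrow> y \<in> K \<Longrightarrow> x + y \<in> K" and sub: "x \<in> K \<Longrightarrow> y \<in> K \<Longrightarrow> x - y \<in> K"
    and mul: "x \<in> K \<Longrightarrow> y \<in> K \<Longrightarrow> x * y \<in> K" for x y using d by auto
  show inv: "x \<in> K \<Longrightarrow> inverse x \<in> K" for x using d 0 by (cases "x = 0") auto
  show div: "x \<in> K \<Longrightarrow> y \<in> K \<Longrightarrow> x / y \<in> K" for x y using mul inv by (simp add: divide_inverse)
  show neg: "x \<in> K \<Longrightarrow> - x \<in> K" for x using sub[OF 0, of x] by simp
  show "x \<in> K \<Longrightarrow> x ^ m \<in> K" by (induction m) (auto intro: 1 mul)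
  show nat: "of_nat m \<in> K" for m by (induction m) (auto intro: 0 1 add)
  show int: "of_int k \<in> K" for k
    using nat[of "nat k"] neg[OF nat[of "nat (- k)"]] by (cases "k \<ge> 0") auto
  obtain a b where "q = Rat.Fract a b" "b > 0" by (cases q) auto
  then show "of_rat q \<in> K" using div[OF int[of a] int[of b]] by (simp add: of_rat_rat)
qed

lemma subfield_C_sum: "subfield_C K \<Longrightarrow> (\<And>i. i \<in> I \<Longrightarrow> f i \<in> K) \<Longrightarrow> sum f I \<in> K"
  by (induction I rule: infinite_finite_induct) (auto intro: subfield_CD)

lemma subfield_C_prod: "subfield_C K \<Longrightarrow> (\<And>i. i \<in> I \<Longrightarrow> f i \<in> K) \<Longrightarrow> prod f I \<in> K"
  by (induction I rule: infinite_finite_induct) (auto intro: subfield_CD)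

section \<open>Rational bases of number fields\<close>

definition rspan :: "(nat \<Rightarrow> complex) \<Rightarrow> nat \<Rightarrow> complex set" where
  "rspan b n = {(\<Sum>i<n. of_rat (q i) * b i) | q. True}"

text \<open>A rational basis consisting of algebraic integers, in general not an integral basis.
  Sizes are measured in its coordinates, and the gap between its integral span and the ring of
  integers is controlled by a common denominator.\<close>

locale number_field_basis =
  fixes K :: "complex set" and b :: "nat \<Rightarrow> complex" and n :: nat
  assumes K: "subfield_C K"
    and b: "i < n \<Longrightarrow> b i \<in> K" "i < n \<Longrightarrow> algebraic_int (b i)"
    and b_indep: "(\<Sum>i<n. of_rat (q i) * b i) = 0 \<Longrightarrow> i < n \<Longrightarrow> q i = 0"
    and b_span: "K \<subseteq> rspan b n"

lemma rspan_basis: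
  assumes "finite S" 
  obtains b n where "\<And>i. i < n \<Longrightarrow> b i \<in> S"
    "\<And>q i. (\<Sum>i<n. of_rat (q i) * b i) = 0 \<Longrightarrow> i < n \<Longrightarrow> q i = (0::rat)"
    "\<And>q. (\<Sum>y\<in>S. of_rat (q y) * y) \<in> rspan b n"
proof -
  interpret Q: vector_space "\<lambda>(q::rat) (x::complex). of_rat q * x"
    by unfold_locales (auto simp: algebra_simps of_rat_add of_rat_mult)
  obtain B where B: "B \<subseteq> S" "Q.independent B" "S \<subseteq> Q.span B"
    using Q.maximal_independent_subset by blast
  have finB: "finite B" using B(1) assms finite_subset by blast
  obtain b where bij: "bij_betw b {..<card B} B"
    using ex_bij_betw_nat_finite[OF finB] by (auto simp: atLeast0LessThan)
  have sumb: "(\<Sum>i<card B. of_rat (q (b i)) * b i) = (\<Sum>y\<in>B. of_rat (q y) * y)" for q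
    using sum.reindex_bij_betw[OF bij, of "\<lambda>y. of_rat (q y) * y"] by simp
  have "q i = 0" if "(\<Sum>i<card B. of_rat (q i) * b i) = 0" "i < card B" for q i
  proof -
    define q' where "q' = q \<circ> inv_into {..<card B} b"
    have q': "q' (b i) = q i" if "i < card B" for i
      using bij that by (auto simp: q'_def bij_betw_def inv_into_f_f)
    have "(\<Sum>y\<in>B. of_rat (q' y) * y) = (\<Sum>i<card B. of_rat (q' (b i)) * b i)" by (rule sumb[symmetric])
    also have "\<dots> = (\<Sum>i<card B. of_rat (q i) * b i)" by (rule sum.cong) (auto simp: q')
    also have "\<dots> = 0" by (rule that(1))
    finally have "q' (b i) = 0"
      using Q.independentD[OF B(2) finB subset_refl, of q' "b i"] bij that(2)
      by (auto simp: bij_betw_def)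
    then show ?thesis using q' that by simp
  qed
  moreover have "(\<Sum>y\<in>S. of_rat (q y) * y) \<in> rspan b (card B)" for q
  proof -
    have "(\<Sum>y\<in>S. of_rat (q y) * y) \<in> Q.span B"
      using B(3) by (intro Q.span_sum Q.span_scale) auto
    then obtain p where "(\<Sum>y\<in>S. of_rat (q y) * y) = (\<Sum>y\<in>B. of_rat (p y) * y)"
      using Q.span_finite[OF finB] by auto
    then have "(\<Sum>y\<in>S. of_rat (q y) * y) = (\<Sum>i<card B. of_rat ((p \<circ> b) i) * b i)" using sumb[of p] by simp
    then show ?thesis unfolding rspan_def by (intro CollectI exI conjI TrueI)
  qed
  moreover have "b i \<in> S" if "i < card B" for i using that bij B(1) by (auto simp: bij_betw_def)
  ultimately show thesis using that by presburger
qed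

text \<open>A common denominator \<open>d\<close> of the multiplication matrix makes
  \<open>d x\<close> integral; substituting \<open>d X\<close> into an equation of
  \<open>d x\<close> gives one for \<open>x\<close>.\<close>

lemma rspan_algebraic:
  assumes st: "\<And>i. i < n \<Longrightarrow> x * b i \<in> rspan b n" and "i0 < n" "b i0 \<noteq> 0"
  shows "algebraic x"
proof -
  have "\<forall>i. \<exists>a. i < n \<longrightarrow> x * b i = (\<Sum>j<n. of_rat (a j) * b j)"
    using st unfolding rspan_def mem_Collect_eq by meson
  then obtain a where a: "\<And>i. i < n \<Longrightarrow> x * b i = (\<Sum>j<n. of_rat (a i j) * b j)" by metis
  define d where "d = (\<Prod>i<n. \<Prod>j<n. snd (quotient_of (a i j)))"
  have dpos: "d > 0" unfolding d_def by (intro prod_pos quotient_of_denom_pos') 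
  have "\<exists>m. of_int d * a i j = of_int m" if "i < n" "j < n" for i j
  proof -
    obtain p q where pq: "quotient_of (a i j) = (p, q)" by force
    have "q dvd (\<Prod>j<n. snd (quotient_of (a i j)))"
      using that pq dvd_prodI[of "{..<n}" j "\<lambda>j. snd (quotient_of (a i j))"] by simp
    then have "q dvd d" unfolding d_def
      using that dvd_prodI[of "{..<n}" i "\<lambda>i. \<Prod>j<n. snd (quotient_of (a i j))"] by (auto intro: dvd_trans)
    then obtain c where "d = q * c" by (auto elim: dvdE)
    moreover have "a i j = of_int p / of_int q" by (rule quotient_of_div[OF pq])
    moreover have "q > 0" using quotient_of_denom_pos[OF pq] .
    ultimately have "of_int d * a i j = of_int (c * p)" by (simp add: field_simps)
    then show ?thesis by blast
  qed
  then obtain m where m: "\<And>i j. i < n \<Longrightarrow> j < n \<Longrightarrow> of_int d * a i j = of_int (m i j)" by metis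
  have "of_int d * x * b i \<in> zspan b n" if "i < n" for i
  proof -
    have "of_int d * x * b i = (\<Sum>j<n. of_rat (of_int d * a i j) * b j)"
      using a[OF that] by (simp add: mult.assoc sum_distrib_left of_rat_mult)
    also have "\<dots> = (\<Sum>j<n. of_int (m i j) * b j)" by (rule sum.cong) (simp_all add: m that)
    finally show ?thesis unfolding zspan_def by (intro CollectI exI conjI TrueI)
  qed
  then have "algebraic_int (of_int d * x)" by (rule zspan_stable_algebraic_int[of n _ b i0]) (use assms in auto)
  then have "algebraic (of_int d * x)" by auto
  then obtain p where p: "\<And>i. coeff p i \<in> \<int>" "p \<noteq> 0" "poly p (of_int d * x) = 0" by (auto simp: algebraic_def)
  have "poly (pcompose p [:0, of_int d:]) x = 0" using p(3) by (simp add: poly_pcompose mult.commute)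
  moreover have "pcompose p [:0, of_int d:] \<noteq> 0" using p(2) dpos by (simp add: pcompose_eq_0_iff)
  moreover have "coeff (pcompose p [:0, of_int d:]) i \<in> \<int>" for i
    using p(1)[of i] coeff_pcompose_linear[of p "of_int d" i] by auto
  ultimately show ?thesis by (auto simp: algebraic_def)
qed

lemma number_field_obtain_basis:
  assumes "number_field K"
  obtains b n where "number_field_basis K b n"
proof -
  have K: "subfield_C K" using assms by (simp add: number_field_def)
  obtain S where S: "finite S" "S \<subseteq> K" "\<And>x. x \<in> K \<Longrightarrow> \<exists>q. x = (\<Sum>y\<in>S. of_rat (q y) * y)"
    using assms by (auto simp: number_field_def)
  obtain b n where b: "\<And>i. i < n \<Longrightarrow> b i \<in> S"
      "\<And>q i. (\<Sum>i<n. of_rat (q i) * b i) = 0 \<Longrightarrow> i < n \<Longrightarrow> q i = (0::rat)"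
      "\<And>q. (\<Sum>y\<in>S. of_rat (q y) * y) \<in> rspan b n"
    by (rule rspan_basis[OF S(1)], rule that) assumption+
  have span: "K \<subseteq> rspan b n"
  proof
    fix x assume "x \<in> K"
    then obtain q where "x = (\<Sum>y\<in>S. of_rat (q y) * y)" using S(3) by blast
    then show "x \<in> rspan b n" using b(3) by simp
  qed
  have bK: "b i \<in> K" if "i < n" for i using b(1) S(2) that by auto
  have "n > 0"
  proof (rule ccontr)
    assume "\<not> n > 0"
    then show False using span subfield_CD(2)[OF K] by (auto simp: rspan_def)
  qed
  moreover have "b 0 \<noteq> 0"
  proof
    assume "b 0 = 0"
    then have "(\<Sum>i<n. of_rat (if i = 0 then 1 else 0) * b i) = 0" by (intro sum.neutral) auto
    then show False using b(2)[of "\<lambda>i. if i = 0 then 1 else 0" 0] \<open>n > 0\<close> by auto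
  qed
  ultimately have alg: "algebraic x" if "x \<in> K" for x
    by (intro rspan_algebraic[of n _ b 0]) (use that bK span in \<open>auto intro: subfield_CD[OF K]\<close>)
  have "\<exists>D>0. algebraic_int (of_nat D * b i)" if "i < n" for i
    by (rule algebraic_multiple_algebraic_int[OF alg[OF bK[OF that]]])
  then obtain D where D: "\<And>i. i < n \<Longrightarrow> D i > 0 \<and> algebraic_int (of_nat (D i) * b i)" by metis
  have "number_field_basis K (\<lambda>i. of_nat (D i) * b i) n"
  proof
    show "subfield_C K" by (rule K)
    show "of_nat (D i) * b i \<in> K" "algebraic_int (of_nat (D i) * b i)" if "i < n" for i
      using that D bK by (auto intro: subfield_CD[OF K])
    show "q i = 0" if "(\<Sum>i<n. of_rat (q i) * (of_nat (D i) * b i)) = 0" "i < n" for q i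
    proof -
      have "(\<Sum>i<n. of_rat (q i * of_nat (D i)) * b i) = 0"
        using that(1) by (simp add: of_rat_mult mult.assoc)
      from b(2)[OF this that(2)] show ?thesis using D[OF that(2)] by simp
    qed
    show "K \<subseteq> rspan (\<lambda>i. of_nat (D i) * b i) n"
    proof
      fix x assume "x \<in> K"
      then obtain q where "x = (\<Sum>i<n. of_rat (q i) * b i)" using span by (auto simp: rspan_def)
      also have "\<dots> = (\<Sum>i<n. of_rat (q i / of_nat (D i)) * (of_nat (D i) * b i))"
      proof (rule sum.cong)
        fix i assume "i \<in> {..<n}"
        then have "D i > 0" using D by auto
        then show "of_rat (q i) * b i = of_rat (q i / of_nat (D i)) * (of_nat (D i) * b i)"
          by (simp add: of_rat_divide)
      qed simp
      finally show "x \<in> rspan (\<lambda>i. of_nat (D i) * b i) n" unfolding rspan_def by (intro CollectI exI conjI TrueI)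
    qed
  qed
  then show thesis by (rule that)
qed

definition units_of_integers :: "complex set \<Rightarrow> complex set" where
  "units_of_integers K = {x \<in> ring_of_integers K. x \<noteq> 0 \<and> inverse x \<in> ring_of_integers K}"

lemma ring_of_integersD:
  assumes "subfield_C K"
  shows "0 \<in> ring_of_integers K" "1 \<in> ring_of_integers K" "of_int m \<in> ring_of_integers K"
    "of_nat k \<in> ring_of_integers K"
    "x \<in> ring_of_integers K \<Longrightarrow> y \<in> ring_of_integers K \<Longrightarrow> x + y \<in> ring_of_integers K"
    "x \<in> ring_of_integers K \<Longrightarrow> y \<in> ring_of_integers K \<Longrightarrow> x - y \<in> ring_of_integers K"
    "x \<in> ring_of_integers K \<Longrightarrow> y \<in> ring_of_integers K \<Longrightarrow> x * y \<in> ring_of_integers K"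
    "x \<in> ring_of_integers K \<Longrightarrow> - x \<in> ring_of_integers K"
    "x \<in> ring_of_integers K \<Longrightarrow> x ^ k \<in> ring_of_integers K"
  using subfield_CD[OF assms]
  by (auto simp: ring_of_integers_def algebraic_int_ring algebraic_int_power)

lemma ring_of_integers_add_subgroup: "subfield_C K \<Longrightarrow> add_subgroup (ring_of_integers K)"
  by (simp add: add_subgroup_def ring_of_integersD)

lemma ring_of_integers_sum:
  "subfield_C K \<Longrightarrow> (\<And>i. i \<in> I \<Longrightarrow> f i \<in> ring_of_integers K) \<Longrightarrow> sum f I \<in> ring_of_integers K"
  by (rule add_subgroup_sum[OF ring_of_integers_add_subgroup])

lemma mult_subgroup_units:
  assumes "subfield_C K"
  shows "mult_subgroup (units_of_integers K)"
proof -
  have "x / y \<in> units_of_integers K" if "x \<in> units_of_integers K" "y \<in> units_of_integers K" for x y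
    using that ring_of_integersD(7)[OF assms, of x "inverse y"] ring_of_integersD(7)[OF assms, of y "inverse x"]
    by (auto simp: units_of_integers_def divide_inverse mult.commute)
  then show ?thesis using ring_of_integersD(2)[OF assms]
    by (auto simp: mult_subgroup_def units_of_integers_def)
qed

text \<open>One more linear factor replaces a coefficient by the difference of a neighbour and
  \<open>a\<close> times itself, which stays integral and costs at most a factor
  \<open>1 + B\<close>. This is applied to characteristic polynomials.\<close>

lemma prod_linear_coeffs:
  fixes as :: "complex list"
  assumes "\<And>a. a \<in> set as \<Longrightarrow> algebraic_int a \<and> norm a \<le> B" "B \<ge> 0"
  shows "algebraic_int (coeff (\<Prod>a\<leftarrow>as. [:- a, 1:]) i) \<and> norm (coeff (\<Prod>a\<leftarrow>as. [:- a, 1:]) i) \<le> (1 + B) ^ length as"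
  using assms(1)
proof (induction as arbitrary: i)
  case Nil
  then show ?case by (auto simp: coeff_pCons split: nat.split)
next
  case (Cons a as)
  let ?p = "\<Prod>a\<leftarrow>as. [:- a, 1:]"
  have a: "algebraic_int a" "norm a \<le> B" using Cons.prems by auto
  have IH: "algebraic_int (coeff ?p j)" "norm (coeff ?p j) \<le> (1 + B) ^ length as" for j
    using Cons.IH[of j] Cons.prems by auto
  define s where "s = (case i of 0 \<Rightarrow> 0 | Suc j \<Rightarrow> coeff ?p j)"
  have s: "algebraic_int s" "norm s \<le> (1 + B) ^ length as"
    using IH assms(2) by (auto simp: s_def split: nat.split)
  have eq: "coeff (\<Prod>a\<leftarrow>a # as. [:- a, 1:]) i = s - a * coeff ?p i"
    by (auto simp: s_def coeff_pCons split: nat.split)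
  have "norm (s - a * coeff ?p i) \<le> norm s + norm a * norm (coeff ?p i)"
    by (metis norm_mult norm_triangle_ineq4)
  also have "\<dots> \<le> (1 + B) ^ length as + B * (1 + B) ^ length as"
    by (intro add_mono mult_mono s a IH assms) auto
  finally show ?case unfolding eq using s(1) a(1) IH(1)
    by (auto simp: algebra_simps intro!: algebraic_int_ring)
qed

lemma finite_polys_bounded:
  assumes "finite (C :: 'a::zero set)"
  shows "finite {p :: 'a poly. degree p \<le> n \<and> (\<forall>i. coeff p i \<in> C)}"
proof -
  have "{p. degree p \<le> n \<and> (\<forall>i. coeff p i \<in> C)} \<subseteq> Poly ` {xs. set xs \<subseteq> C \<and> length xs \<le> Suc n}"
  proof
    fix p :: "'a poly" assume p: "p \<in> {p. degree p \<le> n \<and> (\<forall>i. coeff p i \<in> C)}"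
    have "set (coeffs p) \<subseteq> C" using p by (auto simp: coeffs_def)
    moreover have "length (coeffs p) \<le> Suc n" using p by (auto simp: coeffs_def)
    moreover have "p = Poly (coeffs p)" by simp
    ultimately show "p \<in> Poly ` {xs. set xs \<subseteq> C \<and> length xs \<le> Suc n}" by blast
  qed
  then show ?thesis using finite_lists_length_le[OF assms] by (meson finite_imageI finite_subset)
qed

section \<open>Coordinates and embeddings\<close>

context number_field_basis
begin

abbreviation OK :: "complex set" where "OK \<equiv> ring_of_integers K"

lemma OKD: "x \<in> OK \<Longrightarrow> x \<in> K" "x \<in> OK \<Longrightarrow> algebraic_int x"
  by (auto simp: ring_of_integers_def)

lemma b_OK: "i < n \<Longrightarrow> b i \<in> OK"
  using b by (auto simp: ring_of_integers_def)

text \<open>The value 0 from index \<open>n\<close> on makes the coordinates additive at every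
  index.\<close>

definition co :: "complex \<Rightarrow> nat \<Rightarrow> rat" where
  "co x = (SOME q. x = (\<Sum>i<n. of_rat (q i) * b i) \<and> (\<forall>i\<ge>n. q i = 0))"

lemma co:
  assumes "x \<in> K"
  shows "x = (\<Sum>i<n. of_rat (co x i) * b i)" "i \<ge> n \<Longrightarrow> co x i = 0"
proof -
  obtain q where "x = (\<Sum>i<n. of_rat (q i) * b i)" using assms b_span by (auto simp: rspan_def)
  then have "x = (\<Sum>i<n. of_rat ((\<lambda>i. if i < n then q i else 0) i) * b i) \<and> (\<forall>i\<ge>n. (\<lambda>i. if i < n then q i else 0) i = 0)"
    by simp
  from someI[of "\<lambda>q. x = (\<Sum>i<n. of_rat (q i) * b i) \<and> (\<forall>i\<ge>n. q i = 0)", OF this]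
  show "x = (\<Sum>i<n. of_rat (co x i) * b i)" "i \<ge> n \<Longrightarrow> co x i = 0"
    unfolding co_def by auto
qed

lemma combo_K: "(\<Sum>i<n. of_rat (q i) * b i) \<in> K"
  by (intro subfield_C_sum[OF K] subfield_CD[OF K] b) auto

lemma co_unique:
  assumes "x = (\<Sum>i<n. of_rat (q i) * b i)" "i < n"
  shows "co x i = q i"
proof -
  have "x \<in> K" using assms combo_K by simp
  from co(1)[OF this] assms(1) have "(\<Sum>i<n. of_rat (co x i - q i) * b i) = 0"
    by (simp add: of_rat_diff left_diff_distrib sum_subtractf)
  from b_indep[OF this assms(2)] show ?thesis by simp
qed

lemma co_add:
  assumes "x \<in> K" "y \<in> K"
  shows "co (x + y) i = co x i + co y i"
proof (cases "i < n")
  case True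
  have "x + y = (\<Sum>i<n. of_rat (co x i + co y i) * b i)"
    using co(1)[OF assms(1)] co(1)[OF assms(2)] by (simp add: of_rat_add distrib_right sum.distrib)
  then show ?thesis using True by (rule co_unique)
next
  case False
  then show ?thesis using assms subfield_CD[OF K] by (simp add: co(2))
qed

lemma co_rat:
  assumes "x \<in> K"
  shows "co (of_rat q * x) i = q * co x i"
proof (cases "i < n")
  case True
  have "of_rat q * x = (\<Sum>i<n. of_rat (q * co x i) * b i)"
    using arg_cong[OF co(1)[OF assms(1)], of "\<lambda>x. of_rat q * x"]
    by (simp add: of_rat_mult sum_distrib_left mult.assoc)
  then show ?thesis using True by (rule co_unique)
next
  case False
  then show ?thesis using assms subfield_CD[OF K] by (simp add: co(2))
qed

lemma co_diff: "x \<in> K \<Longrightarrow> y \<in> K \<Longrightarrow> co (x - y) i = co x i - co y i"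
  using co_add[of x "of_rat (-1) * y" i] co_rat[of y "-1" i] subfield_CD[OF K] by simp

lemma n_pos: "n > 0"
proof (rule ccontr)
  assume "\<not> n > 0"
  then show False using b_span subfield_CD(2)[OF K] by (auto simp: rspan_def)
qed

definition mm :: "complex \<Rightarrow> nat \<Rightarrow> nat \<Rightarrow> rat" where "mm x i j = co (x * b i) j"

lemma mm: "x \<in> K \<Longrightarrow> i < n \<Longrightarrow> x * b i = (\<Sum>j<n. of_rat (mm x i j) * b j)"
  unfolding mm_def by (rule co) (auto intro: subfield_CD[OF K] b)

lemma mm_mult:
  assumes "x \<in> K" "y \<in> K" "i < n" "j < n"
  shows "mm (x * y) i j = (\<Sum>l<n. mm y i l * mm x l j)"
proof -
  have "x * y * b i = x * (\<Sum>l<n. of_rat (mm y i l) * b l)" using mm[OF assms(2,3)] by simp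
  also have "\<dots> = (\<Sum>l<n. of_rat (mm y i l) * (x * b l))" by (simp add: sum_distrib_left mult_ac)
  also have "\<dots> = (\<Sum>l<n. \<Sum>j<n. of_rat (mm y i l * mm x l j) * b j)"
    using mm[OF assms(1)] by (intro sum.cong) (auto simp: sum_distrib_left of_rat_mult mult.assoc)
  also have "\<dots> = (\<Sum>j<n. of_rat (\<Sum>l<n. mm y i l * mm x l j) * b j)"
    by (subst sum.swap) (simp add: of_rat_sum sum_distrib_right)
  finally have e: "x * y * b i = (\<Sum>j<n. of_rat (\<Sum>l<n. mm y i l * mm x l j) * b j)" .
  show ?thesis unfolding mm_def[of "x * y"] by (rule co_unique[OF e assms(4)])
qed

text \<open>The field embeddings of \<open>K\<close>. The value 0 outside \<open>K\<close> makes
  each of them one function on all of \<open>complex\<close>; otherwise the set could not be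
  finite.\<close>

definition Homs :: "(complex \<Rightarrow> complex) set" where
  "Homs = {s. s 1 = 1 \<and> (\<forall>x\<in>K. \<forall>y\<in>K. s (x + y) = s x + s y \<and> s (x * y) = s x * s y) \<and> (\<forall>x. x \<notin> K \<longrightarrow> s x = 0)}"

lemma HomsD:
  assumes "s \<in> Homs"
  shows "s 1 = 1" "x \<in> K \<Longrightarrow> y \<in> K \<Longrightarrow> s (x + y) = s x + s y" "x \<in> K \<Longrightarrow> y \<in> K \<Longrightarrow> s (x * y) = s x * s y"
    "s 0 = 0" "x \<in> K \<Longrightarrow> s (- x) = - s x" "x \<in> K \<Longrightarrow> x \<noteq> 0 \<Longrightarrow> s x \<noteq> 0" "s (of_rat q) = of_rat q"
    "(\<And>i. i \<in> I \<Longrightarrow> f i \<in> K) \<Longrightarrow> s (sum f I) = (\<Sum>i\<in>I. s (f i))"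
    "x \<in> K \<Longrightarrow> s (x ^ k) = s x ^ k"
proof -
  note 0 = subfield_CD[OF K]
  show 1: "s 1 = 1" and add: "x \<in> K \<Longrightarrow> y \<in> K \<Longrightarrow> s (x + y) = s x + s y"
     and mul: "x \<in> K \<Longrightarrow> y \<in> K \<Longrightarrow> s (x * y) = s x * s y" for x y using assms by (auto simp: Homs_def)
  show z: "s 0 = 0" using add[of 0 0] 0 by simp
  show neg: "x \<in> K \<Longrightarrow> s (- x) = - s x" for x
  proof -
    assume "x \<in> K"
    then have "s x + s (- x) = 0" using add[of x "- x"] 0(8) z by simp
    then show ?thesis by (rule add.inverse_unique[symmetric])
  qed
  show "x \<in> K \<Longrightarrow> x \<noteq> 0 \<Longrightarrow> s x \<noteq> 0" using mul[of x "inverse x"] 0 1 by auto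
  have nat: "s (of_nat m) = of_nat m" for m using add[OF 0(2) 0(10)] z 1 by (induction m) auto
  have int: "s (of_int m) = of_int m" for m
    using nat[of "nat m"] neg[OF 0(10)[of "nat (- m)"]] nat[of "nat (- m)"] by (cases "m \<ge> 0") auto
  obtain u v where q: "q = Rat.Fract u v" "v > 0" by (cases q) auto
  have "of_rat q * of_int v = (of_int u :: complex)" using q by (simp add: of_rat_rat)
  then have "s (of_rat q) * of_int v = of_int u" using mul[OF 0(12)[of q] 0(11)[of v]] int by metis
  then show "s (of_rat q) = of_rat q" using q by (simp add: of_rat_rat field_simps)
  show "(\<And>i. i \<in> I \<Longrightarrow> f i \<in> K) \<Longrightarrow> s (sum f I) = (\<Sum>i\<in>I. s (f i))"
    by (induction I rule: infinite_finite_induct) (auto simp: z add subfield_C_sum[OF K])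
  show "x \<in> K \<Longrightarrow> s (x ^ k) = s x ^ k" by (induction k) (auto simp: 1 mul 0)
qed

lemma Homs_co:
  assumes s: "s \<in> Homs" and x: "x \<in> K"
  shows "s x = (\<Sum>i<n. of_rat (co x i) * s (b i))"
proof -
  have "s x = s (\<Sum>i<n. of_rat (co x i) * b i)" using co(1)[OF x] by simp
  also have "\<dots> = (\<Sum>i<n. s (of_rat (co x i) * b i))"
    by (rule HomsD(8)[OF s]) (auto intro: subfield_CD[OF K] b)
  also have "\<dots> = (\<Sum>i<n. of_rat (co x i) * s (b i))"
    by (intro sum.cong) (auto simp: HomsD(3)[OF s] HomsD(7)[OF s] subfield_CD[OF K] b)
  finally show ?thesis .
qed

text \<open>An embedding is determined by its values on the basis, and its value at
  \<open>b i\<close> is a root of the integer equation of \<open>b i\<close>.\<close>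

lemma finite_Homs: "finite Homs"
proof -
  have "\<forall>i\<in>{..<n}. \<exists>p. p \<noteq> 0 \<and> (\<forall>s\<in>Homs. poly p (s (b i)) = 0)"
  proof
    fix i assume "i \<in> {..<n}"
    then have i: "i < n" by simp
    obtain p where p: "poly (map_poly of_int p) (b i) = 0" "lead_coeff p = 1"
      using b(2)[OF i] by (auto simp: algebraic_int_altdef_ipoly)
    have "map_poly of_int p \<noteq> (0 :: complex poly)"
      using p(2) by (metis coeff_0 coeff_map_poly of_int_0 of_int_1 zero_neq_one)
    moreover have "poly (map_poly of_int p) (s (b i)) = 0" if s: "s \<in> Homs" for s
    proof -
      let ?p = "map_poly of_int p :: complex poly"
      have cK: "coeff ?p j \<in> K" for j by (simp add: coeff_map_poly subfield_CD[OF K])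
      have sc: "s (coeff ?p j) = coeff ?p j" for j
        using HomsD(7)[OF s, of "of_int (coeff p j)"] by (simp add: coeff_map_poly)
      have si: "s (of_int m) = of_int m" for m using HomsD(7)[OF s, of "of_int m"] by simp
      have "0 = s (poly ?p (b i))" using p HomsD(4)[OF s] by simp
      also have "\<dots> = poly ?p (s (b i))" unfolding poly_altdef
        using i by (simp add: HomsD(8)[OF s] HomsD(3)[OF s] HomsD(9)[OF s] sc si cK b subfield_CD[OF K])
      finally show ?thesis by simp
    qed
    ultimately show "\<exists>p. p \<noteq> 0 \<and> (\<forall>s\<in>Homs. poly p (s (b i)) = 0)" by blast
  qed
  from bchoice[OF this] obtain p where
    p: "\<And>i. i < n \<Longrightarrow> p i \<noteq> 0" "\<And>i s. i < n \<Longrightarrow> s \<in> Homs \<Longrightarrow> poly (p i) (s (b i)) = 0" by auto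
  let ?r = "\<lambda>s. restrict (\<lambda>i. s (b i)) {..<n}"
  have "?r ` Homs \<subseteq> (\<Pi>\<^sub>E i\<in>{..<n}. {z. poly (p i) z = 0})" 
    using p(2) by (simp add: image_subset_iff restrict_PiE_iff del: restrict_apply)
  moreover have "finite (\<Pi>\<^sub>E i\<in>{..<n}. {z. poly (p i) z = 0})"
    by (intro finite_PiE) (auto simp: poly_roots_finite p(1))
  ultimately have "finite (?r ` Homs)" by (rule finite_subset)
  moreover have "inj_on ?r Homs"
  proof
    fix s t assume st: "s \<in> Homs" "t \<in> Homs" "?r s = ?r t"
    have "s (b i) = t (b i)" if "i < n" for i using fun_cong[OF st(3), of i] that by simp
    then have 1: "s x = t x" if "x \<in> K" for x
      unfolding Homs_co[OF st(1) that] Homs_co[OF st(2) that] by simp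
    have 2: "s x = t x" if "x \<notin> K" for x using that st by (simp add: Homs_def)
    show "s = t" using 1 2 by (intro ext) metis
  qed
  ultimately show ?thesis by (rule finite_imageD)
qed

end

section \<open>Eigenvalues of multiplication matrices and embeddings\<close>

lemma complex_vector_space_fun: "complex_vector_space (\<lambda>c (f :: nat \<Rightarrow> complex) i. c * f i)"
  by unfold_locales (auto simp: algebra_simps plus_fun_def)

context number_field_basis
begin

definition mop :: "complex \<Rightarrow> (nat \<Rightarrow> complex) \<Rightarrow> nat \<Rightarrow> complex" where
  "mop x f i = (if i < n then \<Sum>j<n. of_rat (mm x i j) * f j else 0)"

lemma mop_mult: "x \<in> K \<Longrightarrow> y \<in> K \<Longrightarrow> mop (x * y) f = mop y (mop x f)"
proof
  fix i assume xy: "x \<in> K" "y \<in> K"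
  show "mop (x * y) f i = mop y (mop x f) i"
  proof (cases "i < n")
    case True
    have "mop (x * y) f i = (\<Sum>j<n. \<Sum>l<n. of_rat (mm y i l) * of_rat (mm x l j) * f j)"
      using True xy by (simp add: mop_def mm_mult of_rat_sum of_rat_mult sum_distrib_right)
    also have "\<dots> = (\<Sum>l<n. \<Sum>j<n. of_rat (mm y i l) * of_rat (mm x l j) * f j)" by (rule sum.swap)
    also have "\<dots> = mop y (mop x f) i"
      using True by (simp add: mop_def sum_distrib_left mult.assoc)
    finally show ?thesis .
  qed (simp add: mop_def)
qed

lemma mop_add: "x \<in> K \<Longrightarrow> y \<in> K \<Longrightarrow> mop (x + y) f i = mop x f i + mop y f i"
  by (simp add: mop_def mm_def distrib_right co_add b subfield_CD[OF K] of_rat_add sum.distrib)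

lemma mop_one: assumes "\<And>i. i \<ge> n \<Longrightarrow> f i = 0" shows "mop 1 f = f"
proof
  fix i
  have "mm 1 i j = (if j = i then 1 else 0)" if "i < n" "j < n" for j
    unfolding mm_def
    by (rule co_unique[OF _ that(2)]) (simp add: if_distrib[of of_rat] if_distrib[of "\<lambda>x. x * _"] that cong: if_cong)
  then have "(\<Sum>j<n. of_rat (mm 1 i j) * f j) = (\<Sum>j<n. if j = i then f j else 0)" if "i < n"
    using that by (intro sum.cong) auto
  then show "mop 1 f i = f i" using assms by (auto simp: mop_def)
qed

text \<open>The eigenspace for \<open>l\<close> of the multiplication by \<open>x\<close> is stable
  under all multiplications by elements of \<open>K\<close>, and these commute. A common eigenvector
  in it assigns to each element its eigenvalue; this assignment is a ring homomorphism with value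
  \<open>l\<close> at \<open>x\<close>.\<close>

lemma char_root_Homs:
  assumes x: "x \<in> K"
    and l: "poly (char_poly (Matrix.mat n n (\<lambda>(i, j). of_rat (mm x i j)))) l = (0::complex)"
  shows "\<exists>s\<in>Homs. s x = l"
proof -
  let ?sc = "\<lambda>c (f :: nat \<Rightarrow> complex) i. c * f i"
  interpret V: complex_vector_space ?sc by (rule complex_vector_space_fun)
  let ?A = "Matrix.mat n n (\<lambda>(i, j). of_rat (mm x i j)) :: complex mat"
  have A: "?A \<in> carrier_mat n n" by simp
  obtain v where v: "v \<in> carrier_vec n" "v \<noteq> 0\<^sub>v n" "?A *\<^sub>v v = l \<cdot>\<^sub>v v"
    using l eigenvalue_root_char_poly[OF A] by (auto simp: eigenvalue_def eigenvector_def)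
  define W where "W = {f. (\<forall>i\<ge>n. f i = 0) \<and> mop x f = ?sc l f}"
  define f0 where "f0 i = (if i < n then vec_index v i else 0)" for i
  have "mop x f0 i = l * f0 i" for i
  proof (cases "i < n")
    case True
    have "vec_index (?A *\<^sub>v v) i = vec_index (l \<cdot>\<^sub>v v) i" using v by simp
    then show ?thesis using True v(1)
      by (simp add: mop_def f0_def scalar_prod_def row_def atLeast0LessThan)
  qed (simp add: mop_def f0_def)
  then have f0W: "f0 \<in> W" by (auto simp: W_def f0_def)
  have f00: "f0 \<noteq> 0"
  proof
    assume "f0 = 0"
    then have "\<And>i. i < n \<Longrightarrow> vec_index v i = 0" by (metis f0_def zero_fun_apply)
    then have "v = 0\<^sub>v n" using v(1) by (intro eq_vecI) auto
    then show False using v(2) by simp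
  qed
  have mop_lin: "mop y (f + g) = mop y f + mop y g" "mop y (?sc c f) = ?sc c (mop y f)" for y f g c
    by (auto simp: mop_def fun_eq_iff sum.distrib algebra_simps sum_distrib_left)
  have sW: "V.subspace W"
  proof (rule V.subspaceI)
    show "0 \<in> W" by (simp add: W_def mop_def fun_eq_iff)
    show "f + g \<in> W" if "f \<in> W" "g \<in> W" for f g
      using that unfolding W_def mem_Collect_eq mop_lin by (auto simp: fun_eq_iff algebra_simps)
    show "?sc c f \<in> W" if "f \<in> W" for f c
      using that unfolding W_def mem_Collect_eq mop_lin by (auto simp: fun_eq_iff)
  qed
  let ?d = "\<lambda>j (i::nat). if i = j then 1 else (0::complex)"
  have span: "W \<subseteq> V.span (?d ` {..<n})"
  proof
    fix f assume f: "f \<in> W"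
    have "f = (\<Sum>j<n. ?sc (f j) (?d j))"
    proof
      fix i
      have "(\<Sum>j<n. ?sc (f j) (?d j)) i = (\<Sum>j<n. if j = i then f i else 0)"
        by (induction n) (auto simp: zero_fun_def)
      also have "\<dots> = f i" using f by (auto simp: W_def)
      finally show "f i = (\<Sum>j<n. ?sc (f j) (?d j)) i" by simp
    qed
    also have "\<dots> \<in> V.span (?d ` {..<n})"
      by (intro V.span_sum V.span_scale V.span_base) auto
    finally show "f \<in> V.span (?d ` {..<n})" .
  qed
  have op: "complex_operator ?sc g W" if g: "g \<in> mop ` K" for g
  proof -
    obtain y where y: "y \<in> K" "g = mop y" using g by auto
    have "mop y f \<in> W" if "f \<in> W" for f
    proof -
      have "mop x (mop y f) = mop y (mop x f)" using mop_mult[OF x y(1)] mop_mult[OF y(1) x] by (metis mult.commute)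
      also have "\<dots> = ?sc l (mop y f)" using that mop_lin by (simp add: W_def)
      finally show ?thesis by (simp add: W_def mop_def)
    qed
    then show ?thesis unfolding y(2)
      by unfold_locales (use sW mop_lin in auto)
  qed
  have comm: "f (g w) = g (f w)" if fg: "f \<in> mop ` K" "g \<in> mop ` K" for f g w
  proof -
    obtain y z where yz: "y \<in> K" "z \<in> K" "f = mop y" "g = mop z" using fg by auto
    show ?thesis unfolding yz(3,4) using mop_mult[OF yz(1,2), of w] mop_mult[OF yz(2,1), of w]
      by (simp add: mult.commute)
  qed
  have nz: "W \<noteq> {0}" using f0W f00 by auto
  have "\<exists>w\<in>W. w \<noteq> 0 \<and> (\<forall>f\<in>mop ` K. \<exists>c. f w = ?sc c w)"
  proof (rule V.common_eigenvector[OF sW _ span nz])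
    show "complex_operator ?sc g W" if "g \<in> mop ` K" for g by (rule op[OF that])
    show "f (g w) = g (f w)" if "f \<in> mop ` K" "g \<in> mop ` K" for f g w by (rule comm[OF that])
  qed simp
  then obtain w where w: "w \<in> W" "w \<noteq> 0" "\<And>f. f \<in> mop ` K \<Longrightarrow> \<exists>c. f w = ?sc c w"
    by blast
  obtain i0 where i0: "w i0 \<noteq> 0" using w(2) by (auto simp: fun_eq_iff)
  \<comment> \<open>The eigenvalue of the multiplication by \<open>y\<close> at \<open>w\<close>,
    read off at a coordinate where \<open>w\<close> does not vanish.\<close>
  define s where "s y = (if y \<in> K then mop y w i0 / w i0 else 0)" for y
  have s: "mop y w = ?sc (s y) w" if y: "y \<in> K" for y
  proof -
    obtain c where c: "mop y w = ?sc c w" using w(3) y by blast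
    then have "s y = c" using i0 y by (simp add: s_def)
    then show ?thesis using c by simp
  qed
  have "s 1 = 1" using mop_one[of w] w(1) i0
    by (simp add: W_def s_def subfield_CD[OF K])
  moreover have "s (y + z) = s y + s z" if "y \<in> K" "z \<in> K" for y z
    using that mop_add[of y z w i0] by (simp add: s_def subfield_CD[OF K] add_divide_distrib)
  moreover have "s (y * z) = s y * s z" if "y \<in> K" "z \<in> K" for y z
  proof -
    have "?sc (s (y * z)) w = mop (y * z) w" by (rule s[OF subfield_CD(5)[OF K that], symmetric])
    also have "\<dots> = mop z (mop y w)" by (rule mop_mult[OF that])
    also have "mop y w = ?sc (s y) w" by (rule s[OF that(1)])
    also have "mop z (?sc (s y) w) = ?sc (s y) (mop z w)" by (rule mop_lin(2))
    also have "mop z w = ?sc (s z) w" by (rule s[OF that(2)])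
    also have "?sc (s y) (?sc (s z) w) = ?sc (s y * s z) w" by (simp only: mult.assoc)
    finally have e: "?sc (s (y * z)) w = ?sc (s y * s z) w" .
    show ?thesis using fun_cong[OF e, of i0] i0 by simp
  qed
  ultimately have "s \<in> Homs" by (auto simp: Homs_def s_def)
  moreover have "s x = l"
  proof -
    have e: "?sc (s x) w = ?sc l w" using s[OF x] w(1) by (simp add: W_def)
    show ?thesis using fun_cong[OF e, of i0] i0 by simp
  qed
  ultimately show ?thesis by blast
qed

text \<open>The characteristic polynomial of the multiplication by \<open>x\<close> is rational, and
  its roots are values \<open>s x\<close>, which are integral and bounded. Hence its coefficients
  are rational integers in a finite range, and \<open>x\<close> is a root of one of finitely many
  polynomials.\<close>

lemma finite_integers_bounded_embeddings: "finite {x \<in> OK. \<forall>s\<in>Homs. norm (s x) \<le> B}"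
proof (cases "B \<ge> 0")
  case True
  let ?M = "\<lambda>x. Matrix.mat n n (\<lambda>(i, j). mm x i j)"
  let ?A = "\<lambda>x. Matrix.mat n n (\<lambda>(i, j). of_rat (mm x i j)) :: complex mat"
  define C where "C = (of_int :: int \<Rightarrow> complex) ` {- \<lceil>(1 + B) ^ n\<rceil>..\<lceil>(1 + B) ^ n\<rceil>}"
  define P where "P = {p :: complex poly. degree p \<le> n \<and> (\<forall>i. coeff p i \<in> C)}"
  have finP: "finite P" unfolding P_def by (rule finite_polys_bounded) (simp add: C_def)
  have "char_poly (?A x) \<in> P - {0} \<and> poly (char_poly (?A x)) x = 0"
    if x: "x \<in> OK" "\<And>s. s \<in> Homs \<Longrightarrow> norm (s x) \<le> B" for x
  proof -
    have xK: "x \<in> K" using x OKD by auto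
    have A: "?A x \<in> carrier_mat n n" by simp
    have root: "poly (char_poly (?A x)) x = 0"
    proof -
      have "\<exists>i<n. b i \<noteq> 0"
      proof (rule ccontr)
        assume "\<not> ?thesis"
        then show False using co(1)[OF subfield_CD(2)[OF K]] by simp
      qed
      then obtain i where "i < n" "b i \<noteq> 0" by blast
      then show ?thesis using eigen_imp_char_poly_root[of n "\<lambda>i j. of_rat (mm x i j)" b x i] mm[OF xK] by simp
    qed
    obtain as where as: "char_poly (?A x) = (\<Prod>a\<leftarrow>as. [:- a, 1:])" "length as = n"
      using char_poly_factorized[OF A] by auto
    have "algebraic_int a \<and> norm a \<le> B" if "a \<in> set as" for a
    proof -
      have "poly (char_poly (?A x)) a = 0" unfolding as(1) using that
        by (simp add: poly_prod_list prod_list_zero_iff image_iff)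
      then obtain s where s: "s \<in> Homs" "s x = a" using char_root_Homs[OF xK] by auto
      obtain p where p: "poly (map_poly of_int p) x = 0" "lead_coeff p = 1"
        using OKD(2)[OF x(1)] by (auto simp: algebraic_int_altdef_ipoly)
      let ?p = "map_poly of_int p :: complex poly"
      have si: "s (of_int m) = of_int m" for m using HomsD(7)[OF s(1), of "of_int m"] by simp
      have "0 = s (poly ?p x)" using p HomsD(4)[OF s(1)] by simp
      also have "\<dots> = poly ?p (s x)" unfolding poly_altdef
        using xK by (simp add: HomsD(8)[OF s(1)] HomsD(3)[OF s(1)] HomsD(9)[OF s(1)] si subfield_CD[OF K] coeff_map_poly)
      finally have "algebraic_int (s x)" unfolding algebraic_int_altdef_ipoly using p(2) by metis
      then show ?thesis using s x(2) by auto
    qed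
    then have cf: "algebraic_int (coeff (char_poly (?A x)) i)" "norm (coeff (char_poly (?A x)) i) \<le> (1 + B) ^ n" for i
      using prod_linear_coeffs[of as B i] True as by auto
    have hom: "comm_ring_hom (of_rat :: rat \<Rightarrow> complex)" by unfold_locales (auto simp: of_rat_add of_rat_mult)
    have "?A x = map_mat of_rat (?M x)" by (rule eq_matI) auto
    then have "char_poly (?A x) = map_poly of_rat (char_poly (?M x))"
      using comm_ring_hom.char_poly_hom[OF hom, of "?M x" n] by simp
    then have "coeff (char_poly (?A x)) i \<in> \<rat>" for i by (simp add: coeff_map_poly)
    then have int: "coeff (char_poly (?A x)) i \<in> \<int>" for i using cf rational_algebraic_int_is_int by blast
    have "coeff (char_poly (?A x)) i \<in> C" for i
    proof -
      obtain m where m: "coeff (char_poly (?A x)) i = of_int m" using int Ints_cases by blast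
      then have "\<bar>real_of_int m\<bar> \<le> (1 + B) ^ n" using cf(2)[of i] by simp
      then have "m \<in> {- \<lceil>(1 + B) ^ n\<rceil>..\<lceil>(1 + B) ^ n\<rceil>}" by (simp add: abs_le_iff) linarith
      then show ?thesis using m by (auto simp: C_def)
    qed
    moreover have "degree (char_poly (?A x)) = n" "coeff (char_poly (?A x)) n = 1"
      using degree_monic_char_poly[OF A] by auto
    moreover from this have "char_poly (?A x) \<noteq> 0" by auto
    ultimately show ?thesis using root by (auto simp: P_def)
  qed
  then have "{x \<in> OK. \<forall>s\<in>Homs. norm (s x) \<le> B} \<subseteq> (\<Union>p\<in>P - {0}. {x. poly p x = 0})" by blast
  moreover have "finite (\<Union>p\<in>P - {0}. {x. poly p x = 0})"
    using finP by (auto simp: poly_roots_finite)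
  ultimately show ?thesis by (rule finite_subset)
next
  case False
  \<comment> \<open>The inclusion of \<open>K\<close> is an embedding, so no element satisfies a
    negative bound.\<close>
  have "Homs \<noteq> {}"
  proof -
    have "(\<lambda>x. if x \<in> K then x else 0) \<in> Homs" by (auto simp: Homs_def subfield_CD[OF K])
    then show ?thesis by blast
  qed
  then obtain s where "s \<in> Homs" by blast
  moreover have "\<not> norm (s x) \<le> B" for x using False norm_ge_zero[of "s x"] by linarith
  ultimately have e: "{x \<in> OK. \<forall>s\<in>Homs. norm (s x) \<le> B} = {}" by blast
  show ?thesis unfolding e by simp
qed

end

lemma mult_subgroup_mspan:
  assumes "\<And>i. i < r \<Longrightarrow> e i \<noteq> 0"
  shows "mult_subgroup (mspan e r)"
proof -
  have "1 \<in> mspan e r" unfolding mspan_def by (rule CollectI, rule exI[of _ "\<lambda>_. 0"]) simp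
  moreover have "0 \<notin> mspan e r" using assms by (auto simp: mspan_def)
  moreover have "x / y \<in> mspan e r" if xy: "x \<in> mspan e r" "y \<in> mspan e r" for x y
  proof -
    obtain a c where "x = (\<Prod>i<r. e i powi a i)" "y = (\<Prod>i<r. e i powi c i)" using xy by (auto simp: mspan_def)
    then have "x / y = (\<Prod>i<r. e i powi (a i - c i))"
      using assms by (simp add: power_int_diff prod_dividef)
    then show ?thesis unfolding mspan_def by (intro CollectI exI[of _ "\<lambda>i. a i - c i"] conjI TrueI)
  qed
  ultimately show ?thesis by (simp add: mult_subgroup_def)
qed

lemma mspan_base: "i < r \<Longrightarrow> e i \<in> mspan e r"
  unfolding mspan_def
proof (rule CollectI, rule exI[of _ "\<lambda>j. if j = i then 1 else 0"], rule conjI[OF _ TrueI])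
  assume i: "i < r"
  have "(\<Prod>j<r. e j powi (if j = i then 1 else 0)) = (\<Prod>j<r. if j = i then e j else 1)"
    by (rule prod.cong) auto
  then show "e i = (\<Prod>j<r. e j powi (if j = i then 1 else 0))" using i by simp
qed

lemma norm_of_rat: "norm (of_rat q :: complex) = \<bar>real_of_rat q\<bar>"
proof -
  obtain a b where "q = Rat.Fract a b" "b > 0" by (cases q) auto
  then show ?thesis by (simp add: of_rat_rat norm_divide)
qed

section \<open>Sizes of integers and generators of the ring of integers\<close>

context number_field_basis
begin

definition nrm :: "complex \<Rightarrow> real" where "nrm x = (\<Sum>i<n. \<bar>real_of_rat (co x i)\<bar>)"

lemma nrm_nonneg: "nrm x \<ge> 0"
  by (auto simp: nrm_def intro: sum_nonneg)

lemma nrm_add: "x \<in> K \<Longrightarrow> y \<in> K \<Longrightarrow> nrm (x + y) \<le> nrm x + nrm y"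
  by (auto simp: nrm_def co_add of_rat_add sum.distrib[symmetric] simp del: abs_of_rat intro!: sum_mono)

lemma nrm_diff: "x \<in> K \<Longrightarrow> y \<in> K \<Longrightarrow> nrm (x - y) \<le> nrm x + nrm y"
  by (auto simp: nrm_def co_diff of_rat_diff sum.distrib[symmetric] simp del: abs_of_rat intro!: sum_mono)

lemma nrm_rat: "x \<in> K \<Longrightarrow> nrm (of_rat q * x) = \<bar>real_of_rat q\<bar> * nrm x"
  by (auto simp: nrm_def co_rat of_rat_mult sum_distrib_left abs_mult)

lemma nrm_of_nat: "x \<in> K \<Longrightarrow> nrm (of_nat m * x) = real m * nrm x"
  using nrm_rat[of x "of_nat m"] by simp

lemma nrm_of_int: "x \<in> K \<Longrightarrow> nrm (of_int m * x) = \<bar>real_of_int m\<bar> * nrm x"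
  using nrm_rat[of x "of_int m"] by simp

lemma nrm_0: "nrm 0 = 0"
  using nrm_of_nat[OF subfield_CD(1)[OF K], of 0] by simp

lemma nrm_sum: "(\<And>i. i \<in> I \<Longrightarrow> f i \<in> K) \<Longrightarrow> nrm (sum f I) \<le> (\<Sum>i\<in>I. nrm (f i))"
proof (induction I rule: infinite_finite_induct)
  case (insert x F)
  then have "nrm (f x + sum f F) \<le> nrm (f x) + nrm (sum f F)"
    by (intro nrm_add subfield_C_sum[OF K]) auto
  then show ?case using insert by simp
qed (auto simp: nrm_0)

lemma nrm_eq_0: "x \<in> K \<Longrightarrow> nrm x = 0 \<Longrightarrow> x = 0"
proof -
  assume x: "x \<in> K" and "nrm x = 0"
  then have "co x i = 0" if "i < n" for i
    using that by (simp add: nrm_def sum_nonneg_eq_0_iff)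
  then show "x = 0" using co(1)[OF x] by simp
qed

text \<open>The norms of the structure constants of \<open>b\<close> control products; the summand 1
  ensures that the constant is at least 1.\<close>

definition nC :: real where "nC = 1 + (\<Sum>i<n. \<Sum>j<n. nrm (b i * b j))"

lemma nC_pos: "nC \<ge> 1"
  by (auto simp: nC_def nrm_nonneg intro!: sum_nonneg)

lemma nrm_mult:
  assumes "x \<in> K" "y \<in> K"
  shows "nrm (x * y) \<le> nC * nrm x * nrm y"
proof -
  note inK = subfield_CD[OF K]
  have "x * y = (\<Sum>i<n. of_rat (co x i) * b i) * (\<Sum>j<n. of_rat (co y j) * b j)"
    using co(1) assms by metis
  also have "\<dots> = (\<Sum>i<n. \<Sum>j<n. of_rat (co x i * co y j) * (b i * b j))"
    by (simp add: sum_product of_rat_mult mult_ac)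
  finally have "nrm (x * y) = nrm (\<Sum>i<n. \<Sum>j<n. of_rat (co x i * co y j) * (b i * b j))" by simp
  also have "\<dots> \<le> (\<Sum>i<n. nrm (\<Sum>j<n. of_rat (co x i * co y j) * (b i * b j)))"
    by (rule nrm_sum) (auto intro!: subfield_C_sum[OF K] inK b)
  also have "\<dots> \<le> (\<Sum>i<n. \<Sum>j<n. nrm (of_rat (co x i * co y j) * (b i * b j)))"
    by (intro sum_mono nrm_sum) (auto intro!: inK b)
  also have "\<dots> = (\<Sum>i<n. \<Sum>j<n. \<bar>real_of_rat (co x i)\<bar> * \<bar>real_of_rat (co y j)\<bar> * nrm (b i * b j))"
    by (intro sum.cong refl, subst nrm_rat) (auto simp: inK b of_rat_mult abs_mult)
  also have "\<dots> \<le> (\<Sum>i<n. \<Sum>j<n. \<bar>real_of_rat (co x i)\<bar> * \<bar>real_of_rat (co y j)\<bar> * nC)"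
  proof (intro sum_mono mult_left_mono)
    fix i j assume ij: "i \<in> {..<n}" "j \<in> {..<n}"
    have "nrm (b i * b j) \<le> (\<Sum>j<n. nrm (b i * b j))"
      by (rule member_le_sum) (use ij in \<open>auto simp: nrm_nonneg\<close>)
    also have "\<dots> \<le> (\<Sum>i<n. \<Sum>j<n. nrm (b i * b j))"
      by (rule member_le_sum[of i "{..<n}" "\<lambda>i. \<Sum>j<n. nrm (b i * b j)"])
        (use ij in \<open>auto intro: sum_nonneg simp: nrm_nonneg\<close>)
    finally show "nrm (b i * b j) \<le> nC" by (simp add: nC_def)
  qed auto
  also have "\<dots> = nC * nrm x * nrm y"
    by (simp add: nrm_def sum_product sum_distrib_left sum_distrib_right mult_ac)
  finally show ?thesis .
qed

lemma co_le_nrm: "i < n \<Longrightarrow> \<bar>real_of_rat (co x i)\<bar> \<le> nrm x"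
  unfolding nrm_def by (rule member_le_sum) auto

text \<open>Every embedding is a fixed linear form in the coordinates, so bounded coordinates bound
  all embeddings.\<close>

lemma finite_integers_bounded_nrm: "finite {x \<in> OK. nrm x \<le> B}"
proof -
  define M where "M = (\<Sum>s\<in>Homs. \<Sum>i<n. norm (s (b i)))"
  have M: "norm (s (b i)) \<le> M" if s: "s \<in> Homs" and i: "i < n" for s i
  proof -
    have "norm (s (b i)) \<le> (\<Sum>i<n. norm (s (b i)))" by (rule member_le_sum) (use i in auto)
    also have "\<dots> \<le> M" unfolding M_def
      by (rule member_le_sum[of s Homs "\<lambda>s. \<Sum>i<n. norm (s (b i))"]) (use s finite_Homs in \<open>auto intro: sum_nonneg\<close>)
    finally show ?thesis .
  qed
  have "M \<ge> 0" unfolding M_def by (intro sum_nonneg) auto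
  have "norm (s x) \<le> B * M" if x: "x \<in> OK" "nrm x \<le> B" and s: "s \<in> Homs" for x s
  proof -
    have "s x = (\<Sum>i<n. of_rat (co x i) * s (b i))" by (rule Homs_co[OF s OKD(1)[OF x(1)]])
    then have "norm (s x) \<le> (\<Sum>i<n. norm (of_rat (co x i) * s (b i)))" by (simp add: norm_sum)
    also have "\<dots> = (\<Sum>i<n. \<bar>real_of_rat (co x i)\<bar> * norm (s (b i)))"
      by (intro sum.cong) (auto simp: norm_mult norm_of_rat)
    also have "\<dots> \<le> (\<Sum>i<n. \<bar>real_of_rat (co x i)\<bar> * M)"
      by (intro sum_mono mult_left_mono M s) auto
    also have "\<dots> = nrm x * M" by (simp add: nrm_def sum_distrib_right)
    also have "\<dots> \<le> B * M" using x(2) \<open>M \<ge> 0\<close> by (rule mult_right_mono)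
    finally show ?thesis .
  qed
  then have "{x \<in> OK. nrm x \<le> B} \<subseteq> {x \<in> OK. \<forall>s\<in>Homs. norm (s x) \<le> B * M}" by blast
  then show ?thesis using finite_integers_bounded_embeddings by (rule finite_subset)
qed

lemma zspan_b_OK: "zspan b n \<subseteq> OK"
  by (rule zspan_least[OF ring_of_integers_add_subgroup[OF K] b_OK])

lemma multiple_in_zspan:
  assumes "x \<in> K"
  shows "\<exists>D>0. of_nat D * x \<in> zspan b n"
proof -
  define d where "d = (\<Prod>i<n. snd (quotient_of (co x i)))"
  have dpos: "d > 0" unfolding d_def by (intro prod_pos quotient_of_denom_pos')
  have "\<exists>m. of_int d * co x i = of_int m" if i: "i < n" for i
  proof -
    obtain p q where pq: "quotient_of (co x i) = (p, q)" by force
    have "q dvd d" unfolding d_def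
      using i pq dvd_prodI[of "{..<n}" i "\<lambda>i. snd (quotient_of (co x i))"] by simp
    then obtain c where "d = q * c" by (auto elim: dvdE)
    moreover have "co x i = of_int p / of_int q" by (rule quotient_of_div[OF pq])
    moreover have "q > 0" using quotient_of_denom_pos[OF pq] .
    ultimately have "of_int d * co x i = of_int (c * p)" by (simp add: field_simps)
    then show ?thesis by blast
  qed
  then obtain m where m: "\<And>i. i < n \<Longrightarrow> of_int d * co x i = of_int (m i)" by metis
  have "of_int d * x = of_int d * (\<Sum>i<n. of_rat (co x i) * b i)" using co(1)[OF assms] by simp
  also have "\<dots> = (\<Sum>i<n. of_rat (of_int d * co x i) * b i)"
    by (simp add: mult.assoc sum_distrib_left of_rat_mult)
  also have "\<dots> = (\<Sum>i<n. of_int (m i) * b i)" by (rule sum.cong) (simp_all add: m)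
  finally have "of_int d * x \<in> zspan b n" unfolding zspan_def by (intro CollectI exI conjI TrueI)
  then show ?thesis using dpos by (intro exI[of _ "nat d"]) auto
qed

lemma common_multiple_in_zspan:
  assumes "finite F" "F \<subseteq> K"
  shows "\<exists>D>0. \<forall>x\<in>F. of_nat D * x \<in> zspan b n"
  using assms
proof (induction F)
  case (insert x F)
  then obtain D where D: "D > 0" "\<And>y. y \<in> F \<Longrightarrow> of_nat D * y \<in> zspan b n" by auto
  obtain E where E: "E > 0" "of_nat E * x \<in> zspan b n" using multiple_in_zspan[of x] insert by auto
  note sc = add_subgroup_of_int_mult[OF add_subgroup_zspan[of b n]]
  have "of_nat (D * E) * y \<in> zspan b n" if "y \<in> insert x F" for y
    using that sc[OF E(2), of "int D"] sc[OF D(2), of y "int E"] by (auto simp: mult_ac)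
  then show ?case using D(1) E(1) by (intro exI[of _ "D * E"]) auto
qed auto

text \<open>Modulo the integral span of \<open>b\<close>, an integer can be moved to one with
  coordinates between 0 and 1. There are finitely many of those, and finitely many numbers have a
  common denominator.\<close>

lemma integers_bounded_denominator: "\<exists>D>0. \<forall>x\<in>OK. of_nat D * x \<in> zspan b n"
proof -
  define F where "F = {x \<in> OK. nrm x \<le> real n}"
  have "finite F" unfolding F_def by (rule finite_integers_bounded_nrm)
  moreover have "F \<subseteq> K" using OKD by (auto simp: F_def)
  ultimately obtain D where D: "D > 0" "\<And>y. y \<in> F \<Longrightarrow> of_nat D * y \<in> zspan b n"
    using common_multiple_in_zspan[of F] by blast
  have "of_nat D * x \<in> zspan b n" if x: "x \<in> OK" for x
  proof -
    define l where "l = (\<Sum>i<n. of_int \<lfloor>co x i\<rfloor> * b i)"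
    have lz: "l \<in> zspan b n" unfolding l_def zspan_def
      by (intro CollectI exI[of _ "\<lambda>i. \<lfloor>co x i\<rfloor>"] conjI TrueI refl)
    then have lO: "l \<in> OK" using zspan_b_OK by auto
    have xK: "x \<in> K" using x OKD by auto
    have "co l i = of_int \<lfloor>co x i\<rfloor>" if "i < n" for i
      using co_unique[of l "\<lambda>i. of_int \<lfloor>co x i\<rfloor>" i] that by (simp add: l_def)
    then have "\<bar>real_of_rat (co (x - l) i)\<bar> \<le> 1" if "i < n" for i
    proof -
      assume *: "\<And>i. i < n \<Longrightarrow> co l i = of_int \<lfloor>co x i\<rfloor>"
      have "co (x - l) i = co x i - of_int \<lfloor>co x i\<rfloor>" using * that co_diff xK OKD(1)[OF lO] by simp
      then have "0 \<le> co (x - l) i" "co (x - l) i \<le> 1" by linarith+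
      then show ?thesis by (simp add: zero_le_of_rat_iff of_rat_le_1_iff)
    qed
    then have "nrm (x - l) \<le> real n" unfolding nrm_def
      using sum_bounded_above[of "{..<n}" "\<lambda>i. \<bar>real_of_rat (co (x - l) i)\<bar>" 1] by simp
    then have "x - l \<in> F" using x lO by (simp add: F_def ring_of_integersD(6)[OF K])
    from D(2)[OF this] have "of_nat D * (x - l) + of_int (int D) * l \<in> zspan b n"
      by (intro add_subgroupD(4)[OF add_subgroup_zspan] add_subgroup_of_int_mult[OF add_subgroup_zspan] lz)
    then show ?thesis by (simp add: algebra_simps)
  qed
  then show ?thesis using D(1) by blast
qed

lemma ring_of_integers_fg: "\<exists>e. OK = zspan e n"
proof -
  obtain D where D: "D > 0" "\<And>x. x \<in> OK \<Longrightarrow> of_nat D * x \<in> zspan b n"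
    using integers_bounded_denominator by blast
  have "x \<in> zspan (\<lambda>i. b i / of_nat D) n" if x: "x \<in> OK" for x
  proof -
    obtain a where "of_nat D * x = (\<Sum>i<n. of_int (a i) * b i)" using D(2)[OF x] by (auto simp: zspan_def)
    then have "x = (\<Sum>i<n. of_int (a i) * b i) / of_nat D" using D(1) by (simp add: field_simps)
    then have "x = (\<Sum>i<n. of_int (a i) * (b i / of_nat D))" by (simp add: sum_divide_distrib)
    then show ?thesis unfolding zspan_def by (intro CollectI exI conjI TrueI)
  qed
  then show ?thesis using zspan_subgroup_fg[OF ring_of_integers_add_subgroup[OF K]] by blast
qed

lemma number_field: "number_field K"
proof -
  have "\<exists>q. x = (\<Sum>y\<in>b ` {..<n}. of_rat (q y) * y)" if x: "x \<in> K" for x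
  proof -
    have inj: "inj_on b {..<n}"
    proof
      fix i j assume ij: "i \<in> {..<n}" "j \<in> {..<n}" "b i = b j"
      have "co (b i) k = (if k = i then 1 else 0)" if "i < n" "k < n" for i k
        by (rule co_unique[OF _ that(2)])
          (simp add: if_distrib[of of_rat] if_distrib[of "\<lambda>x. x * _"] that cong: if_cong)
      from this[of i i] this[of j i] show "i = j" using ij by (auto split: if_splits)
    qed
    have "x = (\<Sum>y\<in>b ` {..<n}. of_rat (co x (inv_into {..<n} b y)) * y)"
      unfolding sum.reindex[OF inj] using co(1)[OF x] by (simp add: inv_into_f_f[OF inj])
    then show ?thesis by (intro exI)
  qed
  then show ?thesis unfolding number_field_def
    using K b by (intro conjI exI[of _ "b ` {..<n}"]) auto
qed

end

lemma mspan_of_finite_set: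
  assumes "finite G" "\<And>g. g \<in> G \<Longrightarrow> g \<noteq> 0"
  obtains e r where "\<And>i. i < r \<Longrightarrow> e i \<in> G" "G \<subseteq> mspan e r"
proof -
  obtain e where e: "bij_betw e {..<card G} G"
    using ex_bij_betw_nat_finite[OF assms(1)] by (auto simp: atLeast0LessThan)
  have "g \<in> mspan e (card G)" if "g \<in> G" for g
  proof -
    have "g \<in> e ` {..<card G}" using e \<open>g \<in> G\<close> by (simp add: bij_betw_def)
    then obtain i where "i < card G" "e i = g" by auto
    then show ?thesis using mspan_base[of i "card G" e] by simp
  qed
  moreover have "e i \<in> G" if "i < card G" for i using e that by (auto simp: bij_betw_def)
  ultimately show ?thesis using that by blast
qed

section \<open>Finite generation of the unit group\<close>

context number_field_basis
begin

text \<open>The logarithmic embedding with one coordinate for each field embedding; the value 0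
  elsewhere places it in a finite-dimensional space of functions.\<close>

definition logv :: "complex \<Rightarrow> (complex \<Rightarrow> complex) \<Rightarrow> real" where
  "logv u s = (if s \<in> Homs then ln (norm (s u)) else 0)"

lemma units_nz:
  assumes "u \<in> units_of_integers K" "s \<in> Homs"
  shows "u \<in> K" "u \<in> OK" "u \<noteq> 0" "s u \<noteq> 0"
  using assms OKD HomsD(6) by (auto simp: units_of_integers_def)

lemma logv_mult:
  "u \<in> units_of_integers K \<Longrightarrow> v \<in> units_of_integers K \<Longrightarrow> logv (u * v) s = logv u s + logv v s"
  using units_nz[of u s] units_nz[of v s]
  by (simp add: logv_def HomsD(3) norm_mult ln_mult)

lemma logv_one: "logv 1 s = 0"
  by (simp add: logv_def HomsD(1))

lemma logv_powi: 
  assumes u: "u \<in> units_of_integers K"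
  shows "logv (u powi m) s = of_int m * logv u s"
proof -
  note U = mult_subgroup_units[OF K]
  have n: "logv (u ^ k) s = of_nat k * logv u s" for k
    by (induction k) (auto simp: logv_one logv_mult u mult_subgroupD(6)[OF U] algebra_simps)
  have i: "logv (inverse v) s = - logv v s" if "v \<in> units_of_integers K" for v
    using logv_mult[OF that mult_subgroupD(3)[OF U that], of s] mult_subgroupD(5)[OF U that] by (simp add: logv_one)
  show ?thesis
    using n[of "nat m"] n[of "nat (- m)"] i[OF mult_subgroupD(6)[OF U u, of "nat (- m)"]]
    by (cases "m \<ge> 0") (auto simp: power_int_def power_inverse)
qed

lemma logv_prod:
  "(\<And>i. i \<in> I \<Longrightarrow> f i \<in> units_of_integers K) \<Longrightarrow> logv (prod f I) s = (\<Sum>i\<in>I. logv (f i) s)"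
  by (induction I rule: infinite_finite_induct)
    (auto simp: logv_one logv_mult mult_subgroup_prod[OF mult_subgroup_units[OF K]])

text \<open>The logarithmic embedding maps the units to a discrete subgroup of a real vector space: choose a
  basis of its span among the logarithms of units and divide by integral parts.\<close>

theorem units_fg: "\<exists>e r. (\<forall>i<r. e i \<noteq> 0) \<and> units_of_integers K = mspan e r"
proof -
  let ?U = "units_of_integers K"
  note U = mult_subgroup_units[OF K]
  let ?sc = "\<lambda>(c::real) (f :: (complex \<Rightarrow> complex) \<Rightarrow> real) s. c * f s"
  interpret V: vector_space ?sc
    by unfold_locales (auto simp: algebra_simps plus_fun_def)
  obtain B where B: "B \<subseteq> logv ` ?U" "V.independent B" "logv ` ?U \<subseteq> V.span B"
    using V.maximal_independent_subset by blast
  let ?d = "\<lambda>s t. if t = s then 1 else (0::real)"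
  have "logv u \<in> V.span (?d ` Homs)" for u
  proof -
    have "logv u = (\<Sum>s\<in>Homs. ?sc (logv u s) (?d s))"
    proof
      fix t
      have sumd: "(\<Sum>s\<in>S. ?sc (logv u s) (?d s)) t = (\<Sum>s\<in>S. if t = s then logv u s else 0)" for S
        by (induction S rule: infinite_finite_induct) (auto simp: zero_fun_def)
      then show "logv u t = (\<Sum>s\<in>Homs. ?sc (logv u s) (?d s)) t"
        unfolding sumd using finite_Homs by (simp add: logv_def)
    qed
    also have "\<dots> \<in> V.span (?d ` Homs)"
      by (intro V.span_sum V.span_scale V.span_base) auto
    finally show ?thesis .
  qed
  then have finB: "finite B"
    using V.independent_span_bound[OF finite_imageI[OF finite_Homs] B(2)] B(1) by blast
  have "\<forall>v\<in>B. \<exists>u. u \<in> ?U \<and> logv u = v" using B(1) by auto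
  from bchoice[OF this] obtain g where g: "\<And>v. v \<in> B \<Longrightarrow> g v \<in> ?U" "\<And>v. v \<in> B \<Longrightarrow> logv (g v) = v" by auto
  \<comment> \<open>The remaining quotient has logarithm vector \<open>v\<close> with coefficients
    \<open>frac (r v)\<close> between 0 and 1, so \<open>C\<close> bounds its logarithms at all
    embeddings at once.\<close>
  define C where "C = (\<Sum>s\<in>Homs. \<Sum>v\<in>B. \<bar>v s\<bar>)"
  define F where "F = {x \<in> OK. \<forall>s\<in>Homs. norm (s x) \<le> exp C} \<inter> ?U"
  have finF: "finite F" unfolding F_def using finite_integers_bounded_embeddings by blast
  have decomp: "\<exists>f\<in>F. \<exists>a. u = f * (\<Prod>v\<in>B. g v powi a v)" if u: "u \<in> ?U" for u
  proof -
    have "logv u \<in> V.span B" using B(3) u by auto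
    then obtain r where r: "logv u = (\<Sum>v\<in>B. ?sc (r v) v)"
      unfolding V.span_finite[OF finB] by auto
    define p where "p = (\<Prod>v\<in>B. g v powi \<lfloor>r v\<rfloor>)"
    have pU: "p \<in> ?U" unfolding p_def
      by (intro mult_subgroup_prod[OF U] mult_subgroup_powi[OF U] g)
    have fU: "u / p \<in> ?U" by (rule mult_subgroupD(2)[OF U u pU])
    have sumfun: "(\<Sum>v\<in>S. ?sc (r v) v) s = (\<Sum>v\<in>S. r v * v s)" for S s
      by (induction S rule: infinite_finite_induct) (auto simp: zero_fun_def)
    have ls: "logv (u / p) s = (\<Sum>v\<in>B. frac (r v) * v s)" for s
    proof -
      have "logv u s = logv (u / p * p) s" using mult_subgroupD(5)[OF U pU] by simp
      also have "\<dots> = logv (u / p) s + logv p s" by (rule logv_mult[OF fU pU])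
      also have "logv p s = (\<Sum>v\<in>B. of_int \<lfloor>r v\<rfloor> * v s)"
        unfolding p_def using g by (subst logv_prod) (auto intro: mult_subgroup_powi[OF U] simp: logv_powi)
      finally have "logv (u / p) s = logv u s - (\<Sum>v\<in>B. of_int \<lfloor>r v\<rfloor> * v s)" by simp
      then show ?thesis unfolding r sumfun
        by (simp add: frac_def algebra_simps sum_subtractf)
    qed
    have "norm (s (u / p)) \<le> exp C" if s: "s \<in> Homs" for s
    proof -
      have "ln (norm (s (u / p))) = logv (u / p) s" using s by (simp add: logv_def)
      also have "\<dots> \<le> (\<Sum>v\<in>B. \<bar>v s\<bar>)" unfolding ls
      proof (rule sum_mono)
        fix v assume "v \<in> B"
        have "frac (r v) * v s \<le> frac (r v) * \<bar>v s\<bar>" by (intro mult_left_mono) auto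
        also have "\<dots> \<le> 1 * \<bar>v s\<bar>" by (intro mult_right_mono) (auto intro: less_imp_le frac_lt_1)
        finally show "frac (r v) * v s \<le> \<bar>v s\<bar>" by simp
      qed
      also have "\<dots> \<le> C" unfolding C_def
        by (rule member_le_sum[of s Homs "\<lambda>s. \<Sum>v\<in>B. \<bar>v s\<bar>"]) (use s finite_Homs in \<open>auto intro: sum_nonneg\<close>)
      finally have le: "ln (norm (s (u / p))) \<le> C" .
      have "norm (s (u / p)) = exp (ln (norm (s (u / p))))" using units_nz(4)[OF fU s] by simp
      also have "\<dots> \<le> exp C" using le by (simp only: exp_le_cancel_iff)
      finally show ?thesis .
    qed
    then have 1: "u / p \<in> F" using fU by (auto simp: F_def units_of_integers_def)
    have 2: "u = u / p * (\<Prod>v\<in>B. g v powi \<lfloor>r v\<rfloor>)"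
      unfolding p_def[symmetric] using mult_subgroupD(5)[OF U pU] by simp
    show ?thesis by (rule bexI[OF _ 1], rule exI, rule 2)
  qed
  have GU: "g ` B \<union> F \<subseteq> ?U" using g(1) by (auto simp: F_def)
  have G0: "x \<noteq> 0" if "x \<in> g ` B \<union> F" for x
    using mult_subgroupD(5)[OF U subsetD[OF GU that]] .
  have "finite (g ` B \<union> F)" using finF finB by simp
  from mspan_of_finite_set[OF this G0]
  obtain e r where er: "\<And>i. i < r \<Longrightarrow> e i \<in> g ` B \<union> F" "g ` B \<union> F \<subseteq> mspan e r" by metis
  have nz: "\<And>i. i < r \<Longrightarrow> e i \<noteq> 0" by (rule G0[OF er(1)])
  note M = mult_subgroup_mspan[OF nz]
  have "?U \<subseteq> mspan e r"
  proof
    fix u assume "u \<in> ?U"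
    then obtain f a where fa: "f \<in> F" "u = f * (\<Prod>v\<in>B. g v powi a v)" using decomp by blast
    show "u \<in> mspan e r" unfolding fa(2)
      by (intro mult_subgroupD(4)[OF M] mult_subgroup_prod[OF M] mult_subgroup_powi[OF M]) (use er fa in auto)
  qed
  moreover have "mspan e r \<subseteq> ?U" by (rule mspan_least[OF U subsetD[OF GU er(1)]])
  ultimately show ?thesis using nz by blast
qed

end

section \<open>Polynomials over a subring, radical extensions\<close>

definition subring_C :: "complex set \<Rightarrow> bool" where
  "subring_C R \<longleftrightarrow> 0 \<in> R \<and> 1 \<in> R \<and> (\<forall>x\<in>R. \<forall>y\<in>R. x + y \<in> R \<and> x - y \<in> R \<and> x * y \<in> R)"

lemma subring_CD:
  assumes "subring_C R"
  shows "0 \<in> R" "1 \<in> R" "x \<in> R \<Longrightarrow> y \<in> R \<Longrightarrow> x + y \<in> R" "x \<in> R \<Longrightarrow> y \<in> R \<Longrightarrow> x - y \<in> R"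
    "x \<in> R \<Longrightarrow> y \<in> R \<Longrightarrow> x * y \<in> R" "x \<in> R \<Longrightarrow> - x \<in> R" "x \<in> R \<Longrightarrow> x ^ m \<in> R" "of_nat m \<in> R"
    "of_int k \<in> R"
proof -
  show 0: "0 \<in> R" and 1: "1 \<in> R" and add: "x \<in> R \<Longrightarrow> y \<in> R \<Longrightarrow> x + y \<in> R"
    and sub: "x \<in> R \<Longrightarrow> y \<in> R \<Longrightarrow> x - y \<in> R" and mul: "x \<in> R \<Longrightarrow> y \<in> R \<Longrightarrow> x * y \<in> R" for x y
    using assms by (auto simp: subring_C_def)
  show neg: "x \<in> R \<Longrightarrow> - x \<in> R" for x using sub[OF 0, of x] by simp
  show "x \<in> R \<Longrightarrow> x ^ m \<in> R" by (induction m) (auto intro: 1 mul)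
  show nat: "of_nat m \<in> R" for m by (induction m) (auto intro: 0 1 add)
  show "of_int k \<in> R"
    using nat[of "nat k"] neg[OF nat[of "nat (- k)"]] by (cases "k \<ge> 0") auto
qed

lemma subring_C_sum: "subring_C R \<Longrightarrow> (\<And>i. i \<in> I \<Longrightarrow> f i \<in> R) \<Longrightarrow> sum f I \<in> R"
  by (induction I rule: infinite_finite_induct) (auto intro: subring_CD)

lemma subfield_C_subring: "subfield_C K \<Longrightarrow> subring_C K"
  by (simp add: subring_C_def subfield_CD)

lemma ring_of_integers_subring: "subfield_C K \<Longrightarrow> subring_C (ring_of_integers K)"
  by (simp add: subring_C_def ring_of_integersD)

lemma subring_C_add_subgroup: "subring_C R \<Longrightarrow> add_subgroup R"
  by (simp add: subring_C_def add_subgroup_def)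

definition polys :: "complex set \<Rightarrow> complex poly set" where
  "polys R = {p. \<forall>i. coeff p i \<in> R}"

lemma polys_closed:
  assumes R: "subring_C R"
  shows "0 \<in> polys R" "1 \<in> polys R" "p \<in> polys R \<Longrightarrow> q \<in> polys R \<Longrightarrow> p + q \<in> polys R"
    "p \<in> polys R \<Longrightarrow> q \<in> polys R \<Longrightarrow> p - q \<in> polys R" "p \<in> polys R \<Longrightarrow> q \<in> polys R \<Longrightarrow> p * q \<in> polys R"
    "c \<in> R \<Longrightarrow> monom c m \<in> polys R" "p \<in> polys R \<Longrightarrow> p ^ m \<in> polys R"
    "c \<in> R \<Longrightarrow> p \<in> polys R \<Longrightarrow> Polynomial.smult c p \<in> polys R" "c \<in> R \<Longrightarrow> p \<in> polys R \<Longrightarrow> pCons c p \<in> polys R"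
    "p \<in> polys R \<Longrightarrow> x \<in> R \<Longrightarrow> poly p x \<in> R"
proof -
  note d = subring_CD[OF R]
  show "0 \<in> polys R" "p \<in> polys R \<Longrightarrow> q \<in> polys R \<Longrightarrow> p + q \<in> polys R"
    "p \<in> polys R \<Longrightarrow> q \<in> polys R \<Longrightarrow> p - q \<in> polys R" "c \<in> R \<Longrightarrow> monom c m \<in> polys R"
    "c \<in> R \<Longrightarrow> p \<in> polys R \<Longrightarrow> Polynomial.smult c p \<in> polys R" "c \<in> R \<Longrightarrow> p \<in> polys R \<Longrightarrow> pCons c p \<in> polys R"
    by (auto simp: polys_def d coeff_pCons split: nat.split)
  show 1: "1 \<in> polys R" by (auto simp: polys_def d)
  show mul: "p \<in> polys R \<Longrightarrow> q \<in> polys R \<Longrightarrow> p * q \<in> polys R" for p q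
    by (auto simp: polys_def coeff_mult d intro!: subring_C_sum[OF R])
  show "p \<in> polys R \<Longrightarrow> p ^ m \<in> polys R" by (induction m) (auto intro: 1 mul)
  show "p \<in> polys R \<Longrightarrow> x \<in> R \<Longrightarrow> poly p x \<in> R"
    by (auto simp: polys_def poly_altdef d intro!: subring_C_sum[OF R])
qed

lemma polys_prod: "subring_C R \<Longrightarrow> (\<And>i. i \<in> I \<Longrightarrow> f i \<in> polys R) \<Longrightarrow> prod f I \<in> polys R"
  by (induction I rule: infinite_finite_induct) (auto intro: polys_closed)

text \<open>As \<open>f\<close> is monic, leading terms can be cancelled without leaving
  \<open>R\<close>.\<close>

lemma monic_division:
  assumes R: "subring_C R" and f: "f \<in> polys R" "lead_coeff f = 1" "degree f > 0" and p: "p \<in> polys R"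
  shows "\<exists>q\<in>polys R. \<exists>s\<in>polys R. p = f * q + s \<and> degree s < degree f"
  using p
proof (induction "degree p" arbitrary: p rule: less_induct)
  case less
  show ?case
  proof (cases "degree p < degree f")
    case True
    then show ?thesis using less.prems polys_closed(1)[OF R] by (intro bexI[of _ 0] bexI[of _ p]) auto
  next
    case False
    define m where "m = monom (lead_coeff p) (degree p - degree f)"
    define p' where "p' = p - f * m"
    have mR: "m \<in> polys R" using less.prems by (auto simp: m_def polys_def subring_CD[OF R])
    have p'R: "p' \<in> polys R" unfolding p'_def by (intro polys_closed[OF R] less.prems f mR)
    have p0: "p \<noteq> 0" using False f(3) by auto
    have "m \<noteq> 0" "f \<noteq> 0" using p0 f(3) by (auto simp: m_def)
    moreover have "degree m = degree p - degree f" using p0 by (simp add: m_def degree_monom_eq)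
    ultimately have "degree (f * m) = degree p" using False by (simp add: degree_mult_eq)
    moreover have "lead_coeff m = lead_coeff p" unfolding m_def by (rule lead_coeff_monom)
    then have "lead_coeff (f * m) = lead_coeff p" by (simp only: lead_coeff_mult f(2) mult_1)
    ultimately have "degree p' \<le> degree p" "coeff p' (degree p) = 0"
      unfolding p'_def by (auto intro: degree_diff_le)
    moreover have "degree p > 0" using False f(3) by simp
    ultimately have "degree p' < degree p"
      by (metis degree_0 le_neq_implies_less leading_coeff_0_iff)
    from less.hyps[OF this p'R] obtain q s where qs: "q \<in> polys R" "s \<in> polys R"
      "p' = f * q + s" "degree s < degree f" by blast
    then have "p = f * (m + q) + s" by (simp add: p'_def algebra_simps)
    then show ?thesis using qs mR polys_closed(3)[OF R] by blast
  qed
qed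

text \<open>If \<open>p\<close> kills an \<open>l\<close>-th root \<open>x\<close> of \<open>t\<close> and has minimal degree \<open>e\<close>, then all its roots are \<open>l\<close>-th roots
  of \<open>t\<close>, so its constant coefficient shows that \<open>t ^ e\<close> is an \<open>l\<close>-th power.\<close>

lemma const_coeff_of_roots:
  fixes p :: "complex poly"
  assumes "\<And>z. poly p z = 0 \<Longrightarrow> z ^ l = t" "p \<noteq> 0"
  shows "coeff p 0 ^ l = ((- 1) ^ degree p * lead_coeff p) ^ l * t ^ degree p"
  using assms
proof (induction "degree p" arbitrary: p)
  case 0
  then obtain c where "p = [:c:]" by (metis degree_eq_zeroE)
  then show ?case by simp
next
  case (Suc d)
  then obtain z where z: "poly p z = 0"
    using fundamental_theorem_of_algebra[of p] constant_degree[of p] by auto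
  then obtain q where q: "p = [:- z, 1:] * q" by (metis dvdE poly_eq_0_iff_dvd)
  have q0: "q \<noteq> 0" using q Suc.prems by auto
  have dp: "degree p = Suc (degree q)" using q q0 by (simp add: degree_mult_eq del: mult_pCons_left)
  have zt: "z ^ l = t" using Suc.prems(1)[OF z] .
  have "coeff q 0 ^ l = ((- 1) ^ degree q * lead_coeff q) ^ l * t ^ degree q"
    by (rule Suc.hyps) (use dp Suc q q0 in auto)
  then have "((- 1) * z * coeff q 0) ^ l = (- 1) ^ l * t * (((- 1) ^ degree q * lead_coeff q) ^ l * t ^ degree q)"
    by (simp only: power_mult_distrib zt)
  moreover have "lead_coeff p = lead_coeff q" unfolding q lead_coeff_mult by simp
  moreover have "coeff p 0 = (- 1) * z * coeff q 0" unfolding q by simp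
  ultimately show ?case by (simp only: dp power_Suc power_mult_distrib mult_ac)
qed

text \<open>With \<open>e a + l b = 1\<close> the number \<open>d ^ a * t ^ b\<close> is a
  root.\<close>

lemma coprime_power_root:
  assumes F: "subfield_C F" and t: "t \<in> F" "t \<noteq> 0" and d: "d \<in> F" "d ^ l = t ^ e"
    and el: "coprime e l" and l0: "l > 0"
  shows "\<exists>z\<in>F. z ^ l = t"
proof -
  have "gcd (int e) (int l) = 1" using el by (simp add: coprime_iff_gcd_eq_1)
  then obtain a b where ab: "int e * a + int l * b = 1"
    using bezout_int[of "int e" "int l"] by (auto simp: mult.commute)
  have "(d powi a * t powi b) ^ l = (d powi a) ^ l * (t powi b) ^ l" by (rule power_mult_distrib)
  also have "(d powi a) ^ l = (d ^ l) powi a"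
    by (simp add: power_int_power power_int_power' mult.commute)
  also have "(t powi b) ^ l = t powi (int l * b)" by (simp add: power_int_power' mult.commute)
  also have "(d ^ l) powi a * t powi (int l * b) = t powi (int e * a) * t powi (int l * b)"
    unfolding d(2) by (simp only: power_int_power)
  also have "\<dots> = t" using t(2) ab by (simp add: power_int_add[symmetric])
  finally have "(d powi a * t powi b) ^ l = t" .
  moreover have pF: "u powi m \<in> F" if "u \<in> F" for u m
    using that by (auto simp: power_int_def subfield_CD[OF F])
  have "d powi a * t powi b \<in> F" by (rule subfield_CD(5)[OF F pF[OF d(1)] pF[OF t(1)]])
  ultimately show ?thesis by blast
qed

text \<open>A monic annihilator \<open>p1\<close> of least degree \<open>e\<close> divides
  \<open>X ^ l - t\<close>, so its constant coefficient exhibits \<open>t ^ e\<close> as an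
  \<open>l\<close>-th power in \<open>F\<close>. If \<open>0 < e < l\<close>, then \<open>e\<close>
  is prime to \<open>l\<close> and \<open>t\<close> itself would be an \<open>l\<close>-th
  power.\<close>

lemma binomial_irreducible:
  assumes F: "subfield_C F" and l: "prime (l::nat)" and t: "t \<in> F" "\<And>z. z \<in> F \<Longrightarrow> z ^ l \<noteq> t"
    and x: "x ^ l = t" and p: "p \<in> polys F" "p \<noteq> 0" "poly p x = 0"
  shows "degree p \<ge> l"
proof (rule ccontr)
  assume small: "\<not> degree p \<ge> l"
  note R = subfield_C_subring[OF F]
  have t0: "t \<noteq> 0" using t(2)[OF subfield_CD(1)[OF F]] prime_gt_0_nat[OF l] by (auto simp: power_0_left)
  define P where "P d \<longleftrightarrow> (\<exists>p\<in>polys F. p \<noteq> 0 \<and> poly p x = 0 \<and> degree p = d)" for d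
  define e where "e = (LEAST d. P d)"
  have "P (degree p)" using p by (auto simp: P_def)
  then have Pe: "P e" and e_le: "e \<le> degree p" unfolding e_def by (auto intro: LeastI Least_le)
  have e_min: "e \<le> degree q" if "q \<in> polys F" "q \<noteq> 0" "poly q x = 0" for q
    unfolding e_def by (rule Least_le) (use that in \<open>auto simp: P_def\<close>)
  obtain p0 where p0: "p0 \<in> polys F" "p0 \<noteq> 0" "poly p0 x = 0" "degree p0 = e" using Pe by (auto simp: P_def)
  define p1 where "p1 = Polynomial.smult (inverse (lead_coeff p0)) p0"
  have p1: "p1 \<in> polys F" "lead_coeff p1 = 1" "poly p1 x = 0" "degree p1 = e"
    using p0 by (auto simp: p1_def polys_def subfield_CD[OF F])
  have epos: "e > 0"
  proof (rule ccontr)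
    assume "\<not> e > 0"
    then obtain c where "p1 = [:c:]" using p1(4) by (auto elim: degree_eq_zeroE)
    then show False using p1 by simp
  qed
  define f where "f = monom 1 l - [:t:]"
  have fF: "f \<in> polys F" unfolding f_def
    by (intro polys_closed[OF R] t) (auto intro: subfield_CD[OF F])
  obtain q s where qs: "q \<in> polys F" "s \<in> polys F" "f = p1 * q + s" "degree s < degree p1"
    using monic_division[OF R p1(1,2) _ fF] epos p1(4) by auto
  have "poly f x = 0" using x by (simp add: f_def poly_monom)
  then have "poly s x = 0" using p1(3) qs(3) by simp
  then have "s = 0" using e_min[OF qs(2)] qs(4) p1(4) by fastforce
  then have roots: "z ^ l = t" if "poly p1 z = 0" for z
    using that arg_cong[OF qs(3), of "\<lambda>p. poly p z"] by (simp add: f_def poly_monom)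
  have "p1 \<noteq> 0" using p1(2) by auto
  from const_coeff_of_roots[OF roots this]
  have c: "coeff p1 0 ^ l = ((- 1) ^ e) ^ l * t ^ e" using p1 by simp
  define d where "d = (- 1) ^ e * coeff p1 0"
  have dF: "d \<in> F" using p1(1) by (auto simp: d_def polys_def subfield_CD[OF F])
  have dl: "d ^ l = t ^ e" unfolding d_def power_mult_distrib c
    by (simp add: mult.assoc[symmetric] power_mult_distrib[symmetric])
  have "\<not> l dvd e" using epos e_le small by (auto dest: dvd_imp_le)
  then have "coprime e l" using prime_imp_coprime[OF l] by (simp add: coprime_commute)
  from coprime_power_root[OF F t(1) t0 dF dl this prime_gt_0_nat[OF l]] show False using t(2) by blast
qed

text \<open>Only a span of powers. It becomes the ring \<open>F[a]\<close> once \<open>a ^ d\<close>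
  lies in it, without any claim that \<open>d\<close> is the degree of \<open>a\<close>.\<close>

definition adjoin :: "complex set \<Rightarrow> complex \<Rightarrow> nat \<Rightarrow> complex set" where
  "adjoin F a d = {(\<Sum>i<d. c i * a ^ i) | c. \<forall>i. c i \<in> F}"

lemma adjoin_poly:
  assumes F: "subring_C F" and d: "d > 0" "a ^ d \<in> adjoin F a d" and p: "p \<in> polys F"
  shows "poly p a \<in> adjoin F a d"
proof -
  obtain c where c: "a ^ d = (\<Sum>i<d. c i * a ^ i)" "\<And>i. c i \<in> F" using d(2) by (auto simp: adjoin_def)
  define r where "r = (\<Sum>i<d. monom (c i) i)"
  have cr: "coeff r i = (if i < d then c i else 0)" for i by (simp add: r_def coeff_sum)
  have dr: "degree r < d" using d(1) by (intro degree_lessI) (auto simp: cr)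
  define f where "f = monom 1 d - r"
  have "r \<in> polys F" using c subring_CD(1)[OF F] by (auto simp: polys_def cr)
  then have fF: "f \<in> polys F" unfolding f_def using subring_CD(2)[OF F] by (intro polys_closed[OF F])
  have df: "degree f = d" unfolding f_def
    using degree_add_eq_left[of "- r" "monom 1 d"] dr by (simp add: degree_monom_eq)
  then have "lead_coeff f = 1" using dr by (simp add: f_def coeff_eq_0)
  then obtain q s where qs: "s \<in> polys F" "p = f * q + s" "degree s < d"
    using monic_division[OF F fF _ _ p] df d(1) by auto
  have "poly r a = (\<Sum>i<d. c i * a ^ i)" by (simp add: r_def poly_sum poly_monom)
  then have "poly f a = 0" using c(1) by (simp add: f_def poly_monom)
  then have "poly p a = poly s a" using qs(2) by simp
  also have "\<dots> = (\<Sum>i\<le>degree s. coeff s i * a ^ i)" by (rule poly_altdef)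
  also have "\<dots> = (\<Sum>i<d. coeff s i * a ^ i)"
    using qs(3) by (intro sum.mono_neutral_left) (auto simp: coeff_eq_0)
  finally show ?thesis using qs(1) unfolding adjoin_def polys_def by auto
qed

lemma adjoin_eq_polys:
  assumes F: "subring_C F" and d: "d > 0" "a ^ d \<in> adjoin F a d"
  shows "adjoin F a d = (\<lambda>p. poly p a) ` polys F"
proof
  show "(\<lambda>p. poly p a) ` polys F \<subseteq> adjoin F a d" using adjoin_poly[OF F d] by auto
  show "adjoin F a d \<subseteq> (\<lambda>p. poly p a) ` polys F"
  proof
    fix x assume "x \<in> adjoin F a d"
    then obtain c where c: "x = (\<Sum>i<d. c i * a ^ i)" "\<And>i. c i \<in> F" by (auto simp: adjoin_def)
    have "x = poly (\<Sum>i<d. monom (c i) i) a" by (simp add: c poly_sum poly_monom)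
    moreover have "(\<Sum>i<d. monom (c i) i) \<in> polys F" using c(2) subring_CD(1)[OF F] by (auto simp: polys_def coeff_sum)
    ultimately show "x \<in> (\<lambda>p. poly p a) ` polys F" by blast
  qed
qed

lemma poly_image_subring:
  assumes R: "subring_C R"
  shows "subring_C ((\<lambda>p. poly p a) ` polys R)"
proof -
  have "1 \<in> (\<lambda>p. poly p a) ` polys R" by (rule image_eqI[of _ _ 1]) (auto intro: polys_closed[OF R])
  moreover have "0 \<in> (\<lambda>p. poly p a) ` polys R" by (rule image_eqI[of _ _ 0]) (auto intro: polys_closed[OF R])
  ultimately show ?thesis unfolding subring_C_def
    by (auto simp: poly_add[symmetric] poly_diff[symmetric] poly_mult[symmetric] simp del: poly_add poly_diff poly_mult
        intro!: imageI polys_closed[OF R])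
qed

text \<open>After cancelling powers of \<open>x\<close>, an integer equation of \<open>x\<close> has
  nonzero constant term and expresses the inverse as a polynomial in \<open>x\<close>.\<close>

lemma algebraic_subring_subfield:
  assumes R: "subring_C R" and rat: "\<And>q. of_rat q \<in> R" and alg: "\<And>x. x \<in> R \<Longrightarrow> algebraic x"
  shows "subfield_C R"
proof -
  have "inverse x \<in> R" if x: "x \<in> R" "x \<noteq> 0" for x
  proof -
    obtain p where p: "\<And>i. coeff p i \<in> \<int>" "p \<noteq> 0" "poly p x = 0" using alg[OF x(1)] by (auto simp: algebraic_def)
    have "\<exists>p. (\<forall>i. coeff p i \<in> \<int>) \<and> coeff p 0 \<noteq> 0 \<and> poly p x = 0"
      using p
    proof (induction "degree p" arbitrary: p rule: less_induct)
      case less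
      show ?case
      proof (cases "coeff p 0 = 0")
        case True
        then obtain q where q: "p = pCons 0 q" by (metis coeff_pCons_0 pCons_cases)
        have "q \<noteq> 0" "poly q x = 0" using less.prems x(2) by (auto simp: q)
        moreover have "coeff q i \<in> \<int>" for i using less.prems(1)[of "Suc i"] by (simp add: q)
        moreover have "degree q < degree p" using \<open>q \<noteq> 0\<close> by (simp add: q)
        ultimately show ?thesis using less.hyps by blast
      qed (use less.prems in blast)
    qed
    then obtain p where p: "\<And>i. coeff p i \<in> \<int>" "coeff p 0 \<noteq> 0" "poly p x = 0" by blast
    obtain c q where cq: "p = pCons c q" by (cases p)
    obtain m where m: "c = of_int m" using p(1)[of 0] by (auto simp: cq elim: Ints_cases)
    have "q \<in> polys R"
    proof -
      have "coeff q i \<in> R" for i using p(1)[of "Suc i"] subring_CD(9)[OF R] by (auto simp: cq elim!: Ints_cases)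
      then show ?thesis by (auto simp: polys_def)
    qed
    then have qR: "poly q x \<in> R" using polys_closed(10)[OF R] x by blast
    have "c + x * poly q x = 0" using p(3) by (simp add: cq)
    then have "x * poly q x = - c" by (simp add: add_eq_0_iff)
    then have "inverse x = of_rat (- (1 / of_int m)) * poly q x"
      using x(2) p(2) by (simp add: cq m of_rat_minus of_rat_divide field_simps)
    then show ?thesis using subring_CD(5)[OF R rat qR] by simp
  qed
  then show ?thesis using R by (auto simp: subfield_C_def subring_C_def)
qed

lemma number_field_adjoin:
  assumes F: "number_field F" and d: "d > 0" "a ^ d \<in> adjoin F a d"
  shows "number_field (adjoin F a d)" "F \<subseteq> adjoin F a d" "a \<in> adjoin F a d"
proof -
  obtain b n where nb: "number_field_basis F b n" using number_field_obtain_basis[OF F] .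
  interpret number_field_basis F b n by (rule nb)
  note R = subfield_C_subring[OF K]
  note eq = adjoin_eq_polys[OF R d]
  have sub: "subring_C (adjoin F a d)" unfolding eq by (rule poly_image_subring[OF R])
  show FL: "F \<subseteq> adjoin F a d"
  proof
    fix x assume "x \<in> F"
    then have "[:x:] \<in> polys F" by (intro polys_closed[OF R])
    then have "poly [:x:] a \<in> adjoin F a d" by (rule adjoin_poly[OF R d])
    then show "x \<in> adjoin F a d" by simp
  qed
  have "[:0, 1:] \<in> polys F" by (intro polys_closed[OF R] subfield_CD[OF K])
  then have "poly [:0, 1:] a \<in> adjoin F a d" by (rule adjoin_poly[OF R d])
  then show aL: "a \<in> adjoin F a d" by simp
  define S where "S = (\<lambda>(i, j). b i * a ^ j) ` ({..<n} \<times> {..<d})"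
  have finS: "finite S" by (simp add: S_def)
  have SL: "S \<subseteq> adjoin F a d"
    using b(1) FL aL by (auto simp: S_def intro!: subring_CD[OF sub])
  interpret Q: vector_space "\<lambda>(q::rat) (x::complex). of_rat q * x"
    by unfold_locales (auto simp: algebra_simps of_rat_add of_rat_mult)
  have span: "\<exists>q. x = (\<Sum>y\<in>S. of_rat (q y) * y)" if x: "x \<in> adjoin F a d" for x
  proof -
    obtain c where c: "x = (\<Sum>j<d. c j * a ^ j)" "\<And>j. c j \<in> F" using x by (auto simp: adjoin_def)
    have "c j * a ^ j = (\<Sum>i<n. of_rat (co (c j) i) * (b i * a ^ j))" for j
      using arg_cong[OF co(1)[OF c(2)[of j]], of "\<lambda>x. x * a ^ j"] by (simp add: sum_distrib_right mult.assoc)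
    then have "x = (\<Sum>j<d. \<Sum>i<n. of_rat (co (c j) i) * (b i * a ^ j))" using c(1) by simp
    also have "\<dots> \<in> Q.span S"
      by (intro Q.span_sum Q.span_scale Q.span_base) (auto simp: S_def)
    finally show ?thesis using Q.span_finite[OF finS] by auto
  qed
  obtain b' n' where b': "\<And>i. i < n' \<Longrightarrow> b' i \<in> S"
      "\<And>q i. (\<Sum>i<n'. of_rat (q i) * b' i) = 0 \<Longrightarrow> i < n' \<Longrightarrow> q i = (0::rat)"
      "\<And>q. (\<Sum>y\<in>S. of_rat (q y) * y) \<in> rspan b' n'"
    by (rule rspan_basis[OF finS], rule that) assumption+
  have sp: "x \<in> rspan b' n'" if x: "x \<in> adjoin F a d" for x
  proof -
    obtain q where "x = (\<Sum>y\<in>S. of_rat (q y) * y)" using span[OF x] by blast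
    then show ?thesis using b'(3) by simp
  qed
  have n': "n' > 0"
  proof (rule ccontr)
    assume "\<not> n' > 0"
    then show False using sp[OF subring_CD(2)[OF sub]] by (auto simp: rspan_def)
  qed
  have b'0: "b' 0 \<noteq> 0"
  proof
    assume "b' 0 = 0"
    then have "(\<Sum>i<n'. of_rat (if i = 0 then 1 else 0) * b' i) = 0" by (intro sum.neutral) auto
    then show False using b'(2)[of "\<lambda>i. if i = 0 then 1 else 0" 0] n' by auto
  qed
  have "algebraic x" if x: "x \<in> adjoin F a d" for x
    by (rule rspan_algebraic[OF sp[OF subring_CD(5)[OF sub x subsetD[OF SL b'(1)]]] n' b'0])
  then have sf: "subfield_C (adjoin F a d)"
    using FL subfield_CD(12)[OF K] by (intro algebraic_subring_subfield[OF sub]) auto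
  show "number_field (adjoin F a d)" unfolding number_field_def
    by (intro conjI sf exI[of _ S] finS SL ballI span)
qed

lemma (in number_field_basis) scale_basis:
  assumes D: "\<And>i. i < n \<Longrightarrow> (D i :: nat) > 0"
  shows "number_field_basis K (\<lambda>i. of_nat (D i) * b i) n"
proof
  show "subfield_C K" by (rule K)
  show "of_nat (D i) * b i \<in> K" "algebraic_int (of_nat (D i) * b i)" if "i < n" for i
    using that b by (auto intro: subfield_CD[OF K] algebraic_int_ring)
  show "q i = 0" if "(\<Sum>i<n. of_rat (q i) * (of_nat (D i) * b i)) = 0" "i < n" for q i
  proof -
    have "(\<Sum>i<n. of_rat (q i * of_nat (D i)) * b i) = 0"
      using that(1) by (simp add: of_rat_mult mult.assoc)
    from b_indep[OF this that(2)] show ?thesis using D[OF that(2)] by simp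
  qed
  show "K \<subseteq> rspan (\<lambda>i. of_nat (D i) * b i) n"
  proof
    fix x assume "x \<in> K"
    then obtain q where "x = (\<Sum>i<n. of_rat (q i) * b i)" using b_span by (auto simp: rspan_def)
    also have "\<dots> = (\<Sum>i<n. of_rat (q i / of_nat (D i)) * (of_nat (D i) * b i))"
    proof (rule sum.cong)
      fix i assume "i \<in> {..<n}"
      then have "D i > 0" using D by auto
      then show "of_rat (q i) * b i = of_rat (q i / of_nat (D i)) * (of_nat (D i) * b i)"
        by (simp add: of_rat_divide)
    qed simp
    finally show "x \<in> rspan (\<lambda>i. of_nat (D i) * b i) n" unfolding rspan_def by (intro CollectI exI conjI TrueI)
  qed
qed

section \<open>Counting ideals in orders\<close>

text \<open>The index of an additive subgroup is measured by the cardinalities of separated sets.\<close>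

definition separated :: "complex set \<Rightarrow> complex set \<Rightarrow> bool" where
  "separated J F \<longleftrightarrow> finite F \<and> (\<forall>x\<in>F. \<forall>y\<in>F. x - y \<in> J \<longrightarrow> x = y)"

definition is_ideal :: "complex set \<Rightarrow> complex set \<Rightarrow> bool" where
  "is_ideal S J \<longleftrightarrow> J \<subseteq> S \<and> add_subgroup J \<and> (\<forall>x\<in>S. \<forall>y\<in>J. x * y \<in> J)"

lemma is_idealD:
  assumes "is_ideal S J"
  shows "J \<subseteq> S" "add_subgroup J" "x \<in> S \<Longrightarrow> y \<in> J \<Longrightarrow> x * y \<in> J"
  using assms by (auto simp: is_ideal_def)

context number_field_basis
begin

definition box :: "nat \<Rightarrow> complex set" where
  "box T = (\<lambda>a. \<Sum>i<n. of_nat (a i) * b i) ` ({..<n} \<rightarrow>\<^sub>E {..T})"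

lemma co_nat_combo: "i < n \<Longrightarrow> co (\<Sum>i<n. of_nat (a i) * b i) i = of_nat (a i)"
  by (rule co_unique[of _ "\<lambda>i. of_nat (a i)"]) auto

lemma inj_box: "inj_on (\<lambda>a. \<Sum>i<n. of_nat (a i) * b i) ({..<n} \<rightarrow>\<^sub>E {..T})"
proof
  fix a c assume ac: "a \<in> {..<n} \<rightarrow>\<^sub>E {..T}" "c \<in> {..<n} \<rightarrow>\<^sub>E {..T}"
    "(\<Sum>i<n. of_nat (a i) * b i) = (\<Sum>i<n. of_nat (c i) * b i)"
  show "a = c"
  proof (rule PiE_ext[OF ac(1,2)])
    fix i assume "i \<in> {..<n}"
    then have "(of_nat (a i) :: rat) = of_nat (c i)" using co_nat_combo ac(3) by (metis lessThan_iff)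
    then show "a i = c i" by simp
  qed
qed

lemma card_box: "finite (box T)" "card (box T) = (T + 1) ^ n"
  unfolding box_def by (auto simp: card_image[OF inj_box] card_PiE intro!: finite_PiE)

lemma box_zspan: "box T \<subseteq> zspan b n"
proof
  fix x assume "x \<in> box T"
  then obtain a where "x = (\<Sum>i<n. of_int (int (a i)) * b i)" by (auto simp: box_def)
  then show "x \<in> zspan b n" unfolding zspan_def by (intro CollectI exI conjI TrueI)
qed

lemma zspan_K: "zspan b n \<subseteq> K"
  using zspan_b_OK OKD by auto

lemma box_nrm:
  assumes "x \<in> box T" 
  shows "nrm x \<le> real n * T"
proof -
  obtain a where a: "a \<in> {..<n} \<rightarrow>\<^sub>E {..T}" "x = (\<Sum>i<n. of_nat (a i) * b i)" using assms by (auto simp: box_def)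
  have "nrm x = (\<Sum>i<n. real (a i))" unfolding nrm_def a(2)
    by (intro sum.cong) (auto simp: co_nat_combo)
  also have "\<dots> \<le> (\<Sum>i<n. real T)" using a(1) by (intro sum_mono) auto
  finally show ?thesis by simp
qed

lemma box_diff_nrm:
  assumes "x \<in> box T" "y \<in> box T"
  shows "nrm (x - y) \<le> real n * T"
proof -
  obtain a where a: "a \<in> {..<n} \<rightarrow>\<^sub>E {..T}" "x = (\<Sum>i<n. of_nat (a i) * b i)" using assms by (auto simp: box_def)
  obtain c where c: "c \<in> {..<n} \<rightarrow>\<^sub>E {..T}" "y = (\<Sum>i<n. of_nat (c i) * b i)" using assms by (auto simp: box_def)
  have "x \<in> K" "y \<in> K" using assms box_zspan zspan_K by blast+
  then have "nrm (x - y) = (\<Sum>i<n. \<bar>real (a i) - real (c i)\<bar>)" unfolding nrm_def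
    by (intro sum.cong) (auto simp: co_diff a(2) c(2) co_nat_combo of_rat_diff simp del: abs_of_rat)
  also have "\<dots> \<le> (\<Sum>i<n. real T)"
  proof (rule sum_mono)
    fix i assume "i \<in> {..<n}"
    then have "a i \<le> T" "c i \<le> T" using a(1) c(1) by auto
    then show "\<bar>real (a i) - real (c i)\<bar> \<le> real T" by (simp add: abs_le_iff)
  qed
  finally show ?thesis by simp
qed

definition dn :: nat where "dn = (SOME D. D > 0 \<and> (\<forall>x\<in>OK. of_nat D * x \<in> zspan b n))"

lemma dn: "dn > 0" "x \<in> OK \<Longrightarrow> of_nat dn * x \<in> zspan b n"
proof -
  have "dn > 0 \<and> (\<forall>x\<in>OK. of_nat dn * x \<in> zspan b n)"
    unfolding dn_def by (rule someI_ex) (use integers_bounded_denominator in blast)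
  then show "dn > 0" "x \<in> OK \<Longrightarrow> of_nat dn * x \<in> zspan b n" by auto
qed

lemma co_dn:
  assumes x: "x \<in> OK" and i: "i < n"
  shows "of_nat dn * co x i = of_int \<lfloor>of_nat dn * co x i\<rfloor>"
proof -
  obtain a where a: "of_nat dn * x = (\<Sum>i<n. of_int (a i) * b i)" using dn(2)[OF x] by (auto simp: zspan_def)
  have "co (of_nat dn * x) i = of_int (a i)"
    by (rule co_unique[of _ "\<lambda>i. of_int (a i)", OF _ i]) (simp add: a)
  moreover have "co (of_nat dn * x) i = of_nat dn * co x i"
    using co_rat[OF OKD(1)[OF x], of "of_nat dn" i] by simp
  ultimately show ?thesis by simp
qed

lemma co_dn_abs:
  assumes "x \<in> OK" "i < n"
  shows "\<bar>real_of_int \<lfloor>of_nat dn * co x i\<rfloor>\<bar> = real dn * \<bar>real_of_rat (co x i)\<bar>"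
proof -
  have "real dn * real_of_rat (co x i) = real_of_int \<lfloor>of_nat dn * co x i\<rfloor>"
    using arg_cong[OF co_dn[OF assms], of real_of_rat] by (simp add: of_rat_mult)
  then show ?thesis by (metis abs_mult abs_of_nat)
qed

lemma integers_nrm_small:
  assumes x: "x \<in> OK" and "real dn * nrm x < 1"
  shows "x = 0"
proof (rule nrm_eq_0[OF OKD(1)[OF x]])
  have "co x i = 0" if i: "i < n" for i
  proof -
    let ?f = "\<lfloor>of_nat dn * co x i\<rfloor>"
    have "\<bar>real_of_int \<lfloor>of_nat dn * co x i\<rfloor>\<bar> = real dn * \<bar>real_of_rat (co x i)\<bar>"
      by (rule co_dn_abs[OF x i])
    also have "\<dots> \<le> real dn * nrm x" using co_le_nrm[OF i] by (intro mult_left_mono) auto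
    also have "\<dots> < 1" by fact
    finally have "?f = 0" by linarith
    then show ?thesis using co_dn[OF x i] dn(1) by simp
  qed
  then show "nrm x = 0" by (simp add: nrm_def)
qed

lemma card_integers_bounded:
  assumes X: "X \<ge> 0"
  shows "real (card {x \<in> OK. nrm x \<le> X}) \<le> (2 * real dn * X + 1) ^ n"
proof -
  let ?m = "\<lfloor>real dn * X\<rfloor>"
  let ?f = "\<lambda>x. restrict (\<lambda>i. \<lfloor>of_nat dn * co x i\<rfloor>) {..<n}"
  let ?A = "{x \<in> OK. nrm x \<le> X}"
  have m0: "?m \<ge> 0" using X by simp
  have inj: "inj_on ?f ?A"
  proof
    fix x y assume xy: "x \<in> ?A" "y \<in> ?A" "?f x = ?f y"
    have "co x i = co y i" if i: "i < n" for i
    proof -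
      have "\<lfloor>of_nat dn * co x i\<rfloor> = \<lfloor>of_nat dn * co y i\<rfloor>" using fun_cong[OF xy(3), of i] i by simp
      then have "of_nat dn * co x i = of_nat dn * co y i" using co_dn[of x i] co_dn[of y i] xy(1,2) i by simp
      then show ?thesis using dn(1) by simp
    qed
    then have "(\<Sum>i<n. of_rat (co x i) * b i) = (\<Sum>i<n. of_rat (co y i) * b i)" by simp
    then show "x = y" using co(1) xy(1,2) OKD(1) by (metis (no_types, lifting) mem_Collect_eq)
  qed
  have "?f ` ?A \<subseteq> {..<n} \<rightarrow>\<^sub>E {- ?m..?m}"
  proof (clarify)
    fix x assume x: "x \<in> OK" "nrm x \<le> X"
    have "\<lfloor>of_nat dn * co x i\<rfloor> \<in> {- ?m..?m}" if i: "i < n" for i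
    proof -
      have "\<bar>real_of_int \<lfloor>of_nat dn * co x i\<rfloor>\<bar> = real dn * \<bar>real_of_rat (co x i)\<bar>"
        by (rule co_dn_abs[OF x(1) i])
      also have "\<dots> \<le> real dn * X" using co_le_nrm[OF i, of x] x(2) by (intro mult_left_mono) auto
      finally have "\<bar>\<lfloor>of_nat dn * co x i\<rfloor>\<bar> \<le> ?m" by (simp add: le_floor_iff)
      then show ?thesis by auto
    qed
    then show "?f x \<in> {..<n} \<rightarrow>\<^sub>E {- ?m..?m}" by (simp add: restrict_PiE_iff del: restrict_apply)
  qed
  then have "card (?f ` ?A) \<le> card ({..<n} \<rightarrow>\<^sub>E {- ?m..?m})" by (intro card_mono finite_PiE) auto
  also have "\<dots> = nat (2 * ?m + 1) ^ n" by (simp add: card_PiE)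
  finally have "card ?A \<le> nat (2 * ?m + 1) ^ n" by (simp add: card_image[OF inj])
  then have "real (card ?A) \<le> real (nat (2 * ?m + 1)) ^ n" by (metis of_nat_le_iff of_nat_power)
  also have "\<dots> \<le> (2 * real dn * X + 1) ^ n"
  proof (rule power_mono)
    have "real (nat (2 * ?m + 1)) = 2 * of_int ?m + 1" using m0 by simp
    also have "\<dots> \<le> 2 * (real dn * X) + 1" by simp
    finally show "real (nat (2 * ?m + 1)) \<le> 2 * real dn * X + 1" by simp
  qed simp
  finally show ?thesis .
qed

end

text \<open>The order need not be maximal. Ideals are counted in \<open>O[eta]\<close>, while the
  ring of integers itself serves for the supply of principal ideals.\<close>

locale number_field_order = number_field_basis +
  fixes S :: "complex set"
  assumes S: "subring_C S" "zspan b n \<subseteq> S" "S \<subseteq> ring_of_integers K"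
begin

text \<open>Collects the denominator \<open>dn\<close> and the growth of norms under multiplication
  by elements of a box, so that the volume argument ends with the bound
  \<open>(cU * X) ^ n\<close>.\<close>

definition cU :: real where "cU = 2 * real dn * (1 + nC * real n) + 1"

lemma cU_pos: "cU \<ge> 1"
  using nC_pos by (simp add: cU_def)

lemma S_K: "S \<subseteq> K" using S(3) OKD(1) by auto

text \<open>Volume argument: if \<open>F\<close> is separated modulo \<open>\<beta>S\<close>, then the translates \<open>f + \<beta>z\<close> with \<open>f\<close> in \<open>F\<close> and
  \<open>z\<close> in a large box are distinct integers of controlled size.\<close>

lemma card_separated_principal:
  assumes be: "be \<in> ring_of_integers K" "be \<noteq> 0" "nrm be \<le> X" "X \<ge> 1"
    and F: "F \<subseteq> S" "separated ((*) be ` S) F"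
  shows "real (card F) \<le> (cU * X) ^ n"
proof -
  have finF: "finite F" using F by (simp add: separated_def)
  \<comment> \<open>A box side larger than all norms in \<open>F\<close>; the shift by
    \<open>f\<close> then changes the size of a translate by a bounded factor only.\<close>
  define W where "W = nat \<lceil>\<Sum>f\<in>F. nrm f\<rceil> + 1"
  have W: "nrm f \<le> real W" if "f \<in> F" for f
  proof -
    have "nrm f \<le> (\<Sum>f\<in>F. nrm f)" by (rule member_le_sum) (use that finF nrm_nonneg in auto)
    also have "\<dots> \<le> real W" unfolding W_def by linarith
    finally show ?thesis .
  qed
  have W1: "real W \<ge> 1" by (simp add: W_def)
  let ?g = "\<lambda>(f, z). f + be * z"
  have bz: "be \<in> K" "z \<in> OK" "z \<in> S" "z \<in> K" if "z \<in> box W" for z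
    using that box_zspan zspan_b_OK S OKD(1) be(1) by blast+
  have inj: "inj_on ?g (F \<times> box W)"
  proof
    fix p q assume pq: "p \<in> F \<times> box W" "q \<in> F \<times> box W" "?g p = ?g q"
    obtain f z f' z' where fz: "p = (f, z)" "q = (f', z')" "f \<in> F" "f' \<in> F" "z \<in> box W" "z' \<in> box W"
      using pq by auto
    have eq: "f + be * z = f' + be * z'" using pq(3) fz by simp
    have "f - f' = be * (z' - z)" using eq by (simp add: algebra_simps)
    moreover have "z' - z \<in> S" using bz(3) fz by (intro subring_CD(4)[OF S(1)])
    ultimately have "f = f'" using F(2) fz by (auto simp: separated_def)
    then show "p = q" using eq be(2) fz by simp
  qed
  let ?X = "real W * X * (1 + nC * real n)"
  have X0: "?X \<ge> 0" using nC_pos be(4) by simp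
  have "?g ` (F \<times> box W) \<subseteq> {x \<in> OK. nrm x \<le> ?X}"
  proof clarify
    fix f z assume fz: "f \<in> F" "z \<in> box W"
    have fO: "f \<in> OK" using F(1) S(3) fz by auto
    have "nrm (f + be * z) \<le> nrm f + nrm (be * z)"
      using fO bz[OF fz(2)] OKD(1) by (intro nrm_add) (auto intro: subfield_CD[OF K])
    also have "nrm (be * z) \<le> nC * nrm be * nrm z" using bz[OF fz(2)] by (intro nrm_mult)
    also have "nC * nrm be * nrm z \<le> nC * X * (real n * real W)"
      using box_nrm[OF fz(2)] be(3,4) nC_pos nrm_nonneg by (intro mult_mono) auto
    also have "nrm f \<le> real W * X" using W[OF fz(1)] mult_left_mono[OF be(4), of "real W"] by simp
    finally have "nrm (f + be * z) \<le> real W * X + nC * X * (real n * real W)" by simp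
    also have "\<dots> = ?X" by (simp add: algebra_simps)
    finally have "nrm (f + be * z) \<le> ?X" .
    moreover have "f + be * z \<in> OK" using fO bz[OF fz(2)] be(1) by (intro ring_of_integersD[OF K])
    ultimately show "f + be * z \<in> OK \<and> nrm (f + be * z) \<le> ?X" by simp
  qed
  then have "card (?g ` (F \<times> box W)) \<le> card {x \<in> OK. nrm x \<le> ?X}"
    by (intro card_mono finite_integers_bounded_nrm)
  then have "card F * (W + 1) ^ n \<le> card {x \<in> OK. nrm x \<le> ?X}"
    by (simp add: card_image[OF inj] card_cartesian_product card_box)
  then have "real (card F) * real (W + 1) ^ n \<le> real (card {x \<in> OK. nrm x \<le> ?X})"
    by (metis of_nat_le_iff of_nat_mult of_nat_power)
  also have "\<dots> \<le> (2 * real dn * ?X + 1) ^ n" by (rule card_integers_bounded[OF X0])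
  also have "\<dots> \<le> (cU * X * real W) ^ n"
  proof (rule power_mono)
    have "1 * 1 \<le> real W * X" by (rule mult_mono) (use W1 be(4) in auto)
    then show "2 * real dn * ?X + 1 \<le> cU * X * real W" by (simp add: cU_def algebra_simps)
  qed (use X0 in simp)
  also have "\<dots> = (cU * X) ^ n * real W ^ n" by (simp add: power_mult_distrib)
  finally have *: "real (card F) * real (W + 1) ^ n \<le> (cU * X) ^ n * real W ^ n" .
  have "real (card F) * real W ^ n \<le> real (card F) * real (W + 1) ^ n"
    by (intro mult_left_mono power_mono) auto
  then have "real (card F) * real W ^ n \<le> (cU * X) ^ n * real W ^ n" using * by linarith
  then show ?thesis using W1 by (simp add: mult_le_cancel_right)
qed

end

section \<open>Ideals of given size in an order\<close>

context number_field_order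
begin

text \<open>Pigeonhole: the box has more than \<open>T ^ n\<close> elements, so two of them agree
  modulo \<open>J\<close>.\<close>

lemma ideal_small_element:
  assumes J: "is_ideal S J" "\<And>F. F \<subseteq> S \<Longrightarrow> separated J F \<Longrightarrow> card F \<le> T ^ n"
  shows "\<exists>be\<in>J. be \<noteq> 0 \<and> nrm be \<le> real n * real T"
proof -
  have "card (box T) > T ^ n" using power_strict_mono[of T "T + 1" n] n_pos by (simp add: card_box)
  moreover have "box T \<subseteq> S" using box_zspan S(2) by blast
  ultimately have "\<not> separated J (box T)" using J(2)[of "box T"] by auto
  then obtain x y where xy: "x \<in> box T" "y \<in> box T" "x - y \<in> J" "x \<noteq> y"
    using card_box(1) by (auto simp: separated_def)
  then show ?thesis using box_diff_nrm[OF xy(1,2)] by (intro bexI[of _ "x - y"]) auto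
qed

text \<open>The multiples of \<open>be\<close> have index at most \<open>(cU * X) ^ n\<close> in
  \<open>S\<close>, and \<open>J\<close> has index at least \<open>card F\<close>. By the choice of
  \<open>q\<close> their quotient is too small for the multiples \<open>0, ..., q\<close> of
  \<open>x\<close> to be distinct modulo \<open>be\<close>, so some \<open>j x\<close> with
  \<open>1 <= j <= q\<close> is divisible by \<open>be\<close>, and \<open>j\<close> divides
  \<open>q!\<close>.\<close>

lemma ideal_multiple_principal:
  assumes J: "is_ideal S J" and be: "be \<in> J" "be \<noteq> 0" "nrm be \<le> X" "X \<ge> 1"
    and F: "F \<subseteq> S" "separated J F" and q: "real (q + 1) * real (card F) > (cU * X) ^ n"
    and x: "x \<in> J"
  shows "of_nat (fact q) * x \<in> (*) be ` S"
proof -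
  note JD = is_idealD[OF J]
  have R: "x - y \<in> S" if "x \<in> S" "y \<in> S" for x y using that by (rule subring_CD(4)[OF S(1)])
  have bS: "(*) be ` S \<subseteq> J" using JD(3) be(1) by (auto simp: mult.commute)
  have xS: "x \<in> S" using JD x by auto
  have "\<exists>j\<in>{1..q}. of_nat j * x \<in> (*) be ` S"
  proof (rule ccontr)
    assume no: "\<not> ?thesis"
    let ?g = "\<lambda>(f, j::nat). f + of_nat j * x"
    have key: "f = f' \<and> j = j'" if "f \<in> F" "f' \<in> F" "j \<le> q" "j' \<le> q"
        "(f + of_nat j * x) - (f' + of_nat j' * x) \<in> (*) be ` S" for f f' j j'
    proof -
      have jx: "of_nat k * x \<in> J" for k using add_subgroup_of_int_mult[OF JD(2) x, of "int k"] by simp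
      have "f - f' = ((f + of_nat j * x) - (f' + of_nat j' * x)) - of_nat j * x + of_nat j' * x" by simp
      also have "\<dots> \<in> J"
        by (rule add_subgroupD(4)[OF JD(2) add_subgroupD(2)[OF JD(2) subsetD[OF bS that(5)] jx] jx])
      finally have ff: "f = f'" using F(2) that by (auto simp: separated_def)
      have jj: False if "j < j'" "j' \<le> q" "(of_nat j' - of_nat j) * x \<in> (*) be ` S" for j j' :: nat
      proof -
        have "of_nat (j' - j) * x \<in> (*) be ` S" using that by (simp add: of_nat_diff)
        moreover have "j' - j \<in> {1..q}" using that by auto
        ultimately show False using no by blast
      qed
      have d: "(of_nat j - of_nat j') * x \<in> (*) be ` S" using that(5) ff by (simp add: algebra_simps)
      then obtain s where s: "s \<in> S" "(of_nat j - of_nat j') * x = be * s" by auto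
      then have "(of_nat j' - of_nat j) * x = be * (- s)" by (simp add: algebra_simps)
      moreover have "- s \<in> S" using s(1) by (rule subring_CD(6)[OF S(1)])
      ultimately have "(of_nat j' - of_nat j) * x \<in> (*) be ` S" by (metis image_eqI)
      then show ?thesis using ff jj[of j j'] jj[of j' j] d that by (metis linorder_neqE_nat)
    qed
    have inj: "inj_on ?g (F \<times> {..q})"
    proof
      fix p p' assume pp: "p \<in> F \<times> {..q}" "p' \<in> F \<times> {..q}" "?g p = ?g p'"
      obtain f j f' j' where e: "p = (f, j)" "p' = (f', j')" by (cases p, cases p')
      have "(f + of_nat j * x) - (f' + of_nat j' * x) = be * 0" using pp(3) e by simp
      then have "(f + of_nat j * x) - (f' + of_nat j' * x) \<in> (*) be ` S"
        using subring_CD(1)[OF S(1)] by (metis image_eqI)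
      then show "p = p'" using key[of f f' j j'] pp e by auto
    qed
    have "separated ((*) be ` S) (?g ` (F \<times> {..q}))"
      unfolding separated_def
    proof (intro conjI ballI impI)
      show "finite (?g ` (F \<times> {..q}))" using F(2) by (simp add: separated_def)
      fix u v assume uv: "u \<in> ?g ` (F \<times> {..q})" "v \<in> ?g ` (F \<times> {..q})" "u - v \<in> (*) be ` S"
      obtain f j where u: "f \<in> F" "j \<le> q" "u = f + of_nat j * x" using uv(1) by auto
      obtain f' j' where v: "f' \<in> F" "j' \<le> q" "v = f' + of_nat j' * x" using uv(2) by auto
      show "u = v" using key[OF u(1) v(1) u(2) v(2)] uv(3) unfolding u(3) v(3) by simp
    qed
    moreover have "?g ` (F \<times> {..q}) \<subseteq> S" using F(1) xS
      by (auto intro!: subring_CD[OF S(1)])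
    moreover have "be \<in> OK" using be(1) JD(1) S(3) by auto
    ultimately have "real (card (?g ` (F \<times> {..q}))) \<le> (cU * X) ^ n"
      using card_separated_principal[OF _ be(2-4)] by blast
    moreover have "card (?g ` (F \<times> {..q})) = card F * (q + 1)"
      by (simp add: card_image[OF inj] card_cartesian_product)
    then have "real (card (?g ` (F \<times> {..q}))) = real (q + 1) * real (card F)"
      by (metis mult.commute of_nat_mult)
    ultimately show False using q by linarith
  qed
  then obtain j s where j: "1 \<le> j" "j \<le> q" "s \<in> S" "of_nat j * x = be * s" by auto
  then have "j dvd fact q" by (simp add: dvd_fact)
  then obtain m where m: "fact q = j * m" by (auto elim: dvdE)
  have "of_nat (fact q) * x = of_nat m * (of_nat j * x)" unfolding m by simp
  then have "of_nat (fact q) * x = be * (of_nat m * s)" unfolding j(4) by (simp only: mult_ac)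
  moreover have "of_nat m * s \<in> S" using j by (intro subring_CD[OF S(1)])
  ultimately show ?thesis by blast
qed

text \<open>Multiplication by \<open>Q / be\<close> maps such an ideal to a subset of
  \<open>S\<close> stable under adding \<open>Q z\<close> for \<open>z\<close> in the span of
  \<open>b\<close>. This subset is therefore determined by its members among the bounded
  representatives \<open>R\<close>.\<close>

lemma count_ideals_with_element:
  assumes be: "be \<noteq> 0" and Q: "(Q::nat) > 0"
    and C: "\<And>J. J \<in> C \<Longrightarrow> is_ideal S J \<and> be \<in> J \<and> (\<forall>x\<in>J. of_nat Q * x \<in> (*) be ` S)"
  shows "finite C \<and> card C \<le> 2 ^ card {x \<in> S. nrm x \<le> real n * real Q}"
proof -
  define R where "R = {x \<in> S. nrm x \<le> real n * real Q}"
  have finR: "finite R" unfolding R_def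
    by (rule finite_subset[OF _ finite_integers_bounded_nrm[of "real n * real Q"]]) (use S(3) in auto)
  let ?g = "\<lambda>J. {s \<in> R. \<exists>x\<in>J. be * s = of_nat Q * x}"
  have sub: "J \<subseteq> J'" if J: "J \<in> C" and J': "J' \<in> C" and e: "?g J = ?g J'" for J J'
  proof
    fix x assume x: "x \<in> J"
    obtain s where s: "s \<in> S" "of_nat Q * x = be * s" using C[OF J] x by auto
    have sK: "s \<in> K" using s S_K by auto
    \<comment> \<open>Rounding down the coordinates of \<open>s / Q\<close> leaves a remainder
      \<open>rho\<close> with coordinates between 0 and \<open>Q\<close>.\<close>
    define z where "z = (\<Sum>i<n. of_int \<lfloor>co s i / of_nat Q\<rfloor> * b i)"
    have zz: "z \<in> zspan b n" unfolding z_def zspan_def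
      by (intro CollectI exI[of _ "\<lambda>i. \<lfloor>co s i / of_nat Q\<rfloor>"] conjI TrueI refl)
    then have zS: "z \<in> S" and zK: "z \<in> K" using S(2) zspan_K by auto
    define rho where "rho = s - of_nat Q * z"
    have rS: "rho \<in> S" unfolding rho_def using s zS by (intro subring_CD[OF S(1)])
    have "nrm rho \<le> (\<Sum>i<n. real Q)" unfolding nrm_def
    proof (rule sum_mono)
      fix i assume "i \<in> {..<n}"
      then have i: "i < n" by simp
      have "co z i = of_int \<lfloor>co s i / of_nat Q\<rfloor>"
        using co_unique[of z "\<lambda>i. of_int \<lfloor>co s i / of_nat Q\<rfloor>" i] i by (simp add: z_def)
      moreover have "co (of_nat Q * z) i = of_nat Q * co z i" using co_rat[OF zK, of "of_nat Q" i] by simp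
      ultimately have c: "co rho i = co s i - of_nat Q * of_int \<lfloor>co s i / of_nat Q\<rfloor>"
        unfolding rho_def using co_diff[OF sK subfield_CD(5)[OF K subfield_CD(10)[OF K] zK]] by simp
      have "co s i = of_nat Q * (co s i / of_nat Q)" using Q by simp
      then have c2: "co rho i = of_nat Q * frac (co s i / of_nat Q)"
        unfolding c frac_def by (simp add: right_diff_distrib)
      have "0 \<le> co rho i" "co rho i \<le> of_nat Q" unfolding c2
        using frac_lt_1[of "co s i / of_nat Q"] mult_left_le[of "frac (co s i / of_nat Q)" "of_nat Q"]
        by (auto simp: mult.commute)
      then have "\<bar>co rho i\<bar> \<le> of_nat Q" by simp
      then have "real_of_rat \<bar>co rho i\<bar> \<le> real_of_rat (of_nat Q)" by (simp only: of_rat_less_eq)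
      then show "\<bar>real_of_rat (co rho i)\<bar> \<le> real Q" by simp
    qed
    then have rR: "rho \<in> R" using rS by (simp add: R_def)
    have bz: "be * z \<in> J" "be * z \<in> J'"
      using is_idealD(3)[OF conjunct1[OF C[OF J]] zS, of be] is_idealD(3)[OF conjunct1[OF C[OF J']] zS, of be]
        C[OF J] C[OF J'] by (auto simp: mult.commute)
    have "be * rho = of_nat Q * (x - be * z)" using s(2) by (simp add: rho_def algebra_simps)
    moreover have "x - be * z \<in> J"
      using add_subgroupD(2)[OF is_idealD(2)[OF conjunct1[OF C[OF J]]] x bz(1)] .
    ultimately have "rho \<in> ?g J" using rR by auto
    then have "rho \<in> ?g J'" using e by simp
    then obtain x' where x': "x' \<in> J'" "be * rho = of_nat Q * x'" by auto
    then have "of_nat Q * (x - be * z) = of_nat Q * x'" using \<open>be * rho = of_nat Q * (x - be * z)\<close> by simp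
    then have "x - be * z = x'" using Q by simp
    then have "x = x' + be * z" by (simp add: diff_eq_eq)
    then show "x \<in> J'" using add_subgroupD(4)[OF is_idealD(2)[OF conjunct1[OF C[OF J']]] x'(1) bz(2)] by simp
  qed
  have inj: "inj_on ?g C"
  proof (rule inj_onI)
    fix J J' assume J: "J \<in> C" "J' \<in> C" "?g J = ?g J'"
    show "J = J'" by (rule subset_antisym[OF sub[OF J] sub[OF J(2,1) J(3)[symmetric]]])
  qed
  have im: "?g ` C \<subseteq> Pow R" by auto
  have "finite (?g ` C)" using im finR by (meson finite_Pow_iff finite_subset)
  then have "finite C" using finite_imageD[OF _ inj] by blast
  moreover have "card C \<le> card (Pow R)" by (rule card_inj_on_le[OF inj im]) (use finR in simp)
  ultimately show ?thesis using finR by (simp add: card_Pow R_def)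
qed

text \<open>Every such ideal contains one of \<open>O(T ^ n)\<close> small elements. The lower bound
  on its index keeps it within a bounded index of the multiples of that element, so the number of
  ideals containing a given one is bounded independently of \<open>T\<close>.\<close>

theorem count_ideals:
  assumes c0: "c0 > 0"
  shows "\<exists>C. \<forall>T\<ge>1. \<forall>I. finite I \<longrightarrow>
    (\<forall>J\<in>I. is_ideal S J \<and> (\<forall>F. F \<subseteq> S \<longrightarrow> separated J F \<longrightarrow> card F \<le> T ^ n)
       \<and> (\<exists>F. F \<subseteq> S \<and> separated J F \<and> c0 * real T ^ n \<le> real (card F)))
    \<longrightarrow> real (card I) \<le> C * real T ^ n"
proof -
  define q where "q = nat \<lceil>(cU * real n) ^ n / c0\<rceil>"
  define P where "P = (2 :: nat) ^ card {x \<in> S. nrm x \<le> real n * real (fact q :: nat)}"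
  define C where "C = (2 * real dn * real n + 1) ^ n * real P"
  have bound: "real (card I) \<le> C * real T ^ n"
    if T: "T \<ge> 1" and finI: "finite I"
     and I: "\<And>J. J \<in> I \<Longrightarrow> is_ideal S J" "\<And>J F. J \<in> I \<Longrightarrow> F \<subseteq> S \<Longrightarrow> separated J F \<Longrightarrow> card F \<le> T ^ n"
       "\<And>J. J \<in> I \<Longrightarrow> \<exists>F. F \<subseteq> S \<and> separated J F \<and> c0 * real T ^ n \<le> real (card F)" for T :: nat and I
  proof -
    let ?X = "real n * real T"
    have X1: "?X \<ge> 1" using n_pos T mult_mono[of 1 "real n" 1 "real T"] by simp
    define B where "B = {x \<in> OK. nrm x \<le> ?X} - {0}"
    have finB: "finite B" unfolding B_def using finite_integers_bounded_nrm by auto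
    define I' where "I' be = {J \<in> I. be \<in> J}" for be
    have cov: "I \<subseteq> (\<Union>be\<in>B. I' be)"
    proof
      fix J assume J: "J \<in> I"
      obtain be where "be \<in> J" "be \<noteq> 0" "nrm be \<le> ?X" using ideal_small_element[OF I(1,2)[OF J]] by blast
      moreover have "be \<in> OK" using calculation is_idealD(1)[OF I(1)[OF J]] S(3) by auto
      ultimately show "J \<in> (\<Union>be\<in>B. I' be)" using J by (auto simp: B_def I'_def)
    qed
    have "card (I' be) \<le> P" if be: "be \<in> B" for be
    proof -
      have "is_ideal S J \<and> be \<in> J \<and> (\<forall>x\<in>J. of_nat (fact q) * x \<in> (*) be ` S)" if J: "J \<in> I' be" for J
      proof -
        have J': "J \<in> I" "be \<in> J" using J by (auto simp: I'_def)
        obtain F where F: "F \<subseteq> S" "separated J F" "c0 * real T ^ n \<le> real (card F)" using I(3)[OF J'(1)] by blast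
        have "(cU * real n) ^ n / c0 \<le> real q" unfolding q_def by linarith
        then have "(cU * real n) ^ n / c0 < real (q + 1)" by simp
        then have "(cU * real n) ^ n < real (q + 1) * c0" using c0 by (simp add: divide_less_eq)
        then have "(cU * real n) ^ n * real T ^ n < real (q + 1) * c0 * real T ^ n"
          using T by (intro mult_strict_right_mono) auto
        also have "\<dots> \<le> real (q + 1) * real (card F)" using F(3) mult_left_mono[of _ _ "real (q + 1)"]
          by (simp add: mult.assoc del: of_nat_add)
        finally have "(cU * ?X) ^ n < real (q + 1) * real (card F)" by (simp add: power_mult_distrib mult_ac)
        then have "of_nat (fact q) * x \<in> (*) be ` S" if "x \<in> J" for x
          using ideal_multiple_principal[OF I(1)[OF J'(1)] J'(2) _ _ X1 F(1,2) _ that] be by (simp add: B_def)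
        then show ?thesis using I(1)[OF J'(1)] J'(2) by blast
      qed
      from count_ideals_with_element[OF _ _ this, of "I' be"] show ?thesis using be by (simp add: B_def P_def)
    qed
    then have "card (\<Union>be\<in>B. I' be) \<le> card B * P"
      using card_UN_le[OF finB, of I'] sum_bounded_above[of B "\<lambda>be. card (I' be)" P] by (simp add: mult.commute)
    moreover have "card I \<le> card (\<Union>be\<in>B. I' be)"
      using cov finB finI by (intro card_mono) (auto simp: I'_def)
    ultimately have "card I \<le> card B * P" by linarith
    then have "real (card I) \<le> real (card B) * real P" by (metis of_nat_le_iff of_nat_mult)
    also have "real (card B) \<le> real (card {x \<in> OK. nrm x \<le> ?X})"
      unfolding B_def by (simp add: card_mono finite_integers_bounded_nrm)
    also have "\<dots> \<le> (2 * real dn * ?X + 1) ^ n" by (rule card_integers_bounded) simp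
    also have "\<dots> \<le> ((2 * real dn * real n + 1) * real T) ^ n"
      using T by (intro power_mono) (auto simp: algebra_simps)
    also have "\<dots> = (2 * real dn * real n + 1) ^ n * real T ^ n" by (rule power_mult_distrib)
    finally show ?thesis by (simp add: C_def mult_ac mult_right_mono)
  qed
  show ?thesis
  proof (intro exI[of _ C] allI impI)
    fix T :: nat and I
    assume T: "T \<ge> 1" "finite I" and I: "\<forall>J\<in>I. is_ideal S J \<and> (\<forall>F. F \<subseteq> S \<longrightarrow> separated J F \<longrightarrow> card F \<le> T ^ n)
       \<and> (\<exists>F. F \<subseteq> S \<and> separated J F \<and> c0 * real T ^ n \<le> real (card F))"
    show "real (card I) \<le> C * real T ^ n"
    proof (rule bound[OF T])
      fix J assume J: "J \<in> I"
      show "is_ideal S J" using I J by simp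
      show "\<exists>F. F \<subseteq> S \<and> separated J F \<and> c0 * real T ^ n \<le> real (card F)" using I J by simp
      show "card F \<le> T ^ n" if "F \<subseteq> S" "separated J F" for F using I J that by simp
    qed
  qed
qed

end

section \<open>A supply of principal ideals\<close>

lemma card_le_mult_card_image:
  assumes "finite A" "\<And>y. y \<in> f ` A \<Longrightarrow> card {x \<in> A. f x = y} \<le> N"
  shows "card A \<le> N * card (f ` A)"
proof -
  have "A = (\<Union>y\<in>f ` A. {x \<in> A. f x = y})" by auto
  then have "card A \<le> (\<Sum>y\<in>f ` A. card {x \<in> A. f x = y})"
    using card_UN_le[of "f ` A" "\<lambda>y. {x \<in> A. f x = y}"] assms(1) by simp
  also have "\<dots> \<le> card (f ` A) * N" using sum_bounded_above[of "f ` A" "\<lambda>y. card {x \<in> A. f x = y}" N] assms(2) by simp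
  finally show ?thesis by (simp add: mult.commute)
qed

lemma less_Suc_nat_floor: "x < real (Suc (nat \<lfloor>x\<rfloor>))"
  by linarith

context number_field_basis
begin

lemma order_OK: "number_field_order K b n OK"
  by unfold_locales (auto simp: ring_of_integers_subring[OF K] zspan_b_OK[THEN subsetD])

lemma nrm_1: "nrm 1 > 0" "1 \<le> nC * nrm 1"
proof -
  have "nrm 1 \<noteq> 0" using nrm_eq_0[OF subfield_CD(2)[OF K]] by auto
  then show 1: "nrm 1 > 0" using nrm_nonneg[of 1] by simp
  have "nrm 1 \<le> nC * nrm 1 * nrm 1" using nrm_mult[of 1 1] subfield_CD(2)[OF K] by simp
  then show "1 \<le> nC * nrm 1" using 1 by simp
qed

text \<open>The elements \<open>A + l * g\<close> with \<open>g\<close> small compared to \<open>A\<close> have inverses of norm about \<open>1 / A\<close>.\<close>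

lemma many_principal_ideals:
  fixes l :: nat
  assumes l: "l > 0"
  obtains c1 C1 c2 :: real where "c1 > 0" "C1 > 0" "c2 > 0"
   "\<And>A :: nat. A mod l = 1 mod l \<Longrightarrow> A > 0 \<Longrightarrow> \<exists>P. finite P \<and> P \<subseteq> OK \<and> c2 * real A ^ n \<le> real (card P)
      \<and> inj_on (\<lambda>al. (*) al ` OK) P
      \<and> (\<forall>al\<in>P. al \<noteq> 0 \<and> (\<exists>g\<in>OK. al = 1 + of_nat l * g)
          \<and> (\<forall>F. F \<subseteq> OK \<longrightarrow> separated ((*) al ` OK) F \<longrightarrow> real (card F) \<le> C1 * real A ^ n)
          \<and> (\<exists>F. F \<subseteq> OK \<and> separated ((*) al ` OK) F \<and> c1 * real A ^ n \<le> real (card F)))"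
proof -
  interpret O: number_field_order K b n OK by (rule order_OK)
  note inK = subfield_CD[OF K] and inO = ring_of_integersD[OF K]
  have n0: "real n > 0" using n_pos by simp
  \<comment> \<open>\<open>C3\<close> bounds the quotient of two constructed numbers that generate
    the same ideal, so \<open>N\<close> bounds how often an ideal is repeated.\<close>
  define C3 where "C3 = nC * (nrm 1 + 1) * (2 * nrm 1)"
  define N where "N = card {x \<in> OK. nrm x \<le> C3}"
  define c2 where "c2 = (1 / (2 * nC * real n * real l)) ^ n / real N"
  define C1 where "C1 = (O.cU * (nrm 1 + 1)) ^ n"
  define e1 where "e1 = 1 / (4 * nC * nrm 1 * real n * real dn)"
  define c1 where "c1 = e1 ^ n"
  have "1 \<in> {x \<in> OK. nrm x \<le> C3}"
  proof -
    have "1 * nrm 1 \<le> (nC * nrm 1) * (2 * nrm 1)" by (rule mult_mono) (use nrm_1 nC_pos in auto)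
    also have "\<dots> \<le> C3" unfolding C3_def using nrm_1 nC_pos by (intro mult_right_mono mult_left_mono) auto
    finally show ?thesis using inO by simp
  qed
  then have N0: "N > 0" unfolding N_def using finite_integers_bounded_nrm card_gt_0_iff by blast
  have pos: "c1 > 0" "C1 > 0" "c2 > 0"
    using nC_pos nrm_1 n0 dn(1) O.cU_pos N0 l by (auto simp: c1_def e1_def C1_def c2_def)
  have "\<exists>P. finite P \<and> P \<subseteq> OK \<and> c2 * real A ^ n \<le> real (card P)
      \<and> inj_on (\<lambda>al. (*) al ` OK) P
      \<and> (\<forall>al\<in>P. al \<noteq> 0 \<and> (\<exists>g\<in>OK. al = 1 + of_nat l * g)
          \<and> (\<forall>F. F \<subseteq> OK \<longrightarrow> separated ((*) al ` OK) F \<longrightarrow> real (card F) \<le> C1 * real A ^ n)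
          \<and> (\<exists>F. F \<subseteq> OK \<and> separated ((*) al ` OK) F \<and> c1 * real A ^ n \<le> real (card F)))"
    if A: "A mod l = 1 mod l" "A > 0" for A
  proof -
    have A1: "real A \<ge> 1" using A(2) by simp
    \<comment> \<open>This box size keeps the norm of \<open>l * g\<close> below
      \<open>A / (2 * nC)\<close>. Multiplied by any further number, the perturbation is then at
      most half of the main term.\<close>
    let ?x = "real A / (2 * nC * real n * real l)"
    define m where "m = nat \<lfloor>?x\<rfloor>"
    have mle: "real m \<le> ?x" unfolding m_def using nC_pos by simp
    have m1: "?x < real (m + 1)" unfolding m_def using less_Suc_nat_floor[of ?x] by simp
    define al where "al g = of_nat A + of_nat l * g" for g :: complex
    have g: "g \<in> OK" "g \<in> K" if "g \<in> box m" for g using that box_zspan zspan_b_OK OKD by blast+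
    have lg: "nrm (of_nat l * g) \<le> real A / (2 * nC)" if "g \<in> box m" for g
    proof -
      have "nrm (of_nat l * g) = real l * nrm g" using g[OF that] by (simp add: nrm_of_nat)
      also have "\<dots> \<le> real l * (real n * ?x)"
        using box_nrm[OF that] mult_left_mono[OF mle, of "real n"] by (intro mult_left_mono) auto
      also have "\<dots> = real A / (2 * nC)" using n0 l nC_pos by (simp add: field_simps)
      finally show ?thesis .
    qed
    have alO: "al g \<in> OK" if "g \<in> box m" for g
      unfolding al_def using g[OF that] by (intro inO)
    have nA: "nrm (of_nat A) = real A * nrm 1" using nrm_of_nat[OF inK(2), of A] by simp
    have aln: "nrm (al g) \<le> real A * (nrm 1 + 1)" if "g \<in> box m" for g
    proof -
      have "nrm (al g) \<le> nrm (of_nat A) + nrm (of_nat l * g)"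
        unfolding al_def using g[OF that] by (intro nrm_add inK)
      also have "\<dots> \<le> real A * nrm 1 + real A / (2 * nC)" using nA lg[OF that] by simp
      also have "real A / (2 * nC) \<le> real A / 1" by (rule divide_left_mono) (use nC_pos in auto)
      finally show ?thesis by (simp add: algebra_simps)
    qed
    have al0: "al g \<noteq> 0" if gm: "g \<in> box m" for g
    proof
      assume "al g = 0"
      then have "of_nat A = of_int (-1) * (of_nat l * g)" by (simp add: al_def add_eq_0_iff)
      then have "real A * nrm 1 = nrm (of_int (-1) * (of_nat l * g))" using nA by simp
      also have "\<dots> = nrm (of_nat l * g)" using g[OF gm] by (subst nrm_of_int) (auto intro: inK)
      also have "\<dots> \<le> real A / (2 * nC)" by (rule lg[OF gm])
      finally have "real A * nrm 1 \<le> real A * (1 / (2 * nC))" by simp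
      then have "nrm 1 \<le> 1 / (2 * nC)" using A(2) by (metis mult_le_cancel_left_pos of_nat_0_less_iff)
      then have "nC * nrm 1 \<le> 1 / 2" using nC_pos by (simp add: field_simps)
      then show False using nrm_1 by linarith
    qed
    have inv: "nrm (inverse (al g)) \<le> 2 * nrm 1 / real A" if gm: "g \<in> box m" for g
    proof -
      let ?w = "inverse (al g)"
      have wK: "?w \<in> K" using alO[OF gm] OKD inK(6) by blast
      have lgK: "of_nat l * g \<in> K" using g[OF gm] by (intro inK)
      \<comment> \<open>Taking norms, the last term is at most half of the left-hand side and can be
        absorbed into it.\<close>
      have "of_nat A * ?w = 1 - of_nat l * g * ?w" using al0[OF gm] by (simp add: al_def field_simps)
      then have "real A * nrm ?w = nrm (1 - of_nat l * g * ?w)" using nrm_of_nat[OF wK, of A] by simp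
      also have "\<dots> \<le> nrm 1 + nrm (of_nat l * g * ?w)" by (intro nrm_diff inK(2) inK(5)[OF lgK wK])
      also have "nrm (of_nat l * g * ?w) \<le> nC * nrm (of_nat l * g) * nrm ?w" by (rule nrm_mult[OF lgK wK])
      also have "\<dots> \<le> nC * (real A / (2 * nC)) * nrm ?w"
        using lg[OF gm] nC_pos nrm_nonneg by (intro mult_right_mono mult_left_mono) auto
      also have "\<dots> = real A * nrm ?w / 2" using nC_pos by simp
      finally show ?thesis using A(2) by (simp add: field_simps)
    qed
    let ?I = "\<lambda>a. (*) a ` OK"
    define P0 where "P0 = al ` box m"
    have finP0: "finite P0" unfolding P0_def using card_box by simp
    have inj_al: "inj_on al (box m)" using l by (auto simp: inj_on_def al_def)
    have cardP0: "card P0 = (m + 1) ^ n" unfolding P0_def by (simp add: card_image[OF inj_al] card_box)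
    have fib: "card {a \<in> P0. ?I a = J} \<le> N" if J: "J \<in> ?I ` P0" for J
    proof -
      obtain g where gm: "g \<in> box m" "J = ?I (al g)" using J by (auto simp: P0_def)
      let ?f = "\<lambda>a. a / al g"
      have sub: "?f ` {a \<in> P0. ?I a = J} \<subseteq> {x \<in> OK. nrm x \<le> C3}"
      proof (rule image_subsetI)
        fix a assume "a \<in> {a \<in> P0. ?I a = J}"
        then have a: "a \<in> P0" "?I a = J" by auto
        obtain h where h: "h \<in> box m" "a = al h" using a by (auto simp: P0_def)
        have "a \<in> ?I a" using inO(2) by (metis image_eqI mult.right_neutral)
        then obtain u where u: "u \<in> OK" "a = al g * u" using a(2) gm(2) by auto
        have e: "a / al g = u" using u al0[OF gm(1)] by simp
        have nn: "nrm (a * inverse (al g)) \<le> C3"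
        proof -
          have "nrm (a * inverse (al g)) \<le> nC * nrm a * nrm (inverse (al g))"
            using alO[OF gm(1)] alO[OF h(1)] OKD h inK(6) by (intro nrm_mult) auto
          also have "\<dots> \<le> nC * (real A * (nrm 1 + 1)) * (2 * nrm 1 / real A)"
            using aln[OF h(1)] inv[OF gm(1)] h(2) nC_pos nrm_nonneg by (intro mult_mono) auto
          also have "\<dots> = C3" using A(2) by (simp add: C3_def)
          finally show ?thesis .
        qed
        show "a / al g \<in> {x \<in> OK. nrm x \<le> C3}"
          using nn[unfolded divide_inverse[symmetric] e] u(1) e by simp
      qed
      have inj: "inj_on ?f {a \<in> P0. ?I a = J}" using al0[OF gm(1)] by (auto simp: inj_on_def)
      show ?thesis unfolding N_def by (rule card_inj_on_le[OF inj sub finite_integers_bounded_nrm])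
    qed
    \<comment> \<open>One generator is kept for each ideal; since at most \<open>N\<close> share an
      ideal, a fixed proportion survives.\<close>
    obtain P where P: "P \<subseteq> P0" "inj_on ?I P" "?I ` P = ?I ` P0"
      using subset_image_inj[of "?I ` P0" ?I P0] by auto
    have "card P0 \<le> N * card (?I ` P0)" by (rule card_le_mult_card_image[OF finP0 fib])
    then have "(m + 1) ^ n \<le> N * card P" unfolding cardP0 P(3)[symmetric] card_image[OF P(2)] .
    then have "real ((m + 1) ^ n) \<le> real (N * card P)" by (simp only: of_nat_le_iff)
    then have "real (m + 1) ^ n \<le> real N * real (card P)" by (simp only: of_nat_power of_nat_mult)
    moreover have "?x ^ n \<le> real (m + 1) ^ n" using m1 nC_pos by (intro power_mono) auto
    ultimately have "?x ^ n \<le> real N * real (card P)" by linarith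
    moreover have "?x ^ n = real N * (c2 * real A ^ n)" using N0 by (simp add: c2_def power_divide)
    ultimately have card: "c2 * real A ^ n \<le> real (card P)" using N0 by simp
    have each: "a \<noteq> 0 \<and> (\<exists>g\<in>OK. a = 1 + of_nat l * g)
          \<and> (\<forall>F. F \<subseteq> OK \<longrightarrow> separated (?I a) F \<longrightarrow> real (card F) \<le> C1 * real A ^ n)
          \<and> (\<exists>F. F \<subseteq> OK \<and> separated (?I a) F \<and> c1 * real A ^ n \<le> real (card F))" if aP: "a \<in> P" for a
    proof (intro conjI allI impI)
      obtain g where gm: "g \<in> box m" "a = al g" using aP P(1) by (auto simp: P0_def)
      show "a \<noteq> 0" using al0 gm by simp
      have "l dvd A - 1" using A mod_eq_dvd_iff_nat[of 1 A l] by simp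
      then obtain k where "A - 1 = l * k" by (auto elim: dvdE)
      then have "A = 1 + l * k" using A(2) by simp
      then have "a = 1 + of_nat l * (of_nat k + g)" unfolding gm(2) al_def by (simp add: algebra_simps)
      moreover have "of_nat k + g \<in> OK" using g[OF gm(1)] by (intro inO)
      ultimately show "\<exists>g\<in>OK. a = 1 + of_nat l * g" by blast
      show "real (card F) \<le> C1 * real A ^ n" if F: "F \<subseteq> OK" "separated (?I a) F" for F
      proof -
        have "1 * 1 \<le> real A * (nrm 1 + 1)" using A1 nrm_1 by (intro mult_mono) auto
        then have "real (card F) \<le> (O.cU * (real A * (nrm 1 + 1))) ^ n"
          using O.card_separated_principal[OF alO[OF gm(1)] al0[OF gm(1)] aln[OF gm(1)] _ F(1)] F(2) gm(2) by simp
        then show ?thesis by (simp add: C1_def power_mult_distrib mult_ac)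
      qed
      let ?y = "real A * e1"
      \<comment> \<open>\<open>mu < ?y <= mu + 1\<close>: the box still has at least
        \<open>?y ^ n\<close> elements, while \<open>e1\<close> is so small that a difference
        divisible by \<open>a\<close> has a quotient of norm at most \<open>1 / (2 * dn)\<close>,
        which must be 0.\<close>
      define mu where "mu = nat (\<lceil>?y\<rceil> - 1)"
      have e1p: "e1 > 0" using nC_pos nrm_1 n0 dn(1) by (auto simp: e1_def)
      then have y0: "?y > 0" using A1 by simp
      have mu1: "?y \<le> real (mu + 1)" "real mu < ?y" unfolding mu_def using y0 by linarith+
      have "separated (?I a) (box mu)"
        unfolding separated_def
      proof (intro conjI ballI impI)
        show "finite (box mu)" by (rule card_box)
        fix x y assume xy: "x \<in> box mu" "y \<in> box mu" "x - y \<in> ?I a"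
        then obtain r where r: "r \<in> OK" "x - y = a * r" by auto
        have "x \<in> K" "y \<in> K" using xy box_zspan zspan_K by blast+
        then have aK: "inverse a \<in> K" "x - y \<in> K"
          using inK(6)[OF OKD(1)[OF alO[OF gm(1)]]] gm(2) inK(4) by simp_all
        have "r = inverse a * (x - y)" using r al0[OF gm(1)] gm(2) by simp
        then have "nrm r \<le> nC * nrm (inverse a) * nrm (x - y)" using nrm_mult[OF aK] by simp
        also have "\<dots> \<le> nC * (2 * nrm 1 / real A) * (real n * real mu)"
          using inv[OF gm(1)] gm(2) box_diff_nrm[OF xy(1,2)] nC_pos nrm_nonneg by (intro mult_mono) auto
        also have "\<dots> \<le> nC * (2 * nrm 1 / real A) * (real n * ?y)"
          using mu1(2) nC_pos nrm_1 by (intro mult_left_mono) auto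
        also have "\<dots> = 1 / (2 * real dn)"
          using A1 nC_pos nrm_1 n0 dn(1) by (simp add: e1_def field_simps)
        finally have "real dn * nrm r \<le> 1 / 2" using dn(1) by (simp add: field_simps)
        then have "r = 0" using integers_nrm_small[OF r(1)] by linarith
        then show "x = y" using r by simp
      qed
      moreover have "box mu \<subseteq> OK" using box_zspan zspan_b_OK by blast
      moreover have "c1 * real A ^ n \<le> real (card (box mu))"
      proof -
        have "c1 * real A ^ n = ?y ^ n" by (simp add: c1_def power_mult_distrib mult.commute)
        also have "\<dots> \<le> real (mu + 1) ^ n" using mu1(1) y0 by (intro power_mono) auto
        finally show ?thesis by (simp add: card_box)
      qed
      ultimately show "\<exists>F. F \<subseteq> OK \<and> separated (?I a) F \<and> c1 * real A ^ n \<le> real (card F)" by blast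
    qed
    have "finite P" by (rule finite_subset[OF P(1) finP0])
    moreover have "P \<subseteq> OK" using P(1) alO by (auto simp: P0_def)
    ultimately have "finite P \<and> P \<subseteq> OK \<and> c2 * real A ^ n \<le> real (card P) \<and> inj_on ?I P"
      using card P(2) by simp
    then show ?thesis using each by (intro exI[of _ P]) simp
  qed
  then show thesis by (rule that[OF pos])
qed

end

section \<open>Units that are \<open>l\<close>-th powers modulo all integers prime to \<open>l\<close>\<close>

lemma set_eqI_on: "A \<subseteq> U \<Longrightarrow> B \<subseteq> U \<Longrightarrow> (\<And>x. x \<in> U \<Longrightarrow> x \<in> A \<longleftrightarrow> x \<in> B) \<Longrightarrow> A = B"
  by blast

lemma degree_monom_minus_const:
  assumes "l > 0"
  shows "degree (monom 1 l - [:y :: complex:]) = l"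
proof -
  have "monom 1 l - [:y:] = monom 1 l + [:- y:]" by simp
  also have "degree \<dots> = l" using assms degree_add_eq_left[of "[:- y:]" "monom 1 l"]
    by (simp add: degree_monom_eq del: add_pCons)
  finally show ?thesis .
qed

lemma adjoin_base:
  assumes "subring_C F" "d > 0" "x \<in> F"
  shows "x \<in> adjoin F a d"
proof -
  have "x = (\<Sum>i<d. (if i = 0 then x else 0) * a ^ i)"
    using assms(2) by (simp add: if_distrib[of "\<lambda>x. x * _"] cong: if_cong)
  then show ?thesis unfolding adjoin_def
    using subring_CD(1)[OF assms(1)] assms(3) by (intro CollectI exI[of _ "\<lambda>i. if i = 0 then x else 0"]) auto
qed

lemma is_ideal_principal:
  assumes R: "subring_C R" and a: "a \<in> R"
  shows "is_ideal R ((*) a ` R)"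
proof -
  have "add_subgroup ((*) a ` R)" unfolding add_subgroup_def
    using subring_CD(1,4)[OF R] by (auto simp: right_diff_distrib[symmetric] image_iff intro: bexI[of _ 0])
  moreover have "x * (a * y) \<in> (*) a ` R" if "x \<in> R" "y \<in> R" for x y
    using subring_CD(5)[OF R that] by (auto simp: image_iff mult.left_commute)
  ultimately show ?thesis using subring_CD(5)[OF R a] by (auto simp: is_ideal_def)
qed

text \<open>A separated set of greatest size is a full system of residues, since an element
  incongruent to all its members could be added.\<close>

lemma maximal_separated:
  assumes "add_subgroup J" "\<And>F. F \<subseteq> S \<Longrightarrow> separated J F \<Longrightarrow> real (card F) \<le> N"
  obtains G where "G \<subseteq> S" "separated J G" "\<And>x. x \<in> S \<Longrightarrow> \<exists>g\<in>G. x - g \<in> J"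
proof -
  define P where "P m \<longleftrightarrow> (\<exists>F. F \<subseteq> S \<and> separated J F \<and> card F = m)" for m
  have "P 0" unfolding P_def by (rule exI[of _ "{}"]) (simp add: separated_def)
  moreover have "\<forall>m. P m \<longrightarrow> m \<le> nat \<lfloor>N\<rfloor>" using assms(2) by (auto simp: P_def le_nat_floor)
  ultimately obtain m where m: "P m" "\<And>k. P k \<Longrightarrow> k \<le> m" using Greatest_le_nat[of P] GreatestI_nat[of P] by metis
  then obtain G where G: "G \<subseteq> S" "separated J G" "card G = m" by (auto simp: P_def)
  have "\<exists>g\<in>G. x - g \<in> J" if x: "x \<in> S" for x
  proof (rule ccontr)
    assume no: "\<not> ?thesis"
    have "x \<notin> G" using no add_subgroupD(1)[OF assms(1)] by fastforce
    have no2: "g - x \<notin> J" if "g \<in> G" for g using no that add_subgroupD(3)[OF assms(1), of "g - x"] by auto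
    have "separated J (insert x G)" using G(2) no no2 unfolding separated_def by auto
    then have "P (Suc m)" unfolding P_def using G x \<open>x \<notin> G\<close>
      by (intro exI[of _ "insert x G"]) (auto simp: separated_def)
    then show False using m(2)[of "Suc m"] by simp
  qed
  then show thesis using that G by blast
qed

text \<open>The setting of an indirect proof: \<open>y\<close> has no \<open>l\<close>-th root in
  \<open>K\<close>. The assumption that it has one modulo every \<open>M\<close> prime to
  \<open>l\<close> is refuted in \<open>residue_contradiction\<close>.\<close>

locale kummer = number_field_basis +
  fixes l :: nat and w y eta :: complex
  assumes l: "prime l" and w: "w \<in> K" "w ^ l = 1" "w \<noteq> 1"
    and y: "y \<in> units_of_integers K" and eta: "eta ^ l = y"
    and no_root: "\<And>z. z \<in> K \<Longrightarrow> z ^ l \<noteq> y"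
begin

lemma l_pos: "l > 0" using l by (simp add: prime_gt_0_nat)

lemma yO: "y \<in> OK" "inverse y \<in> OK" "y \<noteq> 0" "y \<in> K"
  using y by (auto simp: units_of_integers_def OKD)

lemma wO: "w \<in> OK"
proof -
  have "algebraic_int w"
    by (rule algebraic_int_root[of 1 "monom 1 l" w]) (use l_pos w in \<open>auto simp: poly_monom degree_monom_eq\<close>)
  then show ?thesis using w by (simp add: ring_of_integers_def)
qed

abbreviation PO :: "complex poly set" where "PO \<equiv> polys OK"
abbreviation pri :: "complex \<Rightarrow> complex set" where "pri a \<equiv> (*) a ` OK"

lemma RO: "subring_C OK" by (rule ring_of_integers_subring[OF K])

lemma pri_ideal: "a \<in> OK \<Longrightarrow> is_ideal OK (pri a)"
  by (rule is_ideal_principal[OF RO])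

text \<open>The remainder of \<open>p\<close> modulo the monic \<open>X ^ l - y\<close> kills
  \<open>eta\<close> and has degree below \<open>l\<close>, so irreducibility makes it 0; the
  quotient has integral coefficients.\<close>

lemma annihilator_divisible:
  assumes p: "p \<in> PO" "poly p eta = 0"
  shows "\<exists>q\<in>PO. p = (monom 1 l - [:y:]) * q"
proof -
  let ?f = "monom 1 l - [:y:]"
  have f: "?f \<in> PO" by (intro polys_closed[OF RO] yO subring_CD[OF RO])
  have df: "degree ?f = l" by (rule degree_monom_minus_const[OF l_pos])
  have lf: "lead_coeff ?f = 1" unfolding df using l_pos by (simp add: coeff_pCons split: nat.split)
  obtain q s where qs: "q \<in> PO" "s \<in> PO" "p = ?f * q + s" "degree s < degree ?f"
    using monic_division[OF RO f lf _ p(1)] df l_pos by auto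
  have "poly ?f eta = 0" using eta by (simp add: poly_monom)
  then have "poly s eta = 0" using p(2) qs(3) by simp
  moreover have "s \<in> polys K" using qs(2) OKD by (auto simp: polys_def)
  ultimately have "s = 0"
    using binomial_irreducible[OF K l yO(4) no_root eta, of s] qs(4) df by fastforce
  then show ?thesis using qs by auto
qed

lemma l_divisible: "\<exists>v\<in>OK. of_nat l = (1 - w) * v"
proof -
  \<comment> \<open>The inner sum is \<open>(1 - w ^ i) / (1 - w)\<close>. In the total the powers
    of \<open>w\<close> disappear, as their sum over a period is 0.\<close>
  define v where "v = (\<Sum>i<l. \<Sum>j<i. w ^ j)"
  have vO: "v \<in> OK" unfolding v_def by (intro subring_C_sum[OF RO] subring_CD[OF RO] wO)
  have "(1 - w) * v = (\<Sum>i<l. 1 - w ^ i)"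
    unfolding v_def sum_distrib_left one_diff_power_eq by simp
  also have "\<dots> = of_nat l - (\<Sum>i<l. w ^ i)" by (simp add: sum_subtractf)
  also have "(\<Sum>i<l. w ^ i) = 0"
  proof -
    have "(1 - w) * (\<Sum>i<l. w ^ i) = 1 - w ^ l" by (rule one_diff_power_eq[symmetric])
    then show ?thesis using w by simp
  qed
  finally show ?thesis using vO by force
qed

text \<open>\<open>(1 - w) * r\<close> is invertible modulo \<open>a\<close>: \<open>1 - w\<close>
  divides \<open>l\<close>, which is invertible because \<open>a\<close> is 1 modulo
  \<open>l\<close>, and \<open>r ^ l\<close> is congruent to the unit \<open>y\<close>.\<close>

lemma cancel_mod:
  assumes g: "g \<in> OK" "a = 1 + of_nat l * g" and r: "r \<in> OK" "r ^ l - y \<in> pri a"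
    and x: "x \<in> OK" "x * ((1 - w) * r) \<in> pri a"
  shows "x \<in> pri a"
proof -
  have aO: "a \<in> OK" unfolding g(2) by (intro subring_CD[OF RO] g)
  note I = pri_ideal[OF aO]
  note ID = is_idealD[OF I] and A = add_subgroupD[OF is_idealD(2)[OF I]]
  obtain v where v: "v \<in> OK" "of_nat l = (1 - w) * v" using l_divisible by blast
  have "r ^ l = r * r ^ (l - 1)" using l_pos by (cases l) auto
  then have "of_nat l * x = (v * r ^ (l - 1) * inverse y) * (x * ((1 - w) * r)) - (of_nat l * x * inverse y) * (r ^ l - y)"
    unfolding v(2) using yO(3) by (simp add: field_simps)
  also have "\<dots> \<in> pri a"
    by (intro A(2) ID(3) x r) (intro subring_CD[OF RO] v r yO x)+
  finally have lx: "of_nat l * x \<in> pri a" .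
  have "x = x * a - g * (of_nat l * x)" unfolding g(2) by (simp add: algebra_simps)
  also have "\<dots> \<in> pri a"
    using ID(3)[OF x(1), of a] ID(3)[OF g(1) lx] subring_CD(2)[OF RO]
    by (intro A(2)) (auto simp: image_iff mult.commute)
  finally show ?thesis .
qed

definition S :: "complex set" where "S = (\<lambda>p. poly p eta) ` PO"

text \<open>If \<open>r ^ l\<close> is \<open>y\<close> modulo \<open>a1\<close> and
  \<open>a2\<close>, this is the kernel of the map on \<open>O[eta]\<close> that sends
  \<open>eta\<close> to \<open>r\<close> modulo \<open>a1\<close> and to \<open>w * r\<close> modulo
  \<open>a2\<close>. Different roots keep the two components independent even if \<open>a1\<close>
  and \<open>a2\<close> have common factors.\<close>

definition Jd :: "complex \<Rightarrow> complex \<Rightarrow> complex \<Rightarrow> complex set" where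
  "Jd r a1 a2 = (\<lambda>p. poly p eta) ` {p \<in> PO. poly p r \<in> pri a1 \<and> poly p (w * r) \<in> pri a2}"

lemma Jd_ideal:
  assumes r: "r \<in> OK" and a: "a1 \<in> OK" "a2 \<in> OK"
  shows "is_ideal S (Jd r a1 a2)"
  unfolding is_ideal_def
proof (intro conjI ballI)
  note I1 = pri_ideal[OF a(1)] and I2 = pri_ideal[OF a(2)]
  note A1 = add_subgroupD[OF is_idealD(2)[OF I1]] and A2 = add_subgroupD[OF is_idealD(2)[OF I2]]
  show "Jd r a1 a2 \<subseteq> S" by (auto simp: Jd_def S_def)
  show "add_subgroup (Jd r a1 a2)" unfolding add_subgroup_def
  proof (intro conjI ballI)
    show "0 \<in> Jd r a1 a2" unfolding Jd_def
      by (rule image_eqI[of _ _ 0]) (use A1(1) A2(1) polys_closed(1)[OF RO] in auto)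
    fix u v assume "u \<in> Jd r a1 a2" "v \<in> Jd r a1 a2"
    then obtain p q where p: "p \<in> PO" "poly p r \<in> pri a1" "poly p (w * r) \<in> pri a2" "u = poly p eta"
      and q: "q \<in> PO" "poly q r \<in> pri a1" "poly q (w * r) \<in> pri a2" "v = poly q eta" unfolding Jd_def by blast
    show "u - v \<in> Jd r a1 a2" unfolding Jd_def
      by (rule image_eqI[of _ _ "p - q"])
        (use p q A1(2)[OF p(2) q(2)] A2(2)[OF p(3) q(3)] polys_closed(4)[OF RO p(1) q(1)] in simp_all)
  qed
  fix u v assume "u \<in> S" "v \<in> Jd r a1 a2"
  then obtain p q where p: "p \<in> PO" "u = poly p eta"
      and q: "q \<in> PO" "poly q r \<in> pri a1" "poly q (w * r) \<in> pri a2" "v = poly q eta" unfolding Jd_def S_def by blast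
  have wr: "w * r \<in> OK" by (intro subring_CD[OF RO] wO r)
  show "u * v \<in> Jd r a1 a2" unfolding Jd_def
    by (rule image_eqI[of _ _ "p * q"])
      (use p q is_idealD(3)[OF I1 polys_closed(10)[OF RO p(1) r] q(2)]
        is_idealD(3)[OF I2 polys_closed(10)[OF RO p(1) wr] q(3)] polys_closed(5)[OF RO p(1) q(1)] in simp_all)
qed

text \<open>Membership does not depend on the choice of the polynomial, because \<open>r\<close> and \<open>w * r\<close> are roots of
  \<open>X ^ l - y\<close> modulo \<open>a1\<close> and \<open>a2\<close>.\<close>

lemma Jd_iff:
  assumes r: "r \<in> OK" and a: "a1 \<in> OK" "a2 \<in> OK" "r ^ l - y \<in> pri a1" "r ^ l - y \<in> pri a2"
    and p: "p \<in> PO"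
  shows "poly p eta \<in> Jd r a1 a2 \<longleftrightarrow> poly p r \<in> pri a1 \<and> poly p (w * r) \<in> pri a2"
proof
  assume "poly p eta \<in> Jd r a1 a2"
  then obtain q where q: "q \<in> PO" "poly q r \<in> pri a1" "poly q (w * r) \<in> pri a2" "poly p eta = poly q eta"
    unfolding Jd_def by blast
  have "p - q \<in> PO" "poly (p - q) eta = 0" using p q polys_closed(4)[OF RO] by auto
  from annihilator_divisible[OF this] obtain h where h: "h \<in> PO" "p - q = (monom 1 l - [:y:]) * h" by blast
  have wr: "w * r \<in> OK" by (intro subring_CD[OF RO] wO r)
  have "poly (p - q) z = (z ^ l - y) * poly h z" for z unfolding h(2) by (simp add: poly_monom)
  then have "poly p r = poly h r * (r ^ l - y) + poly q r"
    "poly p (w * r) = poly h (w * r) * (r ^ l - y) + poly q (w * r)"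
    using w(2) by (simp_all add: power_mult_distrib algebra_simps)
  then show "poly p r \<in> pri a1 \<and> poly p (w * r) \<in> pri a2"
    using is_idealD(3)[OF pri_ideal[OF a(1)] polys_closed(10)[OF RO h(1) r] a(3)]
      is_idealD(3)[OF pri_ideal[OF a(2)] polys_closed(10)[OF RO h(1) wr] a(4)] q
      add_subgroupD(4)[OF is_idealD(2)[OF pri_ideal[OF a(1)]]]
      add_subgroupD(4)[OF is_idealD(2)[OF pri_ideal[OF a(2)]]] by simp
qed (use p in \<open>auto simp: Jd_def\<close>)

text \<open>The pair of values at \<open>r\<close> and \<open>w * r\<close>, taken modulo
  \<open>a1\<close> and \<open>a2\<close>, separates the classes modulo \<open>Jd\<close>.\<close>

lemma Jd_upper:
  assumes r: "r \<in> OK" and a: "a1 \<in> OK" "a2 \<in> OK"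
    and N1: "\<And>F. F \<subseteq> OK \<Longrightarrow> separated (pri a1) F \<Longrightarrow> real (card F) \<le> N1"
    and N2: "\<And>F. F \<subseteq> OK \<Longrightarrow> separated (pri a2) F \<Longrightarrow> real (card F) \<le> N2"
    and F: "F \<subseteq> S" "separated (Jd r a1 a2) F"
  shows "real (card F) \<le> N1 * N2"
proof -
  note A1 = is_idealD(2)[OF pri_ideal[OF a(1)]] and A2 = is_idealD(2)[OF pri_ideal[OF a(2)]]
  obtain G1 where G1: "G1 \<subseteq> OK" "separated (pri a1) G1" "\<And>x. x \<in> OK \<Longrightarrow> \<exists>g\<in>G1. x - g \<in> pri a1"
    using maximal_separated[OF A1 N1] by blast
  obtain G2 where G2: "G2 \<subseteq> OK" "separated (pri a2) G2" "\<And>x. x \<in> OK \<Longrightarrow> \<exists>g\<in>G2. x - g \<in> pri a2"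
    using maximal_separated[OF A2 N2] by blast
  have "\<forall>s\<in>F. \<exists>p. p \<in> PO \<and> s = poly p eta" using F(1) by (auto simp: S_def)
  from bchoice[OF this] obtain p where p: "\<And>s. s \<in> F \<Longrightarrow> p s \<in> PO \<and> s = poly (p s) eta" by blast
  have wr: "w * r \<in> OK" by (intro subring_CD[OF RO] wO r)
  have "\<forall>s\<in>F. \<exists>g. g \<in> G1 \<and> poly (p s) r - g \<in> pri a1"
    using G1(3) polys_closed(10)[OF RO _ r] p by blast
  from bchoice[OF this] obtain g1 where g1: "\<And>s. s \<in> F \<Longrightarrow> g1 s \<in> G1 \<and> poly (p s) r - g1 s \<in> pri a1" by blast
  have "\<forall>s\<in>F. \<exists>g. g \<in> G2 \<and> poly (p s) (w * r) - g \<in> pri a2"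
    using G2(3) polys_closed(10)[OF RO _ wr] p by blast
  from bchoice[OF this] obtain g2 where g2: "\<And>s. s \<in> F \<Longrightarrow> g2 s \<in> G2 \<and> poly (p s) (w * r) - g2 s \<in> pri a2" by blast
  have inj: "inj_on (\<lambda>s. (g1 s, g2 s)) F"
  proof
    fix s t assume st: "s \<in> F" "t \<in> F" "(g1 s, g2 s) = (g1 t, g2 t)"
    have "poly (p s - p t) r = (poly (p s) r - g1 s) - (poly (p t) r - g1 t)" using st by simp
    then have 1: "poly (p s - p t) r \<in> pri a1" using add_subgroupD(2)[OF A1] g1 st by metis
    have "poly (p s - p t) (w * r) = (poly (p s) (w * r) - g2 s) - (poly (p t) (w * r) - g2 t)" using st by simp
    then have 2: "poly (p s - p t) (w * r) \<in> pri a2" using add_subgroupD(2)[OF A2] g2 st by metis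
    have "s - t = poly (p s - p t) eta" using p st by simp
    moreover have "p s - p t \<in> PO" using p st polys_closed(4)[OF RO] by blast
    ultimately have "s - t \<in> Jd r a1 a2" unfolding Jd_def using 1 2 by blast
    then show "s = t" using F(2) st by (simp add: separated_def)
  qed
  have fin: "finite (G1 \<times> G2)" using G1 G2 by (simp add: separated_def)
  have "card F \<le> card (G1 \<times> G2)" by (rule card_inj_on_le[OF inj _ fin]) (use g1 g2 in auto)
  then have "real (card F) \<le> real (card G1 * card G2)" by (simp only: card_cartesian_product of_nat_le_iff)
  also have "\<dots> \<le> N1 * N2" unfolding of_nat_mult
    using N1[OF G1(1,2)] N2[OF G2(1,2)] order_trans[OF of_nat_0_le_iff N1[OF G1(1,2)]] by (intro mult_mono) auto
  finally show ?thesis .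
qed

text \<open>The linear polynomials vanish at \<open>w * r\<close> and at \<open>r\<close>
  respectively, so each evaluation sees only one of \<open>x1\<close> and \<open>x2\<close>, up to
  sign times the cancellable \<open>(1 - w) * r\<close>. This replaces the Chinese remainder
  theorem.\<close>

lemma Jd_pair:
  assumes r: "r \<in> OK" and a: "a1 \<in> OK" "a2 \<in> OK" "r ^ l - y \<in> pri a1" "r ^ l - y \<in> pri a2"
    and g: "g1 \<in> OK" "a1 = 1 + of_nat l * g1" "g2 \<in> OK" "a2 = 1 + of_nat l * g2"
    and x: "x1 \<in> OK" "x2 \<in> OK"
  shows "x1 * (eta - w * r) + x2 * (eta - r) \<in> Jd r a1 a2 \<longleftrightarrow> x1 \<in> pri a1 \<and> x2 \<in> pri a2"
proof -
  define p where "p = Polynomial.smult x1 [:- (w * r), 1:] + Polynomial.smult x2 [:- r, 1:]"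
  have pO: "p \<in> PO" unfolding p_def by (intro polys_closed[OF RO] subring_CD[OF RO] x r wO)
  have e: "poly p eta = x1 * (eta - w * r) + x2 * (eta - r)" "poly p r = x1 * ((1 - w) * r)"
     "poly p (w * r) = - (x2 * ((1 - w) * r))"
    by (simp_all add: p_def algebra_simps)
  have rO: "(1 - w) * r \<in> OK" by (intro subring_CD[OF RO] wO r)
  have 1: "x1 * ((1 - w) * r) \<in> pri a1 \<longleftrightarrow> x1 \<in> pri a1"
  proof
    show "x1 \<in> pri a1 \<Longrightarrow> x1 * ((1 - w) * r) \<in> pri a1"
      unfolding mult.commute[of x1] by (rule is_idealD(3)[OF pri_ideal[OF a(1)] rO])
  qed (rule cancel_mod[OF g(1,2) r a(3) x(1)])
  have 2: "- (x2 * ((1 - w) * r)) \<in> pri a2 \<longleftrightarrow> x2 * ((1 - w) * r) \<in> pri a2"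
    using add_subgroupD(3)[OF is_idealD(2)[OF pri_ideal[OF a(2)]], of "x2 * ((1 - w) * r)"]
      add_subgroupD(3)[OF is_idealD(2)[OF pri_ideal[OF a(2)]], of "- (x2 * ((1 - w) * r))"]
    unfolding minus_minus by (rule iffI[rotated])
  have 3: "x2 * ((1 - w) * r) \<in> pri a2 \<longleftrightarrow> x2 \<in> pri a2"
  proof
    show "x2 \<in> pri a2 \<Longrightarrow> x2 * ((1 - w) * r) \<in> pri a2"
      unfolding mult.commute[of x2] by (rule is_idealD(3)[OF pri_ideal[OF a(2)] rO])
  qed (rule cancel_mod[OF g(3,4) r a(4) x(2)])
  show ?thesis using Jd_iff[OF r a pO] unfolding e 1 2 3 by simp
qed

lemma Jd_lower:
  assumes r: "r \<in> OK" and a: "a1 \<in> OK" "a2 \<in> OK" "r ^ l - y \<in> pri a1" "r ^ l - y \<in> pri a2"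
    and g: "g1 \<in> OK" "a1 = 1 + of_nat l * g1" "g2 \<in> OK" "a2 = 1 + of_nat l * g2"
    and F1: "F1 \<subseteq> OK" "separated (pri a1) F1" and F2: "F2 \<subseteq> OK" "separated (pri a2) F2"
  shows "\<exists>F. F \<subseteq> S \<and> separated (Jd r a1 a2) F \<and> card F = card F1 * card F2"
proof -
  let ?h = "\<lambda>(x1, x2). x1 * (eta - w * r) + x2 * (eta - r)"
  have key: "x1 = x1' \<and> x2 = x2'"
    if x: "x1 \<in> F1" "x1' \<in> F1" "x2 \<in> F2" "x2' \<in> F2" and h: "?h (x1, x2) - ?h (x1', x2') \<in> Jd r a1 a2" for x1 x1' x2 x2'
  proof -
    have xO: "x1 - x1' \<in> OK" "x2 - x2' \<in> OK" using x F1(1) F2(1) by (auto intro: subring_CD[OF RO])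
    have "?h (x1, x2) - ?h (x1', x2') = (x1 - x1') * (eta - w * r) + (x2 - x2') * (eta - r)"
      by (simp add: algebra_simps)
    then have "x1 - x1' \<in> pri a1 \<and> x2 - x2' \<in> pri a2" using Jd_pair[OF r a g xO] h by simp
    then show ?thesis using F1(2) F2(2) x by (auto simp: separated_def)
  qed
  have "0 \<in> Jd r a1 a2" using add_subgroupD(1)[OF is_idealD(2)[OF Jd_ideal[OF r a(1,2)]]] .
  have inj: "inj_on ?h (F1 \<times> F2)"
  proof
    fix p q assume pq: "p \<in> F1 \<times> F2" "q \<in> F1 \<times> F2" "?h p = ?h q"
    obtain x1 x2 x1' x2' where e: "p = (x1, x2)" "q = (x1', x2')" by (cases p, cases q)
    have "?h p - ?h q \<in> Jd r a1 a2" using \<open>0 \<in> Jd r a1 a2\<close> pq(3) by simp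
    then show "p = q" using key[of x1 x1' x2 x2'] pq(1,2) unfolding e by simp
  qed
  have "separated (Jd r a1 a2) (?h ` (F1 \<times> F2))" unfolding separated_def
  proof (intro conjI ballI impI)
    show "finite (?h ` (F1 \<times> F2))" using F1 F2 by (simp add: separated_def)
    fix u v assume "u \<in> ?h ` (F1 \<times> F2)" "v \<in> ?h ` (F1 \<times> F2)" and uv: "u - v \<in> Jd r a1 a2"
    then obtain x1 x2 x1' x2' where x: "x1 \<in> F1" "x2 \<in> F2" "u = ?h (x1, x2)" "x1' \<in> F1" "x2' \<in> F2" "v = ?h (x1', x2')"
      by blast
    show "u = v" using key[OF x(1,4,2,5)] uv unfolding x(3,6) by simp
  qed
  moreover have "?h ` (F1 \<times> F2) \<subseteq> S"
  proof clarify
    fix x1 x2 assume x: "x1 \<in> F1" "x2 \<in> F2"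
    define p where "p = Polynomial.smult x1 [:- (w * r), 1:] + Polynomial.smult x2 [:- r, 1:]"
    have "p \<in> PO" unfolding p_def using x F1 F2 by (intro polys_closed[OF RO] subring_CD[OF RO] r wO) auto
    moreover have "poly p eta = x1 * (eta - w * r) + x2 * (eta - r)" by (simp add: p_def algebra_simps)
    ultimately show "x1 * (eta - w * r) + x2 * (eta - r) \<in> S" unfolding S_def by force
  qed
  moreover have "card (?h ` (F1 \<times> F2)) = card F1 * card F2" by (simp add: card_image[OF inj] card_cartesian_product)
  ultimately show ?thesis by blast
qed

text \<open>Taking \<open>x2\<close> or \<open>x1\<close> to be 0 in \<open>Jd_pair\<close> recovers
  each of the two principal ideals from \<open>Jd\<close>.\<close>

lemma Jd_inj:
  assumes r: "r \<in> OK" and a: "a1 \<in> OK" "a2 \<in> OK" "r ^ l - y \<in> pri a1" "r ^ l - y \<in> pri a2"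
    and g: "g1 \<in> OK" "a1 = 1 + of_nat l * g1" "g2 \<in> OK" "a2 = 1 + of_nat l * g2"
    and a': "a1' \<in> OK" "a2' \<in> OK" "r ^ l - y \<in> pri a1'" "r ^ l - y \<in> pri a2'"
    and g': "g1' \<in> OK" "a1' = 1 + of_nat l * g1'" "g2' \<in> OK" "a2' = 1 + of_nat l * g2'"
    and eq: "Jd r a1 a2 = Jd r a1' a2'"
  shows "pri a1 = pri a1' \<and> pri a2 = pri a2'"
proof -
  have z: "0 \<in> pri c" for c using subring_CD(1)[OF RO] by force
  have e1: "x \<in> pri a1 \<longleftrightarrow> x \<in> pri a1'" if "x \<in> OK" for x
    using Jd_pair[OF r a g that subring_CD(1)[OF RO]] Jd_pair[OF r a' g' that subring_CD(1)[OF RO]] eq z by simp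
  have e2: "x \<in> pri a2 \<longleftrightarrow> x \<in> pri a2'" if "x \<in> OK" for x
    using Jd_pair[OF r a g subring_CD(1)[OF RO] that] Jd_pair[OF r a' g' subring_CD(1)[OF RO] that] eq z by simp
  note sub = is_idealD(1)[OF pri_ideal]
  show ?thesis
    using set_eqI_on[OF sub[OF a(1)] sub[OF a'(1)] e1] set_eqI_on[OF sub[OF a(2)] sub[OF a'(2)] e2] by simp
qed

text \<open>The least positive integer divisible by \<open>a\<close> is prime to \<open>l\<close>:
  since \<open>l\<close> is invertible modulo \<open>a\<close>, a factor \<open>l\<close> could be
  divided out.\<close>

lemma integer_multiple_coprime:
  assumes g: "g \<in> OK" "a = 1 + of_nat l * g" "a \<noteq> 0"
  shows "\<exists>M>0. coprime M l \<and> of_nat M \<in> pri a"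
proof -
  have aO: "a \<in> OK" unfolding g(2) by (intro subring_CD[OF RO] g)
  note ID = is_idealD[OF pri_ideal[OF aO]]
  obtain D where D: "D > 0" "of_nat D * inverse a \<in> zspan b n"
    using multiple_in_zspan[OF subfield_CD(6)[OF K OKD(1)[OF aO]]] by blast
  have "of_nat D = a * (of_nat D * inverse a)" using g(3) by simp
  then have "of_nat D \<in> pri a" using D(2) zspan_b_OK by blast
  then have ex: "\<exists>M>0. of_nat M \<in> pri a" using D(1) by blast
  define M where "M = (LEAST M. M > 0 \<and> of_nat M \<in> pri a)"
  have M: "M > 0" "of_nat M \<in> pri a" using LeastI_ex[OF ex] unfolding M_def by auto
  have "\<not> l dvd M"
  proof
    assume "l dvd M"
    then obtain m where m: "M = l * m" by (auto elim: dvdE)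
    have "of_nat m = of_nat m * a - g * of_nat M" unfolding g(2) m by (simp add: algebra_simps)
    also have "\<dots> \<in> pri a"
      using ID(3)[OF subring_CD(8)[OF RO], of a m] ID(3)[OF g(1) M(2)] subring_CD(2)[OF RO]
      by (intro add_subgroupD(2)[OF ID(2)]) (auto simp: image_iff mult.commute)
    finally have "M \<le> m" using m M(1) unfolding M_def by (intro Least_le) auto
    then show False using m M(1) prime_gt_1_nat[OF l] by simp
  qed
  then have "coprime M l" using prime_imp_coprime[OF l] by (simp add: coprime_commute)
  then show ?thesis using M by blast
qed

end

section \<open>The order generated by \<open>eta\<close> and the final count\<close>

lemma ex_nat_power_between:
  fixes x :: real
  assumes x: "x \<ge> 1" and d: "(d::nat) > 0"
  shows "\<exists>T::nat. T \<ge> 1 \<and> x \<le> real T ^ d \<and> real T ^ d \<le> 2 ^ d * x"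
proof -
  define r where "r = root d x"
  have r: "r \<ge> 1" "r ^ d = x" using x d by (auto simp: r_def)
  define T where "T = nat \<lceil>r\<rceil>"
  have T: "r \<le> real T" "real T \<le> 2 * r" unfolding T_def using r(1) by linarith+
  have "x \<le> real T ^ d" using power_mono[OF T(1), of d] r by simp
  moreover have "real T ^ d \<le> 2 ^ d * x" using power_mono[OF T(2), of d] r(2) by (simp add: power_mult_distrib)
  moreover have "T \<ge> 1" using T(1) r(1) by linarith
  ultimately show ?thesis by blast
qed

context kummer
begin

definition L :: "complex set" where "L = adjoin K eta l"

lemma eta_L: "number_field L" "K \<subseteq> L" "eta \<in> L"
proof -
  have e: "eta ^ l \<in> adjoin K eta l" unfolding eta
    by (rule adjoin_base[OF subfield_C_subring[OF K] l_pos yO(4)])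
  show "number_field L" "K \<subseteq> L" "eta \<in> L"
    unfolding L_def by (rule number_field_adjoin[OF number_field l_pos e])+
qed

text \<open>The degree \<open>d\<close> is left undetermined. The count chooses \<open>T\<close>
  such that \<open>T ^ d\<close> has the required size, so \<open>d\<close> need not be compared
  with \<open>n\<close>.\<close>

lemma S_order: "\<exists>b' d. number_field_order L b' d S"
proof -
  obtain b' d where nb: "number_field_basis L b' d" using number_field_obtain_basis[OF eta_L(1)] .
  interpret L: number_field_basis L b' d by (rule nb)
  have SR: "subring_C S" unfolding S_def by (rule poly_image_subring[OF RO])
  note LR = ring_of_integers_subring[OF L.K]
  have "algebraic_int eta"
    by (rule algebraic_int_root[of y "monom 1 l" eta]) (use l_pos eta yO OKD in \<open>auto simp: poly_monom degree_monom_eq\<close>)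
  then have eO: "eta \<in> ring_of_integers L" using eta_L by (simp add: ring_of_integers_def)
  have KL: "OK \<subseteq> ring_of_integers L" using eta_L(2) by (auto simp: ring_of_integers_def)
  have SL: "S \<subseteq> ring_of_integers L"
  proof
    fix x assume "x \<in> S"
    then obtain p where p: "p \<in> PO" "x = poly p eta" by (auto simp: S_def)
    then have "p \<in> polys (ring_of_integers L)" using KL by (auto simp: polys_def)
    then show "x \<in> ring_of_integers L" using polys_closed(10)[OF LR _ eO] p by simp
  qed
  have "\<exists>D>0. of_nat D * x \<in> S" if x: "x \<in> L" for x
  proof -
    obtain c where c: "x = (\<Sum>i<l. c i * eta ^ i)" "\<And>i. c i \<in> K" using x by (auto simp: L_def adjoin_def)
    obtain D where D: "D > 0" "\<And>z. z \<in> c ` {..<l} \<Longrightarrow> of_nat D * z \<in> zspan b n"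
      using common_multiple_in_zspan[of "c ` {..<l}"] c(2) by auto
    define p where "p = (\<Sum>i<l. monom (of_nat D * c i) i)"
    have "of_nat D * c i \<in> OK" if "i < l" for i using D(2)[of "c i"] that zspan_b_OK by auto
    then have "p \<in> PO" using subring_CD(1)[OF RO] by (auto simp: polys_def p_def coeff_sum)
    moreover have "of_nat D * x = poly p eta"
      by (simp add: p_def c(1) poly_sum poly_monom sum_distrib_left mult.assoc)
    ultimately show ?thesis using D(1) by (auto simp: S_def)
  qed
  then have "\<exists>D>0. of_nat D * b' i \<in> S" if "i < d" for i using L.b(1)[OF that] by blast
  then obtain D where D: "\<And>i. i < d \<Longrightarrow> D i > 0 \<and> of_nat (D i) * b' i \<in> S" by metis
  have nb2: "number_field_basis L (\<lambda>i. of_nat (D i) * b' i) d" by (rule L.scale_basis) (use D in blast)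
  have "zspan (\<lambda>i. of_nat (D i) * b' i) d \<subseteq> S"
    by (rule zspan_least[OF subring_C_add_subgroup[OF SR]]) (use D in blast)
  then have "number_field_order L (\<lambda>i. of_nat (D i) * b' i) d S"
    using nb2 SR SL by (simp add: number_field_order_def number_field_order_axioms_def)
  then show ?thesis by blast
qed

text \<open>A single modulus for all generators yields a single root \<open>r\<close>, with which
  all ideals \<open>Jd\<close> are formed.\<close>

lemma common_integer_multiple:
  assumes "finite X" "\<And>a. a \<in> X \<Longrightarrow> a \<noteq> 0 \<and> (\<exists>g\<in>OK. a = 1 + of_nat l * g)"
  shows "\<exists>M>0. coprime M l \<and> (\<forall>a\<in>X. of_nat M \<in> pri a)"
  using assms
proof (induction X)
  case (insert a X)
  then obtain M where M: "M > 0" "coprime M l" "\<And>a. a \<in> X \<Longrightarrow> of_nat M \<in> pri a" by auto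
  obtain g where g: "g \<in> OK" "a = 1 + of_nat l * g" "a \<noteq> 0" using insert.prems by auto
  obtain M' where M': "M' > 0" "coprime M' l" "of_nat M' \<in> pri a" using integer_multiple_coprime[OF g] by blast
  have I: "is_ideal OK (pri a')" if a'X: "a' \<in> insert a X" for a'
  proof -
    obtain g' where g': "g' \<in> OK" "a' = 1 + of_nat l * g'" using insert.prems[OF a'X] by blast
    then have "a' \<in> OK" by (auto intro: subring_CD[OF RO])
    then show ?thesis by (rule pri_ideal)
  qed
  have "of_nat (M * M') \<in> pri a'" if a': "a' \<in> insert a X" for a'
  proof (cases "a' = a")
    case True
    then show ?thesis using is_idealD(3)[OF I[OF a'] subring_CD(8)[OF RO], of "of_nat M'" M] M' by simp
  next
    case False
    then have "a' \<in> X" using a' by simp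
    then show ?thesis unfolding of_nat_mult mult.commute[of "of_nat M"]
      by (intro is_idealD(3)[OF I[OF a'] subring_CD(8)[OF RO]] M(3))
  qed
  moreover have "coprime (M * M') l" using M M' by simp
  ultimately show ?case using M(1) M'(1) by (intro exI[of _ "M * M'"]) simp
qed auto

text \<open>If \<open>y\<close> were an \<open>l\<close>-th power modulo all \<open>M\<close> prime to \<open>l\<close>, then pairs of principal ideals of \<open>OK\<close> would give,
  through \<open>Jd\<close>, about \<open>J * Y ^ n\<close> ideals of the order \<open>S\<close> with index of order \<open>Y ^ n\<close>, for every \<open>J\<close>.\<close>

lemma residue_contradiction:
  assumes res: "\<And>M. M > 0 \<Longrightarrow> coprime M l \<Longrightarrow> \<exists>r\<in>OK. \<exists>z\<in>OK. r ^ l - y = of_nat M * z"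
  shows False
proof -
  define Q where "Q c1 C1 c2 A P \<longleftrightarrow> finite P \<and> P \<subseteq> OK \<and> c2 * real A ^ n \<le> real (card P)
      \<and> inj_on pri P
      \<and> (\<forall>al\<in>P. al \<noteq> 0 \<and> (\<exists>g\<in>OK. al = 1 + of_nat l * g)
          \<and> (\<forall>F. F \<subseteq> OK \<longrightarrow> separated (pri al) F \<longrightarrow> real (card F) \<le> C1 * real A ^ n)
          \<and> (\<exists>F. F \<subseteq> OK \<and> separated (pri al) F \<and> c1 * real A ^ n \<le> real (card F)))"
    for c1 C1 c2 :: real and A :: nat and P
  obtain c1 C0 c2 where pos: "c1 > 0" "C0 > 0" "c2 > 0"
    and "\<And>A. A mod l = 1 mod l \<Longrightarrow> A > 0 \<Longrightarrow> \<exists>P. Q c1 C0 c2 A P"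
    using many_principal_ideals[OF l_pos] unfolding Q_def by metis
  then obtain P where P0: "\<And>A. A mod l = 1 mod l \<Longrightarrow> A > 0 \<Longrightarrow> Q c1 C0 c2 A (P A)" by metis
  define C1 where "C1 = max C0 1"
  have C1: "C1 \<ge> 1" by (simp add: C1_def)
  have P: "finite (P A)" "P A \<subseteq> OK" "c2 * real A ^ n \<le> real (card (P A))" "inj_on pri (P A)"
     "\<And>al. al \<in> P A \<Longrightarrow> al \<noteq> 0 \<and> (\<exists>g\<in>OK. al = 1 + of_nat l * g)"
     "\<And>al F. al \<in> P A \<Longrightarrow> F \<subseteq> OK \<Longrightarrow> separated (pri al) F \<Longrightarrow> real (card F) \<le> C1 * real A ^ n"
     "\<And>al. al \<in> P A \<Longrightarrow> \<exists>F. F \<subseteq> OK \<and> separated (pri al) F \<and> c1 * real A ^ n \<le> real (card F)"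
     if A: "A mod l = 1 mod l" "A > 0" for A
  proof -
    note q = P0[OF A, unfolded Q_def]
    show "finite (P A)" "P A \<subseteq> OK" "c2 * real A ^ n \<le> real (card (P A))" "inj_on pri (P A)"
     "\<And>al. al \<in> P A \<Longrightarrow> al \<noteq> 0 \<and> (\<exists>g\<in>OK. al = 1 + of_nat l * g)"
     "\<And>al. al \<in> P A \<Longrightarrow> \<exists>F. F \<subseteq> OK \<and> separated (pri al) F \<and> c1 * real A ^ n \<le> real (card F)"
      using q by auto
    show "real (card F) \<le> C1 * real A ^ n" if "al \<in> P A" "F \<subseteq> OK" "separated (pri al) F" for al F
    proof -
      have "real (card F) \<le> C0 * real A ^ n" using q that by blast
      also have "\<dots> \<le> C1 * real A ^ n" by (intro mult_right_mono) (auto simp: C1_def)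
      finally show ?thesis .
    qed
  qed
  obtain b' d where "number_field_order L b' d S" using S_order by blast
  then interpret O: number_field_order L b' d S .
  \<comment> \<open>The ideals will have index at least \<open>c1 ^ 2 * ?Y\<close>, and
    \<open>T ^ d\<close> will be at most \<open>2 ^ d * C1 ^ 2 * ?Y\<close>; \<open>c0\<close> is
    the ratio.\<close>
  define c0 where "c0 = c1 ^ 2 / (2 ^ d * C1 ^ 2)"
  have c0: "c0 > 0" using pos C1 by (simp add: c0_def)
  obtain C where C: "\<And>T I. T \<ge> 1 \<Longrightarrow> finite I \<Longrightarrow>
    (\<And>J. J \<in> I \<Longrightarrow> is_ideal S J \<and> (\<forall>F. F \<subseteq> S \<longrightarrow> separated J F \<longrightarrow> card F \<le> T ^ d)
       \<and> (\<exists>F. F \<subseteq> S \<and> separated J F \<and> c0 * real T ^ d \<le> real (card F)))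
    \<Longrightarrow> real (card I) \<le> C * real T ^ d"
    using O.count_ideals[OF c0] by metis
  define C' where "C' = max C 0"
  obtain k where k: "C1 / c1 < 2 ^ k" using real_arch_pow[of 2 "C1 / c1"] by auto
  \<comment> \<open>\<open>h\<close> has to be 1 modulo \<open>l\<close>, like the sizes of the
    generators, and so large that the index ranges belonging to different powers of \<open>h\<close>
    are disjoint; then ideals from different scales differ.\<close>
  define h where "h = (l + 1) ^ k"
  have h0: "h > 0" by (simp add: h_def)
  have "(2::nat) ^ k \<le> h" unfolding h_def using l_pos by (intro power_mono) auto
  also have "h \<le> h ^ n" using n_pos h0 by (intro self_le_power) auto
  finally have "(2::real) ^ k \<le> real h ^ n" by (metis of_nat_le_iff of_nat_numeral of_nat_power)
  then have hn: "C1 < c1 * real h ^ n" using k pos(1) by (simp add: pos_divide_less_eq mult.commute)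
      (smt (verit) mult_left_mono)
  \<comment> \<open>The number of scales is fixed last, so that it beats the constant of the ideal
    count together with all other constants.\<close>
  obtain J :: nat where J: "real (J + 1) * c2 ^ 2 > C' * 2 ^ d * C1 ^ 2"
  proof -
    obtain J :: nat where "C' * 2 ^ d * C1 ^ 2 / c2 ^ 2 < real J" using reals_Archimedean2 by blast
    then have "C' * 2 ^ d * C1 ^ 2 < real J * c2 ^ 2" using pos(3) by (simp add: pos_divide_less_eq)
    also have "\<dots> \<le> real (J + 1) * c2 ^ 2" by (intro mult_right_mono) auto
    finally show thesis by (rule that)
  qed
  have A: "(h ^ j) mod l = 1 mod l" "h ^ j > 0" for j
  proof -
    have "((l + 1) ^ (k * j)) mod l = ((l + 1) mod l) ^ (k * j) mod l" by (rule power_mod[symmetric])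
    also have "(l + 1) mod l = 1" using prime_gt_1_nat[OF l] by (simp add: mod_Suc)
    finally show "(h ^ j) mod l = 1 mod l" by (simp add: h_def power_mult)
    show "h ^ j > 0" using h0 by simp
  qed
  note PP = P[OF A]
  define X where "X = (\<Union>j\<le>J. P (h ^ j))"
  have finX: "finite X" unfolding X_def using PP(1) by auto
  have Xp: "a \<noteq> 0 \<and> (\<exists>g\<in>OK. a = 1 + of_nat l * g)" if "a \<in> X" for a using that PP(5) by (auto simp: X_def)
  obtain M where M: "M > 0" "coprime M l" "\<And>a. a \<in> X \<Longrightarrow> of_nat M \<in> pri a"
    using common_integer_multiple[OF finX Xp] by blast
  obtain r z where r: "r \<in> OK" "z \<in> OK" "r ^ l - y = of_nat M * z" using res[OF M(1,2)] by blast
  have XO: "a \<in> OK" if "a \<in> X" for a using that PP(2) by (auto simp: X_def)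
  have Xr: "r ^ l - y \<in> pri a" if "a \<in> X" for a
    using is_idealD(3)[OF pri_ideal[OF XO[OF that]] r(2) M(3)[OF that]] r(3) by (simp add: mult.commute)
  \<comment> \<open>The sizes \<open>h ^ j\<close> and \<open>h ^ (J - j)\<close> have the same
    product for all \<open>j\<close>, so all pairs give ideals of comparable index.\<close>
  define Z where "Z = (SIGMA j:{..J}. P (h ^ j) \<times> P (h ^ (J - j)))"
  have ZX: "a1 \<in> X \<and> a2 \<in> X" if "(j, a1, a2) \<in> Z" for j a1 a2
  proof -
    have "j \<le> J" "J - j \<le> J" "a1 \<in> P (h ^ j)" "a2 \<in> P (h ^ (J - j))" using that by (auto simp: Z_def)
    then show ?thesis unfolding X_def by blast
  qed
  have finZ: "finite Z" unfolding Z_def using PP(1) by auto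
  define Ph where "Ph = (\<lambda>(j::nat, a1, a2). Jd r a1 a2)"
  have jeq: False if j: "i < j" and a: "a \<in> P (h ^ i)" "a' \<in> P (h ^ j)" "pri a = pri a'" for i j a a'
  proof -
    obtain F where F: "F \<subseteq> OK" "separated (pri a') F" "c1 * real (h ^ j) ^ n \<le> real (card F)" using PP(7)[OF a(2)] by blast
    have "c1 * real (h ^ j) ^ n \<le> C1 * real (h ^ i) ^ n" 
      by (rule order_trans[OF F(3) PP(6)[OF a(1) F(1)]]) (unfold a(3), rule F(2))
    moreover have "C1 * real (h ^ i) ^ n < c1 * real h ^ n * real (h ^ i) ^ n"
      using hn h0 by (intro mult_strict_right_mono) auto
    moreover have "c1 * real h ^ n * real (h ^ i) ^ n = c1 * real (h ^ (Suc i)) ^ n"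
      by (simp add: power_mult_distrib)
    moreover have "h ^ Suc i \<le> h ^ j" using j h0 by (intro power_increasing) auto
    then have "c1 * real (h ^ (Suc i)) ^ n \<le> c1 * real (h ^ j) ^ n"
      using pos(1) by (intro mult_left_mono power_mono) (auto simp del: of_nat_power power_Suc)
    ultimately show False by linarith
  qed
  have inj: "inj_on Ph Z"
  proof
    fix u v assume uv: "u \<in> Z" "v \<in> Z" "Ph u = Ph v"
    obtain i a1 a2 where u: "u = (i, a1, a2)" by (cases u)
    obtain j a1' a2' where v: "v = (j, a1', a2')" by (cases v)
    have uZ: "a1 \<in> P (h ^ i)" "a2 \<in> P (h ^ (J - i))" "a1' \<in> P (h ^ j)" "a2' \<in> P (h ^ (J - j))"
      using uv(1,2) by (auto simp: u v Z_def)
    have x: "a1 \<in> X" "a2 \<in> X" "a1' \<in> X" "a2' \<in> X" using ZX uv(1,2) unfolding u v by blast+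
    obtain g1 g2 g1' g2' where g: "g1 \<in> OK" "a1 = 1 + of_nat l * g1" "g2 \<in> OK" "a2 = 1 + of_nat l * g2"
      and g': "g1' \<in> OK" "a1' = 1 + of_nat l * g1'" "g2' \<in> OK" "a2' = 1 + of_nat l * g2'"
      using Xp[OF x(1)] Xp[OF x(2)] Xp[OF x(3)] Xp[OF x(4)] by blast
    have eq: "Jd r a1 a2 = Jd r a1' a2'" using uv(3) by (simp add: Ph_def u v)
    have pr: "pri a1 = pri a1'" "pri a2 = pri a2'"
      using Jd_inj[OF r(1) XO[OF x(1)] XO[OF x(2)] Xr[OF x(1)] Xr[OF x(2)] g
        XO[OF x(3)] XO[OF x(4)] Xr[OF x(3)] Xr[OF x(4)] g' eq] by auto
    have ij: "i = j" using jeq[OF _ uZ(1,3) pr(1)] jeq[OF _ uZ(3,1) pr(1)[symmetric]] by (metis linorder_neqE_nat)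
    have "a1 = a1'" using inj_onD[OF PP(4) pr(1)] uZ ij by blast
    moreover have "a2 = a2'" using inj_onD[OF PP(4) pr(2)] uZ ij by blast
    ultimately show "u = v" using u v ij by simp
  qed
  let ?Y = "real (h ^ J) ^ n"
  have Yj: "real (h ^ j) ^ n * real (h ^ (J - j)) ^ n = ?Y" if "j \<le> J" for j
    using that by (simp add: power_mult_distrib[symmetric] power_add[symmetric])
  have Y1: "?Y \<ge> 1"
  proof -
    have "(1::nat) \<le> h ^ J" using h0 by simp
    then show ?thesis by (intro one_le_power) (metis of_nat_1 of_nat_le_iff)
  qed
  have "1 * 1 \<le> C1 ^ 2 * ?Y" using C1 Y1 by (intro mult_mono) auto
  then obtain T :: nat where T: "T \<ge> 1" "C1 ^ 2 * ?Y \<le> real T ^ d" "real T ^ d \<le> 2 ^ d * (C1 ^ 2 * ?Y)"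
    using ex_nat_power_between[OF _ O.n_pos] by fastforce
  have each: "is_ideal S I \<and> (\<forall>F. F \<subseteq> S \<longrightarrow> separated I F \<longrightarrow> card F \<le> T ^ d)
       \<and> (\<exists>F. F \<subseteq> S \<and> separated I F \<and> c0 * real T ^ d \<le> real (card F))" if I: "I \<in> Ph ` Z" for I
  proof -
    obtain u where u0: "u \<in> Z" "I = Ph u" using I by blast
    obtain j a1 a2 where u: "u = (j, a1, a2)" by (cases u)
    have jJ: "j \<le> J" and uZ: "a1 \<in> P (h ^ j)" "a2 \<in> P (h ^ (J - j))" using u0 by (auto simp: u Z_def)
    have Ie: "I = Jd r a1 a2" using u0 by (simp add: u Ph_def)
    have x: "a1 \<in> X" "a2 \<in> X" using ZX u0(1) unfolding u by blast+
    obtain g1 g2 where g: "g1 \<in> OK" "a1 = 1 + of_nat l * g1" "g2 \<in> OK" "a2 = 1 + of_nat l * g2"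
      using Xp[OF x(1)] Xp[OF x(2)] by blast
    have 1: "is_ideal S I" unfolding Ie by (rule Jd_ideal[OF r(1) XO[OF x(1)] XO[OF x(2)]])
    have 2: "card F \<le> T ^ d" if F: "F \<subseteq> S" "separated I F" for F
    proof -
      have "real (card F) \<le> (C1 * real (h ^ j) ^ n) * (C1 * real (h ^ (J - j)) ^ n)"
        by (rule Jd_upper[OF r(1) XO[OF x(1)] XO[OF x(2)] PP(6)[OF uZ(1)] PP(6)[OF uZ(2)] F(1) F(2)[unfolded Ie]])
      also have "\<dots> = C1 ^ 2 * (real (h ^ j) ^ n * real (h ^ (J - j)) ^ n)" by (simp only: power2_eq_square mult_ac)
      also have "\<dots> \<le> real T ^ d" unfolding Yj[OF jJ] by (rule T(2))
      finally show ?thesis by (metis of_nat_le_iff of_nat_power)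
    qed
    obtain F1 where F1: "F1 \<subseteq> OK" "separated (pri a1) F1" "c1 * real (h ^ j) ^ n \<le> real (card F1)" using PP(7)[OF uZ(1)] by blast
    obtain F2 where F2: "F2 \<subseteq> OK" "separated (pri a2) F2" "c1 * real (h ^ (J - j)) ^ n \<le> real (card F2)" using PP(7)[OF uZ(2)] by blast
    obtain F where F: "F \<subseteq> S" "separated I F" "card F = card F1 * card F2" unfolding Ie
      using Jd_lower[OF r(1) XO[OF x(1)] XO[OF x(2)] Xr[OF x(1)] Xr[OF x(2)] g F1(1,2) F2(1,2)] by blast
    have "c0 * real T ^ d \<le> c0 * (2 ^ d * (C1 ^ 2 * ?Y))" using T(3) c0 by (intro mult_left_mono) auto
    also have "\<dots> = c1 ^ 2 * ?Y" using C1 by (simp add: c0_def)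
    also have "\<dots> = (c1 * real (h ^ j) ^ n) * (c1 * real (h ^ (J - j)) ^ n)"
      unfolding Yj[OF jJ, symmetric] by (simp only: power2_eq_square mult_ac)
    also have "\<dots> \<le> real (card F1) * real (card F2)" using F1(3) F2(3) pos(1) by (intro mult_mono) auto
    also have "\<dots> = real (card F)" using F(3) by simp
    finally show ?thesis using 1 2 F by blast
  qed
  have "real (card (Ph ` Z)) \<le> C * real T ^ d" by (rule C[OF T(1) finite_imageI[OF finZ] each])
  also have "\<dots> \<le> C' * (2 ^ d * (C1 ^ 2 * ?Y))" unfolding C'_def using T(3) by (intro mult_mono) auto
  finally have up: "real (card Z) \<le> C' * 2 ^ d * C1 ^ 2 * ?Y" by (simp add: card_image[OF inj] mult.assoc)
  \<comment> \<open>Each of the \<open>J + 1\<close> scales contributes at least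
    \<open>c2 ^ 2 * ?Y\<close> ideals.\<close>
  have "real (J + 1) * c2 ^ 2 * ?Y = (\<Sum>j\<le>J. c2 ^ 2 * ?Y)" by (simp add: algebra_simps)
  also have "\<dots> \<le> (\<Sum>j\<le>J. real (card (P (h ^ j)) * card (P (h ^ (J - j)))))"
  proof (rule sum_mono)
    fix j assume "j \<in> {..J}"
    then have jJ: "j \<le> J" by simp
    have "c2 ^ 2 * ?Y = (c2 * real (h ^ j) ^ n) * (c2 * real (h ^ (J - j)) ^ n)"
      unfolding Yj[OF jJ, symmetric] by (simp only: power2_eq_square mult_ac)
    also have "\<dots> \<le> real (card (P (h ^ j))) * real (card (P (h ^ (J - j))))"
      using PP(3) pos(3) by (intro mult_mono) auto
    finally show "c2 ^ 2 * ?Y \<le> real (card (P (h ^ j)) * card (P (h ^ (J - j))))" by simp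
  qed
  also have "\<dots> = real (card Z)"
    unfolding Z_def using PP(1) by (subst card_SigmaI) (auto simp: card_cartesian_product)
  finally have "real (J + 1) * c2 ^ 2 * ?Y \<le> C' * 2 ^ d * C1 ^ 2 * ?Y" using up by linarith
  then have "real (J + 1) * c2 ^ 2 \<le> C' * 2 ^ d * C1 ^ 2" using Y1 by (simp add: mult_le_cancel_right del: of_nat_add)
  then show False using J by linarith
qed

end

lemma complex_root_exists:
  assumes "l > 0"
  shows "\<exists>z. z ^ l = (y :: complex)"
proof -
  have "degree (monom 1 l - [:y:]) = l" by (rule degree_monom_minus_const[OF assms])
  then obtain z where "poly (monom 1 l - [:y:]) z = 0"
    using fundamental_theorem_of_algebra[of "monom 1 l - [:y:]"] constant_degree[of "monom 1 l - [:y:]"] assms by auto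
  then show ?thesis by (auto simp: poly_monom)
qed

theorem unit_power_residue:
  assumes K: "number_field K" and l: "prime (l::nat)" and w: "w \<in> K" "w ^ l = 1" "w \<noteq> 1"
    and y: "y \<in> units_of_integers K"
    and res: "\<And>M. M > 0 \<Longrightarrow> coprime M l \<Longrightarrow>
      \<exists>r\<in>ring_of_integers K. \<exists>z\<in>ring_of_integers K. r ^ l - y = of_nat M * z"
  shows "\<exists>z\<in>K. z ^ l = y"
proof (rule ccontr)
  assume no: "\<not> ?thesis"
  obtain b n where nb: "number_field_basis K b n" using number_field_obtain_basis[OF K] .
  obtain eta where eta: "eta ^ l = y" using complex_root_exists prime_gt_0_nat[OF l] by blast
  have "kummer K b n l w y eta"
    using nb l w y eta no by (auto simp: kummer_def kummer_axioms_def)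
  from kummer.residue_contradiction[OF this res] show False by blast
qed

section \<open>Cyclotomic towers\<close>

lemma prime_root_of_unity_powers:
  assumes l: "prime (l::nat)" and w: "w ^ l = 1" "w \<noteq> (1::complex)"
  shows "w ^ k = 1 \<longleftrightarrow> l dvd k" "inj_on (\<lambda>k. w ^ k) {..<l}" "u ^ l = 1 \<Longrightarrow> \<exists>k<l. u = w ^ k"
proof -
  have w0: "w \<noteq> 0" using w prime_gt_0_nat[OF l] by (auto simp: power_0_left)
  show one: "w ^ k = 1 \<longleftrightarrow> l dvd k" for k
  proof
    assume k: "w ^ k = 1"
    show "l dvd k"
    proof (rule ccontr)
      assume "\<not> l dvd k"
      then have "gcd (int k) (int l) = 1"
        using prime_imp_coprime[OF l] by (simp add: coprime_iff_gcd_eq_1 gcd.commute)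
      then obtain a b where ab: "int k * a + int l * b = 1"
        using bezout_int[of "int k" "int l"] by (auto simp: mult.commute)
      have "w = w powi (int k * a + int l * b)" using ab by simp
      also have "\<dots> = (w ^ k) powi a * (w ^ l) powi b" using w0 by (simp add: power_int_add power_int_power)
      finally show False using k w by simp
    qed
  next
    assume "l dvd k"
    then show "w ^ k = 1" using w by (auto elim!: dvdE simp: power_mult)
  qed
  have eq: "j = k" if jk: "j \<le> k" "k < l" "w ^ j = w ^ k" for j k
  proof -
    have "w ^ (j + (k - j)) = w ^ j" using jk by simp
    then have "w ^ (k - j) = 1" unfolding power_add using w0 by simp
    then have "l dvd k - j" using one by simp
    then show ?thesis using jk dvd_imp_le[of l "k - j"] by linarith
  qed
  show inj: "inj_on (\<lambda>k. w ^ k) {..<l}"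
  proof
    fix j k assume "j \<in> {..<l}" "k \<in> {..<l}" "w ^ j = w ^ k"
    then show "j = k" using eq[of j k] eq[of k j] by (cases "j \<le> k") auto
  qed
  have "(w ^ k) ^ l = 1" for k
    unfolding power_mult[symmetric] mult.commute[of k] by (simp add: power_mult w)
  then have "(\<lambda>k. w ^ k) ` {..<l} \<subseteq> {u. u ^ l = 1}" by auto
  moreover have "card {u::complex. u ^ l = 1} = l" using card_roots_unity_eq[of l] prime_gt_0_nat[OF l] by simp
  moreover have "finite {u::complex. u ^ l = 1}" using finite_roots_unity[of l] prime_ge_1_nat[OF l] by simp
  ultimately have "(\<lambda>k. w ^ k) ` {..<l} = {u. u ^ l = 1}"
    using card_image[OF inj] by (intro card_subset_eq) auto
  then show "u ^ l = 1 \<Longrightarrow> \<exists>k<l. u = w ^ k" by (auto simp: set_eq_iff image_iff)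
qed

lemma root_differs_by_unity:
  assumes l: "prime (l::nat)" and w: "w ^ l = 1" "w \<noteq> (1::complex)" and eq: "x ^ l = z ^ l"
  shows "\<exists>k<l. x = w ^ k * z"
proof (cases "z = 0")
  case True
  then have "x = 0" using eq prime_gt_0_nat[OF l] by (simp add: power_0_left)
  then show ?thesis using True prime_gt_0_nat[OF l] by auto
next
  case False
  then have "(x / z) ^ l = 1" using eq by (simp add: power_divide)
  then obtain k where "k < l" "x / z = w ^ k" using prime_root_of_unity_powers(3)[OF l w] by blast
  then show ?thesis using False by (auto simp: divide_eq_eq)
qed

text \<open>A degree \<open>l\<close> Kummer extension; \<open>c\<close> is only needed because the norm of \<open>xi\<close> is \<open>t\<close> up to a sign.\<close>

locale kummer_extension =
  fixes F :: "complex set" and l :: nat and w c xi :: complex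
  assumes F: "subfield_C F" and l: "prime l" and w: "w \<in> F" "w ^ l = 1" "w \<noteq> 1"
    and c: "c \<in> F" "c ^ l = (\<Prod>k<l. w ^ k)"
    and xi: "xi ^ l \<in> F" "xi \<notin> F"
begin

lemma l_pos: "l > 0" using l by (simp add: prime_gt_0_nat)

lemma R: "subring_C F" by (rule subfield_C_subring[OF F])

lemma nz: "w \<noteq> 0" "xi \<noteq> 0" "c \<noteq> 0"
proof -
  show w0: "w \<noteq> 0" using w l_pos by (auto simp: power_0_left)
  show "xi \<noteq> 0" using xi subfield_CD(1)[OF F] by auto
  have "c ^ l \<noteq> 0" using w0 by (auto simp: c(2) prod_zero_iff)
  then show "c \<noteq> 0" using l_pos by (auto simp: power_0_left)
qed

lemma not_power: "z \<in> F \<Longrightarrow> z ^ l \<noteq> xi ^ l"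
  using root_differs_by_unity[OF l w(2,3), of xi z] xi w subfield_CD(5,9)[OF F] by metis

lemma small_degree_zero:
  assumes p: "p \<in> polys F" "poly p xi = 0" "degree p < l"
  shows "p = 0"
  using binomial_irreducible[OF F l xi(1) not_power refl p(1) _ p(2)] p(3) by fastforce

text \<open>Conjugation in the extension is expressed by polynomials over \<open>F\<close>: a
  polynomial that kills \<open>xi\<close> is divisible by \<open>X ^ l - xi ^ l\<close>, which also
  has the root \<open>w ^ k * xi\<close>.\<close>

lemma conjugate_root:
  assumes p: "p \<in> polys F" "poly p xi = 0"
  shows "poly p (w ^ k * xi) = 0"
proof -
  let ?f = "monom 1 l - [:xi ^ l:]"
  have f: "?f \<in> polys F" by (intro polys_closed[OF R] xi subfield_CD[OF F])
  have df: "degree ?f = l" by (rule degree_monom_minus_const[OF l_pos])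
  have lf: "lead_coeff ?f = 1" unfolding df using l_pos by (simp add: coeff_pCons split: nat.split)
  obtain q s where qs: "q \<in> polys F" "s \<in> polys F" "p = ?f * q + s" "degree s < degree ?f"
    using monic_division[OF R f lf _ p(1)] df l_pos by auto
  have "poly s xi = 0" using p(2) qs(3) by (simp add: poly_monom)
  then have "s = 0" using small_degree_zero qs df by simp
  moreover have "(w ^ k * xi) ^ l = xi ^ l"
    unfolding power_mult_distrib power_mult[symmetric] mult.commute[of k] by (simp add: power_mult w)
  ultimately show ?thesis using qs(3) by (simp add: poly_monom)
qed

text \<open>Conjugation fixes \<open>z ^ l\<close>, so it multiplies \<open>z\<close> by some
  \<open>w ^ i\<close>. Comparison of the coefficients of the powers of \<open>xi\<close> leaves
  only the \<open>i\<close>-th one.\<close>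

lemma l_th_root_in_extension:
  assumes z: "z \<in> adjoin F xi l" "z ^ l \<in> F"
  shows "\<exists>i<l. \<exists>d\<in>F. z = d * xi ^ i"
proof -
  obtain a where a: "z = (\<Sum>k<l. a k * xi ^ k)" "\<And>k. a k \<in> F" using z(1) by (auto simp: adjoin_def)
  define p where "p = (\<Sum>k<l. monom (a k) k)"
  have pF: "p \<in> polys F" using a(2) subfield_CD(1)[OF F] by (auto simp: p_def polys_def coeff_sum)
  have pz: "poly p x = (\<Sum>k<l. a k * x ^ k)" for x by (simp add: p_def poly_sum poly_monom)
  have "p ^ l - [:z ^ l:] \<in> polys F" by (intro polys_closed[OF R] pF z(2))
  moreover have "poly (p ^ l - [:z ^ l:]) xi = 0" using a(1) pz[of xi] by simp
  ultimately have "poly (p ^ l - [:z ^ l:]) (w ^ 1 * xi) = 0" by (rule conjugate_root)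
  then have "poly p (w * xi) ^ l = z ^ l" by simp
  from root_differs_by_unity[OF l w(2,3) this] obtain i where i: "i < l" "poly p (w * xi) = w ^ i * z" by blast
  define q where "q = (\<Sum>k<l. monom (a k * (w ^ k - w ^ i)) k)"
  have cq: "coeff q k = (if k < l then a k * (w ^ k - w ^ i) else 0)" for k by (simp add: q_def coeff_sum)
  have "a k * (w ^ k - w ^ i) \<in> F" for k using a(2) w by (auto intro: subfield_CD[OF F])
  then have qF: "q \<in> polys F" using subfield_CD(1)[OF F] by (auto simp: polys_def cq)
  have "poly q xi = poly p (w * xi) - w ^ i * poly p xi"
    unfolding pz by (simp add: q_def poly_sum poly_monom sum_subtractf sum_distrib_left algebra_simps power_mult_distrib)
  also have "\<dots> = 0" using i(2) a(1) pz[of xi] by simp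
  finally have "poly q xi = 0" .
  moreover have "degree q < l" using l_pos by (intro degree_lessI) (auto simp: cq)
  ultimately have q0: "q = 0" by (intro small_degree_zero qF)
  have "a k = 0" if k: "k < l" "k \<noteq> i" for k
  proof -
    have "w ^ k \<noteq> w ^ i" using inj_onD[OF prime_root_of_unity_powers(2)[OF l w(2,3)], of k i] k i(1) by auto
    moreover have "a k * (w ^ k - w ^ i) = 0" using cq[of k] q0 k by simp
    ultimately show ?thesis by simp
  qed
  then have "z = (\<Sum>k<l. if k = i then a i * xi ^ i else 0)" unfolding a(1) by (intro sum.cong) auto
  then show ?thesis using i(1) a(2) by auto
qed

text \<open>Take norms: the norm \<open>N\<close> of \<open>u\<close> lies in \<open>F\<close> and
  satisfies \<open>N ^ l = (y * c ^ i) ^ l * (xi ^ l) ^ i\<close>. So \<open>(xi ^ l) ^ i\<close> is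
  an \<open>l\<close>-th power in \<open>F\<close>, and then so is \<open>xi ^ l\<close>, because
  \<open>i\<close> is prime to \<open>l\<close>.\<close>

lemma no_root_of_generator:
  assumes u: "u \<in> adjoin F xi l" and y: "y \<in> F" "y \<noteq> 0" and i: "\<not> l dvd i" and eq: "u ^ l = y * xi ^ i"
  shows False
proof -
  obtain a where a: "u = (\<Sum>k<l. a k * xi ^ k)" "\<And>k. a k \<in> F" using u by (auto simp: adjoin_def)
  define p where "p = (\<Sum>k<l. monom (a k) k)"
  have pF: "p \<in> polys F" using a(2) subfield_CD(1)[OF F] by (auto simp: p_def polys_def coeff_sum)
  have pu: "poly p xi = u" using a(1) by (simp add: p_def poly_sum poly_monom)
  have conj: "poly p (w ^ k * xi) ^ l = y * (w ^ k * xi) ^ i" for k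
  proof -
    have "p ^ l - monom y i \<in> polys F" by (intro polys_closed[OF R] pF y(1))
    moreover have "poly (p ^ l - monom y i) xi = 0" using eq pu by (simp add: poly_monom)
    ultimately have "poly (p ^ l - monom y i) (w ^ k * xi) = 0" by (rule conjugate_root)
    then show ?thesis by (simp add: poly_monom)
  qed
  \<comment> \<open>The norm as a polynomial. It is invariant under replacing \<open>X\<close> by
    \<open>w X\<close>, hence a polynomial in \<open>X ^ l\<close>, and so its value at
    \<open>xi\<close> lies in \<open>F\<close>.\<close>
  define P where "P = (\<Prod>k<l. pcompose p [:0, w ^ k:])"
  have PF: "P \<in> polys F" unfolding P_def
  proof (rule polys_prod[OF R])
    fix k
    show "pcompose p [:0, w ^ k:] \<in> polys F"
      using pF w(1) by (auto simp: polys_def coeff_pcompose_linear intro!: subfield_CD[OF F])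
  qed
  have "pcompose P [:0, w:] = (\<Prod>k<l. pcompose p [:0, w ^ Suc k:])"
    unfolding P_def pcompose_prod by (simp add: pcompose_assoc[symmetric] pcompose_pCons mult.commute)
  also have "\<dots> = P"
  proof -
    obtain m where m: "l = Suc m" using l_pos by (cases l) auto
    have "(\<Prod>k<Suc m. pcompose p [:0, w ^ Suc k:]) = (\<Prod>k<m. pcompose p [:0, w ^ Suc k:]) * pcompose p [:0, w ^ Suc m:]" by simp
    also have "w ^ Suc m = w ^ 0" using w(2) m by simp
    also have "(\<Prod>k<m. pcompose p [:0, w ^ Suc k:]) * pcompose p [:0, w ^ 0:] = (\<Prod>k<Suc m. pcompose p [:0, w ^ k:])"
      unfolding prod.lessThan_Suc_shift by (simp add: mult.commute)
    finally show ?thesis unfolding P_def m .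
  qed
  finally have inv: "pcompose P [:0, w:] = P" .
  have c0: "coeff P j = 0" if "\<not> l dvd j" for j
  proof -
    have "coeff P j * w ^ j = coeff P j" using arg_cong[OF inv, of "\<lambda>p. coeff p j"] by (simp add: coeff_pcompose_linear mult.commute)
    moreover have "w ^ j \<noteq> 1" using prime_root_of_unity_powers(1)[OF l w(2,3)] that by blast
    ultimately show ?thesis by simp
  qed
  define N where "N = poly P xi"
  have NF: "N \<in> F" unfolding N_def poly_altdef
  proof (rule subfield_C_sum[OF F])
    fix j
    show "coeff P j * xi ^ j \<in> F"
    proof (cases "l dvd j")
      case True
      then have "xi ^ j \<in> F" using xi(1) subfield_CD(9)[OF F] by (auto elim!: dvdE simp: power_mult)
      then show ?thesis using PF subfield_CD(5)[OF F] by (simp add: polys_def)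
    qed (use c0 subfield_CD(1)[OF F] in simp)
  qed
  have "N = (\<Prod>k<l. poly p (w ^ k * xi))" by (simp add: N_def P_def poly_prod poly_pcompose mult.commute)
  then have "N ^ l = (\<Prod>k<l. y * (w ^ k * xi) ^ i)" by (simp add: prod_power_distrib conj)
  also have "\<dots> = y ^ l * (\<Prod>k<l. w ^ k * xi) ^ i"
    unfolding prod_power_distrib[symmetric] prod.distrib by simp
  also have "(\<Prod>k<l. w ^ k * xi) = c ^ l * xi ^ l" by (simp add: prod.distrib c(2))
  finally have "(N / (y * c ^ i)) ^ l = (xi ^ l) ^ i"
    using y(2) nz by (simp add: power_divide power_mult_distrib mult.commute flip: power_mult)
  moreover have "N / (y * c ^ i) \<in> F" using NF y c by (intro subfield_CD[OF F])
  moreover have "coprime i l" using i prime_imp_coprime[OF l] by (simp add: coprime_commute)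
  moreover have "xi ^ l \<noteq> 0" using nz by simp
  ultimately have "\<exists>z\<in>F. z ^ l = xi ^ l" by (intro coprime_power_root[OF F xi(1) _ _ _ _ l_pos])
  then show False using not_power by blast
qed

end

section \<open>Chevalley's theorem on units\<close>

definition zt :: "nat \<Rightarrow> nat \<Rightarrow> complex" where "zt l j = cis (2 * pi / real (l ^ j))"

lemma zt_Suc: "l > 0 \<Longrightarrow> zt l (Suc j) ^ l = zt l j"
  by (simp add: zt_def Complex.DeMoivre)

lemma zt_0: "zt l 0 = 1"
  by (simp add: zt_def)

lemma zt_nonzero: "zt l j \<noteq> 0"
  by (simp add: zt_def)

lemma zt_power: "l > 0 \<Longrightarrow> zt l (j + i) ^ (l ^ i) = zt l j"
proof (induction i)
  case (Suc i)
  have "zt l (j + Suc i) ^ (l ^ Suc i) = (zt l (Suc (j + i)) ^ l) ^ (l ^ i)" by (simp add: power_mult)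
  then show ?case using Suc by (simp add: zt_Suc)
qed simp

lemma zt_order: "l > 0 \<Longrightarrow> zt l j ^ (l ^ j) = 1"
  using zt_power[of l 0 j] by (simp add: zt_0)

lemma zt_inj:
  assumes "l > 0"
  shows "inj_on (\<lambda>k. zt l j ^ k) {..<l ^ j}"
proof -
  have "bij_betw (\<lambda>k. cis (2 * pi * real k / real (l ^ j))) {..<l ^ j} {z. z ^ (l ^ j) = 1}"
    using assms by (intro Complex.bij_betw_roots_unity) auto
  moreover have "zt l j ^ k = cis (2 * pi * real k / real (l ^ j))" for k
    by (simp add: zt_def Complex.DeMoivre mult.commute)
  ultimately show ?thesis by (simp add: bij_betw_def)
qed

lemma zt_1:
  assumes "prime (l::nat)"
  shows "zt l 1 ^ l = 1" "zt l 1 \<noteq> 1"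
proof -
  show "zt l 1 ^ l = 1" using zt_Suc[of l 0] prime_gt_0_nat[OF assms] by (simp add: zt_0)
  show "zt l 1 \<noteq> 1"
    using inj_onD[OF zt_inj[of l 1], of 0 1] prime_gt_1_nat[OF assms] by auto
qed

lemma zt_closed:
  assumes "subring_C R" "zt l k \<in> R" "j \<le> k" "l > 0"
  shows "zt l j \<in> R"
  using zt_power[OF assms(4), of j "k - j"] assms(1-3) subring_CD(7) by (metis le_add_diff_inverse)

text \<open>Lagrange interpolation on the \<open>q\<close>-th roots of unity, \<open>q = l ^ s\<close>, provides a polynomial which takes every
  \<open>q\<close>-th root of unity to an \<open>l\<close>-th root of it; hence in a ring where \<open>l\<close> is invertible and which contains
  the relevant roots of unity every solution of \<open>e ^ q = 1\<close> is an \<open>l\<close>-th power.\<close>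

lemma root_of_unity_is_power_mod:
  assumes R: "subring_C R" and l: "prime (l::nat)" and xi: "zt l (Suc s) \<in> R"
    and M: "coprime (M::nat) l" and e: "e \<in> R" "e ^ (l ^ s) - 1 = of_nat M * v" "v \<in> R"
  shows "\<exists>r\<in>R. \<exists>v\<in>R. r ^ l - e = of_nat M * v"
proof -
  note l0 = prime_gt_0_nat[OF l]
  note RD = subring_CD[OF R] and RP = polys_closed[OF R]
  let ?q = "l ^ s" and ?z = "zt l s" and ?x = "zt l (Suc s)"
  have q0: "?q > 0" using l0 by simp
  have zR: "?z \<in> R" using zt_closed[OF R xi] l0 by simp
  define zi where "zi = ?z ^ (?q - 1)"
  have "zi * ?z = ?z ^ ?q" unfolding zi_def using q0 by (simp flip: power_Suc2)
  then have zz: "zi * ?z = 1" using zt_order l0 by simp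
  have z1: "?z ^ ?q = 1" "zi ^ ?q = 1"
    using zt_order[OF l0, of s] unfolding zi_def power_mult[symmetric] mult.commute[of "_ - 1"] by (simp_all add: power_mult)
  \<comment> \<open>\<open>V\<close> takes \<open>?z ^ k\<close> to \<open>?q * ?x ^ k\<close>. The
    factor \<open>?q\<close> avoids divisions in \<open>R\<close>; it is inverted modulo
    \<open>M\<close> at the end by Bezout.\<close>
  define V where "V = (\<Sum>i<?q. \<Sum>j<?q. monom (?x ^ i * zi ^ (i * j)) j)"
  have VR: "V \<in> polys R"
    unfolding V_def polys_def mem_Collect_eq coeff_sum coeff_monom
    by (intro allI subring_C_sum[OF R]) (auto intro!: RD xi zR simp: zi_def)
  have Vk: "poly V (?z ^ k) = of_nat ?q * ?x ^ k" if k: "k < ?q" for k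
  proof -
    have inner: "(\<Sum>j<?q. (zi ^ i * ?z ^ k) ^ j) = (if i = k then of_nat ?q else 0)" if i: "i < ?q" for i
    proof -
      define u where "u = zi ^ i * ?z ^ k"
      have uz: "u * ?z ^ i = ?z ^ k"
      proof -
        have "u * ?z ^ i = (zi * ?z) ^ i * ?z ^ k" by (simp add: u_def power_mult_distrib)
        then show ?thesis using zz by simp
      qed
      have "u ^ ?q = 1" unfolding u_def power_mult_distrib power_mult[symmetric] mult.commute[of _ ?q]
        by (simp add: power_mult z1)
      then have "(1 - u) * (\<Sum>j<?q. u ^ j) = 0" by (simp flip: one_diff_power_eq)
      moreover have "u = 1 \<longleftrightarrow> i = k"
        using uz inj_onD[OF zt_inj[OF l0, of s], of i k] i k zt_nonzero[of l s] by auto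
      ultimately show ?thesis unfolding u_def[symmetric] by auto
    qed
    have "poly V (?z ^ k) = (\<Sum>i<?q. ?x ^ i * (\<Sum>j<?q. (zi ^ i * ?z ^ k) ^ j))"
      unfolding V_def poly_sum poly_monom sum_distrib_left
      by (intro sum.cong refl) (simp add: power_mult_distrib power_mult mult.assoc)
    also have "\<dots> = (\<Sum>i<?q. if i = k then of_nat ?q * ?x ^ k else 0)"
      by (intro sum.cong refl) (simp add: inner)
    also have "\<dots> = of_nat ?q * ?x ^ k" using k by simp
    finally show ?thesis .
  qed
  \<comment> \<open>\<open>G\<close> vanishes at all \<open>?q\<close>-th roots of unity and so is
    divisible by \<open>X ^ ?q - 1\<close>; its value at \<open>e\<close> is therefore 0 modulo
    \<open>M\<close>.\<close>
  define G where "G = V ^ l - monom (of_nat ?q ^ l) 1"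
  have GR: "G \<in> polys R" unfolding G_def by (intro RP VR RD)
  have Gk: "poly G (?z ^ k) = 0" if "k < ?q" for k
  proof -
    have "(?x ^ k) ^ l = ?z ^ k" using zt_Suc[OF l0, of s]
      unfolding power_mult[symmetric] mult.commute[of k] by (simp add: power_mult)
    then show ?thesis by (simp add: G_def Vk[OF that] power_mult_distrib poly_monom)
  qed
  let ?f = "monom 1 ?q - [:1:] :: complex poly"
  have f: "?f \<in> polys R" by (intro RP RD)
  have df: "degree ?f = ?q" by (rule degree_monom_minus_const[OF q0])
  have lf: "lead_coeff ?f = 1" unfolding df using q0 by (simp add: coeff_pCons split: nat.split)
  obtain W t where Wt: "W \<in> polys R" "t \<in> polys R" "G = ?f * W + t" "degree t < degree ?f"
    using monic_division[OF R f lf _ GR] df q0 by auto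
  have "t = 0"
  proof (rule ccontr)
    assume t0: "t \<noteq> 0"
    have "(\<lambda>k. ?z ^ k) ` {..<?q} \<subseteq> {x. poly t x = 0}"
    proof clarify
      fix k assume "k < ?q"
      moreover have "(?z ^ k) ^ ?q = 1" unfolding power_mult[symmetric] mult.commute[of k] by (simp add: power_mult z1)
      ultimately show "poly t (?z ^ k) = 0" using Gk[of k] Wt(3) by (simp add: poly_monom)
    qed
    then have "card ((\<lambda>k. ?z ^ k) ` {..<?q}) \<le> card {x. poly t x = 0}" by (intro card_mono poly_roots_finite t0)
    also have "\<dots> \<le> degree t" by (rule poly_roots_degree[OF t0])
    finally show False using Wt(4) df card_image[OF zt_inj[OF l0, of s]] by simp
  qed
  then have "poly G e = (e ^ ?q - 1) * poly W e" using Wt(3) by (simp add: poly_monom)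
  then have Ge: "poly V e ^ l - of_nat ?q ^ l * e = of_nat M * (v * poly W e)"
    using e(2) by (simp add: G_def poly_monom)
  have "coprime (int ?q) (int M)" using M by (simp add: coprime_commute)
  then obtain a b where ab: "a * int ?q + b * int M = 1"
    using bezout_int[of "int ?q" "int M"] by (auto simp: coprime_iff_gcd_eq_1)
  have "int M dvd (a * int ?q) ^ l - 1"
  proof -
    have "1 - a * int ?q = int M * b" using ab by (simp add: algebra_simps)
    then have "int M dvd 1 - a * int ?q" by simp
    then have "int M dvd 1 - (a * int ?q) ^ l" unfolding one_diff_power_eq by (rule dvd_mult2)
    then show ?thesis by (simp only: dvd_diff_commute)
  qed
  then obtain d where d: "(a * int ?q) ^ l - 1 = int M * d" by (auto elim: dvdE)
  define r where "r = of_int a * poly V e"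
  have VeR: "poly V e \<in> R" "poly W e \<in> R" using polys_closed(10)[OF R] VR Wt e by auto
  have "r ^ l - e = of_int a ^ l * (poly V e ^ l - of_nat ?q ^ l * e) + of_int ((a * int ?q) ^ l - 1) * e"
    by (simp add: r_def power_mult_distrib algebra_simps)
  also have "\<dots> = of_nat M * (of_int a ^ l * (v * poly W e) + of_int d * e)"
    unfolding Ge d by (simp add: algebra_simps)
  finally have "r ^ l - e = of_nat M * (of_int a ^ l * (v * poly W e) + of_int d * e)" .
  moreover have "r \<in> R" unfolding r_def by (intro RD VeR)
  moreover have "of_int a ^ l * (v * poly W e) + of_int d * e \<in> R" by (intro RD VeR e)
  ultimately show ?thesis by blast
qed

lemma units_of_integersD:
  assumes "u \<in> units_of_integers K"
  shows "u \<in> ring_of_integers K" "inverse u \<in> ring_of_integers K" "u \<noteq> 0" "u \<in> K" "algebraic_int u"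
  using assms by (auto simp: units_of_integers_def ring_of_integers_def)

lemma units_mono: "K \<subseteq> K' \<Longrightarrow> units_of_integers K \<subseteq> units_of_integers K'"
  by (auto simp: units_of_integers_def ring_of_integers_def)

lemma root_of_unit:
  assumes K: "subfield_C K" and "v \<in> K" "v ^ m \<in> units_of_integers K" "m > 0"
  shows "v \<in> units_of_integers K"
proof -
  have ai: "algebraic_int x" if "algebraic_int (x ^ m)" for x :: complex
    by (rule algebraic_int_root[OF that, of "monom 1 m"]) (use assms(4) in \<open>auto simp: poly_monom degree_monom_eq\<close>)
  note u = units_of_integersD[OF assms(3)]
  have "algebraic_int v" using ai u(5) by blast
  moreover have "algebraic_int (inverse v)" using ai[of "inverse v"] u(2) by (simp add: ring_of_integers_def power_inverse)
  moreover have "v \<noteq> 0" using u(3) assms(4) by auto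
  ultimately show ?thesis using assms(2) subfield_CD(6)[OF K] by (auto simp: units_of_integers_def ring_of_integers_def)
qed

lemma finite_common_modulus:
  assumes "finite X" "\<And>x. x \<in> X \<Longrightarrow> \<exists>M>0. coprime M (l::nat) \<and> P x M"
    and "\<And>x M N. x \<in> X \<Longrightarrow> P x M \<Longrightarrow> P x (M * N)"
  shows "\<exists>M>0. coprime M l \<and> (\<forall>x\<in>X. P x (M::nat))"
  using assms
proof (induction X)
  case empty
  then show ?case by (intro exI[of _ 1]) auto
next
  case (insert x X)
  obtain M where M: "M > 0" "coprime M l" "\<And>y. y \<in> X \<Longrightarrow> P y M" using insert by auto
  obtain N where N: "N > 0" "coprime N l" "P x N" using insert.prems(1)[of x] by auto
  have "P y (M * N)" if "y \<in> insert x X" for y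
    using that insert.prems(2)[of x N M] N M insert.prems(2)[of y M N] by (auto simp: mult.commute)
  then show ?case using M N by (intro exI[of _ "M * N"]) auto
qed

text \<open>One modulus detects \<open>l\<close>-th powers for all units, since there are finitely many classes modulo \<open>l\<close>-th powers.\<close>

lemma unit_power_residue_uniform:
  assumes nf: "number_field K" and l: "prime (l::nat)" and w: "w \<in> K" "w ^ l = 1" "w \<noteq> 1"
  shows "\<exists>M>0. coprime M l \<and> (\<forall>y\<in>units_of_integers K.
    (\<exists>r\<in>ring_of_integers K. \<exists>z\<in>ring_of_integers K. r ^ l - y = of_nat M * z) \<longrightarrow> (\<exists>z\<in>K. z ^ l = y))"
proof -
  obtain b n where nb: "number_field_basis K b n" using number_field_obtain_basis[OF nf] .
  interpret number_field_basis K b n by (rule nb)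
  note RD = ring_of_integersD[OF K]
  note U = mult_subgroup_units[OF K]
  let ?U = "units_of_integers K"
  define Pw where "Pw M y \<longleftrightarrow> (\<exists>r\<in>OK. \<exists>z\<in>OK. r ^ l - y = of_nat M * z)" for M :: nat and y
  obtain e r where er: "\<And>i. i < r \<Longrightarrow> e i \<noteq> 0" "?U = mspan e r" using units_fg by blast
  obtain X where X: "finite X" "X \<subseteq> ?U" "\<And>z. z \<in> ?U \<Longrightarrow> \<exists>f\<in>X. \<exists>v\<in>?U. z = f * v ^ l"
    using mspan_finite_mod_powers[of r e l] er prime_gt_0_nat[OF l] by metis
  define Y where "Y = {f \<in> X. \<not> (\<exists>z\<in>K. z ^ l = f)}"
  have "\<exists>M>0. coprime M l \<and> (\<forall>f\<in>Y. \<not> Pw M f)"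
  proof (rule finite_common_modulus)
    show "finite Y" using X by (simp add: Y_def)
    show "\<exists>M>0. coprime M l \<and> \<not> Pw M f" if fY: "f \<in> Y" for f
    proof (rule ccontr)
      assume no: "\<not> (\<exists>M>0. coprime M l \<and> \<not> Pw M f)"
      have "\<exists>z\<in>K. z ^ l = f"
      proof (rule unit_power_residue[OF nf l w])
        show "f \<in> ?U" using fY X(2) by (auto simp: Y_def)
        fix M :: nat assume "M > 0" "coprime M l"
        then have "Pw M f" using no by blast
        then show "\<exists>r\<in>OK. \<exists>z\<in>OK. r ^ l - f = of_nat M * z" by (simp only: Pw_def)
      qed
      then show False using fY by (simp add: Y_def)
    qed
    show "\<not> Pw (M * N) f" if no: "\<not> Pw M f" for f M N
    proof
      assume "Pw (M * N) f"
      then obtain r z where rz: "r \<in> OK" "z \<in> OK" "r ^ l - f = of_nat (M * N) * z" by (auto simp: Pw_def)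
      have "r ^ l - f = of_nat M * (of_nat N * z)" using rz(3) by simp
      then have "Pw M f" unfolding Pw_def by (intro bexI[OF _ rz(1)] bexI[OF _ RD(7)[OF RD(4) rz(2)]])
      then show False using no by simp
    qed
  qed
  then obtain M where M: "M > 0" "coprime M l" "\<And>f. f \<in> Y \<Longrightarrow> \<not> Pw M f" by blast
  have "\<exists>z\<in>K. z ^ l = y" if y: "y \<in> ?U" and res: "Pw M y" for y
  proof -
    obtain f v where fv: "f \<in> X" "v \<in> ?U" "y = f * v ^ l" using X(3)[OF y] by blast
    note v = units_of_integersD[OF fv(2)]
    obtain r z where rz: "r \<in> OK" "z \<in> OK" "r ^ l - y = of_nat M * z" using res by (auto simp: Pw_def)
    have "(r * inverse v) ^ l - f = (r ^ l - y) * inverse v ^ l"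
      using v(3) by (simp add: fv(3) power_mult_distrib power_inverse left_diff_distrib)
    then have "(r * inverse v) ^ l - f = of_nat M * (z * inverse v ^ l)" using rz by simp
    moreover have "r * inverse v \<in> OK" "z * inverse v ^ l \<in> OK" using rz v RD by auto
    ultimately have "Pw M f" unfolding Pw_def by blast
    then have "f \<notin> Y" using M(3) by blast
    then obtain z where "z \<in> K" "z ^ l = f" using fv(1) by (auto simp: Y_def)
    then have "(z * v) ^ l = y" "z * v \<in> K" using fv(3) v(4) subfield_CD(5)[OF K] by (auto simp: power_mult_distrib)
    then show ?thesis by blast
  qed
  then show ?thesis using M(1,2) unfolding Pw_def by blast
qed

text \<open>Starting from an \<open>a\<close> with \<open>zt l a\<close> but not
  \<open>zt l (Suc a)\<close> in \<open>K\<close>, every step adjoins an \<open>l\<close>-th root of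
  the preceding root of unity and is a proper Kummer extension.\<close>

fun cyc_tower :: "complex set \<Rightarrow> nat \<Rightarrow> nat \<Rightarrow> nat \<Rightarrow> complex set" where
  "cyc_tower K l a 0 = K"
| "cyc_tower K l a (Suc m) = adjoin (cyc_tower K l a m) (zt l (Suc (a + m))) l"

context
  fixes K :: "complex set" and l :: nat and c :: complex and a :: nat
  assumes nf: "number_field K" and l: "prime l" and z1: "zt l 1 \<in> K"
    and c: "c \<in> K" "c ^ l = (\<Prod>k<l. zt l 1 ^ k)"
    and a: "a \<ge> 1" "zt l a \<in> K" "zt l (Suc a) \<notin> K"
begin

private lemma l0: "l > 0" using l by (simp add: prime_gt_0_nat)

lemma cyc_tower_step:
  "number_field (cyc_tower K l a m)" "K \<subseteq> cyc_tower K l a m" "zt l (a + m) \<in> cyc_tower K l a m"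
proof (induction m)
  case 0
  { case 1 show ?case using nf by simp }
  { case 2 show ?case by simp }
  { case 3 show ?case using a by simp }
next
  case (Suc m)
  have sf: "subfield_C (cyc_tower K l a m)" using Suc(1) by (simp add: number_field_def)
  have e: "zt l (Suc (a + m)) ^ l \<in> adjoin (cyc_tower K l a m) (zt l (Suc (a + m))) l"
    using zt_Suc[OF l0, of "a + m"] adjoin_base[OF subfield_C_subring[OF sf] l0 Suc(3)] by simp
  note adj = number_field_adjoin[OF Suc(1) l0 e]
  { case 1 show ?case using adj(1) by simp }
  { case 2 show ?case using adj(2) Suc(2) by auto }
  { case 3 show ?case using adj(3) by simp }
qed

private lemma kummer_step:
  assumes "zt l (Suc (a + m)) \<notin> cyc_tower K l a m"
  shows "kummer_extension (cyc_tower K l a m) l (zt l 1) c (zt l (Suc (a + m)))"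
proof
  show "subfield_C (cyc_tower K l a m)" using cyc_tower_step(1)[of m] by (simp add: number_field_def)
  show "zt l (Suc (a + m)) ^ l \<in> cyc_tower K l a m" using zt_Suc[OF l0] cyc_tower_step(3)[of m] by simp
qed (use assms l z1 c zt_1[OF l] cyc_tower_step(2)[of m] in auto)

text \<open>If the next root of unity were already present, the generator of the current step would
  be an \<open>l\<close>-th power in the extension it generates, which
  \<open>no_root_of_generator\<close> excludes.\<close>

private lemma tower_strict: "zt l (Suc (a + m)) \<notin> cyc_tower K l a m"
proof (induction m)
  case 0
  then show ?case using a by simp
next
  case (Suc m)
  interpret X: kummer_extension "cyc_tower K l a m" l "zt l 1" c "zt l (Suc (a + m))" by (rule kummer_step[OF Suc])
  show ?case
  proof
    assume "zt l (Suc (a + Suc m)) \<in> cyc_tower K l a (Suc m)"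
    then have u: "zt l (Suc (Suc (a + m))) \<in> adjoin (cyc_tower K l a m) (zt l (Suc (a + m))) l" by simp
    have "zt l (Suc (Suc (a + m))) ^ l = 1 * zt l (Suc (a + m)) ^ 1" using zt_Suc[OF l0] by simp
    then show False
      using X.no_root_of_generator[OF u subfield_CD(2)[OF X.F], of 1] prime_gt_1_nat[OF l] by auto
  qed
qed

text \<open>At the top step the root has the form \<open>d * xi ^ i\<close>. If \<open>i\<close> is
  nonzero and this is not the first step, \<open>y\<close> times a power of the previous generator
  becomes an \<open>l\<close>-th power, against \<open>no_root_of_generator\<close>. So only the
  first step contributes, by a power of \<open>zt l a\<close>.\<close>

lemma l_th_root_descent:
  assumes y: "y \<in> K" "y \<noteq> 0" and z: "z \<in> cyc_tower K l a m" "z ^ l = y"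
  shows "\<exists>i. \<exists>v\<in>K. y = zt l a ^ i * v ^ l"
  using z
proof (induction m arbitrary: z)
  case 0
  then show ?case by (intro exI[of _ 0] bexI[of _ z]) auto
next
  case (Suc m)
  interpret X: kummer_extension "cyc_tower K l a m" l "zt l 1" c "zt l (Suc (a + m))" by (rule kummer_step[OF tower_strict])
  have "y \<in> cyc_tower K l a m" using y cyc_tower_step(2) by auto
  then obtain i d where id: "i < l" "d \<in> cyc_tower K l a m" "z = d * zt l (Suc (a + m)) ^ i"
    using X.l_th_root_in_extension[of z] Suc.prems by auto
  show ?case
  proof (cases "i = 0")
    case True
    then show ?thesis using Suc.IH[of d] id Suc.prems(2) by simp
  next
    case False
    have "(zt l (Suc (a + m)) ^ i) ^ l = (zt l (Suc (a + m)) ^ l) ^ i"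
      unfolding power_mult[symmetric] by (simp only: mult.commute)
    then have y2: "y = d ^ l * zt l (a + m) ^ i"
      using Suc.prems(2) id(3) zt_Suc[OF l0, of "a + m"] by (simp add: power_mult_distrib)
    show ?thesis
    proof (cases m)
      case 0
      then show ?thesis using y2 id(2) by (intro exI[of _ i] bexI[of _ d]) (auto simp: mult.commute)
    next
      case (Suc k)
      interpret Y: kummer_extension "cyc_tower K l a k" l "zt l 1" c "zt l (Suc (a + k))" by (rule kummer_step[OF tower_strict])
      \<comment> \<open>The exponent \<open>N - i\<close> inverts the \<open>i\<close>-th power of
        the root of unity; as \<open>l\<close> divides \<open>N\<close>, it is divisible by
        \<open>l\<close> only if \<open>i\<close> is.\<close>
      define N where "N = l ^ (a + m)"
      have lN: "l dvd N" "l \<le> N" using Suc l0 by (auto simp: N_def intro: dvd_imp_le)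
      have "zt l (a + m) ^ (N - i) * zt l (a + m) ^ i = 1"
        using zt_order[OF l0, of "a + m"] id(1) lN(2) by (simp add: N_def flip: power_add)
      then have "d ^ l = y * zt l (a + m) ^ (N - i)" unfolding y2 by (simp add: mult_ac)
      then have dl: "d ^ l = y * zt l (Suc (a + k)) ^ (N - i)" using Suc by simp
      have "\<not> l dvd N - i"
      proof
        assume "l dvd N - i"
        then have "l dvd i" using lN id(1) by (metis dvd_diffD1 le_trans less_imp_le)
        then show False using False id(1) by (auto dest: dvd_imp_le)
      qed
      moreover have "y \<in> cyc_tower K l a k" using y cyc_tower_step(2) by auto
      moreover have "d \<in> adjoin (cyc_tower K l a k) (zt l (Suc (a + k))) l" using id(2) Suc by simp
      ultimately show ?thesis using Y.no_root_of_generator dl y(2) by blast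
    qed
  qed
qed

end

section \<open>Powers of units detected by congruences\<close>

definition cong_one :: "complex set \<Rightarrow> nat \<Rightarrow> complex \<Rightarrow> bool" where
  "cong_one K M x \<longleftrightarrow> (\<exists>v\<in>ring_of_integers K. x - 1 = of_nat M * v)"

lemma cong_one_mult:
  assumes K: "subfield_C K" and c: "cong_one K (M * N) x"
  shows "cong_one K M x" "cong_one K N x"
proof -
  obtain v where v: "v \<in> ring_of_integers K" "x - 1 = of_nat (M * N) * v" using c by (auto simp: cong_one_def)
  then have "x - 1 = of_nat M * (of_nat N * v)" "x - 1 = of_nat N * (of_nat M * v)" by (auto simp: mult_ac)
  moreover have "of_nat N * v \<in> ring_of_integers K" "of_nat M * v \<in> ring_of_integers K"
    by (intro ring_of_integersD[OF K] v)+
  ultimately show "cong_one K M x" "cong_one K N x" unfolding cong_one_def by blast+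
qed

lemma cong_one_mono: "K \<subseteq> K' \<Longrightarrow> cong_one K M x \<Longrightarrow> cong_one K' M x"
  by (auto simp: cong_one_def ring_of_integers_def)

text \<open>Induction on \<open>s\<close>. If \<open>x = y ^ (l ^ s)\<close> is 1 modulo
  \<open>N\<close>, then \<open>y\<close> is an \<open>l\<close>-th power modulo \<open>N\<close> in
  a field \<open>K'\<close> with enough roots of unity, hence an \<open>l\<close>-th power there. In
  \<open>K\<close> this holds only up to roots of unity, but these disappear in
  \<open>y ^ (l ^ s)\<close>.\<close>

lemma chevalley_with_roots:
  assumes nf: "number_field K" and l: "prime (l::nat)" and z1: "zt l 1 \<in> K"
    and c: "c \<in> K" "c ^ l = (\<Prod>k<l. zt l 1 ^ k)"
  shows "\<exists>M>0. coprime M l \<and> (\<forall>x\<in>units_of_integers K. cong_one K M x \<longrightarrow> (\<exists>y\<in>units_of_integers K. x = y ^ (l ^ s)))"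
proof (induction s)
  case 0
  then show ?case by (intro exI[of _ 1]) auto
next
  case (Suc s)
  have K: "subfield_C K" using nf by (simp add: number_field_def)
  note l0 = prime_gt_0_nat[OF l]
  obtain M where M: "M > 0" "coprime M l"
    "\<And>x. x \<in> units_of_integers K \<Longrightarrow> cong_one K M x \<Longrightarrow> \<exists>y\<in>units_of_integers K. x = y ^ (l ^ s)"
    using Suc by blast
  obtain K' where K': "number_field K'" "K \<subseteq> K'" "zt l (Suc s) \<in> K'"
    and desc: "\<And>y z. y \<in> K \<Longrightarrow> y \<noteq> 0 \<Longrightarrow> z \<in> K' \<Longrightarrow> z ^ l = y \<Longrightarrow> \<exists>v\<in>K. y ^ (l ^ s) = v ^ (l ^ Suc s)"
  proof (cases "zt l (Suc s) \<in> K")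
    case True
    then show thesis using that[of K] nf by (force simp: power_mult)
  next
    case False
    have s1: "zt l 1 \<in> K \<and> 1 \<le> s" using z1 False by (cases s) auto
    \<comment> \<open>Since \<open>a\<close> is at most \<open>s\<close>, the factor
      \<open>zt l a ^ i\<close> arising in the descent is killed by the exponent
      \<open>l ^ s\<close>.\<close>
    define a where "a = (GREATEST j. zt l j \<in> K \<and> j \<le> s)"
    have aP: "zt l a \<in> K \<and> a \<le> s" unfolding a_def by (rule GreatestI_nat[of _ 1 s]) (use s1 in auto)
    have amax: "j \<le> a" if "zt l j \<in> K" "j \<le> s" for j
      unfolding a_def by (rule Greatest_le_nat[of _ _ s]) (use that in auto)
    have a1: "1 \<le> a" using amax s1 by blast
    have "zt l (Suc a) \<notin> K" using amax[of "Suc a"] False aP by (cases "a = s") auto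
    note T = nf l z1 c a1 conjunct1[OF aP] this
    let ?K' = "cyc_tower K l a (Suc s - a)"
    have "zt l (Suc s) \<in> ?K'" using cyc_tower_step(3)[OF T, of "Suc s - a"] aP by simp
    moreover have "\<exists>v\<in>K. y ^ (l ^ s) = v ^ (l ^ Suc s)" if y: "y \<in> K" "y \<noteq> 0" "z \<in> ?K'" "z ^ l = y" for y z
    proof -
      obtain i v where iv: "v \<in> K" "y = zt l a ^ i * v ^ l" using l_th_root_descent[OF T y] by blast
      have "l ^ s = l ^ a * l ^ (s - a)" using aP by (simp flip: power_add)
      then have "(zt l a ^ i) ^ (l ^ s) = ((zt l a ^ (l ^ a)) ^ i) ^ (l ^ (s - a))"
        by (simp only: power_mult[symmetric] mult_ac)
      also have "\<dots> = 1" using zt_order[OF l0, of a] by simp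
      finally have "y ^ (l ^ s) = (v ^ l) ^ (l ^ s)" unfolding iv(2) power_mult_distrib by simp
      also have "\<dots> = v ^ (l ^ Suc s)" by (simp add: power_mult)
      finally show ?thesis using iv(1) by blast
    qed
    ultimately show thesis using that[of ?K'] cyc_tower_step(1,2)[OF T] by blast
  qed
  have sK': "subfield_C K'" using K'(1) by (simp add: number_field_def)
  have w': "zt l 1 \<in> K'" using z1 K' by auto
  obtain N where N: "N > 0" "coprime N l" and Nres: "\<And>y r z. y \<in> units_of_integers K' \<Longrightarrow> r \<in> ring_of_integers K' \<Longrightarrow>
     z \<in> ring_of_integers K' \<Longrightarrow> r ^ l - y = of_nat N * z \<Longrightarrow> \<exists>z\<in>K'. z ^ l = y"
    using unit_power_residue_uniform[OF K'(1) l w' zt_1[OF l]] by metis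
  have "\<exists>y\<in>units_of_integers K. x = y ^ (l ^ Suc s)" if x: "x \<in> units_of_integers K" "cong_one K (M * N) x" for x
  proof -
    obtain y where y: "y \<in> units_of_integers K" "x = y ^ (l ^ s)" using M(3)[OF x(1) cong_one_mult(1)[OF K x(2)]] by blast
    have yK': "y \<in> units_of_integers K'" using y units_mono[OF K'(2)] by blast
    note yd = units_of_integersD[OF y(1)]
    obtain v where v: "v \<in> ring_of_integers K'" "y ^ (l ^ s) - 1 = of_nat N * v"
      using cong_one_mono[OF K'(2) cong_one_mult(2)[OF K x(2)]] y(2) by (auto simp: cong_one_def)
    have "algebraic_int (zt l (Suc s))"
      by (rule algebraic_int_root[of 1 "monom 1 (l ^ Suc s)"])
        (use zt_order[OF l0, of "Suc s"] l0 in \<open>auto simp: poly_monom degree_monom_eq\<close>)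
    then have "zt l (Suc s) \<in> ring_of_integers K'" using K'(3) by (simp add: ring_of_integers_def)
    from root_of_unity_is_power_mod[OF ring_of_integers_subring[OF sK'] l this N(2) units_of_integersD(1)[OF yK'] v(2,1)]
    obtain r u where ru: "r \<in> ring_of_integers K'" "u \<in> ring_of_integers K'" "r ^ l - y = of_nat N * u" by blast
    obtain z where "z \<in> K'" "z ^ l = y" using Nres[OF yK' ru] by blast
    then obtain v where "v \<in> K" "y ^ (l ^ s) = v ^ (l ^ Suc s)" using desc[OF yd(4,3)] by blast
    then have v: "v \<in> K" "x = v ^ (l ^ Suc s)" using y(2) by auto
    have "v \<in> units_of_integers K" using root_of_unit[OF K v(1), of "l ^ Suc s"] v(2) x(1) l0 by simp
    then show ?thesis using v(2) by blast
  qed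
  moreover have "coprime (M * N) l" using M N by simp
  ultimately show ?case using M(1) N(1) by (intro exI[of _ "M * N"]) simp
qed

lemma mult_subgroup_coprime_powers:
  assumes U: "mult_subgroup E" and u: "u \<in> E" "v \<in> E" "x = u ^ a" "x = v ^ b" and ab: "coprime a b"
  shows "\<exists>w\<in>E. x = w ^ (a * b)"
proof -
  obtain s t where st: "s * int a + t * int b = 1"
    using bezout_int[of "int a" "int b"] ab by (auto simp: coprime_iff_gcd_eq_1)
  note nz = mult_subgroupD(5)[OF U u(1)] mult_subgroupD(5)[OF U u(2)]
  define w where "w = v powi s * u powi t"
  have "x \<noteq> 0" using u nz by simp
  then have "x = x powi (int a * s) * x powi (int b * t)"
    using st by (simp add: mult.commute flip: power_int_add)
  also have "x powi (int a * s) = (v powi s) ^ (a * b)"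
    unfolding u(4) by (simp add: power_int_power power_int_power' mult_ac)
  also have "x powi (int b * t) = (u powi t) ^ (a * b)"
    unfolding u(3) by (simp add: power_int_power power_int_power' mult_ac)
  finally have "x = w ^ (a * b)" by (simp add: w_def power_mult_distrib)
  moreover have "w \<in> E" unfolding w_def by (intro mult_subgroupD(4)[OF U] mult_subgroup_powi[OF U] u)
  ultimately show ?thesis by blast
qed

text \<open>In \<open>?K2\<close>, which contains \<open>zt l 1\<close> and the auxiliary
  \<open>c\<close>, the unit is even an \<open>l ^ (d + s)\<close>-th power. Raising its root to the
  isolator exponent \<open>N = q * l ^ d\<close> leads back to \<open>K\<close>: the surplus
  \<open>d\<close> absorbs the \<open>l\<close>-part of \<open>N\<close>, and \<open>q\<close>,
  being prime to \<open>l\<close>, is removed by Bezout.\<close>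

lemma chevalley_prime_power:
  assumes nf: "number_field K" and l: "prime (l::nat)"
  shows "\<exists>M>0. \<forall>x\<in>units_of_integers K. cong_one K M x \<longrightarrow> (\<exists>y\<in>units_of_integers K. x = y ^ (l ^ s))"
proof -
  note l0 = prime_gt_0_nat[OF l]
  have K: "subfield_C K" using nf by (simp add: number_field_def)
  have e1: "zt l 1 ^ l \<in> adjoin K (zt l 1) l"
    using adjoin_base[OF subfield_C_subring[OF K] l0 subfield_CD(2)[OF K]] zt_1[OF l] by simp
  note A1 = number_field_adjoin[OF nf l0 e1]
  let ?K1 = "adjoin K (zt l 1) l"
  have K1: "subfield_C ?K1" using A1(1) by (simp add: number_field_def)
  obtain c where c: "c ^ l = (\<Prod>k<l. zt l 1 ^ k)" using complex_root_exists[OF l0] by blast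
  have "c ^ l \<in> ?K1" unfolding c by (intro subfield_C_prod[OF K1] subfield_CD(9)[OF K1] A1(3))
  from adjoin_base[OF subfield_C_subring[OF K1] l0 this]
  have e2: "c ^ l \<in> adjoin ?K1 c l" .
  note A2 = number_field_adjoin[OF A1(1) l0 e2]
  let ?K2 = "adjoin ?K1 c l"
  have K2: "subfield_C ?K2" using A2(1) by (simp add: number_field_def)
  have KK2: "K \<subseteq> ?K2" using A1 A2 by blast
  have z: "zt l 1 \<in> ?K2" using A1 A2 by blast
  note U = mult_subgroup_units[OF K]
  obtain b n where nb: "number_field_basis ?K2 b n" using number_field_obtain_basis[OF A2(1)] .
  obtain e r where er: "\<And>i. i < r \<Longrightarrow> e i \<noteq> 0" "units_of_integers ?K2 = mspan e r"
    using number_field_basis.units_fg[OF nb] by blast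
  obtain N where N: "N > 0" "\<And>z j. z \<in> units_of_integers ?K2 \<Longrightarrow> j > 0 \<Longrightarrow> z ^ j \<in> units_of_integers K \<Longrightarrow> z ^ N \<in> units_of_integers K"
    using mspan_isolator[of r e, OF er(1) U] unfolding er(2) by blast
  obtain d q where q: "N = q * l ^ d" "\<not> l dvd q"
    using multiplicity_decompose'[of N l] N(1) l by (metis not_prime_unit mult.commute neq0_conv)
  obtain M where M: "M > 0" "\<And>x. x \<in> units_of_integers ?K2 \<Longrightarrow> cong_one ?K2 M x \<Longrightarrow> \<exists>y\<in>units_of_integers ?K2. x = y ^ (l ^ (d + s))"
    using chevalley_with_roots[OF A2(1) l z A2(3) c, of "d + s"] by blast
  have "\<exists>y\<in>units_of_integers K. x = y ^ (l ^ s)" if x: "x \<in> units_of_integers K" "cong_one K M x" for x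
  proof -
    have xU: "x \<in> units_of_integers ?K2" using x(1) units_mono[OF KK2] by blast
    obtain z where zz: "z \<in> units_of_integers ?K2" "x = z ^ (l ^ (d + s))"
      using M(2)[OF xU cong_one_mono[OF KK2 x(2)]] by blast
    have zN: "z ^ N \<in> units_of_integers K" using N(2)[OF zz(1), of "l ^ (d + s)"] zz(2) x(1) l0 by simp
    have xq: "x ^ q = (z ^ N) ^ (l ^ s)" unfolding zz(2) q(1) power_mult[symmetric] power_add by (simp only: mult_ac)
    have "coprime (l ^ s) q" using prime_imp_coprime[OF l q(2)] by simp
    then have g: "gcd (int (l ^ s)) (int q) = 1" by (simp only: coprime_int_iff coprime_iff_gcd_eq_1[symmetric])
    obtain s' t where st: "s' * int (l ^ s) + t * int q = 1"
      using bezout_int[of "int (l ^ s)" "int q"] unfolding g by blast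
    have x0: "x \<noteq> 0" using units_of_integersD(3)[OF x(1)] .
    define y where "y = x powi s' * (z ^ N) powi t"
    have "x = x powi (s' * int (l ^ s) + t * int q)" unfolding st by simp
    also have "\<dots> = x powi (int (l ^ s) * s') * (x ^ q) powi t"
      using x0 by (simp add: power_int_add power_int_power mult.commute)
    also have "(x ^ q) powi t = ((z ^ N) powi t) ^ (l ^ s)"
      unfolding xq by (simp only: power_int_power power_int_power' mult_ac)
    also have "x powi (int (l ^ s) * s') = (x powi s') ^ (l ^ s)"
      by (simp only: power_int_power' mult.commute)
    finally have "x = y ^ (l ^ s)" by (simp add: y_def power_mult_distrib)
    moreover have "y \<in> units_of_integers K" unfolding y_def
      by (intro mult_subgroupD(4)[OF U] mult_subgroup_powi[OF U] x zN)
    ultimately show ?thesis by blast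
  qed
  then show ?thesis using M(1) by blast
qed

text \<open>The moduli for the prime powers dividing \<open>m\<close> are multiplied; a unit that is
  a power for coprime exponents is one for their product.\<close>

theorem chevalley:
  assumes nf: "number_field K" and m: "m > 0"
  shows "\<exists>M>0. \<forall>x\<in>units_of_integers K. cong_one K M x \<longrightarrow> (\<exists>y\<in>units_of_integers K. x = y ^ m)"
proof -
  have K: "subfield_C K" using nf by (simp add: number_field_def)
  note U = mult_subgroup_units[OF K]
  have "\<exists>M>0. \<forall>x\<in>units_of_integers K. cong_one K M x \<longrightarrow> (\<exists>y\<in>units_of_integers K. x = y ^ (\<Prod>p\<in>P. p ^ k p))"
    if "finite P" "\<And>p. p \<in> P \<Longrightarrow> prime p" for P and k :: "nat \<Rightarrow> nat"
    using that
  proof (induction P)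
    case empty
    then show ?case by (intro exI[of _ 1]) auto
  next
    case (insert p P)
    obtain M where M: "M > 0" "\<And>x. x \<in> units_of_integers K \<Longrightarrow> cong_one K M x \<Longrightarrow> \<exists>y\<in>units_of_integers K. x = y ^ (\<Prod>p\<in>P. p ^ k p)"
      using insert by auto
    obtain N where N: "N > 0" "\<And>x. x \<in> units_of_integers K \<Longrightarrow> cong_one K N x \<Longrightarrow> \<exists>y\<in>units_of_integers K. x = y ^ (p ^ k p)"
      using chevalley_prime_power[OF nf, of p "k p"] insert.prems by auto
    have cop: "coprime (p ^ k p) (\<Prod>p\<in>P. p ^ k p)"
      using insert by (intro prod_coprime_right) (auto intro!: primes_coprime)
    have "\<exists>y\<in>units_of_integers K. x = y ^ (\<Prod>p\<in>insert p P. p ^ k p)"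
      if x: "x \<in> units_of_integers K" "cong_one K (M * N) x" for x
    proof -
      obtain u where u: "u \<in> units_of_integers K" "x = u ^ (\<Prod>p\<in>P. p ^ k p)" using M(2) x cong_one_mult[OF K] by blast
      obtain v where v: "v \<in> units_of_integers K" "x = v ^ (p ^ k p)" using N(2) x cong_one_mult[OF K] by blast
      show ?thesis using mult_subgroup_coprime_powers[OF U v(1) u(1) v(2) u(2) cop] insert(1,2) by simp
    qed
    then show ?case using M(1) N(1) by (intro exI[of _ "M * N"]) simp
  qed
  from this[of "prime_factors m" "\<lambda>p. multiplicity p m"]
  show ?thesis using prod_prime_factors[of m] m by auto
qed

text \<open>Choose \<open>m\<close> such that \<open>u\<close> is not in \<open>H\<close> even up to
  \<open>m\<close>-th powers, and then \<open>M\<close> such that units congruent to 1 are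
  \<open>m\<close>-th powers. An \<open>h\<close> congruent to \<open>u\<close> would make
  \<open>u / h\<close> an \<open>m\<close>-th power.\<close>

theorem unit_subgroup_congruence_closed:
  assumes nf: "number_field K" and H: "mult_subgroup H" "H \<subseteq> units_of_integers K"
    and u: "u \<in> units_of_integers K" "u \<notin> H"
  shows "\<exists>M>0. \<forall>h\<in>H. \<not> (\<exists>v\<in>ring_of_integers K. h - u = of_nat M * v)"
proof -
  have K: "subfield_C K" using nf by (simp add: number_field_def)
  note U = mult_subgroup_units[OF K]
  obtain b n where nb: "number_field_basis K b n" using number_field_obtain_basis[OF nf] .
  obtain e r where er: "\<And>i. i < r \<Longrightarrow> e i \<noteq> 0" "units_of_integers K = mspan e r"
    using number_field_basis.units_fg[OF nb] by blast
  obtain m where m: "m > 0" "\<And>x z. x \<in> H \<Longrightarrow> z \<in> units_of_integers K \<Longrightarrow> u \<noteq> x * z ^ m"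
    using mspan_subgroup_separable[of r e H u] er H u by auto
  obtain M where M: "M > 0" "\<And>x. x \<in> units_of_integers K \<Longrightarrow> cong_one K M x \<Longrightarrow> \<exists>y\<in>units_of_integers K. x = y ^ m"
    using chevalley[OF nf m(1)] by blast
  have False if h: "h \<in> H" and v: "v \<in> ring_of_integers K" "h - u = of_nat M * v" for h v
  proof -
    have hU: "h \<in> units_of_integers K" using h H by auto
    note hd = units_of_integersD[OF hU]
    have "u / h - 1 = (u - h) * inverse h" using hd(3) by (simp add: field_simps)
    also have "u - h = of_nat M * (- v)" using v(2) by (simp add: algebra_simps)
    finally have "u / h - 1 = of_nat M * (- v * inverse h)" by simp
    moreover have "- v * inverse h \<in> ring_of_integers K" by (intro ring_of_integersD[OF K] v hd)
    ultimately have "cong_one K M (u / h)" unfolding cong_one_def by blast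
    then obtain y where "y \<in> units_of_integers K" "u / h = y ^ m" using M(2) mult_subgroupD(2)[OF U u(1) hU] by blast
    moreover from this have "u = h * y ^ m" using hd(3) by (simp add: field_simps)
    ultimately show False using m(2)[OF h] by blast
  qed
  then show ?thesis using M(1) by blast
qed

section \<open>Zariski-connected solvable groups\<close>

text \<open>Regular functions on the general linear group: values elsewhere are irrelevant, and the
  denominators make matrix inversion regular.\<close>

definition regular :: "(complex^'n^'n \<Rightarrow> complex) \<Rightarrow> bool" where
  "regular f \<longleftrightarrow> (\<exists>p\<in>poly_fun UNIV. \<exists>N. \<forall>A. invertible A \<longrightarrow> f A = p A / det A ^ N)"

definition regular_map :: "(complex^'n^'n \<Rightarrow> complex^'n^'n) \<Rightarrow> bool" where
  "regular_map F \<longleftrightarrow> (\<forall>i j. regular (\<lambda>A. F A $ i $ j))"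

text \<open>Closed in the general linear group, with no condition on singular matrices; preimages
  can thus be formed without intersecting with the group.\<close>

definition closed_GL :: "(complex^'n^'n) set \<Rightarrow> bool" where
  "closed_GL X \<longleftrightarrow> (\<exists>P \<subseteq> poly_fun UNIV. \<forall>A. invertible A \<longrightarrow> (A \<in> X \<longleftrightarrow> A \<in> zero_set P))"

lemma poly_fun_power: "p \<in> poly_fun UNIV \<Longrightarrow> (\<lambda>A. p A ^ m) \<in> poly_fun UNIV"
  by (induction m) (auto intro: poly_fun.intros)

lemma poly_fun_sum:
  "(\<And>i. i \<in> I \<Longrightarrow> p i \<in> poly_fun UNIV) \<Longrightarrow> (\<lambda>A. \<Sum>i\<in>I. p i A) \<in> poly_fun UNIV"
  by (induction I rule: infinite_finite_induct) (auto intro: poly_fun.intros)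

lemma poly_fun_prod:
  "(\<And>i. i \<in> I \<Longrightarrow> p i \<in> poly_fun UNIV) \<Longrightarrow> (\<lambda>A. \<Prod>i\<in>I. p i A) \<in> poly_fun UNIV"
  by (induction I rule: infinite_finite_induct) (auto intro: poly_fun.intros)

lemma poly_fun_det:
  assumes "\<And>i j. (\<lambda>A. F A $ i $ j) \<in> poly_fun UNIV"
  shows "(\<lambda>A. det (F A :: complex^'n^'n)) \<in> poly_fun UNIV"
  unfolding det_def
  by (intro poly_fun_sum poly_fun.mult poly_fun.const poly_fun_prod assms UNIV_I)

lemma det_neq_0: "invertible (A :: complex^'n^'n) \<Longrightarrow> det A \<noteq> 0"
  by (simp add: invertible_det_nz)

lemma regular_poly: "p \<in> poly_fun UNIV \<Longrightarrow> regular p"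
  unfolding regular_def by (intro bexI[of _ p] exI[of _ 0]) auto

lemma regular_const: "regular (\<lambda>A. c)"
  by (intro regular_poly poly_fun.intros) simp

lemma regular_add:
  fixes f g :: "complex^'n^'n \<Rightarrow> complex"
  assumes "regular f" "regular g"
  shows "regular (\<lambda>A. f A + g A)"
proof -
  obtain p N where p: "p \<in> poly_fun UNIV" "\<And>A. invertible A \<Longrightarrow> f A = p A / det A ^ N"
    using assms(1) unfolding regular_def by blast
  obtain q M where q: "q \<in> poly_fun UNIV" "\<And>A. invertible A \<Longrightarrow> g A = q A / det A ^ M"
    using assms(2) unfolding regular_def by blast
  have d: "(\<lambda>A. det A) \<in> poly_fun UNIV" by (rule poly_fun_det) (rule poly_fun.var)
  show ?thesis unfolding regular_def
  proof (intro bexI exI allI impI)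
    show "(\<lambda>A. p A * det A ^ M + q A * det A ^ N) \<in> poly_fun UNIV"
      by (intro poly_fun.add poly_fun.mult poly_fun_power p q d)
    fix A :: "complex^'n^'n" assume "invertible A"
    then show "f A + g A = (p A * det A ^ M + q A * det A ^ N) / det A ^ (N + M)"
      using det_neq_0[of A] p q by (simp add: field_simps power_add)
  qed
qed

lemma regular_mult:
  fixes f g :: "complex^'n^'n \<Rightarrow> complex"
  assumes "regular f" "regular g"
  shows "regular (\<lambda>A. f A * g A)"
proof -
  obtain p N where p: "p \<in> poly_fun UNIV" "\<And>A. invertible A \<Longrightarrow> f A = p A / det A ^ N"
    using assms(1) unfolding regular_def by blast
  obtain q M where q: "q \<in> poly_fun UNIV" "\<And>A. invertible A \<Longrightarrow> g A = q A / det A ^ M"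
    using assms(2) unfolding regular_def by blast
  show ?thesis unfolding regular_def
  proof (intro bexI exI allI impI)
    show "(\<lambda>A. p A * q A) \<in> poly_fun UNIV" by (intro poly_fun.mult p q)
    fix A :: "complex^'n^'n" assume "invertible A"
    then show "f A * g A = (p A * q A) / det A ^ (N + M)"
      using p q by (simp add: power_add)
  qed
qed

lemma regular_sum: "(\<And>i. i \<in> I \<Longrightarrow> regular (f i)) \<Longrightarrow> regular (\<lambda>A. \<Sum>i\<in>I. f i A)"
  by (induction I rule: infinite_finite_induct) (auto intro: regular_const regular_add)

lemma regular_diff:
  assumes "regular f" "regular g"
  shows "regular (\<lambda>A. f A - g A :: complex)"
  using regular_add[OF assms(1) regular_mult[OF regular_const[of "-1"] assms(2)]] by simp

lemma regular_mapD: "regular_map F \<Longrightarrow> regular (\<lambda>A. F A $ i $ j)"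
  by (simp add: regular_map_def)

lemma regular_map_const: "regular_map (\<lambda>A. C)"
  by (simp add: regular_map_def regular_const)

lemma regular_map_id: "regular_map (\<lambda>A. A)"
  by (simp add: regular_map_def regular_poly poly_fun.var)

lemma regular_map_mult:
  "regular_map F \<Longrightarrow> regular_map H \<Longrightarrow> regular_map (\<lambda>A. F A ** H A)"
  unfolding regular_map_def matrix_matrix_mult_def
  by (auto intro!: regular_sum regular_mult)

lemma regular_matrix_vector:
  "regular_map F \<Longrightarrow> regular (\<lambda>A. (F A *v v) $ i)"
  unfolding matrix_vector_mult_def by (auto intro!: regular_sum regular_mult regular_const regular_mapD)

lemma matrix_inv_right: "invertible (A::complex^'n^'n) \<Longrightarrow> A ** matrix_inv A = mat 1"
  and matrix_inv_left: "invertible A \<Longrightarrow> matrix_inv A ** A = mat 1"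
  unfolding invertible_def matrix_inv_def by (metis (mono_tags, lifting) someI_ex)+

lemma invertible_matrix_inv: "invertible (A::complex^'n^'n) \<Longrightarrow> invertible (matrix_inv A)"
  using matrix_inv_left matrix_inv_right unfolding invertible_def by blast

lemma regular_map_inverse: "regular_map (\<lambda>A :: complex^'n^'n. matrix_inv A)"
  unfolding regular_map_def
proof (intro allI)
  fix i j :: 'n
  let ?C = "\<lambda>A :: complex^'n^'n. \<chi> k l. if l = i then axis j 1 $ k else A $ k $ l"
  have "matrix_inv A $ i $ j = det (?C A) / det A ^ 1" if A: "invertible A" for A :: "complex^'n^'n"
  proof -
    have "A *v (matrix_inv A *v axis j 1) = axis j 1"
      by (simp add: matrix_vector_mul_assoc matrix_inv_right[OF A])
    then have "(matrix_inv A *v axis j 1) $ i = det (?C A) / det A"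
      using cramer[OF det_neq_0[OF A], of "matrix_inv A *v axis j 1" "axis j 1"] by simp
    moreover have "(matrix_inv A *v axis j 1) $ i = matrix_inv A $ i $ j"
      by (simp add: matrix_vector_mult_def axis_def if_distrib cong: if_cong)
    ultimately show ?thesis by simp
  qed
  moreover have "(\<lambda>A. det (?C A)) \<in> poly_fun UNIV"
  proof (rule poly_fun_det)
    show "(\<lambda>A. ?C A $ k $ l) \<in> poly_fun UNIV" for k l
      by (cases "l = i") (auto intro: poly_fun.intros)
  qed
  ultimately show "regular (\<lambda>A. matrix_inv A $ i $ j)"
    unfolding regular_def by (intro bexI[of _ "\<lambda>A. det (?C A)"] exI[of _ 1] allI impI)
qed

lemma regular_compose:
  assumes "p \<in> poly_fun UNIV" "regular_map F"
  shows "regular (\<lambda>A. p (F A))"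
  using assms(1)
  by induction (auto intro: regular_const regular_mapD[OF assms(2)] regular_add regular_mult)

lemma closed_GL_regular:
  assumes "\<And>f. f \<in> S \<Longrightarrow> regular f"
  shows "closed_GL {A. \<forall>f\<in>S. f A = 0}"
proof -
  have "\<forall>f\<in>S. \<exists>p. p \<in> poly_fun UNIV \<and> (\<exists>N. \<forall>A. invertible A \<longrightarrow> f A = p A / det A ^ N)"
    using assms unfolding regular_def by blast
  from bchoice[OF this] obtain p where p: "\<forall>f\<in>S. p f \<in> poly_fun UNIV \<and> (\<exists>N. \<forall>A. invertible A \<longrightarrow> f A = p f A / det A ^ N)" ..
  have "f A = 0 \<longleftrightarrow> p f A = 0" if fS: "f \<in> S" and A: "invertible A" for f A
  proof -
    obtain N where "\<forall>A. invertible A \<longrightarrow> f A = p f A / det A ^ N" using p fS by blast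
    then show ?thesis using A det_neq_0[OF A] by simp
  qed
  then show ?thesis unfolding closed_GL_def using p
    by (intro exI[of _ "p ` S"]) (auto simp: zero_set_def)
qed

lemma closed_GL_vimage:
  assumes X: "closed_GL X" and F: "regular_map F" "\<And>A. invertible A \<Longrightarrow> invertible (F A)"
  shows "closed_GL {A. F A \<in> X}"
proof -
  obtain P where P: "P \<subseteq> poly_fun UNIV" "\<And>A. invertible A \<Longrightarrow> A \<in> X \<longleftrightarrow> A \<in> zero_set P"
    using X unfolding closed_GL_def by blast
  have "closed_GL {A. \<forall>f\<in>(\<lambda>p A. p (F A)) ` P. f A = 0}"
    using P(1) F(1) by (intro closed_GL_regular) (auto intro: regular_compose)
  then show ?thesis using P(2) F(2) by (simp add: closed_GL_def zero_set_def)
qed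

lemma closed_GL_Un:
  assumes "closed_GL X" "closed_GL Y"
  shows "closed_GL (X \<union> Y)"
proof -
  obtain P where P: "P \<subseteq> poly_fun UNIV" "\<And>A. invertible A \<Longrightarrow> A \<in> X \<longleftrightarrow> A \<in> zero_set P"
    using assms(1) unfolding closed_GL_def by blast
  obtain Q where Q: "Q \<subseteq> poly_fun UNIV" "\<And>A. invertible A \<Longrightarrow> A \<in> Y \<longleftrightarrow> A \<in> zero_set Q"
    using assms(2) unfolding closed_GL_def by blast
  let ?R = "(\<lambda>(p, q) A. p A * q A) ` (P \<times> Q)"
  have "zero_set ?R = zero_set P \<union> zero_set Q" unfolding zero_set_def by auto
  moreover have "?R \<subseteq> poly_fun UNIV" using P(1) Q(1) by (auto intro: poly_fun.mult)
  ultimately show ?thesis unfolding closed_GL_def using P(2) Q(2) by (intro exI[of _ ?R]) auto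
qed

lemma closed_GL_UN:
  fixes Z :: "'i \<Rightarrow> (complex^'n^'n) set"
  assumes "finite S" "\<And>i. i \<in> S \<Longrightarrow> closed_GL (Z i)"
  shows "closed_GL (\<Union>i\<in>S. Z i)"
  using assms
proof (induction S rule: finite_induct)
  case empty
  have "(\<lambda>A::complex^'n^'n. 1) \<in> poly_fun UNIV" by (intro poly_fun.intros) simp
  then show ?case unfolding closed_GL_def
    by (intro exI[of _ "{\<lambda>A. 1}"]) (auto simp: zero_set_def)
qed (auto intro: closed_GL_Un)

lemma zariski_connectedD:
  assumes G: "zariski_connected G" "\<And>A. A \<in> G \<Longrightarrow> invertible A"
    and "closed_GL X" "closed_GL Y" and cov: "G \<subseteq> X \<union> Y" "G \<inter> X \<inter> Y = {}" "G \<inter> X \<noteq> {}"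
  shows "G \<subseteq> X"
proof -
  obtain P where P: "P \<subseteq> poly_fun UNIV" "\<And>A. invertible A \<Longrightarrow> A \<in> X \<longleftrightarrow> A \<in> zero_set P"
    using assms(3) unfolding closed_GL_def by blast
  obtain Q where Q: "Q \<subseteq> poly_fun UNIV" "\<And>A. invertible A \<Longrightarrow> A \<in> Y \<longleftrightarrow> A \<in> zero_set Q"
    using assms(4) unfolding closed_GL_def by blast
  have e: "G \<inter> zero_set P = G \<inter> X" "G \<inter> zero_set Q = G \<inter> Y"
    using G(2) P(2) Q(2) by auto
  have "G \<inter> zero_set P \<inter> zero_set Q = {}" "G \<subseteq> zero_set P \<union> zero_set Q"
    using e cov by auto
  then have "G \<inter> zero_set Q = {}"
    using G(1) P(1) Q(1) e(1) cov(3) unfolding zariski_connected_def by blast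
  then show ?thesis using e cov(1) by auto
qed

text \<open>All sets but one are merged into a single closed complement.\<close>

lemma zariski_connected_finite_cover:
  assumes G: "zariski_connected G" "\<And>A. A \<in> G \<Longrightarrow> invertible A"
    and S: "finite S" "\<And>i. i \<in> S \<Longrightarrow> closed_GL (Z i)" "G \<subseteq> (\<Union>i\<in>S. Z i)"
    and disj: "\<And>i j A. i \<in> S \<Longrightarrow> j \<in> S \<Longrightarrow> A \<in> G \<Longrightarrow> A \<in> Z i \<Longrightarrow> A \<in> Z j \<Longrightarrow> i = j"
    and i: "i \<in> S" "A \<in> G" "A \<in> Z i"
  shows "G \<subseteq> Z i"
proof (rule zariski_connectedD[OF G])
  show "closed_GL (Z i)" by (rule S(2)[OF i(1)])
  show "closed_GL (\<Union>j\<in>S - {i}. Z j)" using S by (intro closed_GL_UN) auto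
  show "G \<subseteq> Z i \<union> (\<Union>j\<in>S - {i}. Z j)" using S(3) by auto
  show "G \<inter> Z i \<inter> (\<Union>j\<in>S - {i}. Z j) = {}" using disj[OF i(1)] by auto
  show "G \<inter> Z i \<noteq> {}" using i by auto
qed

section \<open>Matrix groups and their derived groups\<close>

lemma GL_grp_simps [simp]:
  "carrier GL_grp = {A. invertible A}" "x \<otimes>\<^bsub>GL_grp\<^esub> y = x ** y" "\<one>\<^bsub>GL_grp\<^esub> = mat 1"
  by (simp_all add: GL_grp_def)

lemma invertible_mat_1: "invertible (mat 1 :: complex^'n^'n)"
  unfolding invertible_def by (intro exI[of _ "mat 1"]) simp

lemma group_GL_grp: "group (GL_grp :: (complex^'n^'n) monoid)"
proof (rule groupI)
  show "\<exists>y\<in>carrier GL_grp. y \<otimes>\<^bsub>GL_grp\<^esub> x = \<one>\<^bsub>GL_grp\<^esub>"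
    if "x \<in> carrier GL_grp" for x :: "complex^'n^'n"
    using that matrix_inv_left[of x] invertible_matrix_inv[of x] by auto
qed (auto simp: invertible_mult invertible_mat_1 matrix_mul_assoc)

lemma inv_GL_grp: "invertible A \<Longrightarrow> inv\<^bsub>GL_grp\<^esub> A = matrix_inv (A :: complex^'n^'n)"
  using group.inv_equality[OF group_GL_grp, of "matrix_inv A" A]
  by (simp add: matrix_inv_left invertible_matrix_inv)

lemma subgroup_GL_D:
  assumes "subgroup G GL_grp"
  shows "A \<in> G \<Longrightarrow> invertible A" "mat 1 \<in> G" "A \<in> G \<Longrightarrow> C \<in> G \<Longrightarrow> A ** C \<in> G"
    "A \<in> G \<Longrightarrow> matrix_inv A \<in> G"
proof -
  show i: "A \<in> G \<Longrightarrow> invertible A" for A using subgroup.subset[OF assms] by auto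
  show "mat 1 \<in> G" using subgroup.one_closed[OF assms] by simp
  show "A \<in> G \<Longrightarrow> C \<in> G \<Longrightarrow> A ** C \<in> G" using subgroup.m_closed[OF assms, of A C] by simp
  show "A \<in> G \<Longrightarrow> matrix_inv A \<in> G" using subgroup.m_inv_closed[OF assms, of A] i[of A] by (simp add: inv_GL_grp)
qed

lemma commutator_in_derived:
  fixes G :: "(complex^'n^'n) set"
  assumes G: "subgroup G GL_grp" and a: "a \<in> G" and x: "x \<in> G"
  shows "a ** x ** matrix_inv a ** matrix_inv x \<in> derived GL_grp G"
proof -
  have "a \<otimes>\<^bsub>GL_grp\<^esub> x \<otimes>\<^bsub>GL_grp\<^esub> inv\<^bsub>GL_grp\<^esub> a \<otimes>\<^bsub>GL_grp\<^esub> inv\<^bsub>GL_grp\<^esub> x \<in> derived_set GL_grp G"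
    using a x by blast
  then show ?thesis unfolding derived_def using subgroup_GL_D(1)[OF G a] subgroup_GL_D(1)[OF G x]
    by (auto simp: inv_GL_grp intro: generate.incl)
qed

text \<open>Let a relatively clopen part contain \<open>z\<close>. For fixed \<open>a\<close> the
  image of \<open>G\<close> under \<open>x |-> z [a, x]\<close> is connected and contains
  \<open>z\<close>, taken at \<open>x = 1\<close>, so it stays in that part. Hence the part is
  stable under multiplication by commutators, which generate. The derived group is the abstract one;
  no closure is taken.\<close>

lemma zariski_connected_derived:
  fixes G :: "(complex^'n^'n) set"
  assumes G: "subgroup G GL_grp" "zariski_connected G"
  shows "zariski_connected (derived GL_grp G)"
proof -
  interpret group "GL_grp :: (complex^'n^'n) monoid" by (rule group_GL_grp)
  let ?D = "derived GL_grp G"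
  note Gd = subgroup_GL_D[OF G(1)]
  have D: "subgroup ?D GL_grp" using derived_is_subgroup subgroup.subset[OF G(1)] by blast
  note Dd = subgroup_GL_D[OF D]
  note comm_D = commutator_in_derived[OF G(1)]
  have main: "?D \<subseteq> X" if XY: "closed_GL X" "closed_GL Y" and cov: "?D \<subseteq> X \<union> Y" "?D \<inter> X \<inter> Y = {}"
    and z0: "z0 \<in> ?D" "z0 \<in> X" for X Y z0
  proof -
    have comm: "z ** (a ** x ** matrix_inv a ** matrix_inv x) \<in> X"
      if z: "z \<in> ?D" "z \<in> X" and a: "a \<in> G" and x: "x \<in> G" for z a x
    proof -
      define F where "F = (\<lambda>x. z ** (a ** x ** matrix_inv a ** matrix_inv x))"
      have FD: "F x \<in> ?D" if "x \<in> G" for x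
        unfolding F_def by (intro Dd(3) z comm_D a that)
      have F: "regular_map F" unfolding F_def
        by (intro regular_map_mult regular_map_const regular_map_id regular_map_inverse)
      have Finv: "invertible (F x)" if "invertible x" for x
        unfolding F_def using that Dd(1)[OF z(1)] Gd(1)[OF a]
        by (intro invertible_mult invertible_matrix_inv)
      have "F (mat 1) = z" unfolding F_def
        using matrix_inv_right[OF Gd(1)[OF a]] matrix_inv_right[OF invertible_mat_1[where 'n='n]] by simp
      then have "mat 1 \<in> G \<inter> {x. F x \<in> X}" using z Gd(2) by simp
      then have ne: "G \<inter> {x. F x \<in> X} \<noteq> {}" by blast
      have "G \<subseteq> {x. F x \<in> X}"
      proof (rule zariski_connectedD[OF G(2) Gd(1) closed_GL_vimage[OF XY(1) F Finv] closed_GL_vimage[OF XY(2) F Finv] _ _ ne])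
        show "G \<subseteq> {x. F x \<in> X} \<union> {x. F x \<in> Y}"
        proof
          fix x assume "x \<in> G"
          then have "F x \<in> X \<union> Y" using FD cov(1) by (meson subsetD)
          then show "x \<in> {x. F x \<in> X} \<union> {x. F x \<in> Y}" by simp
        qed
        show "G \<inter> {x. F x \<in> X} \<inter> {x. F x \<in> Y} = {}"
        proof (rule equals0I)
          fix x assume x: "x \<in> G \<inter> {x. F x \<in> X} \<inter> {x. F x \<in> Y}"
          then have "F x \<in> ?D \<inter> X \<inter> Y" using FD[of x] by simp
          then show False using cov(2) by simp
        qed
      qed
      then show ?thesis using x by (auto simp: F_def)
    qed
    have gen: "\<forall>z. z \<in> ?D \<longrightarrow> z \<in> X \<longrightarrow> z ** d \<in> X" if "d \<in> generate GL_grp (derived_set GL_grp G)" for d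
      using that
    proof induction
      case one
      then show ?case by simp
    next
      case (incl h)
      then obtain a x where ax: "a \<in> G" "x \<in> G" "h = a ** x ** matrix_inv a ** matrix_inv x"
        using Gd(1) by (auto simp: inv_GL_grp)
      show ?case unfolding ax(3) using comm[OF _ _ ax(1,2)] by blast
    next
      case (inv h)
      then obtain a x where ax: "a \<in> G" "x \<in> G" "h = a ** x ** matrix_inv a ** matrix_inv x"
        using Gd(1) by (auto simp: inv_GL_grp)
      have hh: "invertible h" using comm_D[OF ax(1,2)] Dd(1) ax(3) by blast
      note inva = matrix_inv_left[OF Gd(1)[OF ax(1)]] and invx = matrix_inv_left[OF Gd(1)[OF ax(2)]]
      have c: "m ** matrix_inv x ** x = m" "m ** matrix_inv a ** a = m" for m
        by (simp_all flip: matrix_mul_assoc add: inva invx)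
      have c': "m ** x ** matrix_inv x = m" "m ** a ** matrix_inv a = m" for m
        by (simp_all flip: matrix_mul_assoc add: matrix_inv_right[OF Gd(1)[OF ax(1)]] matrix_inv_right[OF Gd(1)[OF ax(2)]])
      \<comment> \<open>The inverse of a commutator is the commutator of the exchanged pair.\<close>
      have "(x ** a ** matrix_inv x ** matrix_inv a) ** h = mat 1"
        unfolding ax(3) by (simp add: matrix_mul_assoc c c' matrix_inv_right[OF Gd(1)[OF ax(2)]])
      then have "inv\<^bsub>GL_grp\<^esub> h = x ** a ** matrix_inv x ** matrix_inv a"
        using inv_equality[of "x ** a ** matrix_inv x ** matrix_inv a" h] hh Dd(1)[OF comm_D[OF ax(2,1)]] by simp
      then show ?case using comm[OF _ _ ax(2,1)] by simp
    next
      case (eng h1 h2)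
      have "h1 \<in> ?D" using eng(1) by (simp add: derived_def)
      then show ?case using eng(3,4) Dd(3) by (simp add: matrix_mul_assoc)
    qed
    show ?thesis
    proof
      fix d assume d: "d \<in> ?D"
      have "matrix_inv z0 ** d \<in> ?D" by (intro Dd(3,4) z0 d)
      then have "z0 ** (matrix_inv z0 ** d) \<in> X" using gen z0 unfolding derived_def by blast
      then show "d \<in> X" using matrix_inv_right[OF Dd(1)[OF z0(1)]] by (simp add: matrix_mul_assoc)
    qed
  qed
  show ?thesis unfolding zariski_connected_def
  proof (rule notI, elim exE conjE)
    fix P Q assume PQ: "P \<subseteq> poly_fun UNIV" "Q \<subseteq> poly_fun UNIV"
      "?D \<inter> zero_set P \<noteq> {}" "?D \<inter> zero_set Q \<noteq> {}"
      "?D \<subseteq> zero_set P \<union> zero_set Q" "?D \<inter> zero_set P \<inter> zero_set Q = {}"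
    have cl: "closed_GL (zero_set P)" "closed_GL (zero_set Q)"
      unfolding closed_GL_def using PQ(1,2) by blast+
    obtain z0 where "z0 \<in> ?D" "z0 \<in> zero_set P" using PQ(3) by blast
    then have "?D \<subseteq> zero_set P" using main[OF cl PQ(5,6)] by blast
    then show False using PQ(4,6) by blast
  qed
qed

section \<open>Common eigenvectors of connected solvable groups\<close>

interpretation cvec: complex_vector_space "(*s) :: complex \<Rightarrow> complex^'n \<Rightarrow> complex^'n"
  by unfold_locales

text \<open>The axioms are required on \<open>C\<close> only. A quotient space will be represented
  by maps \<open>P ** g\<close> with a projection \<open>P\<close>; these send the identity to
  \<open>P\<close>, which is the identity just on its range.\<close>

definition is_rep :: "(complex^'n^'n) set \<Rightarrow> (complex^'n^'n \<Rightarrow> complex^'n^'n) \<Rightarrow> (complex^'n) set \<Rightarrow> bool" where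
  "is_rep G \<rho> C \<longleftrightarrow> vec.subspace C \<and> (\<forall>g\<in>G. \<forall>v\<in>C. \<rho> g *v v \<in> C)
     \<and> (\<forall>g\<in>G. \<forall>h\<in>G. \<forall>v\<in>C. \<rho> (g ** h) *v v = \<rho> g *v (\<rho> h *v v)) \<and> (\<forall>v\<in>C. \<rho> (mat 1) *v v = v)"

lemma is_repD:
  assumes "is_rep G \<rho> C"
  shows "vec.subspace C" "g \<in> G \<Longrightarrow> v \<in> C \<Longrightarrow> \<rho> g *v v \<in> C"
    "g \<in> G \<Longrightarrow> h \<in> G \<Longrightarrow> v \<in> C \<Longrightarrow> \<rho> (g ** h) *v v = \<rho> g *v (\<rho> h *v v)" "v \<in> C \<Longrightarrow> \<rho> (mat 1) *v v = v"
  using assms unfolding is_rep_def by auto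

lemma is_rep_subset: "is_rep G \<rho> C \<Longrightarrow> D \<subseteq> G \<Longrightarrow> is_rep D \<rho> C"
  unfolding is_rep_def by blast

lemma is_rep_nonzero:
  assumes "is_rep G \<rho> C" "subgroup G GL_grp" "g \<in> G" "v \<in> C" "v \<noteq> 0"
  shows "\<rho> g *v v \<noteq> 0"
proof
  assume z: "\<rho> g *v v = 0"
  note G = subgroup_GL_D[OF assms(2)]
  have "v = \<rho> (matrix_inv g ** g) *v v"
    by (simp add: matrix_inv_left[OF G(1)[OF assms(3)]] is_repD(4)[OF assms(1,4)])
  also have "\<dots> = 0" using z by (simp add: is_repD(3)[OF assms(1) G(4)[OF assms(3)] assms(3,4)])
  finally show False using assms(5) by simp
qed

lemma matrix_complex_operator:
  assumes "vec.subspace W" "\<And>v. v \<in> W \<Longrightarrow> X *v v \<in> W"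
  shows "complex_operator (*s) (\<lambda>v. X *v v) (W :: (complex^'n) set)"
  by unfold_locales (use assms in \<open>auto simp: matrix_vector_right_distrib vector_scalar_commute\<close>)

lemma finite_matrix_eigenvalues:
  assumes "vec.subspace W" "\<And>v. v \<in> W \<Longrightarrow> X *v v \<in> (W :: (complex^'n) set)"
  shows "finite {c. \<exists>v\<in>W. v \<noteq> 0 \<and> X *v v = c *s v}"
  by (rule complex_operator.finite_eigenvalues[OF matrix_complex_operator[OF assms] finite_cart_basis])
     (auto simp: span_cart_basis)

text \<open>The sets of all \<open>g\<close> with eigenvalue \<open>c\<close> are closed and, for
  different \<open>c\<close>, disjoint, and finitely many of them cover \<open>G\<close>. A
  connected group lies in one of them.\<close>

lemma eigenvalue_constant:
  fixes X :: "complex^'n^'n"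
  assumes G: "zariski_connected G" "\<And>A. A \<in> G \<Longrightarrow> invertible A" and \<rho>: "regular_map \<rho>"
    and S: "finite S" "\<And>g. g \<in> G \<Longrightarrow> \<exists>c\<in>S. X *v (\<rho> g *v w) = c *s (\<rho> g *v w)"
    and nz: "\<And>g. g \<in> G \<Longrightarrow> \<rho> g *v w \<noteq> 0"
    and g0: "g0 \<in> G" "X *v (\<rho> g0 *v w) = c0 *s (\<rho> g0 *v w)"
    and g: "g \<in> G"
  shows "X *v (\<rho> g *v w) = c0 *s (\<rho> g *v w)"
proof -
  define Z where "Z = (\<lambda>c. {g. \<forall>f\<in>range (\<lambda>i g. (X *v (\<rho> g *v w)) $ i - c * (\<rho> g *v w) $ i). f g = 0})"
  have Z: "g \<in> Z c \<longleftrightarrow> X *v (\<rho> g *v w) = c *s (\<rho> g *v w)" for g c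
    by (auto simp: Z_def vec_eq_iff)
  have "regular (\<lambda>g. (X *v (\<rho> g *v w)) $ i - c * (\<rho> g *v w) $ i)" for i c
    unfolding matrix_vector_mul_assoc
    by (intro regular_diff regular_mult regular_const regular_matrix_vector regular_map_mult regular_map_const \<rho>)
  then have cl: "closed_GL (Z c)" for c unfolding Z_def by (intro closed_GL_regular) auto
  have c0: "c0 \<in> S"
  proof -
    obtain c where "c \<in> S" "X *v (\<rho> g0 *v w) = c *s (\<rho> g0 *v w)" using S(2)[OF g0(1)] by blast
    then show ?thesis using g0(2) nz[OF g0(1)] by simp
  qed
  have "G \<subseteq> Z c0"
  proof (rule zariski_connected_finite_cover[OF G S(1) cl _ _ c0 g0(1)])
    show "G \<subseteq> (\<Union>c\<in>S. Z c)" using S(2) Z by blast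
    show "c = d" if "g \<in> G" "g \<in> Z c" "g \<in> Z d" for c d g
      using that nz[OF that(1)] by (simp add: Z)
    show "g0 \<in> Z c0" using g0 by (simp add: Z)
  qed
  then show ?thesis using g Z by blast
qed

text \<open>Induction on the derived length. A weight space \<open>W\<close> of the derived group is
  stable under \<open>G\<close>, since conjugation could change the weights only within a finite set
  and so does not change them. On \<open>W\<close> the operators of \<open>G\<close> commute, hence
  have a common eigenvector.\<close>

theorem solvable_common_eigenvector:
  fixes G :: "(complex^'n^'n) set"
  assumes "subgroup G GL_grp" "zariski_connected G" "(derived GL_grp ^^ s) G = {mat 1}"
    and "regular_map \<rho>" "is_rep G \<rho> C" "C \<noteq> {0}"
  shows "\<exists>v\<in>C. v \<noteq> 0 \<and> (\<forall>g\<in>G. \<exists>c. \<rho> g *v v = c *s v)"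
  using assms
proof (induction s arbitrary: G)
  case 0
  then have G: "G = {mat 1}" by simp
  have "0 \<in> C" by (rule vec.subspace_0[OF is_repD(1)[OF 0(5)]])
  then obtain v where v: "v \<in> C" "v \<noteq> 0" using 0(6) by auto
  then show ?case using is_repD(4)[OF 0(5) v(1)] unfolding G
    by (intro bexI[of _ v] conjI ballI exI[of _ 1]) auto
next
  case (Suc s)
  interpret group "GL_grp :: (complex^'n^'n) monoid" by (rule group_GL_grp)
  define D where "D = derived GL_grp G"
  note G = Suc.prems(1,2) and Gd = subgroup_GL_D[OF Suc.prems(1)] and rep = is_repD[OF Suc.prems(5)]
  have D: "subgroup D GL_grp" "zariski_connected D" "(derived GL_grp ^^ s) D = {mat 1}" "D \<subseteq> G"
    unfolding D_def using derived_is_subgroup[OF subgroup.subset[OF G(1)]] zariski_connected_derived[OF G]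
      Suc.prems(3) derived_incl[OF subset_refl G(1)] by (auto simp: funpow_swap1)
  note comm_D = commutator_in_derived[OF G(1), folded D_def]
  have conj_D: "\<exists>y\<in>D. x ** g = g ** y" if x: "x \<in> D" and g: "g \<in> G" for x g
  proof
    have xG: "x \<in> G" using x D(4) by blast
    have c: "m ** g ** matrix_inv g = m" "m ** matrix_inv g ** g = m" "m ** x ** matrix_inv x = m" "m ** matrix_inv x ** x = m" for m
      by (simp_all flip: matrix_mul_assoc add: matrix_inv_left matrix_inv_right Gd(1) xG g)
    show "x ** (matrix_inv x ** matrix_inv g ** x ** g) \<in> D"
    proof (rule subgroup_GL_D(3)[OF D(1) x])
      have "matrix_inv x ** matrix_inv g ** matrix_inv (matrix_inv x) ** matrix_inv (matrix_inv g) \<in> D"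
        by (intro comm_D Gd(4) xG g)
      moreover have "matrix_inv (matrix_inv y) = y" if "invertible y" for y :: "complex^'n^'n"
        using inv_inv[of y] that by (simp add: inv_GL_grp invertible_matrix_inv)
      ultimately show "matrix_inv x ** matrix_inv g ** x ** g \<in> D" using Gd(1)[OF xG] Gd(1)[OF g] by simp
    qed
    show "x ** g = g ** (x ** (matrix_inv x ** matrix_inv g ** x ** g))"
      by (simp add: matrix_mul_assoc c matrix_inv_right[OF Gd(1)[OF g]])
  qed
  obtain v0 where v0: "v0 \<in> C" "v0 \<noteq> 0" "\<forall>g\<in>D. \<exists>c. \<rho> g *v v0 = c *s v0"
    using Suc.IH[OF D(1-3) Suc.prems(4) is_rep_subset[OF Suc.prems(5) D(4)] Suc.prems(6)] by blast
  from bchoice[OF v0(3)] obtain \<mu> where \<mu>: "\<forall>g\<in>D. \<rho> g *v v0 = \<mu> g *s v0" ..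
  define W where "W = {w \<in> C. \<forall>g\<in>D. \<rho> g *v w = \<mu> g *s w}"
  have WC: "w \<in> C" if "w \<in> W" for w using that by (simp add: W_def)
  have WD: "\<rho> g *v w = \<mu> g *s w" if "g \<in> D" "w \<in> W" for g w using that by (simp add: W_def)
  have Wsub: "vec.subspace W"
    unfolding W_def using rep(1)
    by (auto simp: vec.subspace_def matrix_vector_right_distrib vector_scalar_commute vector_add_ldistrib ac_simps)
  have v0W: "v0 \<in> W" using v0 \<mu> by (simp add: W_def)
  have Winv: "\<rho> g *v w \<in> W" if g: "g \<in> G" and w: "w \<in> W" for g w
  proof (cases "w = 0")
    case True
    then show ?thesis using w by simp
  next
    case False
    have nz: "\<rho> h *v w \<noteq> 0" if "h \<in> G" for h
      using is_rep_nonzero[OF Suc.prems(5) G(1) that WC[OF w] False] .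
    have "\<rho> x *v (\<rho> g *v w) = \<mu> x *s (\<rho> g *v w)" if x: "x \<in> D" for x
    proof -
      have xG: "x \<in> G" using x D(4) by blast
      let ?S = "{c. \<exists>v\<in>C. v \<noteq> 0 \<and> \<rho> x *v v = c *s v}"
      show ?thesis
      proof (rule eigenvalue_constant[OF G(2) Gd(1) Suc.prems(4) finite_matrix_eigenvalues[OF rep(1) rep(2)[OF xG]] _ nz Gd(2) _ g])
        show "\<rho> x *v (\<rho> (mat 1) *v w) = \<mu> x *s (\<rho> (mat 1) *v w)"
          using rep(4)[OF WC[OF w]] WD[OF x w] by simp
        fix h assume h: "h \<in> G"
        obtain y where y: "y \<in> D" "x ** h = h ** y" using conj_D[OF x h] by blast
        have yG: "y \<in> G" using y D(4) by blast
        have "\<rho> x *v (\<rho> h *v w) = \<rho> h *v (\<rho> y *v w)"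
          using rep(3)[OF xG h WC[OF w]] rep(3)[OF h yG WC[OF w]] y(2) by simp
        also have "\<dots> = \<mu> y *s (\<rho> h *v w)" by (simp add: WD[OF y(1) w] vector_scalar_commute)
        finally have e: "\<rho> x *v (\<rho> h *v w) = \<mu> y *s (\<rho> h *v w)" .
        then show "\<exists>c\<in>?S. \<rho> x *v (\<rho> h *v w) = c *s (\<rho> h *v w)"
          using rep(2)[OF h WC[OF w]] nz[OF h] by (intro bexI[of _ "\<mu> y"]) auto
      qed
    qed
    then show ?thesis using rep(2)[OF g WC[OF w]] by (simp add: W_def)
  qed
  have op: "complex_operator (*s) (\<lambda>v. \<rho> g *v v) W" if "g \<in> G" for g
    by (rule matrix_complex_operator[OF Wsub Winv[OF that]])
  \<comment> \<open>A commutator acts on \<open>W\<close> by a scalar. This scalar is 1, because by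
    connectedness the eigenvalue \<open>c0\<close> of \<open>\<rho> g\<close> is the same at all
    vectors \<open>\<rho> h *v u\<close>.\<close>
  have comm: "\<rho> g *v (\<rho> h *v w') = \<rho> h *v (\<rho> g *v w')" if g: "g \<in> G" and h: "h \<in> G" and w': "w' \<in> W" for g h w'
  proof -
    obtain c0 u where u: "u \<in> W" "u \<noteq> 0" "\<rho> g *v u = c0 *s u"
      using complex_operator.ex_eigenvector[OF op[OF g] finite_cart_basis _ v0W v0(2)] by (auto simp: span_cart_basis)
    have nz: "\<rho> h *v u \<noteq> 0" if "h \<in> G" for h
      using is_rep_nonzero[OF Suc.prems(5) G(1) that WC[OF u(1)] u(2)] .
    have swap: "\<rho> g *v (\<rho> h *v w) = \<mu> (g ** h ** matrix_inv g ** matrix_inv h) *s (\<rho> h *v (\<rho> g *v w))"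
      if h: "h \<in> G" and w: "w \<in> W" for h w
    proof -
      let ?k = "g ** h ** matrix_inv g ** matrix_inv h"
      have kD: "?k \<in> D" by (rule comm_D[OF g h])
      have kG: "?k \<in> G" using kD D(4) by blast
      have c: "m ** matrix_inv g ** g = m" "m ** matrix_inv h ** h = m" for m
        by (simp_all flip: matrix_mul_assoc add: matrix_inv_left Gd(1) h g)
      have "?k ** (h ** g) = g ** h" by (simp add: matrix_mul_assoc c)
      then have "\<rho> g *v (\<rho> h *v w) = \<rho> (?k ** (h ** g)) *v w"
        using rep(3)[OF g h WC[OF w]] by simp
      also have "\<dots> = \<rho> ?k *v (\<rho> h *v (\<rho> g *v w))"
        using rep(3)[OF kG Gd(3)[OF h g] WC[OF w]] rep(3)[OF h g WC[OF w]] by simp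
      also have "\<dots> = \<mu> ?k *s (\<rho> h *v (\<rho> g *v w))"
        by (rule WD[OF kD Winv[OF h Winv[OF g w]]])
      finally show ?thesis .
    qed
    let ?S = "{c. \<exists>v\<in>W. v \<noteq> 0 \<and> \<rho> g *v v = c *s v}"
    have "\<rho> g *v (\<rho> h *v u) = c0 *s (\<rho> h *v u)"
    proof (rule eigenvalue_constant[OF G(2) Gd(1) Suc.prems(4) finite_matrix_eigenvalues[OF Wsub Winv[OF g]] _ nz Gd(2) _ h])
      show "\<rho> g *v (\<rho> (mat 1) *v u) = c0 *s (\<rho> (mat 1) *v u)"
        using rep(4)[OF WC[OF u(1)]] u(3) by simp
      fix h assume h: "h \<in> G"
      show "\<exists>c\<in>?S. \<rho> g *v (\<rho> h *v u) = c *s (\<rho> h *v u)"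
        using swap[OF h u(1)] u(3) Winv[OF h u(1)] nz[OF h]
        by (intro bexI[of _ "\<mu> (g ** h ** matrix_inv g ** matrix_inv h) * c0"]) (auto simp: vector_scalar_commute)
    qed
    then have "(\<mu> (g ** h ** matrix_inv g ** matrix_inv h) * c0) *s (\<rho> h *v u) = c0 *s (\<rho> h *v u)"
      using swap[OF h u(1)] u(3) by (simp add: vector_scalar_commute)
    then have "\<mu> (g ** h ** matrix_inv g ** matrix_inv h) * c0 = c0" using nz[OF h] by simp
    moreover have "c0 \<noteq> 0" using u(3) nz[OF g] by auto
    ultimately have "\<mu> (g ** h ** matrix_inv g ** matrix_inv h) = 1" by simp
    then show ?thesis using swap[OF h w'] by simp
  qed
  have Wne: "W \<noteq> {0}" using v0W v0(2) by blast
  have "\<exists>v\<in>W. v \<noteq> 0 \<and> (\<forall>f\<in>(\<lambda>g v. \<rho> g *v v) ` G. \<exists>c. f v = c *s v)"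
  proof (rule cvec.common_eigenvector[OF Wsub finite_cart_basis _ Wne])
    show "W \<subseteq> vec.span cart_basis" by (simp add: span_cart_basis)
  qed (auto intro: op comm)
  then show ?case using WC by blast
qed

section \<open>Invariant flags\<close>

lemma projection_along:
  fixes U :: "(complex^'n) set"
  assumes U: "vec.subspace U"
  shows "\<exists>P :: complex^'n^'n. (\<forall>u\<in>U. P *v u = 0) \<and> (\<forall>w. P *v w - w \<in> U)"
proof -
  obtain b where b: "b \<subseteq> U" "vec.independent b" "U \<subseteq> vec.span b"
    using vec.maximal_independent_subset[of U] by blast
  let ?E = "vec.extend_basis b"
  have E: "vec.independent ?E" "vec.span ?E = UNIV"
    using vec.independent_extend_basis[OF b(2)] vec.span_extend_basis[OF b(2)] by auto
  obtain p where p: "Vector_Spaces.linear (*s) (*s) p" "\<forall>x\<in>?E. p x = (if x \<in> b then 0 else x)"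
    using vec.linear_independent_extend[OF E(1), of "\<lambda>x. if x \<in> b then 0 else x"] by blast
  have mp: "matrix p *v x = p x" for x by (rule matrix_works[OF p(1)])
  have "matrix p *v u = 0" if u: "u \<in> U" for u
  proof -
    have "u \<in> vec.span b" using u b(3) by blast
    then show ?thesis
    proof (induction rule: vec.span_induct_alt)
      case (step c x y)
      have "x \<in> ?E" using vec.extend_basis_superset[OF b(2)] step(1) by blast
      then show ?case using step p(2) mp[of x] by (simp add: matrix_vector_right_distrib vector_scalar_commute)
    qed simp
  qed
  moreover have "matrix p *v w - w \<in> U" for w
  proof -
    have "w \<in> vec.span ?E" using E(2) by simp
    then show ?thesis
    proof (induction rule: vec.span_induct_alt)
      case base
      then show ?case using vec.subspace_0[OF U] by simp
    next
      case (step c x y)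
      have "p x - x \<in> U" using p(2) step(1) b(1) vec.subspace_0[OF U] vec.subspace_neg[OF U, of x] by auto
      then have "c *s (matrix p *v x - x) + (matrix p *v y - y) \<in> U"
        unfolding mp using step(2)[unfolded mp] by (intro vec.subspace_add[OF U] vec.subspace_scale[OF U])
      moreover have "c *s (matrix p *v x - x) + (matrix p *v y - y) = matrix p *v (c *s x + y) - (c *s x + y)"
        by (simp add: matrix_vector_right_distrib vector_scalar_commute vector_sub_rdistrib)
      ultimately show ?case by (rule back_subst[where P = "\<lambda>x. x \<in> U"])
    qed
  qed
  ultimately show ?thesis by blast
qed

text \<open>The quotient by \<open>U\<close> is realised on the range \<open>C\<close> of a
  projection along \<open>U\<close>, on which \<open>g\<close> acts by \<open>P ** g\<close>. A
  common eigenvector there is one modulo \<open>U\<close>.\<close>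

lemma eigenvector_mod_subspace:
  fixes B :: "(complex^'n^'n) set"
  assumes B: "subgroup B GL_grp" "zariski_connected B" "(derived GL_grp ^^ s) B = {mat 1}"
    and U: "vec.subspace U" "U \<noteq> UNIV" "\<And>g u. g \<in> B \<Longrightarrow> u \<in> U \<Longrightarrow> g *v u \<in> U"
  shows "\<exists>v. v \<notin> U \<and> (\<forall>g\<in>B. \<exists>c. g *v v - c *s v \<in> U)"
proof -
  obtain P :: "complex^'n^'n" where P: "\<And>u. u \<in> U \<Longrightarrow> P *v u = 0" "\<And>w. P *v w - w \<in> U"
    using projection_along[OF U(1)] by blast
  define C where "C = range (\<lambda>w. P *v w)"
  have P_U: "P *v w = P *v w'" if "w - w' \<in> U" for w w'
    using P(1)[OF that] by (simp add: matrix_vector_mult_diff_distrib)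
  have P_C: "P *v v = v" if "v \<in> C" for v using that P_U[OF P(2)] by (auto simp: C_def)
  let ?\<rho> = "\<lambda>g. P ** g"
  have rho: "(P ** g) *v v = P *v (g *v v)" for g v by (simp add: matrix_vector_mul_assoc)
  have rep: "is_rep B ?\<rho> C" unfolding is_rep_def
  proof (intro conjI ballI)
    show "vec.subspace C"
      unfolding C_def by (rule vec.linear_subspace_image) (simp_all add: vec.subspace_UNIV)
    show "?\<rho> g *v v \<in> C" for g v by (simp add: rho C_def)
    show "?\<rho> (mat 1) *v v = v" if "v \<in> C" for v using P_C[OF that] by simp
    fix g h v assume gh: "g \<in> B" "h \<in> B" "v \<in> C"
    have "P *v (h *v v) - h *v v \<in> U" by (rule P(2))
    from U(3)[OF gh(1) this]
    have "g *v (P *v (h *v v)) - g *v (h *v v) \<in> U" by (simp add: matrix_vector_mult_diff_distrib)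
    then show "?\<rho> (g ** h) *v v = ?\<rho> g *v (?\<rho> h *v v)"
      unfolding rho by (simp add: P_U flip: matrix_vector_mul_assoc)
  qed
  obtain x where x: "x \<notin> U" using U(2) by blast
  have "P *v x \<noteq> 0"
  proof
    assume "P *v x = 0"
    then have "- x \<in> U" using P(2)[of x] by simp
    then show False using vec.subspace_neg[OF U(1)] x by fastforce
  qed
  then have "C \<noteq> {0}" by (auto simp: C_def)
  moreover have "regular_map ?\<rho>" by (intro regular_map_mult regular_map_const regular_map_id)
  ultimately obtain v where v: "v \<in> C" "v \<noteq> 0" "\<forall>g\<in>B. \<exists>c. ?\<rho> g *v v = c *s v"
    using solvable_common_eigenvector[OF B _ rep] by blast
  have "v \<notin> U" using P(1)[of v] P_C[OF v(1)] v(2) by auto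
  moreover have "\<exists>c. g *v v - c *s v \<in> U" if g: "g \<in> B" for g
  proof -
    obtain c where c: "?\<rho> g *v v = c *s v" using v(3) g by blast
    have "P *v (g *v v) - g *v v \<in> U" by (rule P(2))
    from vec.subspace_neg[OF U(1) this] show ?thesis using c by (intro exI[of _ c]) (simp add: rho)
  qed
  ultimately show ?thesis by blast
qed

lemma invariant_flag:
  fixes B :: "(complex^'n^'n) set"
  assumes B: "subgroup B GL_grp" "zariski_connected B" "(derived GL_grp ^^ s) B = {mat 1}"
    and m: "m \<le> CARD('n)"
  shows "\<exists>v :: nat \<Rightarrow> complex^'n. inj_on v {..<m} \<and> vec.independent (v ` {..<m})
    \<and> (\<forall>g\<in>B. \<forall>j<m. g *v v j \<in> vec.span (v ` {..j}))"
  using m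
proof (induction m)
  case 0
  then show ?case by (simp add: vec.independent_empty)
next
  case (Suc m)
  then obtain v :: "nat \<Rightarrow> complex^'n" where v: "inj_on v {..<m}" "vec.independent (v ` {..<m})"
    "\<forall>g\<in>B. \<forall>j<m. g *v v j \<in> vec.span (v ` {..j})" by auto
  let ?U = "vec.span (v ` {..<m})"
  have sub: "vec.subspace ?U" by (rule vec.subspace_span)
  have "vec.dim ?U = m" using v(1,2) by (simp add: vec.dim_eq_card_independent card_image)
  moreover have "vec.dim (UNIV :: (complex^'n) set) = CARD('n)" by (rule vec_dim_card)
  ultimately have ne: "?U \<noteq> UNIV" using Suc.prems by (metis Suc_n_not_le_n)
  have inv: "g *v u \<in> ?U" if g: "g \<in> B" and u: "u \<in> ?U" for g u
    using u
  proof (induction rule: vec.span_induct_alt)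
    case base
    then show ?case by (simp add: vec.span_zero)
  next
    case (step c x y)
    then obtain j where j: "j < m" "x = v j" by blast
    have "g *v x \<in> vec.span (v ` {..j})" using v(3) g j by blast
    moreover have "vec.span (v ` {..j}) \<subseteq> ?U" using j by (intro vec.span_mono image_mono) auto
    ultimately have "g *v x \<in> ?U" by blast
    then show ?case using step(2)
      by (simp add: matrix_vector_right_distrib vector_scalar_commute vec.span_add vec.span_scale)
  qed
  obtain w where w: "w \<notin> ?U" "\<forall>g\<in>B. \<exists>c. g *v w - c *s w \<in> ?U"
    using eigenvector_mod_subspace[OF B sub ne inv] by blast
  let ?v = "v(m := w)"
  have im: "?v ` {..<m} = v ` {..<m}" by auto
  have ims: "?v ` {..<Suc m} = insert w (v ` {..<m})" by (simp only: lessThan_Suc image_insert im fun_upd_same)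
  have "w \<notin> v ` {..<m}" 
  proof
    assume "w \<in> v ` {..<m}"
    from vec.span_base[OF this] show False using w(1) by simp
  qed
  then have inj: "inj_on ?v {..<Suc m}"
    using v(1) by (auto simp: inj_on_def less_Suc_eq image_def)
  have ind: "vec.independent (?v ` {..<Suc m})"
    unfolding ims by (rule vec.independent_insertI[OF w(1) v(2)])
  have inv': "g *v ?v j \<in> vec.span (?v ` {..j})" if g: "g \<in> B" and j: "j < Suc m" for g j
  proof (cases "j = m")
    case False
    then have "j < m" using j by simp
    moreover from this have "?v ` {..j} = v ` {..j}" by auto
    ultimately show ?thesis using v(3) g by auto
  next
    case True
    have e: "?v ` {..j} = insert w (v ` {..<m})" unfolding True using ims by (simp add: lessThan_Suc_atMost)
    obtain c where c: "g *v w - c *s w \<in> ?U" using w(2) g by blast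
    have "?U \<subseteq> vec.span (insert w (v ` {..<m}))" by (rule vec.span_mono) auto
    then have "g *v w - c *s w \<in> vec.span (insert w (v ` {..<m}))" using c by blast
    from vec.span_add[OF this vec.span_scale[OF vec.span_base[OF insertI1], of c]]
    have "(g *v w - c *s w) + c *s w \<in> vec.span (insert w (v ` {..<m}))" .
    then show ?thesis unfolding e by (simp add: True)
  qed
  show ?case
    by (intro exI[of _ ?v] conjI ballI allI impI inj ind) (rule inv')
qed

text \<open>The index type of the matrices carries no order. The flag is therefore indexed by
  natural numbers, and triangularity is stated by the coordinate functions
  \<open>cf\<close>.\<close>

theorem lie_kolchin:
  fixes B :: "(complex^'n^'n) set"
  assumes B: "subgroup B GL_grp" "zariski_connected B" "(derived GL_grp ^^ s) B = {mat 1}"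
  obtains v :: "nat \<Rightarrow> complex^'n" and cf :: "nat \<Rightarrow> complex^'n \<Rightarrow> complex"
  where "\<And>w. w = (\<Sum>i<CARD('n). cf i w *s v i)"
    "\<And>i w w'. cf i (w + w') = cf i w + cf i w'" "\<And>i c w. cf i (c *s w) = c * cf i w"
    "\<And>i j. i < CARD('n) \<Longrightarrow> j < CARD('n) \<Longrightarrow> cf i (v j) = (if i = j then 1 else 0)"
    "\<And>g i j. g \<in> B \<Longrightarrow> i < CARD('n) \<Longrightarrow> j < i \<Longrightarrow> cf i (g *v v j) = 0"
proof -
  let ?n = "CARD('n)"
  obtain v :: "nat \<Rightarrow> complex^'n" where v: "inj_on v {..<?n}" "vec.independent (v ` {..<?n})"
    "\<And>g j. g \<in> B \<Longrightarrow> j < ?n \<Longrightarrow> g *v v j \<in> vec.span (v ` {..j})"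
    using invariant_flag[OF B order_refl] by blast
  let ?b = "v ` {..<?n}"
  have "UNIV \<subseteq> vec.span ?b"
  proof (rule vec.card_ge_dim_independent)
    show "vec.dim (UNIV :: (complex^'n) set) \<le> card ?b"
      using v(1) by (simp add: card_image vec_dim_card card_cart_basis)
  qed (use v in auto)
  then have span: "w \<in> vec.span ?b" for w by blast
  let ?R = "vec.representation ?b"
  define cf where "cf = (\<lambda>i w. ?R w (v i))"
  show thesis
  proof
    fix w
    have "w = (\<Sum>b\<in>?b. ?R w b *s b)"
      by (rule vec.sum_representation_eq[symmetric, OF v(2) span]) auto
    then show "w = (\<Sum>i<?n. cf i w *s v i)"
      unfolding cf_def using sum.reindex[OF v(1), of "\<lambda>b. ?R w b *s b"] by (simp add: o_def)
  next
    show "cf i (w + w') = cf i w + cf i w'" for i w w'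
      unfolding cf_def by (simp add: vec.representation_add[OF v(2) span span])
    show "cf i (c *s w) = c * cf i w" for i c w
      unfolding cf_def by (simp add: vec.representation_scale[OF v(2) span])
  next
    fix i j assume ij: "i < ?n" "j < ?n"
    show "cf i (v j) = (if i = j then 1 else 0)"
      unfolding cf_def using ij v(1)
      by (auto simp: vec.representation_basis[OF v(2)] inj_on_def)
  next
    fix g i j assume g: "g \<in> B" and i: "i < ?n" "j < i"
    have sp: "g *v v j \<in> vec.span (v ` {..j})" using v(3) g i by simp
    have sb: "v ` {..j} \<subseteq> ?b" using i by auto
    have "v i \<notin> v ` {..j}"
    proof
      assume "v i \<in> v ` {..j}"
      then obtain l where l: "l \<le> j" "v i = v l" by auto
      then have "i = l" using inj_onD[OF v(1), of i l] i by simp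
      then show False using l i by simp
    qed
    then have "vec.representation (v ` {..j}) (g *v v j) (v i) = 0"
      using vec.representation_ne_zero by blast
    then show "cf i (g *v v j) = 0"
      unfolding cf_def using vec.representation_extend[OF v(2) sp sb] by simp
  qed
qed

lemma solvable_derived_series:
  fixes B :: "(complex^'n^'n) set"
  assumes B: "subgroup B GL_grp" "solvable (GL_grp\<lparr>carrier := B\<rparr>)"
  obtains s where "(derived GL_grp ^^ s) B = {mat 1}"
proof -
  interpret group "GL_grp :: (complex^'n^'n) monoid" by (rule group_GL_grp)
  have gB: "group (GL_grp\<lparr>carrier := B\<rparr>)" by (rule subgroup_imp_group[OF B(1)])
  obtain s where s: "(derived (GL_grp\<lparr>carrier := B\<rparr>) ^^ s) B = {mat 1}"
    using group.solvable_iff_trivial_derived_seq[OF gB] B(2) by auto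
  have "(derived (GL_grp\<lparr>carrier := B\<rparr>) ^^ t) B = (derived GL_grp ^^ t) B \<and> (derived GL_grp ^^ t) B \<subseteq> B" for t
  proof (induction t)
    case (Suc t)
    then show ?case using derived_consistent[OF _ B(1)] derived_incl[OF _ B(1)] by simp
  qed simp
  then show thesis using s that by metis
qed

section \<open>The congruence topology on integral matrices\<close>

definition mat_over :: "complex set \<Rightarrow> complex^'n^'n \<Rightarrow> bool" where
  "mat_over R A \<longleftrightarrow> (\<forall>i j. A $ i $ j \<in> R)"

definition mcong :: "complex set \<Rightarrow> nat \<Rightarrow> complex^'n^'n \<Rightarrow> complex^'n^'n \<Rightarrow> bool" where
  "mcong R m A C \<longleftrightarrow> (\<exists>D. mat_over R D \<and> A - C = real m *\<^sub>R D)"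

definition cong_closure :: "complex set \<Rightarrow> (complex^'n^'n) set \<Rightarrow> (complex^'n^'n) set" where
  "cong_closure R H = {g \<in> GL_R R. \<forall>m>0. \<exists>h\<in>H. mcong R m g h}"

lemma mcongE:
  assumes "mcong R m A C"
  obtains D where "mat_over R D" "A - C = real m *\<^sub>R D"
  using assms unfolding mcong_def by blast

lemma matrix_inv_eq:
  fixes A :: "complex^'n^'n"
  assumes "A ** C = mat 1" "C ** A = mat 1"
  shows "matrix_inv A = C"
proof -
  have "invertible A" using assms unfolding invertible_def by blast
  then have "C = C ** (A ** matrix_inv A)" by (simp add: matrix_inv_right)
  then show ?thesis using assms by (simp add: matrix_mul_assoc)
qed

lemma matrix_inv_1: "matrix_inv (mat 1 :: complex^'n^'n) = mat 1"
  by (rule matrix_inv_eq) simp_all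

lemma matrix_inv_mult:
  fixes A C :: "complex^'n^'n"
  assumes "invertible A" "invertible C"
  shows "matrix_inv (A ** C) = matrix_inv C ** matrix_inv A"
proof (rule matrix_inv_eq)
  have "m ** C ** matrix_inv C = m" "m ** matrix_inv A ** A = m" for m :: "complex^'n^'n"
    by (simp_all flip: matrix_mul_assoc add: matrix_inv_left matrix_inv_right assms)
  then show "A ** C ** (matrix_inv C ** matrix_inv A) = mat 1" "matrix_inv C ** matrix_inv A ** (A ** C) = mat 1"
    by (simp_all add: matrix_mul_assoc matrix_inv_left matrix_inv_right assms)
qed

lemma matrix_inv_matrix_inv: "invertible A \<Longrightarrow> matrix_inv (matrix_inv A) = (A :: complex^'n^'n)"
  by (rule matrix_inv_eq) (simp_all add: matrix_inv_left matrix_inv_right)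

lemma matrix_inv_cancel:
  fixes A :: "complex^'n^'n"
  assumes "invertible A"
  shows "A ** (matrix_inv A ** C) = C" "matrix_inv A ** (A ** C) = C"
    "C ** A ** matrix_inv A = C" "C ** matrix_inv A ** A = C"
  by (simp_all add: matrix_mul_assoc matrix_inv_left[OF assms] matrix_inv_right[OF assms])
     (simp_all flip: matrix_mul_assoc add: matrix_inv_left[OF assms] matrix_inv_right[OF assms])

lemma scaleR_entry: "(real m *\<^sub>R A) $ i $ j = of_nat m * (A :: complex^'n^'n) $ i $ j"
  unfolding vector_scaleR_component by (simp add: scaleR_conv_of_real)

lemma matrix_add_mult: "(A + C) ** E = A ** E + C ** (E :: complex^'n^'n)"
  by (simp add: matrix_matrix_mult_def vec_eq_iff sum.distrib distrib_right)

context
  fixes R :: "complex set"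
  assumes R: "subring_C R"
begin

lemma mat_over_mult: "mat_over R A \<Longrightarrow> mat_over R C \<Longrightarrow> mat_over R (A ** C)"
proof -
  have sum: "sum f S \<in> R" if "\<And>i. i \<in> S \<Longrightarrow> f i \<in> R" for f :: "'a \<Rightarrow> complex" and S
    using that by (induction S rule: infinite_finite_induct) (auto intro: subring_CD[OF R])
  show "mat_over R A \<Longrightarrow> mat_over R C \<Longrightarrow> mat_over R (A ** C)"
    unfolding mat_over_def matrix_matrix_mult_def by (auto intro!: sum subring_CD[OF R])
qed

lemma mat_over_add: "mat_over R A \<Longrightarrow> mat_over R C \<Longrightarrow> mat_over R (A + C)"
  and mat_over_uminus: "mat_over R A \<Longrightarrow> mat_over R (- A)"
  and mat_over_1: "mat_over R (mat 1)"
  and mat_over_0: "mat_over R 0"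
  using subring_CD[OF R] by (auto simp: mat_over_def mat_def)

lemma mat_over_scale: "mat_over R A \<Longrightarrow> mat_over R (real m *\<^sub>R A)"
  unfolding mat_over_def scaleR_entry using subring_CD(5,8)[OF R] by blast

lemma mcong_refl: "mcong R m A A"
  unfolding mcong_def by (intro exI[of _ 0]) (simp add: mat_over_0)

lemma mcong_sym: "mcong R m A C \<Longrightarrow> mcong R m C A"
  unfolding mcong_def
  by (elim exE conjE, rename_tac D, rule_tac x = "- D" in exI) (simp add: mat_over_uminus algebra_simps)

lemma mcong_trans: "mcong R m A C \<Longrightarrow> mcong R m C E \<Longrightarrow> mcong R m A E"
proof -
  assume "mcong R m A C" "mcong R m C E"
  then obtain D D' where "mat_over R D" "A - C = real m *\<^sub>R D" "mat_over R D'" "C - E = real m *\<^sub>R D'"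
    unfolding mcong_def by blast
  moreover have "A - E = (A - C) + (C - E)" by simp
  ultimately show ?thesis unfolding mcong_def
    by (intro exI[of _ "D + D'"]) (simp add: mat_over_add scaleR_add_right)
qed

lemma mcong_mult:
  assumes "mcong R m A C" "mcong R m A' C'" "mat_over R A'" "mat_over R C"
  shows "mcong R m (A ** A') (C ** C')"
proof -
  obtain D D' where D: "mat_over R D" "A - C = real m *\<^sub>R D" "mat_over R D'" "A' - C' = real m *\<^sub>R D'"
    using assms unfolding mcong_def by blast
  have A: "A = C + real m *\<^sub>R D" "A' = C' + real m *\<^sub>R D'" using D by (auto simp: algebra_simps)
  have "A ** A' - C ** C' = (real m *\<^sub>R D) ** A' + C ** (real m *\<^sub>R D')"
    by (simp add: A matrix_add_ldistrib matrix_add_mult)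
  also have "\<dots> = real m *\<^sub>R (D ** A' + C ** D')"
    by (simp add: scalar_matrix_assoc matrix_scalar_ac scaleR_add_right)
  finally show ?thesis unfolding mcong_def
    using D(1,3) assms(3,4) by (intro exI[of _ "D ** A' + C ** D'"]) (simp add: mat_over_add mat_over_mult)
qed

lemma mcong_dvd: "mcong R (m' * m) A C \<Longrightarrow> mcong R m A C"
  unfolding mcong_def
  by (elim exE conjE, rename_tac D, rule_tac x = "real m' *\<^sub>R D" in exI)
     (auto simp: mat_over_scale mult.commute)

lemma GL_R_D:
  assumes "A \<in> GL_R R"
  shows "mat_over R A" "invertible A" "matrix_inv A \<in> GL_R R" "mat_over R (matrix_inv A)"
proof -
  obtain C where C: "A ** C = mat 1" "C ** A = mat 1" "mat_over R C" and A: "mat_over R A"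
    using assms unfolding GL_R_def mat_over_def by blast
  show "mat_over R A" "invertible A" using A C unfolding invertible_def by blast+
  show "matrix_inv A \<in> GL_R R" "mat_over R (matrix_inv A)"
    unfolding matrix_inv_eq[OF C(1,2)] using A C unfolding GL_R_def mat_over_def by blast+
qed

lemma GL_R_I:
  assumes "mat_over R A" "invertible A" "mat_over R (matrix_inv A)"
  shows "A \<in> GL_R R"
  using assms matrix_inv_left[OF assms(2)] matrix_inv_right[OF assms(2)]
  unfolding GL_R_def mat_over_def by blast

lemma GL_R_1: "mat 1 \<in> GL_R R"
  by (rule GL_R_I) (simp_all add: mat_over_1 invertible_mat_1 matrix_inv_1)

lemma GL_R_mult: "A \<in> GL_R R \<Longrightarrow> C \<in> GL_R R \<Longrightarrow> A ** C \<in> GL_R R"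
  by (rule GL_R_I) (auto simp: matrix_inv_mult mat_over_mult GL_R_D invertible_mult)

lemma mcong_inv:
  assumes "mcong R m A C" "A \<in> GL_R R" "C \<in> GL_R R"
  shows "mcong R m (matrix_inv A) (matrix_inv C)"
proof -
  note A = GL_R_D[OF assms(2)] and C = GL_R_D[OF assms(3)]
  have "mcong R m (matrix_inv A ** C ** matrix_inv C) (matrix_inv A ** A ** matrix_inv C)"
    by (intro mcong_mult mcong_refl mcong_sym[OF assms(1)] mat_over_mult A C)
  then show ?thesis using A(2) C(2) by (simp add: matrix_inv_cancel matrix_inv_left)
qed

lemma cong_closureD:
  assumes "g \<in> cong_closure R H"
  shows "g \<in> GL_R R" "m > 0 \<Longrightarrow> \<exists>h\<in>H. mcong R m g h"
  using assms by (auto simp: cong_closure_def)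

lemma cong_closure_translate:
  assumes g: "g \<in> cong_closure R H" and H: "subgroup H GL_grp" "H \<subseteq> GL_R R" and h: "h \<in> H"
  shows "matrix_inv h ** g \<in> cong_closure R H"
proof -
  note Hd = subgroup_GL_D[OF H(1)]
  have hR: "h \<in> GL_R R" using h H(2) by blast
  have "\<exists>h'\<in>H. mcong R m (matrix_inv h ** g) h'" if m: "m > 0" for m
  proof -
    obtain h1 where h1: "h1 \<in> H" "mcong R m g h1" using cong_closureD(2)[OF g m] by blast
    have "mcong R m (matrix_inv h ** g) (matrix_inv h ** h1)"
      by (intro mcong_mult mcong_refl h1 GL_R_D[OF hR] GL_R_D[OF cong_closureD(1)[OF g]])
    then show ?thesis using Hd(3)[OF Hd(4)[OF h] h1(1)] by blast
  qed
  then show ?thesis unfolding cong_closure_def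
    using GL_R_mult[OF GL_R_D(3)[OF hR] cong_closureD(1)[OF g]] by simp
qed

text \<open>An element of \<open>T'\<close> in the closure of \<open>H\<close> is approximated by
  elements of \<open>H\<close>, but \<open>ker\<close> requires approximations in
  \<open>H \<inter> T'\<close>. They are obtained by applying \<open>sep\<close> a second time, to a
  congruence subgroup of \<open>H\<close>; this is why \<open>sep\<close> speaks about all subgroups
  of \<open>T\<close>.\<close>

lemma cong_closed_extension:
  fixes T T' H :: "(complex^'n^'n) set"
  assumes T': "subgroup T' GL_grp"
    and sep: "\<And>X g. subgroup X GL_grp \<Longrightarrow> X \<subseteq> T \<Longrightarrow> g \<in> cong_closure R X \<Longrightarrow> \<exists>x\<in>X. matrix_inv x ** g \<in> T'"
    and ker: "\<And>X. subgroup X GL_grp \<Longrightarrow> X \<subseteq> T' \<Longrightarrow> X \<subseteq> T \<Longrightarrow> cong_closure R X \<subseteq> X"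
    and T: "T \<subseteq> GL_R R"
    and H: "subgroup H GL_grp" "H \<subseteq> T"
  shows "cong_closure R H \<subseteq> H"
proof
  fix g assume g: "g \<in> cong_closure R H"
  interpret group "GL_grp :: (complex^'n^'n) monoid" by (rule group_GL_grp)
  note Hd = subgroup_GL_D[OF H(1)] and T'd = subgroup_GL_D[OF T']
  have HR: "H \<subseteq> GL_R R" using H(2) T by blast
  obtain h where h: "h \<in> H" "matrix_inv h ** g \<in> T'" using sep[OF H g] by blast
  define a where "a = matrix_inv h ** g"
  have a: "a \<in> cong_closure R H" unfolding a_def by (rule cong_closure_translate[OF g H(1) HR h(1)])
  have aT: "a \<in> T'" using h(2) by (simp add: a_def)
  note aR = cong_closureD(1)[OF a]
  have "a \<in> H"
  proof (rule ccontr)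
    assume na: "a \<notin> H"
    define C where "C = H \<inter> T'"
    have C: "subgroup C GL_grp" unfolding C_def by (rule subgroups_Inter_pair[OF H(1) T'])
    have "cong_closure R C \<subseteq> C" by (rule ker[OF C]) (use H(2) in \<open>auto simp: C_def\<close>)
    then have "a \<notin> cong_closure R C" using na by (auto simp: C_def)
    then obtain m where m: "m > 0" "\<And>c. c \<in> C \<Longrightarrow> \<not> mcong R m a c"
      using aR unfolding cong_closure_def by blast
    \<comment> \<open>An approximation \<open>h0\<close> of \<open>a\<close> modulo \<open>m\<close>
      may lie outside \<open>T'\<close>. The error \<open>d\<close> lies in the closure of
      \<open>Y\<close>, so a factor \<open>y\<close> from \<open>Y\<close> moves \<open>h0\<close>
      into \<open>T'\<close> without changing its class modulo \<open>m\<close>.\<close>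
    define Y where "Y = {x \<in> H. mcong R m x (mat 1)}"
    have "subgroup Y GL_grp"
    proof (rule subgroupI)
      show "Y \<subseteq> carrier GL_grp" using Hd(1) by (auto simp: Y_def)
      have "mat 1 \<in> Y" using Hd(2) mcong_refl by (simp add: Y_def)
      then show "Y \<noteq> {}" by blast
      show "inv\<^bsub>GL_grp\<^esub> x \<in> Y" if x: "x \<in> Y" for x
      proof -
        have "mcong R m (matrix_inv x) (matrix_inv (mat 1))"
          by (rule mcong_inv[OF _ _ GL_R_1]) (use x HR in \<open>auto simp: Y_def\<close>)
        then show ?thesis using x Hd(1,4) by (simp add: Y_def inv_GL_grp matrix_inv_1)
      qed
      show "x \<otimes>\<^bsub>GL_grp\<^esub> y \<in> Y" if x: "x \<in> Y" and y: "y \<in> Y" for x y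
      proof -
        have "y \<in> GL_R R" using y HR by (auto simp: Y_def)
        then have "mcong R m (x ** y) (mat 1 ** mat 1)"
          using x y by (intro mcong_mult mat_over_1 GL_R_D) (auto simp: Y_def)
        then show ?thesis using x y Hd(3) by (simp add: Y_def)
      qed
    qed
    note Y = this
    obtain h0 where h0: "h0 \<in> H" "mcong R m a h0" using cong_closureD(2)[OF a m(1)] by blast
    have h0R: "h0 \<in> GL_R R" using h0(1) HR by blast
    define d where "d = matrix_inv h0 ** a"
    have dR: "d \<in> GL_R R" unfolding d_def by (intro GL_R_mult GL_R_D h0R aR)
    have d1: "mcong R m d (mat 1)"
    proof -
      have "mcong R m (matrix_inv h0 ** a) (matrix_inv h0 ** h0)"
        by (intro mcong_mult mcong_refl h0 GL_R_D aR h0R)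
      then show ?thesis using GL_R_D(2)[OF h0R] by (simp add: d_def matrix_inv_left)
    qed
    have "d \<in> cong_closure R Y"
      unfolding cong_closure_def
    proof (intro CollectI conjI allI impI dR)
      fix m' :: nat assume "m' > 0"
      \<comment> \<open>The factor \<open>m\<close> in the modulus forces the approximation
        \<open>h1\<close> into \<open>Y\<close>.\<close>
      then obtain h1 where h1: "h1 \<in> H" "mcong R (m' * m) d h1"
        using cong_closureD(2)[OF cong_closure_translate[OF a H(1) HR h0(1)], of "m' * m"] m(1)
        unfolding d_def by auto
      have "mcong R m h1 (mat 1)" by (rule mcong_trans[OF mcong_sym[OF mcong_dvd[OF h1(2)]] d1])
      moreover have "mcong R m' d h1" using mcong_dvd[of m m'] h1(2) by (simp add: mult.commute)
      ultimately show "\<exists>h\<in>Y. mcong R m' d h" using h1(1) by (auto simp: Y_def)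
    qed
    moreover have "Y \<subseteq> T" using H(2) by (auto simp: Y_def)
    ultimately obtain y where y: "y \<in> Y" "matrix_inv y ** d \<in> T'" using sep[OF Y] by blast
    define b where "b = matrix_inv y ** d"
    have yH: "y \<in> H" "mcong R m y (mat 1)" using y(1) by (auto simp: Y_def)
    then have yR: "y \<in> GL_R R" using HR by blast
    have bR: "b \<in> GL_R R" unfolding b_def by (intro GL_R_mult GL_R_D yR dR)
    have ab: "a = h0 ** y ** b"
      using GL_R_D(2)[OF yR] GL_R_D(2)[OF h0R] by (simp add: b_def d_def matrix_inv_cancel flip: matrix_mul_assoc)
    then have "h0 ** y = a ** matrix_inv b" using GL_R_D(2)[OF bR] by (simp add: matrix_inv_cancel)
    then have "h0 ** y \<in> C" using aT y(2) T'd(3,4) Hd(3)[OF h0(1) yH(1)] by (simp add: C_def b_def)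
    moreover have "mcong R m a (h0 ** y)"
    proof -
      have "mcong R m y d" by (rule mcong_trans[OF yH(2) mcong_sym[OF d1]])
      then have "mcong R m (matrix_inv y ** y) (matrix_inv y ** d)"
        by (rule mcong_mult[OF mcong_refl _ GL_R_D(1)[OF yR] GL_R_D(4)[OF yR]])
      then have "mcong R m (mat 1) b" using GL_R_D(2)[OF yR] by (simp add: b_def matrix_inv_left)
      then have "mcong R m b (mat 1)" by (rule mcong_sym)
      then have "mcong R m (h0 ** y ** b) (h0 ** y ** mat 1)"
        by (rule mcong_mult[OF mcong_refl _ GL_R_D(1)[OF bR] GL_R_D(1)[OF GL_R_mult[OF h0R yR]]])
      then show ?thesis by (simp add: ab)
    qed
    ultimately show False using m(2) by blast
  qed
  then have "h ** a \<in> H" by (rule Hd(3)[OF h(1)])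
  then show "g \<in> H" using Hd(1)[OF h(1)] by (simp add: a_def matrix_inv_cancel)
qed

end

section \<open>Integral triangular groups\<close>

lemma zspan_finite_set:
  assumes "finite S"
  shows "\<exists>e r. S \<subseteq> zspan e r"
proof -
  obtain xs where xs: "set xs = S" using finite_list[OF assms] by blast
  have "x \<in> zspan ((!) xs) (length xs)" if x: "x \<in> S" for x
  proof -
    obtain i where i: "i < length xs" "x = xs ! i" using x xs by (metis in_set_conv_nth)
    show ?thesis unfolding i(2) by (rule zspan_base[OF i(1)])
  qed
  then show ?thesis by blast
qed

lemma zspan_mult:
  assumes "x \<in> zspan e r" "add_subgroup X" "\<And>i. i < r \<Longrightarrow> e i * y \<in> X"
  shows "x * y \<in> X"
proof -
  obtain a where a: "x = (\<Sum>i<r. of_int (a i) * e i)" using assms(1) by (auto simp: zspan_def)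
  have "x * y = (\<Sum>i<r. of_int (a i) * (e i * y))" by (simp add: a sum_distrib_right mult.assoc)
  also have "\<dots> \<in> X"
    by (rule add_subgroup_sum[OF assms(2)]) (auto intro: add_subgroup_of_int_mult[OF assms(2) assms(3)])
  finally show ?thesis .
qed

lemma number_field_containing:
  fixes a :: "nat \<Rightarrow> complex"
  assumes k: "number_field k" and a: "\<forall>i<q. algebraic_int (a i)"
  shows "\<exists>K. number_field K \<and> k \<subseteq> K \<and> (\<forall>i<q. a i \<in> K)"
  using a
proof (induction q)
  case 0
  then show ?case using k by auto
next
  case (Suc q)
  then obtain F where F: "number_field F" "k \<subseteq> F" "\<forall>i<q. a i \<in> F" by auto
  have sF: "subfield_C F" using F(1) by (simp add: number_field_def)
  obtain d where d: "d > 0" "a q ^ d \<in> zspan (\<lambda>i. a q ^ i) d"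
    using algebraic_int_power_span[of "a q"] Suc.prems by auto
  have "zspan (\<lambda>i. a q ^ i) d \<subseteq> adjoin F (a q) d"
  proof (rule zspan_least)
    show "a q ^ i \<in> adjoin F (a q) d" if "i < d" for i
      unfolding adjoin_def using that subfield_CD(1,2)[OF sF]
      by (intro CollectI exI[of _ "\<lambda>j. if j = i then 1 else 0"]) (auto simp: if_distrib[of "\<lambda>x. x * _"] cong: if_cong)
    show "add_subgroup (adjoin F (a q) d)"
      unfolding add_subgroup_def
    proof (intro conjI ballI)
      show "0 \<in> adjoin F (a q) d" unfolding adjoin_def
        using subfield_CD(1)[OF sF] by (intro CollectI exI[of _ "\<lambda>j. 0"]) auto
      fix x y assume "x \<in> adjoin F (a q) d" "y \<in> adjoin F (a q) d"
      then obtain b c where "x = (\<Sum>i<d. b i * a q ^ i)" "\<forall>i. b i \<in> F" "y = (\<Sum>i<d. c i * a q ^ i)" "\<forall>i. c i \<in> F"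
        unfolding adjoin_def by blast
      then show "x - y \<in> adjoin F (a q) d" unfolding adjoin_def using subfield_CD(4)[OF sF]
        by (intro CollectI exI[of _ "\<lambda>i. b i - c i"]) (simp add: sum_subtractf left_diff_distrib)
    qed
  qed
  then have "a q ^ d \<in> adjoin F (a q) d" using d(2) by blast
  note nf = number_field_adjoin[OF F(1) d(1) this]
  have "\<forall>i<Suc q. a i \<in> adjoin F (a q) d"
    using nf(2,3) F(3) by (simp add: less_Suc_eq subset_iff)
  then show ?case using nf(1,2) F(2) by (intro exI[of _ "adjoin F (a q) d"]) simp
qed

text \<open>The numbers \<open>\<omega>\<close> generate \<open>R\<close> as an additive group,
  whereas the basis \<open>v\<close> is an arbitrary complex one.\<close>

locale integral_flag =
  fixes R :: "complex set" and \<omega> :: "nat \<Rightarrow> complex" and s n :: nat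
    and v :: "nat \<Rightarrow> complex^'n" and cf :: "nat \<Rightarrow> complex^'n \<Rightarrow> complex"
  assumes R: "subring_C R" and \<omega>: "R = zspan \<omega> s"
    and expand: "w = (\<Sum>i<n. cf i w *s v i)"
    and cf_add: "cf i (w + w') = cf i w + cf i w'"
    and cf_scale: "cf i (c *s w) = c * cf i w"
    and cf_v: "i < n \<Longrightarrow> j < n \<Longrightarrow> cf i (v j) = (if i = j then 1 else 0)"
begin

definition t :: "nat \<Rightarrow> nat \<Rightarrow> complex^'n^'n \<Rightarrow> complex" where
  "t i j A = cf i (A *v v j)"

lemma cf_0: "cf i 0 = 0"
  using cf_scale[of i 0 0] by simp

lemma cf_sum: "cf i (sum f S) = (\<Sum>x\<in>S. cf i (f x))"
  by (induction S rule: infinite_finite_induct) (auto simp: cf_0 cf_add)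

lemma cf_mult: "cf i (A *v w) = (\<Sum>l<n. t i l A * cf l w)"
proof -
  have "A *v w = A *v (\<Sum>l<n. cf l w *s v l)" by (simp flip: expand)
  also have "\<dots> = (\<Sum>l<n. cf l w *s (A *v v l))"
    by (simp add: vec.sum vector_scalar_commute)
  finally show ?thesis by (simp add: cf_sum cf_scale t_def mult.commute)
qed

lemma t_mult: "t i j (A ** C) = (\<Sum>l<n. t i l A * t l j C)"
  unfolding t_def[of i j] t_def[of _ j] by (simp add: cf_mult flip: matrix_vector_mul_assoc)

lemma t_1: "i < n \<Longrightarrow> j < n \<Longrightarrow> t i j (mat 1) = (if i = j then 1 else 0)"
  by (simp add: t_def cf_v)

lemma t_eq_1:
  assumes "\<And>i j. i < n \<Longrightarrow> j < n \<Longrightarrow> t i j A = (if i = j then 1 else 0)"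
  shows "A = mat 1"
proof -
  have "A *v w = mat 1 *v w" for w
  proof -
    have "cf i (A *v w) = cf i w" if i: "i < n" for i
    proof -
      have "cf i (A *v w) = (\<Sum>l<n. if l = i then cf l w else 0)"
        unfolding cf_mult using assms i by (intro sum.cong) auto
      then show ?thesis using i by simp
    qed
    then have "(\<Sum>i<n. cf i (A *v w) *s v i) = (\<Sum>i<n. cf i w *s v i)" by simp
    then show ?thesis by (simp flip: expand)
  qed
  then show ?thesis by (metis matrix_eq)
qed

definition triangular :: "complex^'n^'n \<Rightarrow> bool" where
  "triangular A \<longleftrightarrow> (\<forall>i<n. \<forall>j<i. t i j A = 0)"

lemma triangularD: "triangular A \<Longrightarrow> j < i \<Longrightarrow> i < n \<Longrightarrow> t i j A = 0"
  by (simp add: triangular_def)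

lemma triangular_1: "triangular (mat 1)"
  by (simp add: triangular_def t_1)

lemma triangular_mult: "triangular A \<Longrightarrow> triangular C \<Longrightarrow> triangular (A ** C)"
  unfolding triangular_def t_mult
proof (intro allI impI sum.neutral ballI)
  fix i j l assume A: "\<forall>i<n. \<forall>j<i. t i j A = 0" "\<forall>i<n. \<forall>j<i. t i j C = 0"
    and "i < n" "j < i" "l \<in> {..<n}"
  then show "t i l A * t l j C = 0" by (cases "l < i") auto
qed

lemma t_mult_diag:
  assumes "triangular A" "triangular C" "i < n"
  shows "t i i (A ** C) = t i i A * t i i C"
proof -
  have "t i i (A ** C) = (\<Sum>l<n. if l = i then t i i A * t i i C else 0)"
    unfolding t_mult
  proof (rule sum.cong[OF refl])
    fix l assume "l \<in> {..<n}"
    then show "t i l A * t l i C = (if l = i then t i i A * t i i C else 0)"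
      using triangularD[OF assms(1), of l i] triangularD[OF assms(2), of i l] assms(3)
      by (cases l i rule: linorder_cases) auto
  qed
  then show ?thesis using assms(3) by simp
qed

lemma t_mult_offdiag:
  assumes "triangular A" "triangular C" "i < j" "j < n"
    and z: "\<And>l. i < l \<Longrightarrow> l < j \<Longrightarrow> t i l A = 0"
  shows "t i j (A ** C) = t i i A * t i j C + t i j A * t j j C"
proof -
  have "t i j (A ** C) = (\<Sum>l<n. (if l = i then t i i A * t i j C else 0) + (if l = j then t i j A * t j j C else 0))"
    unfolding t_mult
  proof (rule sum.cong[OF refl])
    fix l assume "l \<in> {..<n}"
    then show "t i l A * t l j C = (if l = i then t i i A * t i j C else 0) + (if l = j then t i j A * t j j C else 0)"
      using triangularD[OF assms(1), of l i] triangularD[OF assms(2), of j l] z[of l] assms(3,4)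
      by (cases "l < i \<or> j < l \<or> (i < l \<and> l < j)") auto
  qed
  then show ?thesis using assms(3,4) by (simp add: sum.distrib)
qed

definition tcode :: "nat \<Rightarrow> nat \<Rightarrow> nat" where
  "tcode i j = (j - i) * n + i"

lemma tcode_inj:
  assumes "i \<le> j" "i' \<le> j'" "i < n" "i' < n" "tcode i j = tcode i' j'"
  shows "i = i' \<and> j = j'"
proof -
  have "i = tcode i j mod n" "j - i = tcode i j div n" "i' = tcode i' j' mod n" "j' - i' = tcode i' j' div n"
    using assms(3,4) by (auto simp: tcode_def)
  then show ?thesis using assms by simp
qed

lemma tcode_mono: "i < n \<Longrightarrow> i' < n \<Longrightarrow> j - i < j' - i' \<Longrightarrow> tcode i j < tcode i' j'"
proof -
  assume a: "i < n" "i' < n" "j - i < j' - i'"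
  then have "tcode i j < (j - i) * n + n" by (simp add: tcode_def)
  also have "\<dots> = Suc (j - i) * n" by simp
  also have "\<dots> \<le> (j' - i') * n" using a(3) by (intro mult_right_mono) auto
  finally show ?thesis by (simp add: tcode_def)
qed

text \<open>The entries on and above the diagonal are made trivial one at a time, diagonal by diagonal;
  \<open>tcode\<close> numbers them in this order.\<close>

definition trivial_below :: "nat \<Rightarrow> complex^'n^'n \<Rightarrow> bool" where
  "trivial_below r A \<longleftrightarrow> triangular A \<and>
     (\<forall>i j. i \<le> j \<longrightarrow> j < n \<longrightarrow> tcode i j < r \<longrightarrow> t i j A = (if i = j then 1 else 0))"

lemma trivial_belowD:
  assumes "trivial_below r A"
  shows "triangular A" "i \<le> j \<Longrightarrow> j < n \<Longrightarrow> tcode i j < r \<Longrightarrow> t i j A = (if i = j then 1 else 0)"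
  using assms by (auto simp: trivial_below_def)

lemma trivial_below_1: "trivial_below r (mat 1)"
  by (simp add: trivial_below_def triangular_1 t_1)

lemma trivial_below_mult:
  assumes A: "trivial_below r A" and C: "trivial_below r C"
  shows "trivial_below r (A ** C)"
  unfolding trivial_below_def
proof (intro conjI allI impI)
  note Ad = trivial_belowD[OF A] and Cd = trivial_belowD[OF C]
  show "triangular (A ** C)" by (rule triangular_mult[OF Ad(1) Cd(1)])
  fix i j assume ij: "i \<le> j" "j < n" "tcode i j < r"
  show "t i j (A ** C) = (if i = j then 1 else 0)"
  proof (cases "i = j")
    case True
    then show ?thesis using t_mult_diag[OF Ad(1) Cd(1), of i] Ad(2)[OF ij] Cd(2)[OF ij] ij by simp
  next
    case False
    have "t i l A = 0" if "i < l" "l < j" for l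
    proof -
      have "tcode i l < tcode i j" using that ij by (intro tcode_mono) auto
      then show ?thesis using Ad(2)[of i l] that ij by simp
    qed
    then show ?thesis
      using t_mult_offdiag[OF Ad(1) Cd(1), of i j] Ad(2)[OF ij] Cd(2)[OF ij] ij False by simp
  qed
qed

text \<open>The condition is imposed on the inverse as well, so closure under inversion holds by
  definition.\<close>

definition T :: "nat \<Rightarrow> (complex^'n^'n) set" where
  "T r = {A \<in> GL_R R. trivial_below r A \<and> trivial_below r (matrix_inv A)}"

lemma TD:
  assumes "A \<in> T r"
  shows "A \<in> GL_R R" "trivial_below r A" "trivial_below r (matrix_inv A)" "invertible A" "triangular A"
    "matrix_inv A \<in> T r"
  using assms GL_R_D[OF R, of A] by (auto simp: T_def trivial_belowD matrix_inv_matrix_inv)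

lemma T_subset: "T r \<subseteq> GL_R R"
  by (auto simp: T_def)

lemma T_mult:
  assumes "A \<in> T r" "C \<in> T r"
  shows "A ** C \<in> T r"
  using TD[OF assms(1)] TD[OF assms(2)]
  by (auto simp: T_def matrix_inv_mult trivial_below_mult GL_R_mult[OF R])

lemma subgroup_T: "subgroup (T r) GL_grp"
proof -
  interpret group "GL_grp :: (complex^'n^'n) monoid" by (rule group_GL_grp)
  show ?thesis
  proof (rule subgroupI)
    show "T r \<subseteq> carrier GL_grp" using TD(4) by auto
    have "mat 1 \<in> T r" by (simp add: T_def trivial_below_1 matrix_inv_1 GL_R_1[OF R])
    then show "T r \<noteq> {}" by blast
    show "inv\<^bsub>GL_grp\<^esub> A \<in> T r" if "A \<in> T r" for A
      using TD(4,6)[OF that] by (simp add: inv_GL_grp)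
    show "A \<otimes>\<^bsub>GL_grp\<^esub> C \<in> T r" if "A \<in> T r" "C \<in> T r" for A C
      using T_mult[OF that] by simp
  qed
qed

lemma T_final:
  assumes "A \<in> T (n * n)"
  shows "A = mat 1"
proof (rule t_eq_1)
  fix i j assume ij: "i < n" "j < n"
  show "t i j A = (if i = j then 1 else 0)"
  proof (cases "j < i")
    case True
    then show ?thesis using triangularD[OF TD(5)[OF assms]] ij by simp
  next
    case False
    \<comment> \<open>The fictitious position \<open>(0, n)\<close> has code \<open>n * n\<close>,
      beyond the codes of all entries on or above the diagonal.\<close>
    have "tcode i j < tcode 0 n" using ij by (intro tcode_mono) auto
    then have "tcode i j < n * n" by (simp add: tcode_def)
    then show ?thesis using trivial_belowD(2)[OF TD(2)[OF assms], of i j] False ij by simp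
  qed
qed

text \<open>An entry in the basis \<open>v\<close> is a fixed complex linear form in the ordinary
  entries, which are integer combinations of \<open>\<omega>\<close>.\<close>

lemma entries_lattice: "\<exists>e r. \<forall>i<n. \<forall>j<n. \<forall>A. mat_over R A \<longrightarrow> t i j A \<in> zspan e r"
proof -
  let ?S = "(\<lambda>(l, i, j, a, b). \<omega> l * (v j $ b * cf i (axis a 1))) ` ({..<s} \<times> {..<n} \<times> {..<n} \<times> UNIV \<times> UNIV)"
  have "finite ?S" by (intro finite_imageI finite_cartesian_product) auto
  from zspan_finite_set[OF this] obtain e r where er: "?S \<subseteq> zspan e r" by blast
  have main: "t i j A \<in> zspan e r" if ij: "i < n" "j < n" and A: "mat_over R A" for i j A
  proof -
    have w: "w = (\<Sum>a\<in>UNIV. w $ a *s axis a 1)" for w :: "complex^'n" by (simp add: basis_expansion)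
    have "t i j A = cf i (\<Sum>a\<in>UNIV. (A *v v j) $ a *s axis a 1)" unfolding t_def using w by metis
    also have "\<dots> = (\<Sum>a\<in>UNIV. \<Sum>b\<in>UNIV. A $ a $ b * (v j $ b * cf i (axis a 1)))"
      by (simp add: cf_sum cf_scale matrix_vector_mult_def sum_distrib_right mult.assoc)
    also have "\<dots> \<in> zspan e r"
    proof (intro add_subgroup_sum[OF add_subgroup_zspan])
      fix a b
      have Aab: "A $ a $ b \<in> zspan \<omega> s" using A unfolding mat_over_def \<omega> by blast
      show "A $ a $ b * (v j $ b * cf i (axis a 1)) \<in> zspan e r"
      proof (rule zspan_mult[OF Aab add_subgroup_zspan])
        fix l assume "l < s"
        then show "\<omega> l * (v j $ b * cf i (axis a 1)) \<in> zspan e r"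
          using ij by (intro subsetD[OF er] image_eqI[of _ _ "(l, i, j, a, b)"]) auto
      qed
    qed
    finally show ?thesis .
  qed
  show ?thesis by (intro exI[of _ e] exI[of _ r] allI impI) (rule main)
qed

lemma t_mcong:
  assumes "mcong R m A C"
  obtains D where "mat_over R D" "\<And>i j. t i j A - t i j C = of_nat m * t i j D"
proof -
  obtain D where D: "mat_over R D" "A - C = real m *\<^sub>R D" using assms by (rule mcongE)
  have "A = C + real m *\<^sub>R D" using D(2) by (simp add: algebra_simps)
  moreover have "(real m *\<^sub>R D) *v w = of_nat m *s (D *v w)" for w
    by (simp add: vec_eq_iff matrix_vector_mult_def scaleR_entry sum_distrib_left mult.assoc del: vector_scaleR_component)
  ultimately have "t i j A - t i j C = of_nat m * t i j D" for i j
    by (simp add: t_def matrix_vector_mult_add_rdistrib cf_add cf_scale)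
  then show thesis using D(1) that by blast
qed

text \<open>The difference from \<open>c\<close> lies in a finitely generated group and is divisible
  there by every \<open>m\<close>, so it is 0.\<close>

lemma t_mcong_eq:
  assumes A: "mat_over R A" and ij: "i < n" "j < n" and c: "\<And>m. m > 0 \<Longrightarrow> \<exists>h\<in>X. mcong R m A h"
    and X: "\<And>h. h \<in> X \<Longrightarrow> mat_over R h" "\<And>h. h \<in> X \<Longrightarrow> t i j h = c"
  shows "t i j A = c"
proof -
  obtain e r where er: "\<And>A. mat_over R A \<Longrightarrow> t i j A \<in> zspan e r" using entries_lattice ij by blast
  have X0: "add_subgroup {0::complex}" by (simp add: add_subgroup_def)
  have 0: "{0::complex} \<subseteq> zspan e r" using add_subgroupD(1)[OF add_subgroup_zspan] by simp
  obtain h0 where h0: "h0 \<in> X" using c[of 1] by auto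
  have mem: "t i j A - c \<in> zspan e r"
    using add_subgroupD(2)[OF add_subgroup_zspan er[OF A] er[OF X(1)[OF h0]]] X(2)[OF h0] by simp
  have "t i j A - c = 0"
  proof (rule ccontr)
    assume "t i j A - c \<noteq> 0"
    then obtain m where m: "m > 0" "\<forall>z\<in>zspan e r. t i j A - c \<noteq> of_nat m * z"
      using zspan_subgroup_separable[OF X0 0 mem] by auto
    obtain h where h: "h \<in> X" "mcong R m A h" using c[OF m(1)] by blast
    from h(2) obtain D where D: "mat_over R D" "\<And>i j. t i j A - t i j h = of_nat m * t i j D" using t_mcong by blast
    show False using m(2) er[OF D(1)] D(2)[of i j] X(2)[OF h(1)] by simp
  qed
  then show ?thesis by simp
qed

lemma trivial_below_limit:
  assumes A: "mat_over R A" and c: "\<And>m. m > 0 \<Longrightarrow> \<exists>h\<in>X. mcong R m A h"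
    and X: "\<And>h. h \<in> X \<Longrightarrow> mat_over R h" "\<And>h. h \<in> X \<Longrightarrow> trivial_below r h"
  shows "trivial_below r A"
  unfolding trivial_below_def triangular_def
proof (intro conjI allI impI)
  fix i j assume "i < n" "j < i"
  then show "t i j A = 0"
    using triangularD[OF trivial_belowD(1)[OF X(2)]] by (intro t_mcong_eq[OF A _ _ c X(1)]) auto
next
  fix i j assume "i \<le> j" "j < n" "tcode i j < r"
  then show "t i j A = (if i = j then 1 else 0)"
    using trivial_belowD(2)[OF X(2)] by (intro t_mcong_eq[OF A _ _ c X(1)]) auto
qed

lemma cong_closure_T:
  assumes "X \<subseteq> T r"
  shows "cong_closure R X \<subseteq> T r"
proof
  fix g assume g: "g \<in> cong_closure R X"
  note gR = cong_closureD(1)[OF R g]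
  have c: "\<exists>h\<in>X. mcong R m g h" if "m > 0" for m using cong_closureD(2)[OF R g that] .
  have XR: "h \<in> GL_R R" if "h \<in> X" for h using that assms TD(1) by blast
  have "trivial_below r g"
  proof (rule trivial_below_limit[OF GL_R_D(1)[OF R gR] c])
    show "mat_over R h" "trivial_below r h" if "h \<in> X" for h
      using GL_R_D(1)[OF R XR[OF that]] TD(2)[of h r] that assms by auto
  qed
  moreover have "trivial_below r (matrix_inv g)"
  proof (rule trivial_below_limit[OF GL_R_D(4)[OF R gR]])
    show "\<exists>h\<in>matrix_inv ` X. mcong R m (matrix_inv g) h" if "m > 0" for m
      using c[OF that] mcong_inv[OF R _ gR XR] by blast
    show "mat_over R h" "trivial_below r h" if "h \<in> matrix_inv ` X" for h
      using GL_R_D(4)[OF R XR] TD(3)[of _ r] that assms by auto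
  qed
  ultimately show "g \<in> T r" using gR by (simp add: T_def)
qed

text \<open>The matrix acts by \<open>t j j A\<close> on the \<open>j\<close>-th coordinates of the lattice vectors in the
  \<open>j\<close>-th step of the flag, and these coordinates form a finitely generated group.\<close>

lemma diagonal_algebraic_int:
  assumes A: "mat_over R A" "triangular A" and j: "j < n"
  shows "algebraic_int (t j j A)"
proof -
  let ?S = "(\<lambda>(l, b). \<omega> l * v j $ b) ` ({..<s} \<times> UNIV)"
  \<comment> \<open>The lattice has to contain \<open>v j\<close>, whose coordinates need not lie in
    \<open>R\<close>; so its coordinates are taken from the \<open>R\<close>-module that those of
    \<open>v j\<close> generate.\<close>
  define N where "N = {x. \<exists>a. (\<forall>b. a b \<in> R) \<and> x = (\<Sum>b\<in>UNIV. a b * v j $ b)}"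
  have N_add: "add_subgroup N"
    unfolding add_subgroup_def
  proof (intro conjI ballI)
    show "0 \<in> N" unfolding N_def using subring_CD(1)[OF R] by (intro CollectI exI[of _ "\<lambda>_. 0"]) simp
    fix x y assume "x \<in> N" "y \<in> N"
    then obtain a c where "\<forall>b. a b \<in> R" "x = (\<Sum>b\<in>UNIV. a b * v j $ b)" "\<forall>b. c b \<in> R" "y = (\<Sum>b\<in>UNIV. c b * v j $ b)"
      unfolding N_def by blast
    then show "x - y \<in> N" unfolding N_def using subring_CD(4)[OF R]
      by (intro CollectI exI[of _ "\<lambda>b. a b - c b"]) (simp add: sum_subtractf left_diff_distrib)
  qed
  have N_mult: "c * x \<in> N" if c: "c \<in> R" and x: "x \<in> N" for c x
  proof -
    obtain a where "\<forall>b. a b \<in> R" "x = (\<Sum>b\<in>UNIV. a b * v j $ b)" using x unfolding N_def by blast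
    then show ?thesis unfolding N_def using subring_CD(5)[OF R c]
      by (intro CollectI exI[of _ "\<lambda>b. c * a b"]) (simp add: sum_distrib_left mult.assoc)
  qed
  have N_v: "v j $ b \<in> N" for b
    unfolding N_def using subring_CD(1,2)[OF R]
    by (intro CollectI exI[of _ "\<lambda>b'. if b' = b then 1 else 0"]) (auto simp: if_distrib[of "\<lambda>x. x * _"] cong: if_cong)
  define L where "L = {w. (\<forall>a. w $ a \<in> N) \<and> (\<forall>i<n. j < i \<longrightarrow> cf i w = 0)}"
  have cf_diff: "cf i (x - y) = cf i x - cf i y" for i x y
    using cf_add[of i "x - y" y] by simp
  define Y where "Y = cf j ` L"
  have Y_add: "add_subgroup Y" unfolding add_subgroup_def
  proof (intro conjI ballI)
    have "0 \<in> L" using add_subgroupD(1)[OF N_add] by (simp add: L_def cf_0)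
    then show "0 \<in> Y" unfolding Y_def using cf_0[of j] by (metis image_eqI)
    fix x y assume "x \<in> Y" "y \<in> Y"
    then obtain w w' where w: "w \<in> L" "w' \<in> L" "x = cf j w" "y = cf j w'" by (auto simp: Y_def)
    then have "w - w' \<in> L" using add_subgroupD(2)[OF N_add] by (simp add: L_def cf_diff)
    then show "x - y \<in> Y" unfolding Y_def w(3,4) cf_diff[symmetric] by (rule imageI)
  qed
  have "finite ((\<lambda>(l, b, a). \<omega> l * (v j $ b * cf j (axis a 1))) ` ({..<s} \<times> (UNIV :: 'n set) \<times> (UNIV :: 'n set)))" (is "finite ?F")
    by (intro finite_imageI finite_cartesian_product) auto
  from zspan_finite_set[OF this] obtain e r where er: "?F \<subseteq> zspan e r" by blast
  have "Y \<subseteq> zspan e r"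
  proof
    fix y assume "y \<in> Y"
    then obtain w where w: "\<And>a. w $ a \<in> N" "y = cf j w" unfolding Y_def L_def by blast
    have "y = cf j (\<Sum>a\<in>UNIV. w $ a *s axis a 1)" by (simp add: basis_expansion w(2))
    also have "\<dots> = (\<Sum>a\<in>UNIV. w $ a * cf j (axis a 1))" by (simp add: cf_sum cf_scale)
    also have "\<dots> \<in> zspan e r"
    proof (rule add_subgroup_sum[OF add_subgroup_zspan])
      fix a
      obtain d where d: "\<forall>b. d b \<in> R" "w $ a = (\<Sum>b\<in>UNIV. d b * v j $ b)" using w(1)[of a] unfolding N_def by blast
      have "w $ a * cf j (axis a 1) = (\<Sum>b\<in>UNIV. d b * (v j $ b * cf j (axis a 1)))"
        by (simp add: d(2) sum_distrib_right mult.assoc)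
      also have "\<dots> \<in> zspan e r"
      proof (rule add_subgroup_sum[OF add_subgroup_zspan])
        fix b
        have db: "d b \<in> zspan \<omega> s" using d(1) \<omega> by blast
        show "d b * (v j $ b * cf j (axis a 1)) \<in> zspan e r"
        proof (rule zspan_mult[OF db add_subgroup_zspan])
          fix l assume "l < s"
          then show "\<omega> l * (v j $ b * cf j (axis a 1)) \<in> zspan e r"
            by (intro subsetD[OF er] image_eqI[of _ _ "(l, b, a)"]) auto
        qed
      qed
      finally show "w $ a * cf j (axis a 1) \<in> zspan e r" .
    qed
    finally show "y \<in> zspan e r" .
  qed
  from zspan_subgroup_fg[OF Y_add this] obtain e' where e': "Y = zspan e' r" by blast
  have stable: "t j j A * y \<in> Y" if y: "y \<in> Y" for y
  proof -
    obtain w where w: "w \<in> L" "y = cf j w" using y by (auto simp: Y_def)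
    have cf_A: "cf i (A *v w) = (if i = j then t j j A * cf j w else 0)" if i: "i < n" "j \<le> i" for i
    proof -
      have "cf i (A *v w) = (\<Sum>l<n. if l = j then (if i = j then t j j A * cf j w else 0) else 0)"
        unfolding cf_mult
      proof (rule sum.cong[OF refl])
        fix l assume l: "l \<in> {..<n}"
        show "t i l A * cf l w = (if l = j then (if i = j then t j j A * cf j w else 0) else 0)"
        proof (cases l j rule: linorder_cases)
          case less
          then show ?thesis using triangularD[OF A(2), of l i] i by simp
        next
          case equal
          then show ?thesis using triangularD[OF A(2), of j i] i by auto
        next
          case greater
          then show ?thesis using w(1) l by (simp add: L_def)
        qed
      qed
      then show ?thesis using j by simp
    qed
    have "(A *v w) $ a \<in> N" for a
      unfolding matrix_vector_mult_def using A(1) w(1)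
      by (auto simp: mat_over_def L_def intro!: add_subgroup_sum[OF N_add] N_mult)
    then have "A *v w \<in> L" using cf_A unfolding L_def by auto
    then have "cf j (A *v w) \<in> Y" unfolding Y_def by (rule imageI)
    then show ?thesis using cf_A[OF j] w(2) by simp
  qed
  have "v j \<in> L" using N_v cf_v j by (simp add: L_def)
  then have "cf j (v j) \<in> Y" unfolding Y_def by (rule imageI)
  then have one: "1 \<in> Y" using cf_v[OF j j] by simp
  \<comment> \<open>The vector \<open>v j\<close> contributes the coordinate 1, so the generators of
    \<open>Y\<close> do not all vanish.\<close>
  have "\<exists>i<r. e' i \<noteq> 0"
  proof (rule ccontr)
    assume "\<not> (\<exists>i<r. e' i \<noteq> 0)"
    then have "zspan e' r \<subseteq> {0}" by (intro zspan_least) (auto simp: add_subgroup_def)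
    then show False using one e' by auto
  qed
  then obtain i0 where i0: "i0 < r" "e' i0 \<noteq> 0" by blast
  show ?thesis
  proof (rule zspan_stable_algebraic_int[where e = e' and r = r and ?i0.0 = i0])
    show "t j j A * e' i \<in> zspan e' r" if "i < r" for i
      using stable[of "e' i"] zspan_base[OF that, of e'] e' by simp
  qed (rule i0)+
qed

end

section \<open>Separation of single entries\<close>

context integral_flag
begin

lemma T_diag_mult: "A \<in> T r \<Longrightarrow> C \<in> T r \<Longrightarrow> j < n \<Longrightarrow> t j j (A ** C) = t j j A * t j j C"
  by (rule t_mult_diag[OF TD(5) TD(5)])

lemma T_diag_inverse:
  assumes "A \<in> T r" "j < n"
  shows "t j j A * t j j (matrix_inv A) = 1"
  using T_diag_mult[OF assms(1) TD(6)[OF assms(1)] assms(2)] matrix_inv_right[OF TD(4)[OF assms(1)]]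
    t_1[OF assms(2) assms(2)] by simp

text \<open>The earlier entries of row \<open>i\<close> have smaller codes and are already trivial,
  as is the diagonal; so no other products enter.\<close>

lemma T_offdiag_mult:
  assumes A: "A \<in> T (tcode i j)" and C: "C \<in> T (tcode i j)" and ij: "i < j" "j < n"
  shows "t i j (A ** C) = t i j A + t i j C"
proof -
  have c: "tcode i l < tcode i j" if "l < j" for l using that ij by (intro tcode_mono) auto
  have "tcode j j < tcode i j" using ij by (intro tcode_mono) auto
  then have 1: "t i i A = 1" "t j j C = 1"
    using trivial_belowD(2)[OF TD(2)[OF A], of i i] trivial_belowD(2)[OF TD(2)[OF C], of j j] c[OF ij(1)] ij by auto
  have "t i l A = 0" if "i < l" "l < j" for l
    using trivial_belowD(2)[OF TD(2)[OF A], of i l] c[OF that(2)] that ij by simp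
  then show ?thesis using t_mult_offdiag[OF TD(5)[OF A] TD(5)[OF C] ij] 1 by simp
qed

lemma T_offdiag_inverse:
  assumes A: "A \<in> T (tcode i j)" and ij: "i < j" "j < n"
  shows "t i j (matrix_inv A) = - t i j A"
proof -
  have "t i j A + t i j (matrix_inv A) = 0"
    using T_offdiag_mult[OF A TD(6)[OF A] ij] matrix_inv_right[OF TD(4)[OF A]] t_1[of i j] ij by simp
  then show ?thesis by (simp add: add_eq_0_iff)
qed

lemma T_Suc_I:
  assumes A: "A \<in> T r"
    and z: "\<And>i j. i \<le> j \<Longrightarrow> j < n \<Longrightarrow> tcode i j = r \<Longrightarrow> t i j A = (if i = j then 1 else 0)"
      "\<And>i j. i \<le> j \<Longrightarrow> j < n \<Longrightarrow> tcode i j = r \<Longrightarrow> t i j (matrix_inv A) = (if i = j then 1 else 0)"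
  shows "A \<in> T (Suc r)"
  using TD(1)[OF A] trivial_belowD[OF TD(2)[OF A]] trivial_belowD[OF TD(3)[OF A]] z
  unfolding T_def trivial_below_def less_Suc_eq by blast

text \<open>The entry is a homomorphism from \<open>X\<close> to a finitely generated additive
  group, in which subgroups are separated by divisibility, and matrix congruences become
  divisibilities there.\<close>

lemma offdiagonal_separation:
  assumes X: "subgroup X GL_grp" "X \<subseteq> T (tcode i j)" and g: "g \<in> cong_closure R X" and ij: "i < j" "j < n"
  shows "\<exists>x\<in>X. t i j x = t i j g"
proof (rule ccontr)
  assume "\<not> (\<exists>x\<in>X. t i j x = t i j g)"
  then have ng: "t i j g \<notin> t i j ` X" by (metis imageE)
  note Xd = subgroup_GL_D[OF X(1)]
  have inj: "i < n" using ij by simp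
  obtain e r where er: "\<And>A. mat_over R A \<Longrightarrow> t i j A \<in> zspan e r" using entries_lattice inj ij(2) by blast
  have XT: "x \<in> T (tcode i j)" if "x \<in> X" for x using that X(2) by blast
  have XR: "mat_over R x" if "x \<in> X" for x using GL_R_D(1)[OF R TD(1)[OF XT[OF that]]] .
  have add: "add_subgroup (t i j ` X)"
    unfolding add_subgroup_def
  proof (intro conjI ballI)
    have "t i j (mat 1) = 0" using t_1[OF inj ij(2)] ij(1) by simp
    then show "0 \<in> t i j ` X" using Xd(2) by (metis image_eqI)
    fix x y assume "x \<in> t i j ` X" "y \<in> t i j ` X"
    then obtain A C where A: "A \<in> X" "x = t i j A" "C \<in> X" "y = t i j C" by blast
    have "x - y = t i j (A ** matrix_inv C)"
      using T_offdiag_mult[OF XT[OF A(1)] TD(6)[OF XT[OF A(3)]] ij] T_offdiag_inverse[OF XT[OF A(3)] ij] A by simp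
    then show "x - y \<in> t i j ` X" using Xd(3)[OF A(1) Xd(4)[OF A(3)]] by (rule image_eqI)
  qed
  have sub: "t i j ` X \<subseteq> zspan e r" using er XR by auto
  have gL: "t i j g \<in> zspan e r" by (rule er[OF GL_R_D(1)[OF R cong_closureD(1)[OF R g]]])
  obtain m where m: "m > 0" "\<forall>x\<in>t i j ` X. \<forall>z\<in>zspan e r. t i j g \<noteq> x + of_nat m * z"
    using zspan_subgroup_separable[OF add sub gL ng] by blast
  obtain x where x: "x \<in> X" "mcong R m g x" using cong_closureD(2)[OF R g m(1)] by blast
  obtain D where D: "mat_over R D" "\<And>i j. t i j g - t i j x = of_nat m * t i j D" using t_mcong[OF x(2)] by blast
  have "t i j g = t i j x + of_nat m * t i j D" using D(2)[of i j] by (simp add: algebra_simps)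
  then show False using m(2) x(1) er[OF D(1)] by blast
qed

text \<open>A matrix congruence makes the quotient of a difference of entries an element of a
  lattice in \<open>C\<close>, not an algebraic integer. The lattice elements with some integral
  multiple form a finitely generated group, so one denominator \<open>D\<close> and one field
  \<open>K\<close> serve for all of them.\<close>

lemma diagonal_field:
  assumes k: "number_field k" and j: "j < n"
  shows "\<exists>K D. number_field K \<and> D > 0 \<and>
    (\<forall>A. mat_over R A \<longrightarrow> algebraic_int (t j j A) \<longrightarrow> t j j A \<in> K) \<and>
    (\<forall>A M. mat_over R A \<longrightarrow> M > 0 \<longrightarrow> algebraic_int (of_nat M * t j j A) \<longrightarrow> of_nat D * t j j A \<in> ring_of_integers K)"
proof -
  obtain e r where er: "\<And>A. mat_over R A \<Longrightarrow> t j j A \<in> zspan e r" using entries_lattice j by blast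
  have nat_int: "algebraic_int (of_nat M * x)" if "algebraic_int x" for M :: nat and x :: complex
    by (rule algebraic_int_ring(3)[OF _ that]) simp
  define L where "L = {x \<in> zspan e r. \<exists>D>0. algebraic_int (of_nat D * x)}"
  have L: "add_subgroup L"
    unfolding add_subgroup_def
  proof (intro conjI ballI)
    show "0 \<in> L" unfolding L_def using add_subgroupD(1)[OF add_subgroup_zspan] by (auto intro!: exI[of _ 1])
    fix x y assume "x \<in> L" "y \<in> L"
    then obtain D E where D: "x \<in> zspan e r" "D > 0" "algebraic_int (of_nat D * x)"
      "y \<in> zspan e r" "E > 0" "algebraic_int (of_nat E * y)" unfolding L_def by blast
    have "algebraic_int (of_nat E * (of_nat D * x) - of_nat D * (of_nat E * y))"
      by (rule algebraic_int_ring(2)[OF nat_int[OF D(3)] nat_int[OF D(6)]])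
    then have "algebraic_int (of_nat (D * E) * (x - y))" by (simp add: algebra_simps)
    moreover have "x - y \<in> zspan e r" by (rule add_subgroupD(2)[OF add_subgroup_zspan D(1,4)])
    moreover have "D * E > 0" using D(2,5) by simp
    ultimately show "x - y \<in> L" unfolding L_def by blast
  qed
  have "L \<subseteq> zspan e r" by (auto simp: L_def)
  from zspan_subgroup_fg[OF L this] obtain a where a: "L = zspan a r" by blast
  have "\<forall>i. \<exists>D. i < r \<longrightarrow> D > 0 \<and> algebraic_int (of_nat D * a i)"
  proof
    fix i
    show "\<exists>D. i < r \<longrightarrow> D > 0 \<and> algebraic_int (of_nat D * a i)"
    proof (cases "i < r")
      case True
      then have "a i \<in> L" using zspan_base[of i r a] a by simp
      then show ?thesis unfolding L_def by blast
    qed simp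
  qed
  from choice[OF this] obtain d :: "nat \<Rightarrow> nat" where d: "\<And>i. i < r \<Longrightarrow> d i > 0" "\<And>i. i < r \<Longrightarrow> algebraic_int (of_nat (d i) * a i)" by blast
  define D where "D = (\<Prod>i<r. d i)"
  have D0: "D > 0" unfolding D_def using d(1) by (intro prod_pos) auto
  have Da: "algebraic_int (of_nat D * a i)" if i: "i < r" for i
  proof -
    have "D = (\<Prod>i\<in>{..<r} - {i}. d i) * d i" unfolding D_def using i by (simp add: prod.remove[of _ i])
    then have eq: "of_nat D * a i = of_nat (\<Prod>i\<in>{..<r} - {i}. d i) * (of_nat (d i) * a i)"
      by (simp only: of_nat_mult mult.assoc)
    show ?thesis unfolding eq by (rule nat_int[OF d(2)[OF i]])
  qed
  obtain K where K: "number_field K" "\<forall>i<r. of_nat D * a i \<in> K"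
    using number_field_containing[OF k, of r "\<lambda>i. of_nat D * a i"] Da by blast
  have sK: "subfield_C K" using K(1) by (simp add: number_field_def)
  have DL: "of_nat D * x \<in> ring_of_integers K" if x: "x \<in> L" for x
  proof -
    obtain b where b: "x = (\<Sum>i<r. of_int (b i) * a i)" using x unfolding a zspan_def by blast
    have "of_nat D * x = (\<Sum>i<r. of_int (b i) * (of_nat D * a i))"
      by (simp add: b sum_distrib_left mult.left_commute)
    also have "\<dots> \<in> ring_of_integers K"
    proof (rule ring_of_integers_sum[OF sK])
      fix i assume "i \<in> {..<r}"
      then have "of_nat D * a i \<in> ring_of_integers K" using K(2) Da by (auto simp: ring_of_integers_def)
      then show "of_int (b i) * (of_nat D * a i) \<in> ring_of_integers K"
        by (rule ring_of_integersD(7)[OF sK ring_of_integersD(3)[OF sK]])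
    qed
    finally show ?thesis .
  qed
  show ?thesis
  proof (intro exI[of _ K] exI[of _ D] conjI allI impI K(1) D0)
    fix A M assume A: "mat_over R A" "M > 0" "algebraic_int (of_nat M * t j j A)"
    then show "of_nat D * t j j A \<in> ring_of_integers K" by (intro DL) (auto simp: L_def er)
  next
    fix A assume A: "mat_over R A" "algebraic_int (t j j A)"
    have "t j j A \<in> L" using A(2) er[OF A(1)] by (auto simp: L_def intro!: exI[of _ 1])
    then have "of_nat D * t j j A \<in> K" using DL[of "t j j A"] by (simp add: ring_of_integers_def)
    then have "of_nat D * t j j A / of_nat D \<in> K" by (intro subfield_CD(7,10)[OF sK])
    then show "t j j A \<in> K" using D0 by simp
  qed
qed

text \<open>The diagonal entry maps \<open>X\<close> to units of \<open>K\<close>, where a modulus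
  \<open>M\<close> separates. Matrices are compared modulo \<open>M * D\<close>, the factor
  \<open>D\<close> paying for the denominator of the quotient.\<close>

lemma diagonal_separation:
  assumes k: "number_field k" and X: "subgroup X GL_grp" "X \<subseteq> T r" and g: "g \<in> cong_closure R X" and j: "j < n"
  shows "\<exists>x\<in>X. t j j x = t j j g"
proof (rule ccontr)
  assume "\<not> (\<exists>x\<in>X. t j j x = t j j g)"
  then have ng: "t j j g \<notin> t j j ` X" by (metis imageE)
  note Xd = subgroup_GL_D[OF X(1)]
  obtain K D where K: "number_field K" and D: "D > 0"
    and tK: "\<And>A. mat_over R A \<Longrightarrow> algebraic_int (t j j A) \<Longrightarrow> t j j A \<in> K"
    and tD: "\<And>A M. mat_over R A \<Longrightarrow> M > 0 \<Longrightarrow> algebraic_int (of_nat M * t j j A) \<Longrightarrow> of_nat D * t j j A \<in> ring_of_integers K"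
    using diagonal_field[OF k j] by blast
  have sK: "subfield_C K" using K by (simp add: number_field_def)
  have TR: "mat_over R A" if "A \<in> T r" for A using GL_R_D(1)[OF R TD(1)[OF that]] .
  have ti: "algebraic_int (t j j A)" if "A \<in> T r" for A
    by (rule diagonal_algebraic_int[OF TR[OF that] TD(5)[OF that] j])
  have tO: "t j j A \<in> ring_of_integers K" if "A \<in> T r" for A
    using tK[OF TR[OF that] ti[OF that]] ti[OF that] by (simp add: ring_of_integers_def)
  have tinv: "inverse (t j j A) = t j j (matrix_inv A)" "t j j A \<noteq> 0" if "A \<in> T r" for A
  proof -
    have tt: "t j j A * t j j (matrix_inv A) = 1" by (rule T_diag_inverse[OF that j])
    show "inverse (t j j A) = t j j (matrix_inv A)" by (rule inverse_unique[OF tt])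
    show "t j j A \<noteq> 0"
    proof
      assume "t j j A = 0"
      then show False using tt by simp
    qed
  qed
  have tU: "t j j A \<in> units_of_integers K" if "A \<in> T r" for A
    using tO[OF that] tO[OF TD(6)[OF that]] tinv[OF that] by (simp add: units_of_integers_def)
  have XT: "x \<in> T r" if "x \<in> X" for x using that X(2) by blast
  have gT: "g \<in> T r" using cong_closure_T[OF X(2)] g by blast
  have ms: "mult_subgroup (t j j ` X)"
    unfolding mult_subgroup_def
  proof (intro conjI ballI)
    have "t j j (mat 1) = 1" using t_1[OF j j] by simp
    then show "1 \<in> t j j ` X" using Xd(2) by (metis image_eqI)
    show "0 \<notin> t j j ` X" using tinv(2)[OF XT] by (metis imageE)
    fix x y assume "x \<in> t j j ` X" "y \<in> t j j ` X"
    then obtain A C where A: "A \<in> X" "x = t j j A" "C \<in> X" "y = t j j C" by blast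
    have "x / y = t j j (A ** matrix_inv C)"
      using T_diag_mult[OF XT[OF A(1)] TD(6)[OF XT[OF A(3)]] j] tinv(1)[OF XT[OF A(3)]] A by (simp add: divide_inverse)
    then show "x / y \<in> t j j ` X" using Xd(3)[OF A(1) Xd(4)[OF A(3)]] by (rule image_eqI)
  qed
  have sub: "t j j ` X \<subseteq> units_of_integers K" using tU XT by auto
  obtain M where M: "M > 0" "\<forall>h\<in>t j j ` X. \<not> (\<exists>v\<in>ring_of_integers K. h - t j j g = of_nat M * v)"
    using unit_subgroup_congruence_closed[OF K ms sub tU[OF gT] ng] by blast
  have MD: "M * D > 0" using M(1) D by simp
  obtain x where x: "x \<in> X" "mcong R (M * D) g x" using cong_closureD(2)[OF R g MD] by blast
  obtain E where E: "mat_over R E" "\<And>i j. t i j g - t i j x = of_nat (M * D) * t i j E" using t_mcong[OF x(2)] by blast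
  have "algebraic_int (t j j g - t j j x)" by (rule algebraic_int_ring(2)[OF ti[OF gT] ti[OF XT[OF x(1)]]])
  then have "algebraic_int (of_nat (M * D) * t j j E)" unfolding E(2) .
  from tD[OF E(1) MD this] have z: "of_nat D * t j j E \<in> ring_of_integers K" .
  have "t j j x - t j j g = of_nat M * (- (of_nat D * t j j E))"
    using E(2)[of j j] by (simp add: algebra_simps)
  then show False using M(2) x(1) ring_of_integersD(8)[OF sK z] by blast
qed

text \<open>If \<open>r\<close> is the code of no entry on or above the diagonal, \<open>T r\<close>
  and \<open>T (Suc r)\<close> impose the same conditions. Otherwise it is the code of exactly one
  entry, and an \<open>x\<close> that agrees with \<open>g\<close> there makes this entry of the
  quotient trivial.\<close>

lemma T_separation:
  assumes k: "number_field k" and X: "subgroup X GL_grp" "X \<subseteq> T r" and g: "g \<in> cong_closure R X"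
  shows "\<exists>x\<in>X. matrix_inv x ** g \<in> T (Suc r)"
proof -
  have gT: "g \<in> T r" using cong_closure_T[OF X(2)] g by blast
  have XT: "x \<in> T r" if "x \<in> X" for x using that X(2) by blast
  have one: "t i j (mat 1) = (if i = j then 1 else 0)" if "i \<le> j" "j < n" for i j
    using t_1 that by simp
  show ?thesis
  proof (cases "\<exists>i j. i \<le> j \<and> j < n \<and> tcode i j = r")
    case False
    have "matrix_inv (mat 1) ** g \<in> T (Suc r)"
      unfolding matrix_inv_1 matrix_mul_lid by (rule T_Suc_I[OF gT]) (use False in blast)+
    then show ?thesis using subgroup_GL_D(2)[OF X(1)] by blast
  next
    case True
    then obtain i j where ij: "i \<le> j" "j < n" "tcode i j = r" by blast
    have uniq: "i' = i \<and> j' = j" if "i' \<le> j'" "j' < n" "tcode i' j' = r" for i' j'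
      using tcode_inj[of i' j' i j] that ij by simp
    have "\<exists>x\<in>X. t i j x = t i j g"
    proof (cases "i = j")
      case True
      show ?thesis unfolding True by (rule diagonal_separation[OF k X g ij(2)])
    next
      case False
      then show ?thesis using offdiagonal_separation[OF X(1) _ g] X(2) ij by simp
    qed
    then obtain x where x: "x \<in> X" "t i j x = t i j g" by blast
    note xT = XT[OF x(1)]
    define y where "y = matrix_inv x ** g"
    have yT: "y \<in> T r" unfolding y_def by (rule T_mult[OF TD(6)[OF xT] gT])
    have ty: "t i j y = (if i = j then 1 else 0) \<and> t i j (matrix_inv y) = (if i = j then 1 else 0)"
    proof (cases "i = j")
      case True
      have "t j j y = t j j (matrix_inv x) * t j j x"
        unfolding y_def T_diag_mult[OF TD(6)[OF xT] gT ij(2)] using x(2) True by simp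
      then have "t j j y = 1" using T_diag_inverse[OF xT ij(2)] by (simp add: mult.commute)
      then show ?thesis using T_diag_inverse[OF yT ij(2)] True by simp
    next
      case False
      then have lt: "i < j" using ij by simp
      note T = xT gT yT
      note T = T[folded ij(3)]
      have "t i j y = 0"
        unfolding y_def T_offdiag_mult[OF TD(6)[OF T(1)] T(2) lt ij(2)] T_offdiag_inverse[OF T(1) lt ij(2)]
        using x(2) by simp
      then show ?thesis using T_offdiag_inverse[OF T(3) lt ij(2)] False by simp
    qed
    have "y \<in> T (Suc r)"
    proof (rule T_Suc_I[OF yT])
      fix i' j' assume "i' \<le> j'" "j' < n" "tcode i' j' = r"
      from uniq[OF this] show "t i' j' y = (if i' = j' then 1 else 0)" "t i' j' (matrix_inv y) = (if i' = j' then 1 else 0)"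
        using ty by auto
    qed
    then show ?thesis using x(1) unfolding y_def by blast
  qed
qed

text \<open>Starting from the trivial group \<open>T (n * n)\<close>, one entry is released at a
  time by \<open>cong_closed_extension\<close>.\<close>

theorem triangular_subgroup_closed:
  assumes k: "number_field k" and X: "subgroup X GL_grp" "X \<subseteq> T 0"
  shows "cong_closure R X \<subseteq> X"
proof -
  have "d \<le> n * n \<Longrightarrow> (\<forall>X. subgroup X GL_grp \<longrightarrow> X \<subseteq> T (n * n - d) \<longrightarrow> cong_closure R X \<subseteq> X)" for d
  proof (induction d)
    case 0
    show ?case
    proof (intro allI impI subsetI)
      fix X g assume X: "subgroup X GL_grp" "X \<subseteq> T (n * n - 0)" "g \<in> cong_closure R X"
      then have "g = mat 1" using cong_closure_T[OF X(2)] T_final by auto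
      then show "g \<in> X" using subgroup_GL_D(2)[OF X(1)] by simp
    qed
  next
    case (Suc d)
    then have IH: "\<And>X. subgroup X GL_grp \<Longrightarrow> X \<subseteq> T (n * n - d) \<Longrightarrow> cong_closure R X \<subseteq> X" by simp
    have e: "n * n - d = Suc (n * n - Suc d)" using Suc.prems by simp
    show ?case
    proof (intro allI impI)
      fix X assume X: "subgroup X GL_grp" "X \<subseteq> T (n * n - Suc d)"
      show "cong_closure R X \<subseteq> X"
      proof (rule cong_closed_extension[OF R subgroup_T[of "Suc (n * n - Suc d)"] _ _ T_subset X])
        show "\<exists>x\<in>Y. matrix_inv x ** g \<in> T (Suc (n * n - Suc d))"
          if "subgroup Y GL_grp" "Y \<subseteq> T (n * n - Suc d)" "g \<in> cong_closure R Y" for Y g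
          by (rule T_separation[OF k that])
        show "cong_closure R Y \<subseteq> Y" if "subgroup Y GL_grp" "Y \<subseteq> T (Suc (n * n - Suc d))" for Y
          using IH[OF that(1)] that(2) e by simp
      qed
    qed
  qed
  from this[of "n * n"] X show ?thesis by simp
qed

end

section \<open>From congruence closedness to separability\<close>

lemma subgroup_GL_R:
  assumes R: "subring_C R"
  shows "subgroup (GL_R R) (GL_grp :: (complex^'n^'n) monoid)"
proof -
  interpret group "GL_grp :: (complex^'n^'n) monoid" by (rule group_GL_grp)
  show ?thesis
  proof (rule subgroupI)
    show "GL_R R \<subseteq> carrier (GL_grp :: (complex^'n^'n) monoid)" using GL_R_D(2)[OF R] by auto
    show "GL_R R \<noteq> ({} :: (complex^'n^'n) set)" using GL_R_1[OF R] by blast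
    show "inv\<^bsub>GL_grp\<^esub> A \<in> GL_R R" if "A \<in> GL_R R" for A :: "complex^'n^'n"
      using GL_R_D(2,3)[OF R that] by (simp add: inv_GL_grp)
    show "A \<otimes>\<^bsub>GL_grp\<^esub> C \<in> GL_R R" if "A \<in> GL_R R" "C \<in> GL_R R" for A C :: "complex^'n^'n"
      using GL_R_mult[OF R that] by simp
  qed
qed

text \<open>The coefficients with respect to \<open>\<omega>\<close> are chosen and need not be
  unique. This is harmless, since equal residues are only required to imply congruence.\<close>

lemma finite_residues:
  assumes \<omega>: "R = zspan \<omega> s" and m: "m > 0"
  shows "\<exists>(f :: complex^'n^'n \<Rightarrow> 'n \<times> 'n \<Rightarrow> nat \<Rightarrow> int) F. finite F \<and> (\<forall>A. f A \<in> F) \<and>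
    (\<forall>A C. mat_over R A \<longrightarrow> mat_over R C \<longrightarrow> f A = f C \<longrightarrow> mcong R m A C)"
proof -
  have "\<forall>x. \<exists>a. x \<in> R \<longrightarrow> x = (\<Sum>i<s. of_int (a i) * \<omega> i)" unfolding \<omega> zspan_def by blast
  from choice[OF this] obtain c where c: "\<And>x. x \<in> R \<Longrightarrow> x = (\<Sum>i<s. of_int (c x i) * \<omega> i)" by blast
  define f :: "complex^'n^'n \<Rightarrow> 'n \<times> 'n \<Rightarrow> nat \<Rightarrow> int"
    where "f = (\<lambda>A p i. if i < s then c (A $ fst p $ snd p) i mod int m else 0)"
  define F0 :: "(nat \<Rightarrow> int) set"
    where "F0 = {h. \<forall>i. (i \<in> {..<s} \<longrightarrow> h i \<in> {0..<int m}) \<and> (i \<notin> {..<s} \<longrightarrow> h i = 0)}"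
  define F :: "('n \<times> 'n \<Rightarrow> nat \<Rightarrow> int) set"
    where "F = {h. \<forall>p. (p \<in> UNIV \<longrightarrow> h p \<in> F0) \<and> (p \<notin> UNIV \<longrightarrow> h p = (\<lambda>_. 0))}"
  have "finite F0" unfolding F0_def by (rule finite_set_of_finite_funs) auto
  then have fin: "finite F" unfolding F_def by (intro finite_set_of_finite_funs) auto
  have mem: "f A \<in> F" for A using m by (auto simp: f_def F_def F0_def)
  have cong: "mcong R m A C" if A: "mat_over R A" and C: "mat_over R C" and eq: "f A = f C" for A C
  proof -
    let ?d = "\<lambda>k l i. (c (A $ k $ l) i - c (C $ k $ l) i) div int m"
    define D :: "complex^'n^'n" where "D = (\<chi> k l. \<Sum>i<s. of_int (?d k l i) * \<omega> i)"
    have "mat_over R D" unfolding mat_over_def D_def \<omega> zspan_def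
      by (auto intro!: exI)
    moreover have "(A - C) $ k $ l = (real m *\<^sub>R D) $ k $ l" for k l
    proof -
      have d: "of_int (c (A $ k $ l) i - c (C $ k $ l) i) = (of_nat m * of_int (?d k l i) :: complex)" if i: "i < s" for i
      proof -
        have "c (A $ k $ l) i mod int m = c (C $ k $ l) i mod int m"
          using fun_cong[OF fun_cong[OF eq, of "(k, l)"], of i] i by (simp add: f_def)
        then have "int m dvd c (A $ k $ l) i - c (C $ k $ l) i" by (simp add: mod_eq_dvd_iff)
        then have "c (A $ k $ l) i - c (C $ k $ l) i = int m * ?d k l i" by simp
        then have "of_int (c (A $ k $ l) i - c (C $ k $ l) i) = (of_int (int m * ?d k l i) :: complex)" by (simp only:)
        then show ?thesis by simp
      qed
      have mem': "A $ k $ l \<in> R" "C $ k $ l \<in> R" using A C by (auto simp: mat_over_def)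
      have "(A - C) $ k $ l = (\<Sum>i<s. of_int (c (A $ k $ l) i) * \<omega> i) - (\<Sum>i<s. of_int (c (C $ k $ l) i) * \<omega> i)"
        using c[OF mem'(1)] c[OF mem'(2)] by simp
      also have "\<dots> = (\<Sum>i<s. of_int (c (A $ k $ l) i - c (C $ k $ l) i) * \<omega> i)"
        by (simp add: sum_subtractf left_diff_distrib)
      also have "\<dots> = (\<Sum>i<s. of_nat m * (of_int (?d k l i) * \<omega> i))"
        using d by (intro sum.cong) (auto simp: mult.assoc)
      also have "\<dots> = (real m *\<^sub>R D) $ k $ l" by (simp add: scaleR_entry D_def sum_distrib_left del: vector_scaleR_component)
      finally show ?thesis .
    qed
    ultimately show ?thesis unfolding mcong_def by (intro exI[of _ D]) (simp add: vec_eq_iff)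
  qed
  show ?thesis by (intro exI[of _ f] exI[of _ F] conjI allI impI fin mem cong)
qed

lemma cong_closed_separable:
  fixes P H :: "(complex^'n^'n) set"
  assumes R: "subring_C R" and \<omega>: "R = zspan \<omega> s"
    and P: "subgroup P GL_grp" "P \<subseteq> GL_R R" and H: "subgroup H GL_grp" "H \<subseteq> P"
    and closed: "cong_closure R H \<subseteq> H"
  shows "separable_in (GL_grp\<lparr>carrier := P\<rparr>) H"
  unfolding separable_in_def
proof
  interpret group "GL_grp :: (complex^'n^'n) monoid" by (rule group_GL_grp)
  note Pd = subgroup_GL_D[OF P(1)] and Hd = subgroup_GL_D[OF H(1)]
  let ?\<Gamma> = "GL_grp\<lparr>carrier := P\<rparr>"
  fix g assume "g \<in> carrier ?\<Gamma> - H"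
  then have g: "g \<in> P" "g \<notin> H" by auto
  then have "g \<notin> cong_closure R H" "g \<in> GL_R R" using closed P(2) by auto
  then obtain m where m: "m > 0" "\<And>h. h \<in> H \<Longrightarrow> \<not> mcong R m g h" unfolding cong_closure_def by blast
  \<comment> \<open>Written as a union of congruence classes, so that the group laws follow directly
    from the compatibility of \<open>mcong\<close> with products and inverses.\<close>
  define K where "K = {x \<in> P. \<exists>h\<in>H. mcong R m x h}"
  have PR: "x \<in> GL_R R" if "x \<in> P" for x using that P(2) by blast
  have HR: "x \<in> GL_R R" if "x \<in> H" for x using that H(2) P(2) by blast
  have KP: "K \<subseteq> P" by (auto simp: K_def)
  have KG: "subgroup K GL_grp"
  proof (rule subgroupI)
    show "K \<subseteq> carrier GL_grp" using KP Pd(1) by auto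
    have "mat 1 \<in> K" unfolding K_def using Pd(2) Hd(2) mcong_refl[OF R, of m "mat 1"] by blast
    then show "K \<noteq> {}" by blast
    fix x assume x: "x \<in> K"
    then obtain h where h: "x \<in> P" "h \<in> H" "mcong R m x h" by (auto simp: K_def)
    have "mcong R m (matrix_inv x) (matrix_inv h)" by (rule mcong_inv[OF R h(3) PR[OF h(1)] HR[OF h(2)]])
    then have "matrix_inv x \<in> K" unfolding K_def using Pd(4)[OF h(1)] Hd(4)[OF h(2)] by blast
    then show "inv\<^bsub>GL_grp\<^esub> x \<in> K" using Pd(1)[OF h(1)] by (simp add: inv_GL_grp)
    fix y assume y: "y \<in> K"
    then obtain k where k: "y \<in> P" "k \<in> H" "mcong R m y k" by (auto simp: K_def)
    have "mcong R m (x ** y) (h ** k)"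
      by (rule mcong_mult[OF R h(3) k(3) GL_R_D(1)[OF R PR[OF k(1)]] GL_R_D(1)[OF R HR[OF h(2)]]])
    then have "x ** y \<in> K" unfolding K_def using Pd(3)[OF h(1) k(1)] Hd(3)[OF h(2) k(2)] by blast
    then show "x \<otimes>\<^bsub>GL_grp\<^esub> y \<in> K" by simp
  qed
  note Kd = subgroup_GL_D[OF KG]
  have coset: "K #>\<^bsub>?\<Gamma>\<^esub> a \<subseteq> K #>\<^bsub>?\<Gamma>\<^esub> b" if a: "a \<in> P" and b: "b \<in> P" and ab: "mcong R m a b" for a b
  proof
    fix x assume "x \<in> K #>\<^bsub>?\<Gamma>\<^esub> a"
    then obtain k where k: "k \<in> K" "x = k ** a" by (auto simp: r_coset_def)
    have "mcong R m (a ** matrix_inv b) (b ** matrix_inv b)"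
      by (rule mcong_mult[OF R ab mcong_refl[OF R] GL_R_D(4)[OF R PR[OF b]] GL_R_D(1)[OF R PR[OF b]]])
    then have "mcong R m (a ** matrix_inv b) (mat 1)" using matrix_inv_right[OF Pd(1)[OF b]] by simp
    then have "a ** matrix_inv b \<in> K" unfolding K_def using Hd(2) Pd(3)[OF a Pd(4)[OF b]] by blast
    from Kd(3)[OF k(1) this] have "k ** (a ** matrix_inv b) \<in> K" .
    moreover have "x = k ** (a ** matrix_inv b) ** b"
      using matrix_inv_left[OF Pd(1)[OF b]] by (simp add: k(2) flip: matrix_mul_assoc)
    ultimately show "x \<in> K #>\<^bsub>?\<Gamma>\<^esub> b" by (auto simp: r_coset_def)
  qed
  obtain f :: "complex^'n^'n \<Rightarrow> 'n \<times> 'n \<Rightarrow> nat \<Rightarrow> int" and F where f: "finite F" "\<forall>A. f A \<in> F"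
    "\<forall>A C. mat_over R A \<longrightarrow> mat_over R C \<longrightarrow> f A = f C \<longrightarrow> mcong R m A C"
    using finite_residues[OF \<omega> m(1)] by blast
  have same: "K #>\<^bsub>?\<Gamma>\<^esub> a = K #>\<^bsub>?\<Gamma>\<^esub> b" if a: "a \<in> P" and b: "b \<in> P" and ab: "f a = f b" for a b
  proof -
    have "mcong R m a b" using f(3) GL_R_D(1)[OF R PR[OF a]] GL_R_D(1)[OF R PR[OF b]] ab by blast
    then show ?thesis using coset[OF a b] coset[OF b a] mcong_sym[OF R] by blast
  qed
  have "rcosets\<^bsub>?\<Gamma>\<^esub> K \<subseteq> (\<lambda>y. K #>\<^bsub>?\<Gamma>\<^esub> (SOME a. a \<in> P \<and> f a = y)) ` F"
  proof
    fix X assume "X \<in> rcosets\<^bsub>?\<Gamma>\<^esub> K"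
    then obtain a where a: "a \<in> P" "X = K #>\<^bsub>?\<Gamma>\<^esub> a" by (auto simp: RCOSETS_def)
    have "(SOME b. b \<in> P \<and> f b = f a) \<in> P \<and> f (SOME b. b \<in> P \<and> f b = f a) = f a"
      by (rule someI[of "\<lambda>b. b \<in> P \<and> f b = f a" a]) (simp add: a(1))
    then have "X = K #>\<^bsub>?\<Gamma>\<^esub> (SOME b. b \<in> P \<and> f b = f a)"
      unfolding a(2) by (intro same a(1)) auto
    then show "X \<in> (\<lambda>y. K #>\<^bsub>?\<Gamma>\<^esub> (SOME a. a \<in> P \<and> f a = y)) ` F" using f(2) by blast
  qed
  then have "finite (rcosets\<^bsub>?\<Gamma>\<^esub> K)" using f(1) finite_surj by blast
  moreover have "subgroup K ?\<Gamma>" by (rule subgroup_incl[OF KG P(1) KP])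
  moreover have "H \<subseteq> K" using H(2) mcong_refl[OF R] unfolding K_def by blast
  moreover have "g \<notin> K" using m(2) by (auto simp: K_def)
  ultimately show "\<exists>K. subgroup K ?\<Gamma> \<and> finite (rcosets\<^bsub>?\<Gamma>\<^esub> K) \<and> H \<subseteq> K \<and> g \<notin> K" by blast
qed

theorem theorem3p1:
  fixes k :: "complex set" and G B H :: "(complex^'n^'n) set"
  assumes "number_field k"
    and "k_algebraic k G"
    and "zariski_connected G"
    and "borel_subgroup B G"
    and "subgroup H (GL_grp\<lparr>carrier := points (ring_of_integers k) G\<rparr>)"
    and "H \<subseteq> points (ring_of_integers k) B"
  shows "separable_in (GL_grp\<lparr>carrier := points (ring_of_integers k) G\<rparr>) H"
proof -
  interpret group "GL_grp :: (complex^'n^'n) monoid" by (rule group_GL_grp)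
  define R where "R = ring_of_integers k"
  have "subfield_C k" using assms(1) by (simp add: number_field_def)
  then have R: "subring_C R" unfolding R_def by (rule ring_of_integers_subring)
  obtain b d where "number_field_basis k b d" using number_field_obtain_basis[OF assms(1)] .
  then obtain \<omega> where \<omega>: "R = zspan \<omega> d"
    unfolding R_def using number_field_basis.ring_of_integers_fg by blast
  have G: "subgroup G GL_grp" using assms(2) by (simp add: k_algebraic_def lin_alg_group_def)
  have P: "subgroup (points R G) GL_grp" "points R G \<subseteq> GL_R R"
    unfolding points_def using subgroups_Inter_pair[OF G subgroup_GL_R[OF R]] by auto
  have H: "subgroup H GL_grp" "H \<subseteq> points R G"
    using incl_subgroup[OF P(1)] subgroup.subset[OF assms(5)] assms(5) by (auto simp: R_def)
  have B: "subgroup B GL_grp" "zariski_connected B" "solvable (GL_grp\<lparr>carrier := B\<rparr>)"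
    using assms(4) by (auto simp: borel_subgroup_def conn_solv_alg_def lin_alg_group_def)
  obtain s where s: "(derived GL_grp ^^ s) B = {mat 1}" using solvable_derived_series[OF B(1,3)] .
  show ?thesis
  proof (rule lie_kolchin[OF B(1,2) s])
    fix v :: "nat \<Rightarrow> complex^'n" and cf :: "nat \<Rightarrow> complex^'n \<Rightarrow> complex"
    assume v: "\<And>w. w = (\<Sum>i<CARD('n). cf i w *s v i)" "\<And>i w w'. cf i (w + w') = cf i w + cf i w'"
        "\<And>i c w. cf i (c *s w) = c * cf i w"
        "\<And>i j. i < CARD('n) \<Longrightarrow> j < CARD('n) \<Longrightarrow> cf i (v j) = (if i = j then 1 else 0)"
      and tri: "\<And>g i j. g \<in> B \<Longrightarrow> i < CARD('n) \<Longrightarrow> j < i \<Longrightarrow> cf i (g *v v j) = 0"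
    interpret F: integral_flag R \<omega> d "CARD('n)" v cf
      by unfold_locales (rule R \<omega> v; assumption?)+
    \<comment> \<open>At level 0 no entry has to be trivial yet, so triangularity is the only
      condition.\<close>
    have triB: "F.trivial_below 0 g" if "g \<in> B" for g
      using tri[OF that] by (simp add: F.trivial_below_def F.triangular_def F.t_def)
    have "H \<subseteq> F.T 0"
    proof
      fix h assume h: "h \<in> H"
      then have "h \<in> B" "h \<in> GL_R R" using assms(6) by (auto simp: points_def R_def)
      then show "h \<in> F.T 0" using triB subgroup_GL_D(4)[OF B(1)] by (simp add: F.T_def)
    qed
    then have "cong_closure R H \<subseteq> H" by (rule F.triangular_subgroup_closed[OF assms(1) H(1)])
    then show ?thesis using cong_closed_separable[OF R \<omega> P H] by (simp add: R_def)
  qed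
qed

end
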